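(* Let $G$ be a compact Lie group with complexification $G^c$, and let $M$ be a compactification of $G^c$ with finite isotropy subgroup, endowed with a $G$-invariant Kähler structure with Kähler form $\omega$. Assume $(M,\omega)$ is positive Kähler-Einstein. Then $M$ contains a unique minimal Lagrangian $G$-orbit in the dense open $G^c$-orbit.
   Context: Complexification: for a compact Lie group $G$ with Lie algebra $\mathfrak{g}$, $G^c$ is the complex Lie group containing $G$ that is universal for continuous homomorphisms of $G$ into complex Lie groups (each extends uniquely to a holomorphic homomorphism of $G^c$). Its Lie algebra is $\mathfrak{g}\otimes\mathbb{C}$, and $(X,g)\mapsto\exp(iX)g$ is a diffeomorphism $\mathfrak{g}\times G\to G^c$. Compactification: $M$ is a compact complex manifold with a right action of $G^c$ by complex automorphisms having a dense open $G^c$-orbit. "With finite isotropy subgroup" means that the isotropy subgroup in $G^c$ of a point of the dense open orbit is finite; in particular $\dim_{\mathbb{C}}M=\dim_{\mathbb{R}}G$. Positive Kähler-Einstein means that the Ricci form is a positive constant multiple of $\omega$. Lagrangian means of real dimension $\dim_{\mathbb{C}}M$ with $\omega$ restricting to zero; minimal means zero mean curvature with respect to the Kähler metric. *)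

theory Defs
  imports "HOL-Analysis.Analysis" "HOL-Algebra.Group_Action"
begin

text \<open>
  Manifolds of arbitrary (numeric) dimension are needed, because the universal property of the
  complexification ranges over complex Lie groups of every dimension. The model spaces are
  therefore the library's spaces \<^const>\<open>Euclidean_space\<close> of functions \<open>nat \<Rightarrow> real\<close> vanishing from
  the index \<open>n\<close> on, and differential calculus is done with partial derivatives.
\<close>

section \<open>Partial derivatives and smooth functions\<close>

definition pd :: "nat \<Rightarrow> ((nat \<Rightarrow> real) \<Rightarrow> real) \<Rightarrow> (nat \<Rightarrow> real) \<Rightarrow> real" where
  "pd i f x = deriv (\<lambda>t. f (x(i := t))) (x i)"

definition smooth_on :: "nat \<Rightarrow> (nat \<Rightarrow> real) set \<Rightarrow> ((nat \<Rightarrow> real) \<Rightarrow> real) \<Rightarrow> bool" where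
  "smooth_on n W f \<longleftrightarrow> openin (Euclidean_space n) W \<and>
     (\<forall>is. set is \<subseteq> {..<n} \<longrightarrow>
        continuous_map (subtopology (Euclidean_space n) W) euclideanreal (foldr pd is f) \<and>
        (\<forall>i<n. \<forall>x\<in>W. (\<lambda>t. foldr pd is f (x(i := t))) field_differentiable (at (x i))))"

abbreviation Rn :: "nat \<Rightarrow> (nat \<Rightarrow> real) set" where
  "Rn n \<equiv> topspace (Euclidean_space n)"

definition unit_vec :: "nat \<Rightarrow> nat \<Rightarrow> real" where
  "unit_vec i = (\<lambda>j. if j = i then 1 else 0)"

text \<open>The standard complex structure, for the identification
  \<open>z\<^sub>j = x\<^sub>2\<^sub>j + \<i> x\<^sub>2\<^sub>j\<^sub>+\<^sub>1\<close> of complex \<open>n\<close>-space with real \<open>2n\<close>-space.\<close>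

definition J :: "(nat \<Rightarrow> real) \<Rightarrow> nat \<Rightarrow> real" where
  "J v = (\<lambda>k. if even k then - v (k + 1) else v (k - 1))"

definition bil :: "nat \<Rightarrow> (nat \<Rightarrow> nat \<Rightarrow> real) \<Rightarrow> (nat \<Rightarrow> real) \<Rightarrow> (nat \<Rightarrow> real) \<Rightarrow> real" where
  "bil n a u v = (\<Sum>i<n. \<Sum>j<n. a i j * u i * v j)"

text \<open>Only the entries with both indices below \<open>n\<close> are meaningful.\<close>

definition mat_inv :: "nat \<Rightarrow> (nat \<Rightarrow> nat \<Rightarrow> real) \<Rightarrow> nat \<Rightarrow> nat \<Rightarrow> real" where
  "mat_inv n a = (SOME b. \<forall>i<n. \<forall>j<n. (\<Sum>k<n. a i k * b k j) = (if i = j then 1 else 0))"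


section \<open>Smooth and complex manifolds\<close>

type_synonym 'a chart = "'a set \<times> ('a \<Rightarrow> nat \<Rightarrow> real)"

record 'a mfd =
  mtop :: "'a topology"
  mdim :: nat
  atlas :: "'a chart set"

definition chart_inv :: "'a chart \<Rightarrow> (nat \<Rightarrow> real) \<Rightarrow> 'a" where
  "chart_inv c = inv_into (fst c) (snd c)"

definition is_chart :: "'a topology \<Rightarrow> nat \<Rightarrow> 'a chart \<Rightarrow> bool" where
  "is_chart T n c \<longleftrightarrow> openin T (fst c) \<and> openin (Euclidean_space n) (snd c ` fst c) \<and>
     homeomorphic_map (subtopology T (fst c)) (subtopology (Euclidean_space n) (snd c ` fst c)) (snd c)"

definition smooth_manifold :: "'a mfd \<Rightarrow> bool" where
  "smooth_manifold X \<longleftrightarrow>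
     Hausdorff_space (mtop X) \<and> second_countable (mtop X) \<and>
     (\<forall>c\<in>atlas X. is_chart (mtop X) (mdim X) c) \<and>
     (\<Union>c\<in>atlas X. fst c) = topspace (mtop X) \<and>
     (\<forall>c\<in>atlas X. \<forall>d\<in>atlas X. \<forall>k<mdim X.
        smooth_on (mdim X) (snd c ` (fst c \<inter> fst d)) (\<lambda>x. snd d (chart_inv c x) k))"

definition smooth_map :: "'a mfd \<Rightarrow> 'b mfd \<Rightarrow> ('a \<Rightarrow> 'b) \<Rightarrow> bool" where
  "smooth_map X Y F \<longleftrightarrow> continuous_map (mtop X) (mtop Y) F \<and>
     (\<forall>c\<in>atlas X. \<forall>d\<in>atlas Y. \<forall>k<mdim Y.
        smooth_on (mdim X) (snd c ` (fst c \<inter> F -` fst d)) (\<lambda>x. snd d (F (chart_inv c x)) k))"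

definition diffeomorphism :: "'a mfd \<Rightarrow> 'b mfd \<Rightarrow> ('a \<Rightarrow> 'b) \<Rightarrow> bool" where
  "diffeomorphism X Y F \<longleftrightarrow> bij_betw F (topspace (mtop X)) (topspace (mtop Y)) \<and>
     smooth_map X Y F \<and> smooth_map Y X (inv_into (topspace (mtop X)) F)"

text \<open>The differential of \<open>F\<close> at \<open>p\<close> applied to \<open>v\<close>; tangent vectors at \<open>p\<close> and at \<open>F p\<close> are
  given by their components with respect to the charts \<open>c\<close> and \<open>d\<close>.\<close>

definition differential ::
    "'a mfd \<Rightarrow> 'b mfd \<Rightarrow> ('a \<Rightarrow> 'b) \<Rightarrow> 'a chart \<Rightarrow> 'b chart \<Rightarrow> 'a \<Rightarrow> (nat \<Rightarrow> real) \<Rightarrow> nat \<Rightarrow> real" where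
  "differential X Y F c d p v = (\<lambda>k. if k < mdim Y
     then \<Sum>i<mdim X. pd i (\<lambda>x. snd d (F (chart_inv c x)) k) (snd c p) * v i else 0)"

definition commutes_with_J :: "'a mfd \<Rightarrow> 'b mfd \<Rightarrow> ('a \<Rightarrow> 'b) \<Rightarrow> bool" where
  "commutes_with_J X Y F \<longleftrightarrow>
     (\<forall>c\<in>atlas X. \<forall>d\<in>atlas Y. \<forall>p\<in>fst c \<inter> F -` fst d. \<forall>v\<in>Rn (mdim X).
        differential X Y F c d p (J v) = J (differential X Y F c d p v))"

text \<open>For a complex manifold \<open>mdim\<close> is the real dimension; the Cauchy-Riemann equations for the
  coordinate changes say that these are holomorphic.\<close>

definition complex_manifold :: "'a mfd \<Rightarrow> bool" where
  "complex_manifold X \<longleftrightarrow> smooth_manifold X \<and> even (mdim X) \<and> commutes_with_J X X (\<lambda>p. p)"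

definition holomorphic_map :: "'a mfd \<Rightarrow> 'b mfd \<Rightarrow> ('a \<Rightarrow> 'b) \<Rightarrow> bool" where
  "holomorphic_map X Y F \<longleftrightarrow> smooth_map X Y F \<and> commutes_with_J X Y F"

definition prod_chart :: "nat \<Rightarrow> 'a chart \<Rightarrow> 'b chart \<Rightarrow> ('a \<times> 'b) chart" where
  "prod_chart m c d =
     (fst c \<times> fst d, \<lambda>(x, y) i. if i < m then snd c x i else snd d y (i - m))"

definition prod_mfd :: "'a mfd \<Rightarrow> 'b mfd \<Rightarrow> ('a \<times> 'b) mfd" where
  "prod_mfd X Y = \<lparr>mtop = prod_topology (mtop X) (mtop Y), mdim = mdim X + mdim Y,
     atlas = {prod_chart (mdim X) c d | c d. c \<in> atlas X \<and> d \<in> atlas Y}\<rparr>"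

definition open_mfd :: "nat \<Rightarrow> (nat \<Rightarrow> real) set \<Rightarrow> (nat \<Rightarrow> real) mfd" where
  "open_mfd n W = \<lparr>mtop = subtopology (Euclidean_space n) W, mdim = n, atlas = {(W, \<lambda>x. x)}\<rparr>"


section \<open>Lie groups and complexification\<close>

definition lie_group :: "('a, 'r) monoid_scheme \<Rightarrow> 'a mfd \<Rightarrow> bool" where
  "lie_group G X \<longleftrightarrow> group G \<and> smooth_manifold X \<and> carrier G = topspace (mtop X) \<and>
     smooth_map (prod_mfd X X) X (\<lambda>(g, h). g \<otimes>\<^bsub>G\<^esub> h) \<and> smooth_map X X (\<lambda>g. inv\<^bsub>G\<^esub> g)"

definition compact_lie_group :: "('a, 'r) monoid_scheme \<Rightarrow> 'a mfd \<Rightarrow> bool" where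
  "compact_lie_group G X \<longleftrightarrow> lie_group G X \<and> compact_space (mtop X)"

definition complex_lie_group :: "('a, 'r) monoid_scheme \<Rightarrow> 'a mfd \<Rightarrow> bool" where
  "complex_lie_group G X \<longleftrightarrow> group G \<and> complex_manifold X \<and> carrier G = topspace (mtop X) \<and>
     holomorphic_map (prod_mfd X X) X (\<lambda>(g, h). g \<otimes>\<^bsub>G\<^esub> h) \<and>
     holomorphic_map X X (\<lambda>g. inv\<^bsub>G\<^esub> g)"

text \<open>\<open>E\<close> is the exponential map of \<open>G\<close>, the Lie algebra being identified with \<open>Rn (mdim X)\<close> by
  means of the chart \<open>c\<close> at the identity: for each \<open>v\<close> the curve \<open>t \<mapsto> E (t v)\<close> is the
  one-parameter subgroup with initial velocity \<open>v\<close>.\<close>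

definition lie_exp ::
    "('a, 'r) monoid_scheme \<Rightarrow> 'a mfd \<Rightarrow> 'a chart \<Rightarrow> ((nat \<Rightarrow> real) \<Rightarrow> 'a) \<Rightarrow> bool" where
  "lie_exp G X c E \<longleftrightarrow> (\<forall>v\<in>Rn (mdim X). 
     continuous_map euclideanreal (mtop X) (\<lambda>t. E (\<lambda>i. t * v i)) \<and>
     (\<forall>s t. E (\<lambda>i. (s + t) * v i) = E (\<lambda>i. s * v i) \<otimes>\<^bsub>G\<^esub> E (\<lambda>i. t * v i)) \<and>
     (\<forall>k<mdim X. ((\<lambda>t. snd c (E (\<lambda>i. t * v i)) k) has_real_derivative v k) (at 0)))"

text \<open>The test groups \<open>H\<close> have carriers inside \<^typ>\<open>real\<close>. This is no restriction: a second
  countable Lie group has at most the cardinality of the continuum, so it is isomorphic to such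
  an \<open>H\<close>.\<close>

definition universal_complex ::
    "('g, 'r) monoid_scheme \<Rightarrow> 'g mfd \<Rightarrow> ('c, 's) monoid_scheme \<Rightarrow> 'c mfd \<Rightarrow> ('g \<Rightarrow> 'c) \<Rightarrow> bool" where
  "universal_complex G X Gc Xc \<iota> \<longleftrightarrow>
     (\<forall>(H :: real monoid) Y f.
        complex_lie_group H Y \<and> f \<in> hom G H \<and> continuous_map (mtop X) (mtop Y) f \<longrightarrow>
        (\<exists>F. (F \<in> hom Gc H \<and> holomorphic_map Xc Y F \<and> (\<forall>g\<in>carrier G. F (\<iota> g) = f g)) \<and>
          (\<forall>F'. F' \<in> hom Gc H \<and> holomorphic_map Xc Y F' \<and> (\<forall>g\<in>carrier G. F' (\<iota> g) = f g) \<longrightarrow>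
             (\<forall>x\<in>carrier Gc. F' x = F x))))"

text \<open>Here \<open>L\<close> is the inclusion of the Lie algebra of \<open>G\<close> into that of \<open>Gc\<close>, and \<open>J\<close>
  is multiplication by \<open>\<i>\<close>. Since the bracket of \<open>Gc\<close> is complex bilinear and \<open>L\<close> is a Lie
  algebra homomorphism, bijectivity of \<open>X + \<i> Y \<mapsto> L X + J (L Y)\<close> says that the Lie
  algebra of \<open>Gc\<close> is the complexification of the one of \<open>G\<close>. In the polar decomposition,
  \<open>E (J (L v))\<close> is \<open>exp (\<i> v)\<close>. Both clauses are well-known consequences of universality; they
  are recorded as part of the structure of the complexification.\<close>

definition complexification ::
    "('g, 'r) monoid_scheme \<Rightarrow> 'g mfd \<Rightarrow> ('c, 's) monoid_scheme \<Rightarrow> 'c mfd \<Rightarrow> ('g \<Rightarrow> 'c) \<Rightarrow> bool" where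
  "complexification G X Gc Xc \<iota> \<longleftrightarrow>
     complex_lie_group Gc Xc \<and>
     \<iota> \<in> hom G Gc \<and> inj_on \<iota> (carrier G) \<and> smooth_map X Xc \<iota> \<and>
     universal_complex G X Gc Xc \<iota> \<and>
     (\<forall>c\<in>atlas X. \<forall>d\<in>atlas Xc. \<one>\<^bsub>G\<^esub> \<in> fst c \<and> \<one>\<^bsub>Gc\<^esub> \<in> fst d \<longrightarrow>
        (let L = differential X Xc \<iota> c d \<one>\<^bsub>G\<^esub> in
           bij_betw (\<lambda>(u, v). \<lambda>k. L u k + J (L v) k)
             (Rn (mdim X) \<times> Rn (mdim X)) (Rn (mdim Xc)) \<and>
           (\<exists>E. lie_exp Gc Xc d E \<and>
              diffeomorphism (prod_mfd (open_mfd (mdim X) (Rn (mdim X))) X) Xc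
                (\<lambda>(v, g). E (J (L v)) \<otimes>\<^bsub>Gc\<^esub> \<iota> g))))"


section \<open>Actions and compactifications\<close>

text \<open>A right action is written with the group element as first argument, so that the library's
  \<^const>\<open>orbit\<close> and \<^const>\<open>stabilizer\<close> apply: \<open>act g p\<close> stands for \<open>p \<cdot> g\<close>.\<close>

definition right_action ::
    "('c, 's) monoid_scheme \<Rightarrow> 'm set \<Rightarrow> ('c \<Rightarrow> 'm \<Rightarrow> 'm) \<Rightarrow> bool" where
  "right_action G S act \<longleftrightarrow>
     (\<forall>g\<in>carrier G. \<forall>p\<in>S. act g p \<in> S) \<and> (\<forall>p\<in>S. act \<one>\<^bsub>G\<^esub> p = p) \<and>
     (\<forall>g\<in>carrier G. \<forall>h\<in>carrier G. \<forall>p\<in>S. act (g \<otimes>\<^bsub>G\<^esub> h) p = act h (act g p))"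

definition compactification ::
    "('c, 's) monoid_scheme \<Rightarrow> 'c mfd \<Rightarrow> 'm mfd \<Rightarrow> ('c \<Rightarrow> 'm \<Rightarrow> 'm) \<Rightarrow> 'm set \<Rightarrow> bool" where
  "compactification Gc Xc M act \<Omega> \<longleftrightarrow>
     complex_manifold M \<and> compact_space (mtop M) \<and>
     right_action Gc (topspace (mtop M)) act \<and>
     holomorphic_map (prod_mfd M Xc) M (\<lambda>(p, g). act g p) \<and>
     (\<exists>p\<in>topspace (mtop M). \<Omega> = orbit Gc act p) \<and>
     openin (mtop M) \<Omega> \<and> (mtop M) closure_of \<Omega> = topspace (mtop M)"


section \<open>Kaehler structures\<close>

text \<open>A covariant 2-tensor is given by its components \<open>\<omega> c p i j\<close> at \<open>p\<close> with respect to each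
  chart \<open>c\<close> around \<open>p\<close>. The following says \<open>F\<^sup>*\<omega> = \<omega>\<close>; for the identity map \<open>F\<close> it is the
  transformation law under a change of coordinates.\<close>

type_synonym 'a tensor2 = "'a chart \<Rightarrow> 'a \<Rightarrow> nat \<Rightarrow> nat \<Rightarrow> real"

definition preserves_tensor :: "'a mfd \<Rightarrow> 'a tensor2 \<Rightarrow> ('a \<Rightarrow> 'a) \<Rightarrow> bool" where
  "preserves_tensor X \<omega> F \<longleftrightarrow>
     (\<forall>c\<in>atlas X. \<forall>d\<in>atlas X. \<forall>p\<in>fst c \<inter> F -` fst d. \<forall>u\<in>Rn (mdim X). \<forall>v\<in>Rn (mdim X).
        bil (mdim X) (\<omega> d (F p)) (differential X X F c d p u) (differential X X F c d p v)
          = bil (mdim X) (\<omega> c p) u v)"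

definition in_coords :: "'a tensor2 \<Rightarrow> 'a chart \<Rightarrow> (nat \<Rightarrow> real) \<Rightarrow> nat \<Rightarrow> nat \<Rightarrow> real" where
  "in_coords \<omega> c x = \<omega> c (chart_inv c x)"

definition closed_2form :: "'a mfd \<Rightarrow> 'a tensor2 \<Rightarrow> bool" where
  "closed_2form X \<omega> \<longleftrightarrow>
     preserves_tensor X \<omega> (\<lambda>p. p) \<and>
     (\<forall>c\<in>atlas X. \<forall>i<mdim X. \<forall>j<mdim X.
        smooth_on (mdim X) (snd c ` fst c) (\<lambda>x. in_coords \<omega> c x i j)) \<and>
     (\<forall>c\<in>atlas X. \<forall>p\<in>fst c. \<forall>i<mdim X. \<forall>j<mdim X. \<omega> c p i j = - \<omega> c p j i) \<and>
     (\<forall>c\<in>atlas X. \<forall>x\<in>snd c ` fst c. \<forall>i<mdim X. \<forall>j<mdim X. \<forall>k<mdim X.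
        pd i (\<lambda>y. in_coords \<omega> c y j k) x + pd j (\<lambda>y. in_coords \<omega> c y k i) x
          + pd k (\<lambda>y. in_coords \<omega> c y i j) x = 0)"

definition kaehler_form :: "'a mfd \<Rightarrow> 'a tensor2 \<Rightarrow> bool" where
  "kaehler_form X \<omega> \<longleftrightarrow> closed_2form X \<omega> \<and>
     (\<forall>c\<in>atlas X. \<forall>p\<in>fst c. \<forall>u\<in>Rn (mdim X). \<forall>v\<in>Rn (mdim X).
        bil (mdim X) (\<omega> c p) (J u) (J v) = bil (mdim X) (\<omega> c p) u v) \<and>
     (\<forall>c\<in>atlas X. \<forall>p\<in>fst c. \<forall>u\<in>Rn (mdim X). u \<noteq> (\<lambda>_. 0) \<longrightarrow>
        bil (mdim X) (\<omega> c p) u (J u) > 0)"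

text \<open>Convention: \<open>g(u, v) = \<omega>(u, J v)\<close>, equivalently \<open>\<omega>(u, v) = g(J u, v)\<close>.\<close>

definition kaehler_metric :: "'a mfd \<Rightarrow> 'a tensor2 \<Rightarrow> 'a tensor2" where
  "kaehler_metric X \<omega> c p i j = bil (mdim X) (\<omega> c p) (unit_vec i) (J (unit_vec j))"

definition invariant_form ::
    "('g, 'r) monoid_scheme \<Rightarrow> 'm mfd \<Rightarrow> ('g \<Rightarrow> 'm \<Rightarrow> 'm) \<Rightarrow> 'm tensor2 \<Rightarrow> bool" where
  "invariant_form G M act \<omega> \<longleftrightarrow> (\<forall>g\<in>carrier G. preserves_tensor M \<omega> (act g))"


section \<open>Levi-Civita connection, curvature and the Ricci form\<close>

context
  fixes n :: nat and g :: "(nat \<Rightarrow> real) \<Rightarrow> nat \<Rightarrow> nat \<Rightarrow> real"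
begin

text \<open>\<open>christoffel x k i j\<close> is the component \<open>\<Gamma>\<^sup>k\<^sub>i\<^sub>j\<close> at \<open>x\<close> of the metric \<open>g\<close>.\<close>

definition christoffel :: "(nat \<Rightarrow> real) \<Rightarrow> nat \<Rightarrow> nat \<Rightarrow> nat \<Rightarrow> real" where
  "christoffel x k i j = (1/2) * (\<Sum>l<n. mat_inv n (g x) k l *
     (pd i (\<lambda>y. g y j l) x + pd j (\<lambda>y. g y i l) x - pd l (\<lambda>y. g y i j) x))"

text \<open>\<open>riemann x l i j k\<close> is the \<open>l\<close>-th component of \<open>R(\<partial>\<^sub>i, \<partial>\<^sub>j)\<partial>\<^sub>k\<close>, where
  \<open>R(u, v) = [\<nabla>\<^sub>u, \<nabla>\<^sub>v] - \<nabla>\<^bsub>[u,v]\<^esub>\<close>; \<open>Ric(v, w)\<close> is the trace of \<open>u \<mapsto> R(u, v)w\<close>.\<close>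

definition riemann :: "(nat \<Rightarrow> real) \<Rightarrow> nat \<Rightarrow> nat \<Rightarrow> nat \<Rightarrow> nat \<Rightarrow> real" where
  "riemann x l i j k =
     pd i (\<lambda>y. christoffel y l j k) x - pd j (\<lambda>y. christoffel y l i k) x
     + (\<Sum>m<n. christoffel x l i m * christoffel x m j k - christoffel x l j m * christoffel x m i k)"

definition ricci :: "(nat \<Rightarrow> real) \<Rightarrow> nat \<Rightarrow> nat \<Rightarrow> real" where
  "ricci x j k = (\<Sum>i<n. riemann x i i j k)"

end

definition ricci_form :: "'a mfd \<Rightarrow> 'a tensor2 \<Rightarrow> 'a tensor2" where
  "ricci_form X \<omega> c p i j =
     bil (mdim X) (ricci (mdim X) (in_coords (kaehler_metric X \<omega>) c) (snd c p))
       (J (unit_vec i)) (unit_vec j)"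

definition positive_kaehler_einstein :: "'a mfd \<Rightarrow> 'a tensor2 \<Rightarrow> bool" where
  "positive_kaehler_einstein X \<omega> \<longleftrightarrow>
     (\<exists>r>0. \<forall>c\<in>atlas X. \<forall>p\<in>fst c. \<forall>i<mdim X. \<forall>j<mdim X. ricci_form X \<omega> c p i j = r * \<omega> c p i j)"


section \<open>Minimal Lagrangian submanifolds\<close>

text \<open>A \<open>k\<close>-dimensional embedded submanifold \<open>L\<close> is one that is covered by local
  parametrizations: smooth immersions of open sets \<open>W\<close> of real \<open>k\<close>-space that are homeomorphisms onto
  relatively open subsets of \<open>L\<close>.\<close>

definition local_param ::
    "'a mfd \<Rightarrow> nat \<Rightarrow> 'a set \<Rightarrow> (nat \<Rightarrow> real) set \<Rightarrow> ((nat \<Rightarrow> real) \<Rightarrow> 'a) \<Rightarrow> bool" where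
  "local_param X k L W \<sigma> \<longleftrightarrow>
     openin (Euclidean_space k) W \<and> smooth_map (open_mfd k W) X \<sigma> \<and>
     embedding_map (subtopology (Euclidean_space k) W) (mtop X) \<sigma> \<and>
     openin (subtopology (mtop X) L) (\<sigma> ` W) \<and>
     (\<forall>x\<in>W. \<forall>c\<in>atlas X. \<sigma> x \<in> fst c \<longrightarrow>
        inj_on (differential (open_mfd k W) X \<sigma> (W, \<lambda>x. x) c x) (Rn k))"

definition embedded_submanifold :: "'a mfd \<Rightarrow> nat \<Rightarrow> 'a set \<Rightarrow> bool" where
  "embedded_submanifold X k L \<longleftrightarrow> L \<subseteq> topspace (mtop X) \<and>
     (\<forall>p\<in>L. \<exists>W \<sigma>. local_param X k L W \<sigma> \<and> p \<in> \<sigma> ` W)"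

definition lagrangian :: "'a mfd \<Rightarrow> 'a tensor2 \<Rightarrow> 'a set \<Rightarrow> bool" where
  "lagrangian X \<omega> L \<longleftrightarrow> embedded_submanifold X (mdim X div 2) L \<and>
     (\<forall>W \<sigma>. local_param X (mdim X div 2) L W \<sigma> \<longrightarrow>
        (\<forall>x\<in>W. \<forall>c\<in>atlas X. \<sigma> x \<in> fst c \<longrightarrow>
           (\<forall>u\<in>Rn (mdim X div 2). \<forall>v\<in>Rn (mdim X div 2).
              (let D = differential (open_mfd (mdim X div 2) W) X \<sigma> (W, \<lambda>x. x) c x
               in bil (mdim X) (\<omega> c (\<sigma> x)) (D u) (D v) = 0))))"

text \<open>In coordinates of the ambient \<open>n\<close>-space with metric \<open>g\<close>, let \<open>s\<close> be an immersion of an open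
  subset of \<open>k\<close>-space. \<open>second_deriv\<close> is \<open>\<nabla>\<^sub>a \<partial>\<^sub>b s\<close>, the second fundamental form is its
  component normal to the image of \<open>s\<close>, and the mean curvature vector is the trace of the second
  fundamental form with respect to the induced metric.\<close>

context
  fixes n k :: nat
    and g :: "(nat \<Rightarrow> real) \<Rightarrow> nat \<Rightarrow> nat \<Rightarrow> real"
    and s :: "(nat \<Rightarrow> real) \<Rightarrow> nat \<Rightarrow> real"
    and x :: "nat \<Rightarrow> real"
begin

definition tangent_vec :: "nat \<Rightarrow> nat \<Rightarrow> real" where
  "tangent_vec a i = pd a (\<lambda>y. s y i) x"

definition induced_metric :: "nat \<Rightarrow> nat \<Rightarrow> real" where
  "induced_metric a b = bil n (g (s x)) (tangent_vec a) (tangent_vec b)"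

definition normal_part :: "(nat \<Rightarrow> real) \<Rightarrow> nat \<Rightarrow> real" where
  "normal_part v i = v i - (\<Sum>a<k. \<Sum>b<k.
     mat_inv k induced_metric a b * bil n (g (s x)) v (tangent_vec a) * tangent_vec b i)"

definition second_deriv :: "nat \<Rightarrow> nat \<Rightarrow> nat \<Rightarrow> real" where
  "second_deriv a b i = pd a (pd b (\<lambda>y. s y i)) x +
     (\<Sum>j<n. \<Sum>l<n. christoffel n g (s x) i j l * tangent_vec a j * tangent_vec b l)"

definition second_fundamental_form :: "nat \<Rightarrow> nat \<Rightarrow> nat \<Rightarrow> real" where
  "second_fundamental_form a b = normal_part (second_deriv a b)"

definition mean_curvature :: "nat \<Rightarrow> real" where
  "mean_curvature i =
     (\<Sum>a<k. \<Sum>b<k. mat_inv k induced_metric a b * second_fundamental_form a b i)"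

end

definition minimal_submanifold :: "'a mfd \<Rightarrow> 'a tensor2 \<Rightarrow> nat \<Rightarrow> 'a set \<Rightarrow> bool" where
  "minimal_submanifold X g k L \<longleftrightarrow> embedded_submanifold X k L \<and>
     (\<forall>W \<sigma>. local_param X k L W \<sigma> \<longrightarrow>
        (\<forall>x\<in>W. \<forall>c\<in>atlas X. \<sigma> x \<in> fst c \<longrightarrow>
           (\<forall>i<mdim X. mean_curvature (mdim X) k (in_coords g c) (\<lambda>y. snd c (\<sigma> y)) x i = 0)))"

end

theory Submission
  imports Defs "Jordan_Normal_Form.Determinant" "HOL-Homology.Invariance_of_Domain"
begin

text \<open>Let \<open>X\<close> also denote the fundamental vector field on \<open>M\<close> of an element \<open>X\<close> of the Lie algebra of
  \<open>G\<close>; it is holomorphic and Killing. The Einstein equation with constant \<open>r\<close> turns into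
  \<open>d(div JX)(u) = - 2 r g(u, JX)\<close>. Let \<open>D\<close> be the Gram determinant of the frame
  \<open>X\<^sub>1, \<dots>, X\<^sub>n, JX\<^sub>1, \<dots>, JX\<^sub>n\<close>. It vanishes exactly off the open orbit, every element of \<open>G\<close>
  multiplies it by a constant, and \<open>JX D = 2 div(JX) D\<close>.

  The mean curvature \<open>H\<close> of a Lagrangian \<open>G\<close>-orbit satisfies \<open>2 g(H, JX) = - div JX\<close>. Conversely, if all
  \<open>div JX\<close> vanish along an orbit, differentiating along the orbit gives \<open>g(X\<^sub>a, JX\<^sub>b) = 0\<close>, so the orbit
  is Lagrangian. Hence the minimal Lagrangian orbits are the orbits of critical points of \<open>D\<close> in the
  open orbit. A maximum of \<open>\<bar>D\<bar>\<close> on the compact \<open>M\<close> provides one. Along \<open>t \<mapsto> p exp(\<i> t X)\<close> the second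
  derivative of \<open>log \<bar>D\<bar>\<close> is \<open>- 4 r g(X, X) < 0\<close>, so by the polar decomposition of \<open>G\<^sup>c\<close> there is only
  one.\<close>

section \<open>Partial derivatives and smooth functions\<close>

text \<open>The difficulty is to extract from the Einstein equation, which is second order in the
  metric, a statement about one function. Since X is Killing, div X = 0, and d(div JX)(u) equals
  d(div JX)(u) - d(div X)(J u). X being holomorphic, its second derivatives cancel in this
  difference, and what is left is - (Ric(u, JX) + Ric(J u, J JX)), whose two terms agree because Ric
  = r g; this is the origin of the factor 2. The same interplay governs D: bracketing with JX sends
  the X half of the frame into the JX half and back, so the structure constants enter with trace
  zero and only the divergence remains. Finite isotropy enters through one-parameter subgroups: a
  vanishing fundamental vector would place a nonconstant one inside a finite group. That dim M = 2
  dim G, so that the frame is a basis, is derived from Baire's theorem and invariance of domain; the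
  latter also shows that a point with nonzero D lies in the dense orbit. The notions of Lagrangian
  and minimal range over all local parametrizations, so the tangent spaces of an orbit have to be
  computed in an arbitrary one.\<close>

lemma Rn_iff: "x \<in> Rn n \<longleftrightarrow> (\<forall>i\<ge>n. x i = 0)"
  by (simp add: topspace_Euclidean_space)

text \<open>Boxes rather than balls: changing a single coordinate within the allowed range stays in
  the box, which is what arguments with partial derivatives need.\<close>

definition cube :: "nat \<Rightarrow> (nat \<Rightarrow> real) \<Rightarrow> real \<Rightarrow> (nat \<Rightarrow> real) set" where
  "cube n x e = {y \<in> Rn n. \<forall>i<n. \<bar>y i - x i\<bar> < e}"

lemma cube_mono: "d \<le> e \<Longrightarrow> cube n x d \<subseteq> cube n x e"
  by (force simp: cube_def)

lemma cube_self: "x \<in> Rn n \<Longrightarrow> 0 < e \<Longrightarrow> x \<in> cube n x e"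
  by (simp add: cube_def)

lemma cube_Rn: "y \<in> cube n x e \<Longrightarrow> y \<in> Rn n"
  unfolding cube_def by blast

lemma continuous_map_coord: "continuous_map (Euclidean_space n) euclideanreal (\<lambda>x. x i)"
  unfolding Euclidean_space_def
  by (intro continuous_map_from_subtopology continuous_map_product_projection) auto

lemma openin_cube: "openin (Euclidean_space n) (cube n x e)"
proof -
  have "openin (Euclidean_space n) {y \<in> Rn n. y i \<in> {x i - e <..< x i + e}}" for i
    by (rule openin_continuous_map_preimage[OF continuous_map_coord]) auto
  then have "openin (Euclidean_space n) (Rn n \<inter> (\<Inter>i\<in>{..<n}. {y \<in> Rn n. y i \<in> {x i - e <..< x i + e}}))"
    by (intro openin_Int_Inter) auto
  also have "Rn n \<inter> (\<Inter>i\<in>{..<n}. {y \<in> Rn n. y i \<in> {x i - e <..< x i + e}}) = cube n x e"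
    by (auto simp: cube_def abs_less_iff algebra_simps)
  finally show ?thesis .
qed

text \<open>All points of \<open>Euclidean_space n\<close> agree in the coordinates from n on, so of
  a basic open set of the infinite product only the first n sides matter, and the smallest of n
  positive radii gives a cube.\<close>

lemma openin_Rn_iff:
  "openin (Euclidean_space n) W \<longleftrightarrow> W \<subseteq> Rn n \<and> (\<forall>x\<in>W. \<exists>e>0. cube n x e \<subseteq> W)"
proof (intro iffI conjI ballI)
  assume W: "openin (Euclidean_space n) W"
  then show "W \<subseteq> Rn n" by (rule openin_subset)
  fix x assume x: "x \<in> W"
  obtain T where T: "openin (powertop_real UNIV) T" "W = T \<inter> {x. \<forall>i\<ge>n. x i = 0}"
    using W by (auto simp: Euclidean_space_def openin_subtopology)
  then obtain U where U: "finite {i. U i \<noteq> (UNIV::real set)}" "\<And>i. open (U i)"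
      "x \<in> Pi\<^sub>E UNIV U" "Pi\<^sub>E UNIV U \<subseteq> T"
    using x by (force simp: openin_product_topology_alt)
  have "\<exists>e>0. ball (x i) e \<subseteq> U i" for i
    using U(2,3) by (meson PiE_mem UNIV_I open_contains_ball)
  then obtain e where e: "\<And>i. e i > 0" "\<And>i. ball (x i) (e i) \<subseteq> U i" by metis
  \<comment> \<open>The inserted 1 provides a radius when n = 0.\<close>
  define d where "d = Min (insert 1 (e ` {..<n}))"
  have "d > 0" using e by (auto simp: d_def)
  have dle: "d \<le> e i" if "i < n" for i using that by (auto simp: d_def)
  have "cube n x d \<subseteq> W"
  proof
    fix y assume y: "y \<in> cube n x d"
    have "y i \<in> U i" for i
    proof (cases "i < n")
      case True
      then have "\<bar>y i - x i\<bar> < e i" using y dle[OF True] by (force simp: cube_def)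
      then show ?thesis using e(2)[of i] by (auto simp: dist_real_def subset_iff abs_minus_commute)
    next
      case False
      then have "y i = x i" using y x T(2) by (auto simp: cube_def Rn_iff)
      then show ?thesis using U(3) by auto
    qed
    then have "y \<in> T" using U(4) by blast
    then show "y \<in> W" using y T(2) by (auto simp: cube_def Rn_iff)
  qed
  then show "\<exists>e>0. cube n x e \<subseteq> W" using \<open>d > 0\<close> by blast
next
  assume R: "W \<subseteq> Rn n \<and> (\<forall>x\<in>W. \<exists>e>0. cube n x e \<subseteq> W)"
  show "openin (Euclidean_space n) W"
  proof (subst openin_subopen, intro ballI)
    fix x assume "x \<in> W"
    then obtain e where "e > 0" "cube n x e \<subseteq> W" using R by blast
    then show "\<exists>T. openin (Euclidean_space n) T \<and> x \<in> T \<and> T \<subseteq> W"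
      using openin_cube[of n x e] cube_self[of x n e] R \<open>x \<in> W\<close> by blast
  qed
qed

lemma openin_cubeD:
  assumes "openin (Euclidean_space n) W" "x \<in> W"
  obtains e where "e > 0" "cube n x e \<subseteq> W"
  using assms openin_Rn_iff by blast

lemma openin_Rn_subset: "openin (Euclidean_space n) W \<Longrightarrow> x \<in> W \<Longrightarrow> x \<in> Rn n"
  using openin_subset by blast

lemma continuous_cubeD:
  assumes "continuous_map (subtopology (Euclidean_space n) W) euclideanreal f"
    and "openin (Euclidean_space n) W" "x \<in> W" "e > 0"
  obtains d where "d > 0" "cube n x d \<subseteq> W" "\<And>y. y \<in> cube n x d \<Longrightarrow> \<bar>f y - f x\<bar> < e"
proof -
  have "openin (subtopology (Euclidean_space n) W)
      {y \<in> topspace (subtopology (Euclidean_space n) W). f y \<in> ball (f x) e}"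
    by (rule openin_continuous_map_preimage[OF assms(1)]) auto
  then have "openin (Euclidean_space n) {y \<in> topspace (subtopology (Euclidean_space n) W). f y \<in> ball (f x) e}"
    using assms(2) openin_trans_full by blast
  moreover have "x \<in> {y \<in> topspace (subtopology (Euclidean_space n) W). f y \<in> ball (f x) e}"
    using assms openin_Rn_subset by auto
  ultimately obtain d where "d > 0"
    "cube n x d \<subseteq> {y \<in> topspace (subtopology (Euclidean_space n) W). f y \<in> ball (f x) e}"
    by (rule openin_cubeD)
  then show thesis using that[of d]
    by (auto simp: subset_iff dist_real_def abs_minus_commute)
qed

lemma continuous_cubeI:
  assumes "openin (Euclidean_space n) W"
    and "\<And>x e. x \<in> W \<Longrightarrow> e > 0 \<Longrightarrow> \<exists>d>0. \<forall>y\<in>cube n x d \<inter> W. \<bar>f y - f x\<bar> < e"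
  shows "continuous_map (subtopology (Euclidean_space n) W) euclideanreal f"
  unfolding continuous_map_def
proof (intro conjI allI impI)
  fix U :: "real set" assume "openin euclideanreal U"
  then have U: "open U" by simp
  have "openin (Euclidean_space n) {x \<in> W. f x \<in> U}"
    unfolding openin_Rn_iff
  proof (intro conjI ballI)
    show "{x \<in> W. f x \<in> U} \<subseteq> Rn n" using assms(1) openin_Rn_iff by auto
    fix x assume x: "x \<in> {x \<in> W. f x \<in> U}"
    obtain e where e: "e > 0" "ball (f x) e \<subseteq> U" using U x open_contains_ball by blast
    obtain d where d: "d > 0" "\<forall>y\<in>cube n x d \<inter> W. \<bar>f y - f x\<bar> < e" using assms(2) e x by blast
    obtain d' where d': "d' > 0" "cube n x d' \<subseteq> W" using assms(1) x openin_cubeD by blast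
    have "cube n x (min d d') \<subseteq> {x \<in> W. f x \<in> U}"
    proof
      fix y assume "y \<in> cube n x (min d d')"
      then have "y \<in> cube n x d" "y \<in> W"
        using cube_mono[of "min d d'" d n x] cube_mono[of "min d d'" d' n x] d'(2) by (auto simp: subset_iff)
      then have "f y \<in> ball (f x) e" using d by (auto simp: dist_real_def abs_minus_commute)
      then show "y \<in> {x \<in> W. f x \<in> U}" using e \<open>y \<in> W\<close> by blast
    qed
    then show "\<exists>e>0. cube n x e \<subseteq> {x \<in> W. f x \<in> U}"
      using d(1) d'(1) by (intro exI[of _ "min d d'"]) auto
  qed
  moreover have "{x \<in> topspace (subtopology (Euclidean_space n) W). f x \<in> U} = {x \<in> W. f x \<in> U}"
    using openin_subset[OF assms(1)] by auto
  ultimately show "openin (subtopology (Euclidean_space n) W)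
      {x \<in> topspace (subtopology (Euclidean_space n) W). f x \<in> U}"
    using assms(1) by (auto simp: openin_open_subtopology)
qed auto

section \<open>Locality of partial derivatives and of smoothness\<close>

lemma upd_cube: "y \<in> cube n x e \<Longrightarrow> i < n \<Longrightarrow> \<bar>t - x i\<bar> < e \<Longrightarrow> y(i := t) \<in> cube n x e"
  by (auto simp: cube_def Rn_iff)

lemma eventually_upd:
  assumes "openin (Euclidean_space n) W" "x \<in> W" "i < n"
  shows "eventually (\<lambda>t. x(i := t) \<in> W) (nhds (x i))"
proof -
  obtain e where e: "e > 0" "cube n x e \<subseteq> W" using assms openin_cubeD by blast
  have "x(i := t) \<in> W" if "dist t (x i) < e" for t
    using upd_cube[OF cube_self[of x n e] assms(3), of t] e that openin_Rn_subset[OF assms(1,2)]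
    by (auto simp: dist_real_def)
  then show ?thesis unfolding eventually_nhds_metric using e(1) by blast
qed

text \<open>A partial derivative only sees the germ. Functions built from \<open>chart_inv\<close>
  have arbitrary values outside their domain, and this is the rule that lets them be rewritten
  inside an open set.\<close>

lemma pd_cong:
  assumes "openin (Euclidean_space n) W" "\<And>y. y \<in> W \<Longrightarrow> f y = g y" "x \<in> W" "i < n"
  shows "pd i f x = pd i g x"
  unfolding pd_def
  by (rule deriv_cong_ev) (auto intro: eventually_mono[OF eventually_upd[OF assms(1,3,4)]] assms(2))

lemma pd_eqI: "((\<lambda>t. f (x(i := t))) has_real_derivative v) (at (x i)) \<Longrightarrow> pd i f x = v"
  unfolding pd_def by (rule DERIV_imp_deriv)

lemma smooth_onD:
  assumes "smooth_on n W f"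
  shows smooth_on_open: "openin (Euclidean_space n) W"
    and smooth_on_cont: "continuous_map (subtopology (Euclidean_space n) W) euclideanreal f"
    and smooth_on_pd: "\<And>i. i < n \<Longrightarrow> smooth_on n W (pd i f)"
    and smooth_on_deriv: "\<And>i x. i < n \<Longrightarrow> x \<in> W \<Longrightarrow>
      ((\<lambda>t. f (x(i := t))) has_real_derivative pd i f x) (at (x i))"
proof -
  note S = assms[unfolded smooth_on_def, THEN conjunct2, rule_format]
  show o: "openin (Euclidean_space n) W" using assms by (simp add: smooth_on_def)
  show "continuous_map (subtopology (Euclidean_space n) W) euclideanreal f"
    using S[of "[]"] by simp
  show "smooth_on n W (pd i f)" if "i < n" for i
    unfolding smooth_on_def
  proof (intro conjI o allI impI)
    fix "is" assume "set is \<subseteq> {..<n}"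
    then have s: "set (is @ [i]) \<subseteq> {..<n}" using that by auto
    show "continuous_map (subtopology (Euclidean_space n) W) euclideanreal (foldr pd is (pd i f))"
      using S[OF s] by simp
    fix j assume "j < n"
    then show "\<forall>x\<in>W. (\<lambda>t. foldr pd is (pd i f) (x(j := t))) field_differentiable at (x j)"
      using S[OF s] by simp
  qed
  show "((\<lambda>t. f (x(i := t))) has_real_derivative pd i f x) (at (x i))" if "i < n" "x \<in> W" for i x
    using S[of "[]"] that unfolding pd_def
    by (simp add: DERIV_deriv_iff_field_differentiable)
qed

lemma smooth_on_deriv':
  assumes "smooth_on n W f" "i < n" "x(i := t) \<in> W"
  shows "((\<lambda>t. f (x(i := t))) has_real_derivative pd i f (x(i := t))) (at t)"
  using smooth_on_deriv[OF assms] by simp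

text \<open>Smoothness speaks about every iterated partial derivative. A family of continuous,
  partially differentiable functions that contains the partial derivatives of its members, up to
  equality on W, supplies all of them at once: membership in F is the coinductive invariant.\<close>

lemma smooth_on_coinduct:
  assumes W: "openin (Euclidean_space n) W" and f: "f \<in> F"
    and c: "\<And>f. f \<in> F \<Longrightarrow> continuous_map (subtopology (Euclidean_space n) W) euclideanreal f"
    and d: "\<And>f i x. f \<in> F \<Longrightarrow> i < n \<Longrightarrow> x \<in> W \<Longrightarrow>
      \<exists>D. ((\<lambda>t. f (x(i := t))) has_real_derivative D) (at (x i))"
    and p: "\<And>f i. f \<in> F \<Longrightarrow> i < n \<Longrightarrow> \<exists>g\<in>F. \<forall>x\<in>W. pd i f x = g x"
  shows "smooth_on n W f"
proof -
  have *: "\<exists>g\<in>F. \<forall>x\<in>W. foldr pd is f x = g x" if "set is \<subseteq> {..<n}" for "is"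
    using that
  proof (induction "is")
    case Nil
    then show ?case using f by auto
  next
    case (Cons i "is")
    then obtain g where g: "g \<in> F" "\<forall>x\<in>W. foldr pd is f x = g x" by auto
    have i: "i < n" using Cons by auto
    obtain h where h: "h \<in> F" "\<forall>x\<in>W. pd i g x = h x" using p[OF g(1) i] by auto
    have "pd i (foldr pd is f) x = h x" if "x \<in> W" for x
      using pd_cong[OF W _ that i, of "foldr pd is f" g] g h that by auto
    then show ?case using h by auto
  qed
  show ?thesis unfolding smooth_on_def
  proof (intro conjI W allI impI ballI)
    fix "is" assume "set is \<subseteq> {..<n}"
    then obtain g where g: "g \<in> F" "\<forall>x\<in>W. foldr pd is f x = g x" using * by blast
    show "continuous_map (subtopology (Euclidean_space n) W) euclideanreal (foldr pd is f)"
      by (rule continuous_map_eq[OF c[OF g(1)]]) (use g in auto)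
    fix i x assume i: "i < n" and x: "x \<in> W"
    obtain D where D: "((\<lambda>t. g (x(i := t))) has_real_derivative D) (at (x i))" using d[OF g(1) i x] by blast
    have "((\<lambda>t. foldr pd is f (x(i := t))) has_real_derivative D) (at (x i))"
      by (subst DERIV_cong_ev[OF refl _ refl, where g = "\<lambda>t. g (x(i := t))"])
         (use D g in \<open>auto intro: eventually_mono[OF eventually_upd[OF W x i]]\<close>)
    then show "(\<lambda>t. foldr pd is f (x(i := t))) field_differentiable at (x i)"
      by (auto simp: field_differentiable_def)
  qed
qed

lemma smooth_on_cong:
  assumes "smooth_on n W f" "\<And>x. x \<in> W \<Longrightarrow> f x = g x"
  shows "smooth_on n W g"
proof (rule smooth_on_coinduct[where F = "{h. \<exists>f. smooth_on n W f \<and> (\<forall>x\<in>W. f x = h x)}"])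
  show "openin (Euclidean_space n) W" using assms smooth_on_open by blast
  note W = this
  show "g \<in> {h. \<exists>f. smooth_on n W f \<and> (\<forall>x\<in>W. f x = h x)}" using assms by auto
  fix h assume "h \<in> {h. \<exists>f. smooth_on n W f \<and> (\<forall>x\<in>W. f x = h x)}"
  then obtain f where f: "smooth_on n W f" "\<forall>x\<in>W. f x = h x" by auto
  show "continuous_map (subtopology (Euclidean_space n) W) euclideanreal h"
    by (rule continuous_map_eq[OF smooth_on_cont[OF f(1)]]) (use f in auto)
  fix i assume i: "i < n"
  { fix x assume x: "x \<in> W"
    have "((\<lambda>t. h (x(i := t))) has_real_derivative pd i f x) (at (x i))"
      by (subst DERIV_cong_ev[OF refl _ refl, where g = "\<lambda>t. f (x(i := t))"])
         (use smooth_on_deriv[OF f(1) i x] f in \<open>auto intro: eventually_mono[OF eventually_upd[OF W x i]]\<close>)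
    then show "\<exists>D. ((\<lambda>t. h (x(i := t))) has_real_derivative D) (at (x i))" by blast }
  show "\<exists>g\<in>{h. \<exists>f. smooth_on n W f \<and> (\<forall>x\<in>W. f x = h x)}. \<forall>x\<in>W. pd i h x = g x"
    using smooth_on_pd[OF f(1) i] pd_cong[OF W _ _ i, of h f] f by (intro bexI[of _ "pd i f"]) auto
qed

lemma smooth_on_subset:
  assumes "smooth_on n W f" "V \<subseteq> W" "openin (Euclidean_space n) V"
  shows "smooth_on n V f"
proof (rule smooth_on_coinduct[where F = "{f. smooth_on n W f}"])
  fix f i assume f: "f \<in> {f. smooth_on n W f}"
  show "continuous_map (subtopology (Euclidean_space n) V) euclideanreal f"
    using smooth_on_cont[of n W f] f assms(2) continuous_map_from_subtopology_mono by blast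
  assume i: "i < n"
  show "\<exists>D. ((\<lambda>t. f (x(i := t))) has_real_derivative D) (at (x i))" if "x \<in> V" for x
    using smooth_on_deriv[of n W f i x] i f assms(2) that by blast
  show "\<exists>g\<in>{f. smooth_on n W f}. \<forall>x\<in>V. pd i f x = g x"
    using smooth_on_pd[of n W f i] f i by auto
qed (use assms in auto)

lemma smooth_on_local:
  assumes "\<And>x. x \<in> W \<Longrightarrow> \<exists>V. x \<in> V \<and> V \<subseteq> W \<and> smooth_on n V f"
  shows "smooth_on n W f"
proof (rule smooth_on_coinduct[where F = "{f. \<forall>x\<in>W. \<exists>V. x \<in> V \<and> V \<subseteq> W \<and> smooth_on n V f}"])
  show W: "openin (Euclidean_space n) W"
  proof (subst openin_subopen, intro ballI)
    fix x assume "x \<in> W"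
    then obtain V where "x \<in> V" "V \<subseteq> W" "smooth_on n V f" using assms by blast
    then show "\<exists>T. openin (Euclidean_space n) T \<and> x \<in> T \<and> T \<subseteq> W"
      using smooth_on_open by (intro exI[of _ V]) auto
  qed
  show "f \<in> {f. \<forall>x\<in>W. \<exists>V. x \<in> V \<and> V \<subseteq> W \<and> smooth_on n V f}" using assms by auto
  fix f assume "f \<in> {f. \<forall>x\<in>W. \<exists>V. x \<in> V \<and> V \<subseteq> W \<and> smooth_on n V f}"
  then have "\<forall>x\<in>W. \<exists>V. x \<in> V \<and> V \<subseteq> W \<and> smooth_on n V f" by simp
  then obtain V where V: "\<And>x. x \<in> W \<Longrightarrow> x \<in> V x" "\<And>x. x \<in> W \<Longrightarrow> V x \<subseteq> W"
    "\<And>x. x \<in> W \<Longrightarrow> smooth_on n (V x) f" by metis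
  show "continuous_map (subtopology (Euclidean_space n) W) euclideanreal f"
  proof (rule continuous_cubeI[OF W])
    fix x and e :: real assume x: "x \<in> W" and "e > 0"
    obtain d where "d > 0" "\<And>y. y \<in> cube n x d \<Longrightarrow> \<bar>f y - f x\<bar> < e"
      using continuous_cubeD[OF smooth_on_cont[OF V(3)[OF x]] smooth_on_open[OF V(3)[OF x]] V(1)[OF x] \<open>e > 0\<close>] by metis
    then show "\<exists>d>0. \<forall>y\<in>cube n x d \<inter> W. \<bar>f y - f x\<bar> < e" by (intro exI[of _ d]) auto
  qed
  fix i assume i: "i < n"
  show "\<exists>D. ((\<lambda>t. f (x(i := t))) has_real_derivative D) (at (x i))" if "x \<in> W" for x
    using smooth_on_deriv[OF V(3)[OF that] i V(1)[OF that]] by (rule exI)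
  have "\<exists>Va. x \<in> Va \<and> Va \<subseteq> W \<and> smooth_on n Va (pd i f)" if "x \<in> W" for x
    using smooth_on_pd[OF V(3)[OF that] i] V(1,2)[OF that] by (intro exI[of _ "V x"]) simp
  then show "\<exists>g\<in>{f. \<forall>x\<in>W. \<exists>V. x \<in> V \<and> V \<subseteq> W \<and> smooth_on n V f}. \<forall>x\<in>W. pd i f x = g x"
    by (intro bexI[of _ "pd i f"]) auto
qed

section \<open>Mean value estimates, strict differentiability and the chain rule\<close>

lemma MVT_between:
  fixes \<phi> :: "real \<Rightarrow> real"
  assumes "\<And>t. min a b \<le> t \<Longrightarrow> t \<le> max a b \<Longrightarrow> (\<phi> has_real_derivative \<phi>' t) (at t)"
  shows "\<exists>\<xi>. min a b \<le> \<xi> \<and> \<xi> \<le> max a b \<and> \<phi> b - \<phi> a = \<phi>' \<xi> * (b - a)"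
proof (cases a b rule: linorder_cases)
  case less
  obtain z where "z > a" "z < b" "\<phi> b - \<phi> a = (b - a) * \<phi>' z"
    using MVT2[OF less, of \<phi> \<phi>'] assms less by auto
  then show ?thesis using less by (intro exI[of _ z]) (auto simp: algebra_simps)
next
  case equal
  then show ?thesis by (intro exI[of _ a]) auto
next
  case greater
  obtain z where "z > b" "z < a" "\<phi> a - \<phi> b = (a - b) * \<phi>' z"
    using MVT2[OF greater, of \<phi> \<phi>'] assms greater by auto
  then show ?thesis using greater by (intro exI[of _ z]) (auto simp: algebra_simps)
qed

text \<open>The path from z to y changes one coordinate at a time, through the points
  \<open>h k\<close>; it stays in the cube, and each leg is a one-variable mean value theorem with
  its own intermediate point.\<close>

lemma smooth_on_mean_value:
  assumes f: "smooth_on n W f" and e: "cube n x e \<subseteq> W" and y: "y \<in> cube n x e" and z: "z \<in> cube n x e"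
  shows "\<exists>p. (\<forall>k<n. p k \<in> cube n x e) \<and> f y - f z = (\<Sum>k<n. pd k f (p k) * (y k - z k))"
proof -
  define h where "h k = (\<lambda>i. if i < k then y i else z i)" for k
  have hc: "h k \<in> cube n x e" for k using y z by (auto simp: h_def cube_def Rn_iff)
  have "h n = y" using y z by (auto simp: h_def cube_def Rn_iff fun_eq_iff)
  moreover have "h 0 = z" by (simp add: h_def)
  ultimately have 1: "f y - f z = (\<Sum>k<n. f (h (Suc k)) - f (h k))"
    using sum_lessThan_telescope[of "\<lambda>k. f (h k)" n] by simp
  have "\<exists>p. p \<in> cube n x e \<and> f (h (Suc k)) - f (h k) = pd k f p * (y k - z k)" if k: "k < n" for k
  proof -
    have c: "(h k)(k := t) \<in> cube n x e" if "min (z k) (y k) \<le> t" "t \<le> max (z k) (y k)" for t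
    proof (rule upd_cube[OF hc k])
      have "\<bar>y k - x k\<bar> < e" "\<bar>z k - x k\<bar> < e" using y z k by (auto simp: cube_def)
      then show "\<bar>t - x k\<bar> < e" using that by (auto simp: min_def max_def abs_less_iff split: if_splits)
    qed
    have "\<exists>\<xi>. min (z k) (y k) \<le> \<xi> \<and> \<xi> \<le> max (z k) (y k) \<and>
        f ((h k)(k := y k)) - f ((h k)(k := z k)) = pd k f ((h k)(k := \<xi>)) * (y k - z k)"
      by (rule MVT_between, rule smooth_on_deriv'[OF f k]) (use c e in blast)
    moreover have "(h k)(k := y k) = h (Suc k)" "(h k)(k := z k) = h k"
      by (auto simp: h_def fun_eq_iff less_Suc_eq)
    ultimately show ?thesis using c by auto
  qed
  then obtain p where "\<And>k. k < n \<Longrightarrow> p k \<in> cube n x e \<and> f (h (Suc k)) - f (h k) = pd k f (p k) * (y k - z k)"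
    by metis
  then show ?thesis by (intro exI[of _ p]) (simp add: 1)
qed

text \<open>The total derivative at x applied to v, written with partial derivatives. That it
  computes derivatives along curves is \<open>smooth_on_curve\<close>.\<close>

definition dd :: "nat \<Rightarrow> ((nat \<Rightarrow> real) \<Rightarrow> real) \<Rightarrow> (nat \<Rightarrow> real) \<Rightarrow> (nat \<Rightarrow> real) \<Rightarrow> real" where
  "dd n f x v = (\<Sum>i<n. pd i f x * v i)"

lemma finite_min_pos:
  assumes "\<And>k. k < (n::nat) \<Longrightarrow> \<exists>d>0. \<forall>d'. 0 < d' \<and> d' \<le> d \<longrightarrow> P k d'"
  shows "\<exists>d>(0::real). \<forall>d'. 0 < d' \<and> d' \<le> d \<longrightarrow> (\<forall>k<n. P k d')"
  using assms
proof (induction n)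
  case 0
  show ?case by (auto intro: exI[of _ 1])
next
  case (Suc n)
  obtain d where "d > 0" "\<forall>d'. 0 < d' \<and> d' \<le> d \<longrightarrow> (\<forall>k<n. P k d')" using Suc by force
  moreover obtain e where "e > 0" "\<forall>d'. 0 < d' \<and> d' \<le> e \<longrightarrow> P n d'" using Suc.prems by blast
  ultimately show ?case by (intro exI[of _ "min d e"]) (auto simp: less_Suc_eq)
qed

text \<open>Strict differentiability: both points vary, which is stronger than differentiability at
  x and follows from continuity of the partial derivatives through the mean value formula. The
  two-point form is what later makes immersions locally injective with a linear bound.\<close>

lemma smooth_on_strict:
  assumes f: "smooth_on n W f" and x: "x \<in> W" and e: "e > 0"
  shows "\<exists>d>0. cube n x d \<subseteq> W \<and> (\<forall>y\<in>cube n x d. \<forall>z\<in>cube n x d.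
       \<bar>f y - f z - dd n f x (\<lambda>i. y i - z i)\<bar> \<le> e * (\<Sum>i<n. \<bar>y i - z i\<bar>))"
proof -
  have W: "openin (Euclidean_space n) W" using f smooth_on_open by blast
  have 1: "\<exists>d>0. \<forall>d'. 0 < d' \<and> d' \<le> d \<longrightarrow> (\<forall>y\<in>cube n x d'. \<bar>pd k f y - pd k f x\<bar> < e)" if "k < n" for k
    using continuous_cubeD[OF smooth_on_cont[OF smooth_on_pd[OF f that]] W x e]
      cube_mono[of _ _ n x] by (metis subset_iff)
  obtain d1 where d1: "d1 > 0" "\<forall>k<n. \<forall>y\<in>cube n x d1. \<bar>pd k f y - pd k f x\<bar> < e"
    using finite_min_pos[of n "\<lambda>k d'. \<forall>y\<in>cube n x d'. \<bar>pd k f y - pd k f x\<bar> < e", OF 1] by blast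
  obtain d2 where d2: "d2 > 0" "cube n x d2 \<subseteq> W" using openin_cubeD[OF W x] by blast
  define d where "d = min d1 d2"
  have d: "d > 0" "cube n x d \<subseteq> W" "cube n x d \<subseteq> cube n x d1"
    using d1 d2 cube_mono[of d d2 n x] cube_mono[of d d1 n x] by (auto simp: d_def subset_iff)
  show ?thesis
  proof (intro exI[of _ d] conjI d(1,2) ballI)
    fix y z assume yz: "y \<in> cube n x d" "z \<in> cube n x d"
    obtain p where p: "\<forall>k<n. p k \<in> cube n x d" "f y - f z = (\<Sum>k<n. pd k f (p k) * (y k - z k))"
      using smooth_on_mean_value[OF f d(2) yz] by blast
    have "f y - f z - dd n f x (\<lambda>i. y i - z i) = (\<Sum>k<n. (pd k f (p k) - pd k f x) * (y k - z k))"
      unfolding p(2) dd_def sum_subtractf[symmetric] by (simp add: algebra_simps)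
    also have "\<bar>\<dots>\<bar> \<le> (\<Sum>k<n. \<bar>(pd k f (p k) - pd k f x) * (y k - z k)\<bar>)" by (rule sum_abs)
    also have "\<dots> \<le> (\<Sum>k<n. e * \<bar>y k - z k\<bar>)"
    proof (rule sum_mono)
      fix k assume "k \<in> {..<n}"
      then have "\<bar>pd k f (p k) - pd k f x\<bar> \<le> e" using d1(2) d(3) p(1) by (simp add: subset_iff less_imp_le)
      then show "\<bar>(pd k f (p k) - pd k f x) * (y k - z k)\<bar> \<le> e * \<bar>y k - z k\<bar>"
        by (simp add: abs_mult mult_right_mono)
    qed
    finally show "\<bar>f y - f z - dd n f x (\<lambda>i. y i - z i)\<bar> \<le> e * (\<Sum>i<n. \<bar>y i - z i\<bar>)"
      by (simp add: sum_distrib_left)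
  qed
qed

text \<open>The difference quotient of f along the curve is the linear part of the coordinate
  quotients plus the remainder quotient \<open>?R\<close>; strict differentiability bounds the
  latter by a small constant times the sum \<open>?Q\<close> of coordinate quotients, which stays
  bounded.\<close>

lemma smooth_on_curve:
  assumes f: "smooth_on n W f" and x: "\<gamma> t \<in> W"
    and g: "\<And>i. i < n \<Longrightarrow> ((\<lambda>s. \<gamma> s i) has_real_derivative v i) (at t)"
    and R: "eventually (\<lambda>s. \<gamma> s \<in> Rn n) (at t)"
  shows "((\<lambda>s. f (\<gamma> s)) has_real_derivative dd n f (\<gamma> t) v) (at t)"
proof -
  let ?Q = "\<lambda>s. (\<Sum>i<n. \<bar>(\<gamma> s i - \<gamma> t i) / (s - t)\<bar>)"
  have q: "((\<lambda>s. (\<gamma> s i - \<gamma> t i) / (s - t)) \<longlongrightarrow> v i) (at t)" if "i < n" for i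
    using g[OF that] by (simp add: has_field_derivative_iff)
  have Q: "(?Q \<longlongrightarrow> (\<Sum>i<n. \<bar>v i\<bar>)) (at t)"
    by (intro tendsto_intros q) auto
  let ?R = "\<lambda>s. (f (\<gamma> s) - f (\<gamma> t) - dd n f (\<gamma> t) (\<lambda>i. \<gamma> s i - \<gamma> t i)) / (s - t)"
  have "(?R \<longlongrightarrow> 0) (at t)"
  proof (rule tendstoI)
    fix e :: real assume e: "e > 0"
    \<comment> \<open>One more than the limit of \<open>?Q\<close>, hence an eventual bound for it;
      the tolerance e / (2 C) then leaves an error of at most e / 2.\<close>
    define C where "C = (\<Sum>i<n. \<bar>v i\<bar>) + 1"
    have C: "C > 0" unfolding C_def by (intro add_nonneg_pos sum_nonneg) auto
    obtain d where d: "d > 0" "\<And>y z. y \<in> cube n (\<gamma> t) d \<Longrightarrow> z \<in> cube n (\<gamma> t) d \<Longrightarrow>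
       \<bar>f y - f z - dd n f (\<gamma> t) (\<lambda>i. y i - z i)\<bar> \<le> e / (2 * C) * (\<Sum>i<n. \<bar>y i - z i\<bar>)"
    proof -
      have "e / (2 * C) > 0" using e C by simp
      from smooth_on_strict[OF f x this] show thesis using that by blast
    qed
    have 1: "eventually (\<lambda>s. \<forall>i\<in>{..<n}. \<bar>\<gamma> s i - \<gamma> t i\<bar> < d) (at t)"
    proof (rule eventually_ball_finite)
      show "\<forall>i\<in>{..<n}. \<forall>\<^sub>F s in at t. \<bar>\<gamma> s i - \<gamma> t i\<bar> < d"
      proof
        fix i assume "i \<in> {..<n}"
        then have "((\<lambda>s. \<gamma> s i) \<longlongrightarrow> \<gamma> t i) (at t)"
          using g DERIV_isCont isCont_def by blast
        from tendstoD[OF this d(1)] show "\<forall>\<^sub>F s in at t. \<bar>\<gamma> s i - \<gamma> t i\<bar> < d"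
          by (simp add: dist_real_def)
      qed
    qed simp
    have 2: "eventually (\<lambda>s. ?Q s < C) (at t)"
      by (rule order_tendstoD(2)[OF Q]) (simp add: C_def)
    have 3: "eventually (\<lambda>s. s \<noteq> t) (at t)" by (simp add: eventually_neq_at_within)
    show "\<forall>\<^sub>F s in at t. dist (?R s) 0 < e"
      using 1 2 3 R
    proof eventually_elim
      case (elim s)
      have "\<gamma> s \<in> cube n (\<gamma> t) d" "\<gamma> t \<in> cube n (\<gamma> t) d"
        using elim x d(1) openin_Rn_subset[OF smooth_on_open[OF f]] by (auto simp: cube_def)
      from d(2)[OF this] have "\<bar>?R s\<bar> \<le> e / (2 * C) * (\<Sum>i<n. \<bar>\<gamma> s i - \<gamma> t i\<bar>) / \<bar>s - t\<bar>"
        unfolding abs_divide by (rule divide_right_mono) simp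
      also have "\<dots> = e / (2 * C) * ?Q s"
        by (simp only: abs_divide sum_divide_distrib[symmetric] times_divide_eq_right)
      also have "\<dots> \<le> e / (2 * C) * C" using elim(2) e C by (intro mult_left_mono) auto
      also have "\<dots> < e" using C e by simp
      finally show ?case by (simp add: dist_real_def)
    qed
  qed
  moreover have "((\<lambda>s. \<Sum>i<n. pd i f (\<gamma> t) * ((\<gamma> s i - \<gamma> t i) / (s - t))) \<longlongrightarrow> dd n f (\<gamma> t) v) (at t)"
    unfolding dd_def by (intro tendsto_intros q) auto
  ultimately have "((\<lambda>s. ?R s + (\<Sum>i<n. pd i f (\<gamma> t) * ((\<gamma> s i - \<gamma> t i) / (s - t)))) \<longlongrightarrow> 0 + dd n f (\<gamma> t) v) (at t)"
    by (rule tendsto_add)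
  moreover have "?R s + (\<Sum>i<n. pd i f (\<gamma> t) * ((\<gamma> s i - \<gamma> t i) / (s - t))) = (f (\<gamma> s) - f (\<gamma> t)) / (s - t)" for s
    unfolding dd_def times_divide_eq_right sum_divide_distrib[symmetric] add_divide_distrib[symmetric] by simp
  ultimately show ?thesis by (simp add: has_field_derivative_iff)
qed

lemma smooth_on_curve_cong:
  assumes f: "smooth_on n W f" and x: "\<gamma> t \<in> W"
    and g: "\<And>i. i < n \<Longrightarrow> ((\<lambda>s. \<gamma> s i) has_real_derivative v i) (at t)"
    and R: "\<And>s. \<gamma> s \<in> Rn n"
  shows "((\<lambda>s. f (\<gamma> s)) has_real_derivative dd n f (\<gamma> t) v) (at t)"
  using smooth_on_curve[of n W f \<gamma> t v, OF f x g] R by (simp add: always_eventually)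

lemma pd_chain:
  assumes f: "smooth_on k V f" and x: "\<Phi> x \<in> V" and j: "j < n" and xW: "x \<in> W"
    and g: "\<And>i. i < k \<Longrightarrow> smooth_on n W (\<lambda>x. \<Phi> x i)" and W: "openin (Euclidean_space n) W"
    and R: "\<And>x. x \<in> W \<Longrightarrow> \<Phi> x \<in> Rn k"
  shows "((\<lambda>t. f (\<Phi> (x(j := t)))) has_real_derivative (\<Sum>i<k. pd i f (\<Phi> x) * pd j (\<lambda>x. \<Phi> x i) x)) (at (x j))"
proof -
  have "((\<lambda>s. f (\<Phi> (x(j := s)))) has_real_derivative
      dd k f (\<Phi> (x(j := x j))) (\<lambda>i. pd j (\<lambda>x. \<Phi> x i) x)) (at (x j))"
  proof (rule smooth_on_curve[OF f])
    show "\<Phi> (x(j := x j)) \<in> V" using x by simp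
    show "((\<lambda>s. \<Phi> (x(j := s)) i) has_real_derivative pd j (\<lambda>x. \<Phi> x i) x) (at (x j))" if "i < k" for i
      using smooth_on_deriv[OF g[OF that] j xW] .
    show "\<forall>\<^sub>F s in at (x j). \<Phi> (x(j := s)) \<in> Rn k"
      using eventually_upd[OF W xW j] unfolding eventually_nhds_conv_at
      by (auto elim: eventually_mono intro: R)
  qed
  then show ?thesis by (simp add: dd_def)
qed

text \<open>This class is closed under partial derivatives and its members are continuous, so they are all
  smooth; a direct induction on \<open>smooth_on\<close> would not go through for composites and inverses.\<close>

inductive smooth_alg :: "nat \<Rightarrow> (nat \<Rightarrow> real) set \<Rightarrow> ((nat \<Rightarrow> real) \<Rightarrow> real) \<Rightarrow> bool" for n W where
  const: "smooth_alg n W (\<lambda>x. c)"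
| coord: "i < n \<Longrightarrow> smooth_alg n W (\<lambda>x. x i)"
| comp: "smooth_on k V f \<Longrightarrow> (\<And>i. i < k \<Longrightarrow> smooth_on n W (\<lambda>x. \<Phi> x i)) \<Longrightarrow> (\<And>x. x \<in> W \<Longrightarrow> \<Phi> x \<in> V)
    \<Longrightarrow> smooth_alg n W (\<lambda>x. f (\<Phi> x))"
| base: "smooth_on n W f \<Longrightarrow> smooth_alg n W f"
| inv: "smooth_on n W f \<Longrightarrow> (\<And>x. x \<in> W \<Longrightarrow> f x \<noteq> 0) \<Longrightarrow> smooth_alg n W (\<lambda>x. inverse (f x))"
| add: "smooth_alg n W f \<Longrightarrow> smooth_alg n W g \<Longrightarrow> smooth_alg n W (\<lambda>x. f x + g x)"
| mult: "smooth_alg n W f \<Longrightarrow> smooth_alg n W g \<Longrightarrow> smooth_alg n W (\<lambda>x. f x * g x)"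

lemma smooth_alg_sum: "(\<And>i. i < (k::nat) \<Longrightarrow> smooth_alg n W (f i)) \<Longrightarrow> smooth_alg n W (\<lambda>x. \<Sum>i<k. f i x)"
  by (induction k) (auto intro: smooth_alg.const smooth_alg.add)

text \<open>One round of the closure argument: each constructor is continuous and its partial
  derivatives are again in the class. For composites this is the chain rule, whose outer factors
  \<open>pd i f\<close> are composed with the same inner map.\<close>

lemma smooth_alg_props:
  assumes W: "openin (Euclidean_space n) W" and "smooth_alg n W f"
  shows "continuous_map (subtopology (Euclidean_space n) W) euclideanreal f \<and>
    (\<forall>i<n. \<exists>g. smooth_alg n W g \<and> (\<forall>x\<in>W. ((\<lambda>t. f (x(i := t))) has_real_derivative g x) (at (x i))))"
  using assms(2)
proof induction
  case (const c)
  then show ?case by (auto intro!: exI[of _ "\<lambda>x. 0"] smooth_alg.const)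
next
  case (coord j)
  have "smooth_alg n W (\<lambda>x. if i = j then 1 else 0)" for i
    using smooth_alg.const[of n W 1] smooth_alg.const[of n W 0] by (cases "i = j") auto
  moreover have "((\<lambda>t. (x(i := t)) j) has_real_derivative (if i = j then 1 else 0)) (at (x i))" for x i
    by (cases "i = j") (auto intro!: derivative_eq_intros)
  ultimately show ?case
    by (intro conjI allI impI continuous_map_from_subtopology continuous_map_coord) blast+
next
  case (comp k V f \<Phi>)
  have V: "openin (Euclidean_space k) V" using comp smooth_on_open by blast
  have R: "\<Phi> x \<in> Rn k" if "x \<in> W" for x using comp(3)[OF that] openin_Rn_subset[OF V] by blast
  show ?case
  proof (intro conjI allI impI)
    \<comment> \<open>Over W the map \<open>\<Phi>\<close> already vanishes from the index k on,
      because V lies in \<open>Rn k\<close>; the truncated form is the one to which the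
      componentwise criterion for continuity applies.\<close>
    have *: "continuous_map (subtopology (Euclidean_space n) W) (Euclidean_space k) (\<lambda>x i. if i < k then \<Phi> x i else 0)"
      unfolding continuous_map_componentwise_Euclidean_space using comp(2) smooth_on_cont by blast
    have "continuous_map (subtopology (Euclidean_space n) W) (subtopology (Euclidean_space k) V) \<Phi>"
      unfolding continuous_map_in_subtopology
    proof (intro conjI)
      show "continuous_map (subtopology (Euclidean_space n) W) (Euclidean_space k) \<Phi>"
        by (rule continuous_map_eq[OF *]) (use R in \<open>force simp: Rn_iff fun_eq_iff\<close>)
      show "\<Phi> \<in> topspace (subtopology (Euclidean_space n) W) \<rightarrow> V" using comp(3) by auto
    qed
    from continuous_map_compose[OF this smooth_on_cont[OF comp(1)]]
    show "continuous_map (subtopology (Euclidean_space n) W) euclideanreal (\<lambda>x. f (\<Phi> x))" by (simp add: o_def)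
    fix j assume j: "j < n"
    show "\<exists>g. smooth_alg n W g \<and> (\<forall>x\<in>W. ((\<lambda>t. f (\<Phi> (x(j := t)))) has_real_derivative g x) (at (x j)))"
    proof (intro exI conjI ballI)
      show "smooth_alg n W (\<lambda>x. \<Sum>i<k. pd i f (\<Phi> x) * pd j (\<lambda>x. \<Phi> x i) x)"
        using comp j by (intro smooth_alg_sum smooth_alg.mult smooth_alg.comp[of k V] smooth_alg.base smooth_on_pd) auto
      show "((\<lambda>t. f (\<Phi> (x(j := t)))) has_real_derivative (\<Sum>i<k. pd i f (\<Phi> x) * pd j (\<lambda>x. \<Phi> x i) x)) (at (x j))"
        if "x \<in> W" for x
        using pd_chain[of k V f \<Phi> x j n W, OF comp(1) comp(3)[OF that] j that comp(2) W R] .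
    qed
  qed
next
  case (base f)
  then show ?case using smooth_on_cont smooth_on_deriv smooth_on_pd smooth_alg.base by metis
next
  case (inv f)
  show ?case
  proof (intro conjI allI impI)
    show "continuous_map (subtopology (Euclidean_space n) W) euclideanreal (\<lambda>x. inverse (f x))"
      using inv smooth_on_cont by (intro continuous_map_real_inverse) auto
    fix i assume i: "i < n"
    show "\<exists>g. smooth_alg n W g \<and> (\<forall>x\<in>W. ((\<lambda>t. inverse (f (x(i := t)))) has_real_derivative g x) (at (x i)))"
    proof (intro exI conjI ballI)
      show "smooth_alg n W (\<lambda>x. (- 1) * (inverse (f x) * pd i f x * inverse (f x)))"
        using inv i by (intro smooth_alg.mult smooth_alg.const smooth_alg.inv smooth_alg.base smooth_on_pd) auto
      fix x assume x: "x \<in> W"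
      show "((\<lambda>t. inverse (f (x(i := t)))) has_real_derivative (- 1) * (inverse (f x) * pd i f x * inverse (f x))) (at (x i))"
        using DERIV_inverse'[OF smooth_on_deriv[OF inv(1) i x]] inv(2)[OF x] by simp
    qed
  qed
next
  case (add f g)
  show ?case
  proof (intro conjI allI impI)
    show "continuous_map (subtopology (Euclidean_space n) W) euclideanreal (\<lambda>x. f x + g x)"
      using add by (intro continuous_map_add) auto
    fix i assume i: "i < n"
    obtain f' g' where "smooth_alg n W f'" "\<forall>x\<in>W. ((\<lambda>t. f (x(i := t))) has_real_derivative f' x) (at (x i))"
      "smooth_alg n W g'" "\<forall>x\<in>W. ((\<lambda>t. g (x(i := t))) has_real_derivative g' x) (at (x i))"
      using add i by metis
    then show "\<exists>h. smooth_alg n W h \<and> (\<forall>x\<in>W. ((\<lambda>t. f (x(i := t)) + g (x(i := t))) has_real_derivative h x) (at (x i)))"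
      by (intro exI[of _ "\<lambda>x. f' x + g' x"]) (auto intro: smooth_alg.add DERIV_add)
  qed
next
  case (mult f g)
  show ?case
  proof (intro conjI allI impI)
    show "continuous_map (subtopology (Euclidean_space n) W) euclideanreal (\<lambda>x. f x * g x)"
      using mult by (intro continuous_map_real_mult) auto
    fix i assume i: "i < n"
    obtain f' g' where *: "smooth_alg n W f'" "\<forall>x\<in>W. ((\<lambda>t. f (x(i := t))) has_real_derivative f' x) (at (x i))"
      "smooth_alg n W g'" "\<forall>x\<in>W. ((\<lambda>t. g (x(i := t))) has_real_derivative g' x) (at (x i))"
      using mult i by metis
    show "\<exists>h. smooth_alg n W h \<and> (\<forall>x\<in>W. ((\<lambda>t. f (x(i := t)) * g (x(i := t))) has_real_derivative h x) (at (x i)))"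
    proof (intro exI conjI ballI)
      show "smooth_alg n W (\<lambda>x. f' x * g x + g' x * f x)" using * mult by (intro smooth_alg.add smooth_alg.mult)
      fix x assume x: "x \<in> W"
      show "((\<lambda>t. f (x(i := t)) * g (x(i := t))) has_real_derivative f' x * g x + g' x * f x) (at (x i))"
        using DERIV_mult[OF bspec[OF *(2) x] bspec[OF *(4) x]] by simp
    qed
  qed
qed

lemma smooth_alg_smooth:
  assumes W: "openin (Euclidean_space n) W" and f: "smooth_alg n W f"
  shows "smooth_on n W f"
proof (rule smooth_on_coinduct[OF W, where F = "{f. smooth_alg n W f}"])
  fix f i assume "f \<in> {f. smooth_alg n W f}"
  note P = smooth_alg_props[OF W this[simplified]]
  show "continuous_map (subtopology (Euclidean_space n) W) euclideanreal f" using P by blast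
  assume i: "i < n"
  then obtain g where g: "smooth_alg n W g" "\<And>x. x \<in> W \<Longrightarrow> ((\<lambda>t. f (x(i := t))) has_real_derivative g x) (at (x i))"
    using P by blast
  show "\<exists>D. ((\<lambda>t. f (x(i := t))) has_real_derivative D) (at (x i))" if "x \<in> W" for x using g(2)[OF that] by blast
  show "\<exists>g\<in>{f. smooth_alg n W f}. \<forall>x\<in>W. pd i f x = g x"
    using g pd_eqI by (intro bexI[of _ g]) auto
qed (use f in auto)

section \<open>Algebra of smooth functions\<close>

lemma smooth_on_const: "openin (Euclidean_space n) W \<Longrightarrow> smooth_on n W (\<lambda>x. c)"
  by (intro smooth_alg_smooth smooth_alg.const)

lemma smooth_on_coord: "openin (Euclidean_space n) W \<Longrightarrow> i < n \<Longrightarrow> smooth_on n W (\<lambda>x. x i)"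
  by (intro smooth_alg_smooth smooth_alg.coord)

lemma smooth_on_add: "smooth_on n W f \<Longrightarrow> smooth_on n W g \<Longrightarrow> smooth_on n W (\<lambda>x. f x + g x)"
  by (metis smooth_alg_smooth smooth_alg.add smooth_alg.base smooth_on_open)

lemma smooth_on_mult: "smooth_on n W f \<Longrightarrow> smooth_on n W g \<Longrightarrow> smooth_on n W (\<lambda>x. f x * g x)"
  by (metis smooth_alg_smooth smooth_alg.mult smooth_alg.base smooth_on_open)

lemma smooth_on_inverse:
  "smooth_on n W f \<Longrightarrow> (\<And>x. x \<in> W \<Longrightarrow> f x \<noteq> 0) \<Longrightarrow> smooth_on n W (\<lambda>x. inverse (f x))"
  by (metis smooth_alg_smooth smooth_alg.inv smooth_on_open)

lemma smooth_on_cmult: "smooth_on n W f \<Longrightarrow> smooth_on n W (\<lambda>x. c * f x)"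
  by (intro smooth_on_mult smooth_on_const smooth_on_open)

lemma smooth_on_minus: "smooth_on n W f \<Longrightarrow> smooth_on n W (\<lambda>x. - f x)"
  using smooth_on_cmult[of n W f "-1"] by simp

lemma smooth_on_diff: "smooth_on n W f \<Longrightarrow> smooth_on n W g \<Longrightarrow> smooth_on n W (\<lambda>x. f x - g x)"
  using smooth_on_add[of n W f "\<lambda>x. - g x"] smooth_on_minus by simp

lemma smooth_on_sum:
  assumes "openin (Euclidean_space n) W" "\<And>i. i \<in> A \<Longrightarrow> smooth_on n W (f i)"
  shows "smooth_on n W (\<lambda>x. \<Sum>i\<in>A. f i x)"
  using assms(2)
  by (induction A rule: infinite_finite_induct) (auto intro: smooth_on_const[OF assms(1)] smooth_on_add)

lemma smooth_on_prod:
  assumes "openin (Euclidean_space n) W" "\<And>i. i \<in> A \<Longrightarrow> smooth_on n W (f i)"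
  shows "smooth_on n W (\<lambda>x. \<Prod>i\<in>A. f i x)"
  using assms(2)
  by (induction A rule: infinite_finite_induct) (auto intro: smooth_on_const[OF assms(1)] smooth_on_mult)

lemma smooth_on_compose:
  assumes "smooth_on k V f" "\<And>i. i < k \<Longrightarrow> smooth_on n W (\<lambda>x. \<Phi> x i)" "\<And>x. x \<in> W \<Longrightarrow> \<Phi> x \<in> V"
    and "openin (Euclidean_space n) W"
  shows "smooth_on n W (\<lambda>x. f (\<Phi> x))"
  by (rule smooth_alg_smooth[OF assms(4) smooth_alg.comp[OF assms(1-3)]])

text \<open>The mean value theorem in direction i is applied to the difference of the two slices at
  x j + s and x j, then in direction j to \<open>pd i f\<close>. The left side is symmetric in i and
  j while the right side is not, which is what \<open>pd_commute\<close> exploits.\<close>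

lemma second_difference:
  assumes f: "smooth_on n W f" and e: "cube n x e \<subseteq> W" and xR: "x \<in> Rn n"
    and ij: "i < n" "j < n" "i \<noteq> j" and s: "0 < s" "s < e"
  shows "\<exists>p\<in>cube n x e. f (x(i := x i + s, j := x j + s)) - f (x(i := x i + s)) - f (x(j := x j + s)) + f x
    = s * s * pd j (pd i f) p"
proof -
  have in_c: "x(i := a, j := b) \<in> cube n x e" if "\<bar>a - x i\<bar> < e" "\<bar>b - x j\<bar> < e" for a b
    using upd_cube[OF upd_cube[OF cube_self[OF xR]] ij(2)] that ij s by simp
  have tw: "x(i := a, j := b) = x(j := b, i := a)" for a b using ij(3) by (simp add: fun_upd_twist)
  have 1: "\<exists>\<xi>. min (x i) (x i + s) \<le> \<xi> \<and> \<xi> \<le> max (x i) (x i + s) \<and>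
      (f (x(j := x j + s, i := x i + s)) - f (x(j := x j, i := x i + s)))
      - (f (x(j := x j + s, i := x i)) - f (x(j := x j, i := x i)))
      = (pd i f (x(j := x j + s, i := \<xi>)) - pd i f (x(j := x j, i := \<xi>))) * (x i + s - x i)"
  proof (rule MVT_between, rule DERIV_diff; rule smooth_on_deriv'[OF f ij(1)])
    fix t assume t: "min (x i) (x i + s) \<le> t" "t \<le> max (x i) (x i + s)"
    show "x(j := x j + s, i := t) \<in> W" using in_c[of t "x j + s"] t s e by (auto simp: tw)
    show "x(j := x j, i := t) \<in> W" using in_c[of t "x j"] t s e by (auto simp: tw)
  qed
  then obtain \<xi> where \<xi>: "x i \<le> \<xi>" "\<xi> \<le> x i + s"
    "f (x(i := x i + s, j := x j + s)) - f (x(i := x i + s)) - f (x(j := x j + s)) + f x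
      = (pd i f (x(i := \<xi>, j := x j + s)) - pd i f (x(i := \<xi>, j := x j))) * s"
  proof -
    have "x(j := x j + s, i := x i) = x(j := x j + s)" using ij(3) by (auto simp: fun_eq_iff)
    then show thesis using 1 s that by (auto simp: tw algebra_simps)
  qed
  have "\<exists>\<eta>. min (x j) (x j + s) \<le> \<eta> \<and> \<eta> \<le> max (x j) (x j + s) \<and>
      pd i f (x(i := \<xi>, j := x j + s)) - pd i f (x(i := \<xi>, j := x j))
      = pd j (pd i f) (x(i := \<xi>, j := \<eta>)) * (x j + s - x j)"
  proof (rule MVT_between, rule smooth_on_deriv'[OF smooth_on_pd[OF f ij(1)] ij(2)])
    fix t assume t: "min (x j) (x j + s) \<le> t" "t \<le> max (x j) (x j + s)"
    show "x(i := \<xi>, j := t) \<in> W" using in_c[of \<xi> t] t s e \<xi> by auto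
  qed
  then obtain \<eta> where \<eta>: "x j \<le> \<eta>" "\<eta> \<le> x j + s"
    "pd i f (x(i := \<xi>, j := x j + s)) - pd i f (x(i := \<xi>, j := x j)) = pd j (pd i f) (x(i := \<xi>, j := \<eta>)) * s"
    using s by auto
  show ?thesis
    using in_c[of \<xi> \<eta>] \<xi> \<eta> s by (intro bexI[of _ "x(i := \<xi>, j := \<eta>)"]) auto
qed

lemma pd_commute:
  assumes f: "smooth_on n W f" and x: "x \<in> W" and ij: "i < n" "j < n"
  shows "pd i (pd j f) x = pd j (pd i f) x"
proof (cases "i = j")
  case False
  have W: "openin (Euclidean_space n) W" using f smooth_on_open by blast
  have xR: "x \<in> Rn n" using openin_Rn_subset[OF W x] .
  show ?thesis
  proof (rule ccontr)
    assume ne: "pd i (pd j f) x \<noteq> pd j (pd i f) x"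
    \<comment> \<open>Half the gap: each mixed derivative varies by less than e on its cube, so
      equality of the values at p and q forces the gap below 2 e.\<close>
    define e where "e = \<bar>pd i (pd j f) x - pd j (pd i f) x\<bar> / 2"
    have e: "e > 0" using ne by (simp add: e_def)
    obtain d1 where d1: "d1 > 0" "cube n x d1 \<subseteq> W" "\<And>y. y \<in> cube n x d1 \<Longrightarrow> \<bar>pd i (pd j f) y - pd i (pd j f) x\<bar> < e"
      using continuous_cubeD[OF smooth_on_cont[OF smooth_on_pd[OF smooth_on_pd[OF f ij(2)] ij(1)]] W x e] by metis
    obtain d2 where d2: "d2 > 0" "cube n x d2 \<subseteq> W" "\<And>y. y \<in> cube n x d2 \<Longrightarrow> \<bar>pd j (pd i f) y - pd j (pd i f) x\<bar> < e"
      using continuous_cubeD[OF smooth_on_cont[OF smooth_on_pd[OF smooth_on_pd[OF f ij(1)] ij(2)]] W x e] by metis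
    define s where "s = min d1 d2 / 2"
    have s: "0 < s" "s < d1" "s < d2" using d1 d2 by (auto simp: s_def)
    obtain p where p: "p \<in> cube n x d2" "f (x(i := x i + s, j := x j + s)) - f (x(i := x i + s)) - f (x(j := x j + s)) + f x
        = s * s * pd j (pd i f) p"
      using second_difference[OF f d2(2) xR ij False s(1,3)] by blast
    obtain q where q: "q \<in> cube n x d1" "f (x(j := x j + s, i := x i + s)) - f (x(j := x j + s)) - f (x(i := x i + s)) + f x
        = s * s * pd i (pd j f) q"
      using second_difference[OF f d1(2) xR ij(2,1) _ s(1,2)] False by metis
    have tw: "x(j := x j + s, i := x i + s) = x(i := x i + s, j := x j + s)" using False by (simp add: fun_upd_twist)
    have "s * s * pd j (pd i f) p = s * s * pd i (pd j f) q" using p(2) q(2)[unfolded tw] by linarith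
    then have "pd j (pd i f) p = pd i (pd j f) q" using s by simp
    then have "\<bar>pd i (pd j f) x - pd j (pd i f) x\<bar> < 2 * e" using d1(3)[OF q(1)] d2(3)[OF p(1)] by linarith
    then show False by (simp add: e_def)
  qed
qed simp

section \<open>Determinants and matrix inverses\<close>

hide_const (open) Matrix.unit_vec
hide_fact (open) Matrix.unit_vec_def

text \<open>Cuts out the block of indices below n. Coordinate arrays have meaningless entries beyond
  it, and the determinant must not depend on them.\<close>

definition dt :: "nat \<Rightarrow> (nat \<Rightarrow> nat \<Rightarrow> real) \<Rightarrow> real" where
  "dt n a = Determinant.det (mat n n (\<lambda>(i, j). a i j))"

lemma dt_leibniz:
  "dt n a = (\<Sum>p\<in>{p. p permutes {0..<n}}. signof p * (\<Prod>i=0..<n. a i (p i)))"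
  unfolding dt_def
  by (subst det_def'[of _ n]) (auto intro!: sum.cong prod.cong dest: permutes_in_image)

lemma dt_cong: "(\<And>i j. i < n \<Longrightarrow> j < n \<Longrightarrow> a i j = b i j) \<Longrightarrow> dt n a = dt n b"
  unfolding dt_def by (intro arg_cong[where f = Determinant.det] eq_matI) auto

lemma mat_mult_fun:
  "mat n n (\<lambda>(i, j). a i j) * mat n n (\<lambda>(i, j). b i j) = mat n n (\<lambda>(i, j). \<Sum>k<n. a i k * (b k j :: real))"
  by (rule eq_matI) (auto simp: scalar_prod_def atLeast0LessThan)

lemma dt_mult: "dt n (\<lambda>i j. \<Sum>k<n. a i k * b k j) = dt n a * dt n b"
  unfolding dt_def mat_mult_fun[symmetric] by (rule Determinant.det_mult) auto

lemma dt_transpose: "dt n (\<lambda>i j. a j i) = dt n a"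
proof -
  have "transpose_mat (mat n n (\<lambda>(i, j). a i j)) = mat n n (\<lambda>(i, j). a j i)"
    by (rule eq_matI) auto
  then show ?thesis using Determinant.det_transpose[of "mat n n (\<lambda>(i, j). a i j)" n] by (simp add: dt_def)
qed

lemma dt_id: "dt n (\<lambda>i j. if i = j then 1 else 0) = 1"
proof -
  have "mat n n (\<lambda>(i, j). if i = j then 1 else (0::real)) = 1\<^sub>m n" by (rule eq_matI) auto
  then show ?thesis by (simp add: dt_def)
qed

lemma dt_nonzero_iff:
  "dt n a \<noteq> 0 \<longleftrightarrow> (\<forall>v\<in>Rn n. (\<forall>i<n. (\<Sum>j<n. a i j * v j) = 0) \<longrightarrow> v = (\<lambda>_. 0))"
proof -
  let ?A = "mat n n (\<lambda>(i, j). a i j)"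
  have e: "(?A *\<^sub>v vec n v = 0\<^sub>v n) \<longleftrightarrow> (\<forall>i<n. (\<Sum>j<n. a i j * v j) = 0)" for v
    by (auto simp: vec_eq_iff scalar_prod_def atLeast0LessThan)
  have "dt n a = 0 \<longleftrightarrow> (\<exists>v. v \<in> carrier_vec n \<and> v \<noteq> 0\<^sub>v n \<and> ?A *\<^sub>v v = 0\<^sub>v n)"
    unfolding dt_def by (rule det_0_iff_vec_prod_zero_field) auto
  also have "\<dots> \<longleftrightarrow> (\<exists>v\<in>Rn n. v \<noteq> (\<lambda>_. 0) \<and> (\<forall>i<n. (\<Sum>j<n. a i j * v j) = 0))"
  proof
    assume "\<exists>v. v \<in> carrier_vec n \<and> v \<noteq> 0\<^sub>v n \<and> ?A *\<^sub>v v = 0\<^sub>v n"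
    then obtain v where v: "v \<in> carrier_vec n" "v \<noteq> 0\<^sub>v n" "?A *\<^sub>v v = 0\<^sub>v n" by blast
    define w where "w = (\<lambda>i. if i < n then v $ i else 0)"
    have vw: "v = vec n w" using v(1) by (auto simp: vec_eq_iff w_def)
    have "w \<noteq> (\<lambda>_. 0)" using v(2) unfolding vw by (auto simp: vec_eq_iff)
    moreover have "w \<in> Rn n" by (simp add: Rn_iff w_def)
    ultimately show "\<exists>v\<in>Rn n. v \<noteq> (\<lambda>_. 0) \<and> (\<forall>i<n. (\<Sum>j<n. a i j * v j) = 0)"
      using v(3) e[of w] unfolding vw[symmetric] by blast
  next
    assume "\<exists>v\<in>Rn n. v \<noteq> (\<lambda>_. 0) \<and> (\<forall>i<n. (\<Sum>j<n. a i j * v j) = 0)"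
    then obtain v where v: "v \<in> Rn n" "v \<noteq> (\<lambda>_. 0)" "\<forall>i<n. (\<Sum>j<n. a i j * v j) = 0" by blast
    obtain i where "v i \<noteq> 0" using v(2) by auto
    then have "i < n" using v(1) unfolding Rn_iff by (metis not_less)
    with \<open>v i \<noteq> 0\<close> have "vec n v \<noteq> 0\<^sub>v n" by (auto simp: vec_eq_iff)
    then show "\<exists>v. v \<in> carrier_vec n \<and> v \<noteq> 0\<^sub>v n \<and> ?A *\<^sub>v v = 0\<^sub>v n"
      using v(3) e[of v] by (intro exI[of _ "vec n v"]) auto
  qed
  finally show ?thesis by blast
qed

text \<open>Spelled out through minors so that the inverse matrix, which \<open>mat_inv\<close>
  merely selects by choice, becomes a polynomial expression over the determinant and thereby smooth
  in the entries.\<close>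

definition adjugate :: "nat \<Rightarrow> (nat \<Rightarrow> nat \<Rightarrow> real) \<Rightarrow> nat \<Rightarrow> nat \<Rightarrow> real" where
  "adjugate n a i j = (-1) ^ (j + i) *
     dt (n - 1) (\<lambda>i' j'. a (if i' < j then i' else Suc i') (if j' < i then j' else Suc j'))"

lemma adj_mat_adjugate:
  "adj_mat (mat n n (\<lambda>(i, j). a i j)) = mat n n (\<lambda>(i, j). adjugate n a i j)"
  unfolding adj_mat_def adjugate_def dt_def cofactor_def
  by (rule eq_matI) (auto simp: mat_delete_def intro!: arg_cong[where f = Determinant.det] eq_matI)

lemma adjugate_mult:
  assumes "i < n" "j < n"
  shows "(\<Sum>k<n. a i k * adjugate n a k j) = (if i = j then dt n a else 0)"
    and "(\<Sum>k<n. adjugate n a i k * a k j) = (if i = j then dt n a else 0)"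
proof -
  let ?A = "mat n n (\<lambda>(i, j). a i j)"
  have A: "?A \<in> carrier_mat n n" by simp
  have "(?A * adj_mat ?A) $$ (i, j) = (dt n a \<cdot>\<^sub>m 1\<^sub>m n) $$ (i, j)"
    using adj_mat(2)[OF A] by (simp add: dt_def)
  then show "(\<Sum>k<n. a i k * adjugate n a k j) = (if i = j then dt n a else 0)"
    unfolding adj_mat_adjugate mat_mult_fun using assms by simp
  have "(adj_mat ?A * ?A) $$ (i, j) = (dt n a \<cdot>\<^sub>m 1\<^sub>m n) $$ (i, j)"
    using adj_mat(3)[OF A] by (simp add: dt_def)
  then show "(\<Sum>k<n. adjugate n a i k * a k j) = (if i = j then dt n a else 0)"
    unfolding adj_mat_adjugate mat_mult_fun using assms by simp
qed

lemma sum_delta_left: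
  "i < (n::nat) \<Longrightarrow> (\<Sum>k<n. (if i = k then 1 else 0) * f k) = (f i :: real)"
  by (subst sum.cong[OF refl, of _ _ "\<lambda>k. if i = k then f k else 0"]) (auto simp: sum.delta)

lemma sum_delta_right:
  "i < (n::nat) \<Longrightarrow> (\<Sum>k<n. f k * (if k = i then 1 else 0)) = (f i :: real)"
  by (subst sum.cong[OF refl, of _ _ "\<lambda>k. if i = k then f k else 0"]) (auto simp: sum.delta)

lemma sum_mult_assoc:
  "(\<Sum>k<(n::nat). (\<Sum>l<(m::nat). a l * b l k) * c k) = (\<Sum>l<m. a l * (\<Sum>k<n. b l k * (c k :: real)))"
  unfolding sum_distrib_left sum_distrib_right by (subst sum.swap) (simp add: mult.assoc)

text \<open>The choice in \<open>mat_inv\<close> only promises a right inverse. Multiplying by the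
  left inverse b, which Cramer's rule provides, determines its entries.\<close>

lemma mat_inv_adjugate:
  assumes d: "dt n a \<noteq> 0" and ij: "i < n" "j < n"
  shows "mat_inv n a i j = adjugate n a i j * inverse (dt n a)"
proof -
  define b where "b i j = adjugate n a i j * inverse (dt n a)" for i j
  have ab: "(\<Sum>k<n. a i k * b k j) = (if i = j then 1 else 0)" if "i < n" "j < n" for i j
    using adjugate_mult(1)[OF that, of a] d unfolding b_def mult.assoc[symmetric] sum_distrib_right[symmetric] by simp
  have ba: "(\<Sum>k<n. b i k * a k j) = (if i = j then 1 else 0)" if "i < n" "j < n" for i j
  proof -
    have "(\<Sum>k<n. b i k * a k j) = (\<Sum>k<n. adjugate n a i k * a k j) * inverse (dt n a)"
      unfolding b_def sum_distrib_right by (intro sum.cong) auto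
    then show ?thesis using adjugate_mult(2)[OF that, of a] d by simp
  qed
  have "\<forall>i<n. \<forall>j<n. (\<Sum>k<n. a i k * mat_inv n a k j) = (if i = j then 1 else 0)"
    unfolding mat_inv_def by (rule someI[of _ b]) (use ab in blast)
  then have am: "(\<Sum>k<n. a i k * mat_inv n a k j) = (if i = j then 1 else 0)" if "i < n" "j < n" for i j
    using that by blast
  have "mat_inv n a i j = (\<Sum>l<n. (if i = l then 1 else 0) * mat_inv n a l j)" using ij by (simp only: sum_delta_left)
  also have "\<dots> = (\<Sum>l<n. (\<Sum>k<n. b i k * a k l) * mat_inv n a l j)" using ba ij by (intro sum.cong) auto
  also have "\<dots> = (\<Sum>k<n. b i k * (\<Sum>l<n. a k l * mat_inv n a l j))" by (rule sum_mult_assoc)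
  also have "\<dots> = (\<Sum>k<n. b i k * (if k = j then 1 else 0))" using am ij by (intro sum.cong) auto
  also have "\<dots> = b i j" using ij by (simp only: sum_delta_right)
  finally show ?thesis by (simp add: b_def)
qed

lemma mat_inv_mult:
  assumes d: "dt n a \<noteq> 0" and ij: "i < n" "j < n"
  shows "(\<Sum>k<n. a i k * mat_inv n a k j) = (if i = j then 1 else 0)"
    and "(\<Sum>k<n. mat_inv n a i k * a k j) = (if i = j then 1 else 0)"
proof -
  have "(\<Sum>k<n. a i k * mat_inv n a k j) = (\<Sum>k<n. a i k * adjugate n a k j) * inverse (dt n a)"
    unfolding sum_distrib_right using mat_inv_adjugate[OF d] ij by (intro sum.cong) auto
  then show "(\<Sum>k<n. a i k * mat_inv n a k j) = (if i = j then 1 else 0)"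
    using adjugate_mult(1)[OF ij, of a] d by simp
  have "(\<Sum>k<n. mat_inv n a i k * a k j) = (\<Sum>k<n. adjugate n a i k * a k j) * inverse (dt n a)"
    unfolding sum_distrib_right using mat_inv_adjugate[OF d] ij by (intro sum.cong) auto
  then show "(\<Sum>k<n. mat_inv n a i k * a k j) = (if i = j then 1 else 0)"
    using adjugate_mult(2)[OF ij, of a] d by simp
qed

lemma right_inverse_imp_nonzero:
  assumes "\<And>i j. i < n \<Longrightarrow> j < n \<Longrightarrow> (\<Sum>k<n. a i k * b k j) = (if i = j then 1 else 0)"
  shows "dt n a \<noteq> 0" "dt n b \<noteq> 0"
proof -
  have "dt n a * dt n b = dt n (\<lambda>i j. if i = j then 1 else 0)"
    unfolding dt_mult[symmetric] by (rule dt_cong) (use assms in auto)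
  then show "dt n a \<noteq> 0" "dt n b \<noteq> 0" by (auto simp: dt_id)
qed

lemma smooth_on_dt:
  assumes W: "openin (Euclidean_space m) W"
    and a: "\<And>i j. i < n \<Longrightarrow> j < n \<Longrightarrow> smooth_on m W (\<lambda>x. a x i j)"
  shows "smooth_on m W (\<lambda>x. dt n (a x))"
  unfolding dt_leibniz
  by (intro smooth_on_sum[OF W] smooth_on_cmult smooth_on_prod[OF W] a) (auto dest: permutes_in_image)

lemma smooth_on_mat_inv:
  assumes W: "openin (Euclidean_space m) W"
    and a: "\<And>i j. i < n \<Longrightarrow> j < n \<Longrightarrow> smooth_on m W (\<lambda>x. a x i j)"
    and d: "\<And>x. x \<in> W \<Longrightarrow> dt n (a x) \<noteq> 0" and ij: "i < n" "j < n"
  shows "smooth_on m W (\<lambda>x. mat_inv n (a x) i j)"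
proof (rule smooth_on_cong)
  show "smooth_on m W (\<lambda>x. adjugate n (a x) i j * inverse (dt n (a x)))"
    unfolding adjugate_def
    by (intro smooth_on_mult smooth_on_cmult smooth_on_inverse smooth_on_dt[OF W] smooth_on_const[OF W] a d)
       (use ij in auto)
  show "adjugate n (a x) i j * inverse (dt n (a x)) = mat_inv n (a x) i j" if "x \<in> W" for x
    using mat_inv_adjugate[OF d[OF that] ij] by simp
qed

text \<open>Jacobi's formula at the identity matrix. In the differentiated Leibniz sum one factor is
  deleted; any permutation other than the identity still contributes a vanishing off-diagonal
  factor.\<close>

lemma dt_deriv_id:
  assumes d: "\<And>i j. i < n \<Longrightarrow> j < n \<Longrightarrow> ((\<lambda>t. c t i j) has_real_derivative c' i j) (at t0)"
    and c: "\<And>i j. i < n \<Longrightarrow> j < n \<Longrightarrow> c t0 i j = (if i = j then 1 else 0)"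
  shows "((\<lambda>t. dt n (c t)) has_real_derivative (\<Sum>i<n. c' i i)) (at t0)"
proof -
  let ?P = "{p. p permutes {0..<n}}"
  have fin: "finite ?P" by (rule finite_permutations) simp
  have "((\<lambda>t. dt n (c t)) has_real_derivative
      (\<Sum>p\<in>?P. signof p * (\<Sum>i=0..<n. c' i (p i) * (\<Prod>j\<in>{0..<n} - {i}. c t0 j (p j))))) (at t0)"
    unfolding dt_leibniz
  proof (rule DERIV_sum)
    fix p assume p: "p \<in> ?P"
    have *: "((\<lambda>t. \<Prod>i=0..<n. c t i (p i)) has_real_derivative
        (\<Sum>i=0..<n. c' i (p i) * (\<Prod>j\<in>{0..<n} - {i}. c t0 j (p j)))) (at t0)"
    proof (rule has_field_derivative_prod)
      fix i assume "i \<in> {0..<n}"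
      then show "((\<lambda>t. c t i (p i)) has_real_derivative c' i (p i)) (at t0)"
        using p d permutes_in_image[of p "{0..<n}" i] by auto
    qed
    show "((\<lambda>t. signof p * (\<Prod>i=0..<n. c t i (p i))) has_real_derivative
        signof p * (\<Sum>i=0..<n. c' i (p i) * (\<Prod>j\<in>{0..<n} - {i}. c t0 j (p j)))) (at t0)"
      using DERIV_cmult[OF *] .
  qed
  also have "(\<Sum>p\<in>?P. signof p * (\<Sum>i=0..<n. c' i (p i) * (\<Prod>j\<in>{0..<n} - {i}. c t0 j (p j))))
      = (\<Sum>p\<in>?P. if p = id then \<Sum>i<n. c' i i else 0)"
  proof (rule sum.cong[OF refl])
    fix p assume p: "p \<in> ?P"
    show "signof p * (\<Sum>i=0..<n. c' i (p i) * (\<Prod>j\<in>{0..<n} - {i}. c t0 j (p j))) = (if p = id then \<Sum>i<n. c' i i else 0)"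
    proof (cases "p = id")
      case True
      have "(\<Prod>j\<in>{0..<n} - {i}. c t0 j j) = 1" for i by (rule prod.neutral) (auto simp: c)
      then show ?thesis using True by (simp add: atLeast0LessThan)
    next
      case False
      have "(\<Prod>j\<in>{0..<n} - {i}. c t0 j (p j)) = 0" if i: "i \<in> {0..<n}" for i
      proof -
        \<comment> \<open>No permutation moves exactly one point, so an off-diagonal entry survives
          the deletion of the factor i.\<close>
        have "\<exists>j\<in>{0..<n} - {i}. p j \<noteq> j"
        proof (rule ccontr)
          assume none: "\<not> ?thesis"
          have fx: "p j = j" if "j \<noteq> i" for j
            using p none that by (cases "j < n") (auto simp: permutes_def)
          have "p i = i" using fx p by (metis (mono_tags) mem_Collect_eq permutes_inj injD)
          then show False using False fx by (metis eq_id_iff)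
        qed
        then obtain j where j: "j \<in> {0..<n} - {i}" "p j \<noteq> j" by blast
        have "p j < n" using p j permutes_in_image[of p "{0..<n}" j] by auto
        then have "c t0 j (p j) = 0" using j c by auto
        then show ?thesis using j by (intro prod_zero) auto
      qed
      then show ?thesis using False by (simp del: prod_zero_iff)
    qed
  qed
  also have "\<dots> = (\<Sum>i<n. c' i i)" using fin by (simp add: sum.delta permutes_id)
  finally show ?thesis .
qed

text \<open>Multiplication by the constant inverse at t0 moves the base point to the identity
  matrix, where \<open>dt_deriv_id\<close> applies; multiplicativity of the determinant undoes the
  move.\<close>

lemma dt_deriv:
  assumes d: "\<And>i j. i < n \<Longrightarrow> j < n \<Longrightarrow> ((\<lambda>t. a t i j) has_real_derivative a' i j) (at t0)"
    and nz: "dt n (a t0) \<noteq> 0"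
  shows "((\<lambda>t. dt n (a t)) has_real_derivative
      dt n (a t0) * (\<Sum>i<n. \<Sum>k<n. mat_inv n (a t0) i k * a' k i)) (at t0)"
proof -
  define b where "b = mat_inv n (a t0)"
  have ba: "(\<Sum>k<n. b i k * a t0 k j) = (if i = j then 1 else 0)" if "i < n" "j < n" for i j
    unfolding b_def by (rule mat_inv_mult(2)[OF nz that])
  have "((\<lambda>t. dt n (\<lambda>i j. \<Sum>k<n. b i k * a t k j)) has_real_derivative (\<Sum>i<n. \<Sum>k<n. b i k * a' k i)) (at t0)"
  proof (rule dt_deriv_id[where c' = "\<lambda>i j. \<Sum>k<n. b i k * a' k j"])
    fix i j assume ij: "i < n" "j < n"
    show "((\<lambda>t. \<Sum>k<n. b i k * a t k j) has_real_derivative (\<Sum>k<n. b i k * a' k j)) (at t0)"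
      using ij by (intro DERIV_sum DERIV_cmult d) auto
    show "(\<Sum>k<n. b i k * a t0 k j) = (if i = j then 1 else 0)" by (rule ba[OF ij])
  qed
  then have 1: "((\<lambda>t. dt n b * dt n (a t)) has_real_derivative (\<Sum>i<n. \<Sum>k<n. b i k * a' k i)) (at t0)"
    by (simp add: dt_mult)
  have "dt n b * dt n (a t0) = dt n (\<lambda>i j. if i = j then 1 else 0)"
    unfolding dt_mult[symmetric] by (rule dt_cong) (use ba in auto)
  then have bd: "dt n b * dt n (a t0) = 1" by (simp add: dt_id)
  have "((\<lambda>t. dt n (a t0) * (dt n b * dt n (a t))) has_real_derivative dt n (a t0) * (\<Sum>i<n. \<Sum>k<n. b i k * a' k i)) (at t0)"
    by (rule DERIV_cmult[OF 1])
  moreover have "(\<lambda>t. dt n (a t0) * (dt n b * dt n (a t))) = (\<lambda>t. dt n (a t))"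
    using bd by (metis mult.assoc mult.commute mult.right_neutral)
  ultimately show ?thesis unfolding b_def by (simp only:)
qed

section \<open>Directional derivatives and bilinear forms\<close>

lemma pd_add: "smooth_on n W f \<Longrightarrow> smooth_on n W g \<Longrightarrow> x \<in> W \<Longrightarrow> i < n \<Longrightarrow> pd i (\<lambda>y. f y + g y) x = pd i f x + pd i g x"
  by (intro pd_eqI DERIV_add smooth_on_deriv)

lemma pd_cmult: "smooth_on n W f \<Longrightarrow> x \<in> W \<Longrightarrow> i < n \<Longrightarrow> pd i (\<lambda>y. c * f y) x = c * pd i f x"
  by (intro pd_eqI DERIV_cmult smooth_on_deriv)

lemma pd_minus: "smooth_on n W f \<Longrightarrow> x \<in> W \<Longrightarrow> i < n \<Longrightarrow> pd i (\<lambda>y. - f y) x = - pd i f x"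
  by (intro pd_eqI DERIV_minus smooth_on_deriv)

lemma pd_mult: "smooth_on n W f \<Longrightarrow> smooth_on n W g \<Longrightarrow> x \<in> W \<Longrightarrow> i < n \<Longrightarrow>
    pd i (\<lambda>y. f y * g y) x = pd i f x * g x + f x * pd i g x"
  by (rule pd_eqI, rule DERIV_mult'[THEN DERIV_cong], rule smooth_on_deriv, assumption+, rule smooth_on_deriv, assumption+)
     simp

lemma pd_sum: "(\<And>m. m \<in> A \<Longrightarrow> smooth_on n W (f m)) \<Longrightarrow> x \<in> W \<Longrightarrow> i < n \<Longrightarrow>
    pd i (\<lambda>y. \<Sum>m\<in>A. f m y) x = (\<Sum>m\<in>A. pd i (f m) x)"
  by (intro pd_eqI DERIV_sum smooth_on_deriv)

lemma dd_cong: "openin (Euclidean_space n) W \<Longrightarrow> (\<And>y. y \<in> W \<Longrightarrow> f y = g y) \<Longrightarrow> x \<in> W \<Longrightarrow> dd n f x v = dd n g x v"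
  unfolding dd_def by (intro sum.cong refl) (metis pd_cong lessThan_iff)

lemma dd_add: "smooth_on n W f \<Longrightarrow> smooth_on n W g \<Longrightarrow> x \<in> W \<Longrightarrow> dd n (\<lambda>y. f y + g y) x v = dd n f x v + dd n g x v"
  unfolding dd_def sum.distrib[symmetric] by (intro sum.cong refl) (simp add: pd_add[of n W] algebra_simps)

lemma dd_cmult: "smooth_on n W f \<Longrightarrow> x \<in> W \<Longrightarrow> dd n (\<lambda>y. c * f y) x v = c * dd n f x v"
  unfolding dd_def sum_distrib_left by (intro sum.cong refl) (simp add: pd_cmult[of n W] algebra_simps)

lemma dd_minus: "smooth_on n W f \<Longrightarrow> x \<in> W \<Longrightarrow> dd n (\<lambda>y. - f y) x v = - dd n f x v"
  using dd_cmult[of n W f x "-1"] by simp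

lemma dd_mult: "smooth_on n W f \<Longrightarrow> smooth_on n W g \<Longrightarrow> x \<in> W \<Longrightarrow>
    dd n (\<lambda>y. f y * g y) x v = dd n f x v * g x + f x * dd n g x v"
  unfolding dd_def sum_distrib_left sum_distrib_right sum.distrib[symmetric]
  by (intro sum.cong refl) (simp add: pd_mult[of n W] algebra_simps)

lemma dd_sum: "(\<And>m. m \<in> A \<Longrightarrow> smooth_on n W (f m)) \<Longrightarrow> x \<in> W \<Longrightarrow>
    dd n (\<lambda>y. \<Sum>m\<in>A. f m y) x v = (\<Sum>m\<in>A. dd n (f m) x v)"
  unfolding dd_def by (subst sum.swap) (intro sum.cong refl, simp add: pd_sum[of A n W] sum_distrib_right)

lemma dd_lin: "dd n f x (\<lambda>k. \<Sum>m\<in>A. c m * u m k) = (\<Sum>m\<in>A. c m * dd n f x (u m))"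
  unfolding dd_def sum_distrib_left by (subst sum.swap) (simp add: mult_ac)

lemma dd_vadd: "dd n f x (\<lambda>k. u k + v k) = dd n f x u + dd n f x v"
  unfolding dd_def by (simp add: algebra_simps sum.distrib)

lemma dd_vminus: "dd n f x (\<lambda>k. - v k) = - dd n f x v"
  unfolding dd_def by (simp add: sum_negf)

lemma dd_unit: "i < n \<Longrightarrow> dd n f x (unit_vec i) = pd i f x"
  unfolding dd_def unit_vec_def by (rule sum_delta_right)

lemma smooth_on_dd: "smooth_on n W f \<Longrightarrow> smooth_on n W (\<lambda>x. dd n f x v)"
  unfolding dd_def by (intro smooth_on_sum smooth_on_mult smooth_on_pd smooth_on_const) (auto intro: smooth_on_open)

lemma dd_commute:
  assumes f: "smooth_on n W f" and x: "x \<in> W"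
  shows "dd n (\<lambda>y. dd n f y u) x v = dd n (\<lambda>y. dd n f y v) x u"
proof -
  have *: "dd n (\<lambda>y. dd n f y u) x v = (\<Sum>i<n. \<Sum>j<n. pd i (pd j f) x * u j * v i)" for u v
  proof -
    have "dd n (\<lambda>y. dd n f y u) x v = (\<Sum>i<n. pd i (\<lambda>y. \<Sum>j<n. u j * pd j f y) x * v i)"
      unfolding dd_def[of n _ x v] dd_def[of n f _ u] by (simp add: mult.commute)
    also have "\<dots> = (\<Sum>i<n. (\<Sum>j<n. u j * pd i (pd j f) x) * v i)"
      proof (intro sum.cong refl)
      fix i assume "i \<in> {..<n}"
      then have i: "i < n" by simp
      have "pd i (\<lambda>y. \<Sum>j<n. u j * pd j f y) x = (\<Sum>j<n. pd i (\<lambda>y. u j * pd j f y) x)"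
        by (rule pd_sum[OF _ x i]) (intro smooth_on_cmult smooth_on_pd[OF f], auto)
      also have "\<dots> = (\<Sum>j<n. u j * pd i (pd j f) x)"
        by (intro sum.cong refl pd_cmult[OF smooth_on_pd[OF f] x i]) auto
      finally show "pd i (\<lambda>y. \<Sum>j<n. u j * pd j f y) x * v i = (\<Sum>j<n. u j * pd i (pd j f) x) * v i" by simp
    qed
    also have "\<dots> = (\<Sum>i<n. \<Sum>j<n. pd i (pd j f) x * u j * v i)"
      by (simp add: sum_distrib_right sum_distrib_left mult_ac)
    finally show ?thesis .
  qed
  show ?thesis unfolding *
    by (subst sum.swap) (auto intro!: sum.cong simp: pd_commute[OF f x] mult_ac)
qed

section \<open>Linear algebra of coordinate vectors, the complex structure and bilinear
  forms\<close>

lemma unit_vec_Rn: "i < n \<Longrightarrow> unit_vec i \<in> Rn n"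
  by (auto simp: Rn_iff unit_vec_def)

lemma Rn_sum_unit: "v \<in> Rn n \<Longrightarrow> (\<Sum>j<n. v j * unit_vec j k) = v k"
  unfolding unit_vec_def Rn_iff
  by (cases "k < n") (auto simp: if_distrib sum.delta cong: if_cong)

lemma Rn_expand: "v \<in> Rn n \<Longrightarrow> (\<lambda>k. \<Sum>j<n. v j * unit_vec j k) = v"
  by (simp add: Rn_sum_unit)

lemma Rn_eqI: "u \<in> Rn n \<Longrightarrow> v \<in> Rn n \<Longrightarrow> (\<And>k. k < n \<Longrightarrow> u k = v k) \<Longrightarrow> u = v"
  unfolding Rn_iff by (metis ext not_less)

lemma Rn_add: "u \<in> Rn n \<Longrightarrow> v \<in> Rn n \<Longrightarrow> (\<lambda>k. u k + v k) \<in> Rn n"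
  and Rn_minus: "u \<in> Rn n \<Longrightarrow> (\<lambda>k. - u k) \<in> Rn n"
  and Rn_zero: "(\<lambda>_. 0) \<in> Rn n"
  by (simp_all add: Rn_iff)

lemma Rn_sum: "(\<And>m. m \<in> A \<Longrightarrow> f m \<in> Rn n) \<Longrightarrow> (\<lambda>k. \<Sum>m\<in>A. c m * f m k) \<in> Rn n"
  by (simp add: Rn_iff)

lemma J_Rn: "even n \<Longrightarrow> v \<in> Rn n \<Longrightarrow> J v \<in> Rn n"
proof -
  assume n: "even n" and v: "v \<in> Rn n"
  have "J v k = 0" if "n \<le> k" for k
  proof (cases "even k")
    case False
    then have "n \<le> k - 1" using that n by (cases "k = n") auto
    then show ?thesis using v False by (simp add: Rn_iff J_def)
  qed (use v that in \<open>simp add: Rn_iff J_def\<close>)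
  then show ?thesis by (simp add: Rn_iff)
qed

lemma J_J: "J (J v) = (\<lambda>k. - v k)"
  by (auto simp: J_def fun_eq_iff)

lemma J_lin: "J (\<lambda>k. \<Sum>m\<in>A. c m * u m k) = (\<lambda>k. \<Sum>m\<in>A. c m * J (u m) k)"
  by (auto simp: J_def fun_eq_iff sum_negf)

lemma J_add: "J (\<lambda>k. u k + v k) = (\<lambda>k. J u k + J v k)"
  and J_zero: "J (\<lambda>_. 0) = (\<lambda>_. 0)"
  by (auto simp: J_def fun_eq_iff)

lemma J_expand: "v \<in> Rn n \<Longrightarrow> J v k = (\<Sum>j<n. v j * J (unit_vec j) k)"
  using J_lin[where A = "{..<n}" and c = v and u = unit_vec] Rn_expand[of v n] by metis

lemma bil_lin1: "bil n a (\<lambda>k. \<Sum>m\<in>A. c m * u m k) v = (\<Sum>m\<in>A. c m * bil n a (u m) v)"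
proof -
  have "bil n a (\<lambda>k. \<Sum>m\<in>A. c m * u m k) v = (\<Sum>i<n. \<Sum>j<n. \<Sum>m\<in>A. c m * (a i j * u m i * v j))"
    unfolding bil_def by (simp add: sum_distrib_left sum_distrib_right mult_ac)
  also have "\<dots> = (\<Sum>i<n. \<Sum>m\<in>A. \<Sum>j<n. c m * (a i j * u m i * v j))"
    by (intro sum.cong refl sum.swap)
  also have "\<dots> = (\<Sum>m\<in>A. \<Sum>i<n. \<Sum>j<n. c m * (a i j * u m i * v j))" by (rule sum.swap)
  finally show ?thesis by (simp add: bil_def sum_distrib_left)
qed

lemma bil_transpose: "bil n (\<lambda>i j. a j i) u v = bil n a v u"
  unfolding bil_def by (subst sum.swap) (simp add: mult_ac)

lemma bil_lin2: "bil n a u (\<lambda>k. \<Sum>m\<in>A. c m * v m k) = (\<Sum>m\<in>A. c m * bil n a u (v m))"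
  using bil_lin1[where a = "\<lambda>i j. a j i" and n = n and A = A and c = c and u = v and v = u] unfolding bil_transpose[of n a] .

lemma bil_add1: "bil n a (\<lambda>k. u k + u' k) v = bil n a u v + bil n a u' v"
  and bil_add2: "bil n a u (\<lambda>k. v k + v' k) = bil n a u v + bil n a u v'"
  and bil_minus1: "bil n a (\<lambda>k. - u k) v = - bil n a u v"
  and bil_minus2: "bil n a u (\<lambda>k. - v k) = - bil n a u v"
  and bil_zero1: "bil n a (\<lambda>_. 0) v = 0"
  and bil_zero2: "bil n a u (\<lambda>_. 0) = 0"
  unfolding bil_def by (simp_all add: algebra_simps sum.distrib sum_negf)

lemma bil_unit: "i < n \<Longrightarrow> j < n \<Longrightarrow> bil n a (unit_vec i) (unit_vec j) = a i j"
proof -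
  assume ij: "i < n" "j < n"
  have "bil n a (unit_vec i) (unit_vec j) = (\<Sum>k<n. (\<Sum>l<n. a k l * unit_vec i k * (if l = j then 1 else 0)))"
    unfolding bil_def unit_vec_def by simp
  also have "\<dots> = (\<Sum>k<n. a k j * (if k = i then 1 else 0))"
    using ij by (intro sum.cong refl) (simp only: sum_delta_right unit_vec_def)
  also have "\<dots> = a i j" using ij by (simp only: sum_delta_right)
  finally show ?thesis .
qed

lemma bil_cong: "(\<And>i j. i < n \<Longrightarrow> j < n \<Longrightarrow> a i j = b i j) \<Longrightarrow> (\<And>i. i < n \<Longrightarrow> u i = u' i) \<Longrightarrow> (\<And>i. i < n \<Longrightarrow> v i = v' i)
    \<Longrightarrow> bil n a u v = bil n b u' v'"
  unfolding bil_def by (intro sum.cong refl) auto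

lemma bil_row: "bil n a u v = (\<Sum>i<n. u i * (\<Sum>j<n. a i j * v j))"
  unfolding bil_def by (simp add: sum_distrib_left mult_ac)

lemma bil_col: "bil n a u v = (\<Sum>j<n. (\<Sum>i<n. a i j * u i) * v j)"
  unfolding bil_def by (subst sum.swap) (simp add: sum_distrib_right sum_distrib_left mult_ac)

lemma bil_sum_mat: "bil n (\<lambda>i j. \<Sum>m\<in>A. c m * a m i j) u v = (\<Sum>m\<in>A. c m * bil n (a m) u v)"
proof -
  have "bil n (\<lambda>i j. \<Sum>m\<in>A. c m * a m i j) u v = (\<Sum>i<n. \<Sum>j<n. \<Sum>m\<in>A. c m * (a m i j * u i * v j))"
    unfolding bil_def by (simp add: sum_distrib_left sum_distrib_right mult_ac)
  also have "\<dots> = (\<Sum>i<n. \<Sum>m\<in>A. \<Sum>j<n. c m * (a m i j * u i * v j))"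
    by (intro sum.cong refl sum.swap)
  also have "\<dots> = (\<Sum>m\<in>A. \<Sum>i<n. \<Sum>j<n. c m * (a m i j * u i * v j))" by (rule sum.swap)
  finally show ?thesis by (simp add: bil_def sum_distrib_left)
qed

lemma bil_add_mat: "bil n (\<lambda>i j. a i j + b i j) u v = bil n a u v + bil n b u v"
  and bil_minus_mat: "bil n (\<lambda>i j. - a i j) u v = - bil n a u v"
  and bil_cmult_mat: "bil n (\<lambda>i j. c * a i j) u v = c * bil n a u v"
  unfolding bil_def by (simp_all add: algebra_simps sum.distrib sum_negf sum_distrib_left)

lemma bil_diff_mat: "bil n (\<lambda>i j. a i j - b i j) u v = bil n a u v - bil n b u v"
  unfolding bil_def by (simp add: algebra_simps sum_subtractf)

lemma smooth_on_bil:
  assumes W: "openin (Euclidean_space m) W"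
    and "\<And>i j. i < n \<Longrightarrow> j < n \<Longrightarrow> smooth_on m W (\<lambda>x. a x i j)"
    and "\<And>i. i < n \<Longrightarrow> smooth_on m W (\<lambda>x. u x i)" "\<And>i. i < n \<Longrightarrow> smooth_on m W (\<lambda>x. v x i)"
  shows "smooth_on m W (\<lambda>x. bil n (a x) (u x) (v x))"
  unfolding bil_def by (intro smooth_on_sum[OF W] smooth_on_mult assms) auto

lemma dd_bil_const:
  assumes a: "\<And>i j. i < n \<Longrightarrow> j < n \<Longrightarrow> smooth_on m W (\<lambda>x. a x i j)" and x: "x \<in> W"
  shows "dd m (\<lambda>y. bil n (a y) u v) x z = bil n (\<lambda>i j. dd m (\<lambda>y. a y i j) x z) u v"
\<comment> \<open>For n = 0 the smoothness hypothesis is vacuous and says nothing about W being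
  open.\<close>
proof (cases "n = 0")
  case True
  then show ?thesis by (simp add: bil_def dd_def pd_def)
next
  case False
  then have W: "openin (Euclidean_space m) W" using a smooth_on_open by blast
  have c: "(\<lambda>y. bil n (a y) u v) = (\<lambda>y. \<Sum>i<n. \<Sum>j<n. (u i * v j) * a y i j)"
    by (simp add: bil_def mult_ac)
  have "dd m (\<lambda>y. bil n (a y) u v) x z = (\<Sum>i<n. dd m (\<lambda>y. \<Sum>j<n. (u i * v j) * a y i j) x z)"
    unfolding c by (rule dd_sum[OF _ x]) (intro smooth_on_sum[OF W] smooth_on_cmult a, auto)
  also have "\<dots> = (\<Sum>i<n. \<Sum>j<n. dd m (\<lambda>y. (u i * v j) * a y i j) x z)"
    by (intro sum.cong refl dd_sum[OF _ x] smooth_on_cmult a) auto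
  also have "\<dots> = (\<Sum>i<n. \<Sum>j<n. (u i * v j) * dd m (\<lambda>y. a y i j) x z)"
    by (intro sum.cong refl dd_cmult[OF _ x] a) auto
  finally show ?thesis by (simp add: bil_def mult_ac)
qed

lemma dd_bil:
  assumes W: "openin (Euclidean_space m) W" and a: "\<And>i j. i < n \<Longrightarrow> j < n \<Longrightarrow> smooth_on m W (\<lambda>x. a x i j)"
    and u: "\<And>i. i < n \<Longrightarrow> smooth_on m W (\<lambda>x. u x i)" and v: "\<And>i. i < n \<Longrightarrow> smooth_on m W (\<lambda>x. v x i)"
    and x: "x \<in> W"
  shows "dd m (\<lambda>y. bil n (a y) (u y) (v y)) x z = bil n (\<lambda>i j. dd m (\<lambda>y. a y i j) x z) (u x) (v x)
    + bil n (a x) (\<lambda>i. dd m (\<lambda>y. u y i) x z) (v x) + bil n (a x) (u x) (\<lambda>i. dd m (\<lambda>y. v y i) x z)"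
proof -
  have "dd m (\<lambda>y. bil n (a y) (u y) (v y)) x z = (\<Sum>i<n. dd m (\<lambda>y. \<Sum>j<n. a y i j * u y i * v y j) x z)"
    unfolding bil_def by (rule dd_sum[OF _ x]) (intro smooth_on_sum[OF W] smooth_on_mult a u v, auto)
  also have "\<dots> = (\<Sum>i<n. \<Sum>j<n. dd m (\<lambda>y. a y i j * u y i * v y j) x z)"
    by (intro sum.cong refl dd_sum[OF _ x] smooth_on_mult a u v) auto
  also have "\<dots> = (\<Sum>i<n. \<Sum>j<n. dd m (\<lambda>y. a y i j) x z * u x i * v x j
      + a x i j * dd m (\<lambda>y. u y i) x z * v x j + a x i j * u x i * dd m (\<lambda>y. v y j) x z)"
  proof (intro sum.cong refl)
    fix i j assume "i \<in> {..<n}" "j \<in> {..<n}"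
    then show "dd m (\<lambda>y. a y i j * u y i * v y j) x z = dd m (\<lambda>y. a y i j) x z * u x i * v x j
      + a x i j * dd m (\<lambda>y. u y i) x z * v x j + a x i j * u x i * dd m (\<lambda>y. v y j) x z"
      using a[of i j] u[of i] v[of j] x
      by (simp add: dd_mult[of m W] smooth_on_mult algebra_simps)
  qed
  finally show ?thesis by (simp add: bil_def sum.distrib)
qed

section \<open>Kaehler metrics in a chart\<close>

text \<open>Contractions of the first derivatives of a matrix-valued function. In the Koszul formula
  and in dw = 0 the indices are permuted; here this becomes a permutation of vector
  arguments.\<close>

definition tri :: "nat \<Rightarrow> (nat \<Rightarrow> nat \<Rightarrow> nat \<Rightarrow> real) \<Rightarrow> (nat \<Rightarrow> real) \<Rightarrow> (nat \<Rightarrow> real) \<Rightarrow> (nat \<Rightarrow> real) \<Rightarrow> real" where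
  "tri n a u v z = (\<Sum>i<n. \<Sum>j<n. \<Sum>l<n. a i j l * u i * v j * z l)"

lemma tri_rot: "tri n a v z u = tri n (\<lambda>i j l. a j l i) u v z"
proof -
  have "tri n a v z u = (\<Sum>j<n. \<Sum>i<n. \<Sum>l<n. a j l i * u i * v j * z l)"
    unfolding tri_def by (rule sum.cong[OF refl], subst sum.swap) (simp add: mult_ac)
  also have "\<dots> = tri n (\<lambda>i j l. a j l i) u v z" unfolding tri_def by (rule sum.swap)
  finally show ?thesis .
qed

lemma tri_swap: "tri n a v u z = tri n (\<lambda>i j l. a j i l) u v z"
  unfolding tri_def by (subst sum.swap) (simp add: mult_ac)

lemma tri_add: "tri n (\<lambda>i j l. a i j l + b i j l) u v z = tri n a u v z + tri n b u v z"
  and tri_diff: "tri n (\<lambda>i j l. a i j l - b i j l) u v z = tri n a u v z - tri n b u v z"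
  unfolding tri_def by (simp_all add: algebra_simps sum.distrib sum_subtractf sum_distrib_left)

lemma tri_cong: "(\<And>i j l. i < n \<Longrightarrow> j < n \<Longrightarrow> l < n \<Longrightarrow> a i j l = b i j l) \<Longrightarrow> tri n a u v z = tri n b u v z"
  unfolding tri_def by (intro sum.cong refl) auto

lemma dd_bil_tri:
  assumes "\<And>i j. i < n \<Longrightarrow> j < n \<Longrightarrow> smooth_on n W (\<lambda>x. a x i j)" and "x \<in> W"
  shows "dd n (\<lambda>y. bil n (a y) v z) x u = tri n (\<lambda>i j l. pd i (\<lambda>y. a y j l) x) u v z"
proof -
  have "(\<lambda>j l. dd n (\<lambda>y. a y j l) x u) = (\<lambda>j l. \<Sum>i<n. u i * pd i (\<lambda>y. a y j l) x)"
    by (simp add: dd_def mult.commute)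
  then have "dd n (\<lambda>y. bil n (a y) v z) x u = bil n (\<lambda>j l. \<Sum>i<n. u i * pd i (\<lambda>y. a y j l) x) v z"
    using dd_bil_const[where a = a and m = n and n = n, OF assms] by simp
  also have "\<dots> = tri n (\<lambda>i j l. pd i (\<lambda>y. a y j l) x) u v z"
    unfolding bil_sum_mat unfolding bil_def tri_def by (simp add: sum_distrib_left mult_ac)
  finally show ?thesis .
qed

definition tr :: "nat \<Rightarrow> ((nat \<Rightarrow> real) \<Rightarrow> nat \<Rightarrow> real) \<Rightarrow> real" where
  "tr n f = (\<Sum>i<n. f (unit_vec i) i)"

text \<open>Connection, curvature and divergence are local, so they are treated on an open set of
  coordinates with component functions w. The manifold enters again only when the action is read in
  such charts.\<close>

locale kaehler_chart =
  fixes N :: nat and U :: "(nat \<Rightarrow> real) set" and w :: "(nat \<Rightarrow> real) \<Rightarrow> nat \<Rightarrow> nat \<Rightarrow> real"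
  assumes evenN: "even N" and U: "openin (Euclidean_space N) U"
    and w_smooth: "\<And>i j. i < N \<Longrightarrow> j < N \<Longrightarrow> smooth_on N U (\<lambda>x. w x i j)"
    and w_anti: "\<And>x i j. x \<in> U \<Longrightarrow> i < N \<Longrightarrow> j < N \<Longrightarrow> w x i j = - w x j i"
    and w_closed: "\<And>x i j k. x \<in> U \<Longrightarrow> i < N \<Longrightarrow> j < N \<Longrightarrow> k < N \<Longrightarrow>
      pd i (\<lambda>y. w y j k) x + pd j (\<lambda>y. w y k i) x + pd k (\<lambda>y. w y i j) x = 0"
    and w_J: "\<And>x u v. x \<in> U \<Longrightarrow> u \<in> Rn N \<Longrightarrow> v \<in> Rn N \<Longrightarrow> bil N (w x) (J u) (J v) = bil N (w x) u v"
    and w_pos: "\<And>x u. x \<in> U \<Longrightarrow> u \<in> Rn N \<Longrightarrow> u \<noteq> (\<lambda>_. 0) \<Longrightarrow> bil N (w x) u (J u) > 0"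
begin

definition g :: "(nat \<Rightarrow> real) \<Rightarrow> nat \<Rightarrow> nat \<Rightarrow> real" where
  "g x i j = bil N (w x) (unit_vec i) (J (unit_vec j))"

abbreviation G where "G x u v \<equiv> bil N (g x) u v"

lemma U_Rn: "x \<in> U \<Longrightarrow> x \<in> Rn N"
  using U openin_Rn_subset by blast

lemma JR: "v \<in> Rn N \<Longrightarrow> J v \<in> Rn N"
  using evenN J_Rn by blast

lemma G_w: assumes "u \<in> Rn N" "v \<in> Rn N" shows "G x u v = bil N (w x) u (J v)"
proof -
  have "bil N (w x) (\<lambda>k. \<Sum>i<N. u i * unit_vec i k) (\<lambda>k. \<Sum>j<N. v j * J (unit_vec j) k)
      = (\<Sum>i<N. \<Sum>j<N. u i * (v j * g x i j))"
    unfolding bil_lin1 bil_lin2 g_def by (simp add: sum_distrib_left)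
  moreover have "(\<lambda>k. \<Sum>i<N. u i * unit_vec i k) = u" by (rule Rn_expand[OF assms(1)])
  moreover have "(\<lambda>k. \<Sum>j<N. v j * J (unit_vec j) k) = J v" using J_expand[OF assms(2)] by (simp add: fun_eq_iff)
  ultimately show ?thesis by (simp add: bil_def mult_ac)
qed

lemma w_swap: "x \<in> U \<Longrightarrow> bil N (w x) u v = - bil N (w x) v u"
proof -
  assume x: "x \<in> U"
  have "bil N (w x) u v = bil N (\<lambda>i j. - w x j i) u v" by (rule bil_cong, rule w_anti[OF x]) simp_all
  also have "\<dots> = - bil N (\<lambda>i j. w x j i) u v" by (rule bil_minus_mat)
  finally show ?thesis unfolding bil_transpose[of N "w x"] .
qed

lemma G_sym: assumes "x \<in> U" "u \<in> Rn N" "v \<in> Rn N" shows "G x u v = G x v u"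
proof -
  have "G x u v = bil N (w x) (J u) (J (J v))" using assms by (simp add: G_w w_J JR)
  also have "\<dots> = bil N (w x) v (J u)" unfolding J_J bil_minus2 using w_swap[OF assms(1)] by metis
  finally show ?thesis using assms by (simp add: G_w)
qed

lemma G_J: assumes "x \<in> U" "u \<in> Rn N" "v \<in> Rn N" shows "G x (J u) (J v) = G x u v"
  using assms by (simp add: G_w w_J JR)

lemma G_J1: assumes "x \<in> U" "u \<in> Rn N" "v \<in> Rn N" shows "G x (J u) v = - G x u (J v)"
  using G_J[OF assms(1) JR[OF assms(2)] assms(3)] by (simp add: J_J bil_minus1)

lemma w_G: assumes "x \<in> U" "u \<in> Rn N" "v \<in> Rn N" shows "bil N (w x) u v = - G x u (J v)"
  using assms by (simp add: G_w JR J_J bil_minus2)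

lemma g_sym: "x \<in> U \<Longrightarrow> i < N \<Longrightarrow> j < N \<Longrightarrow> g x i j = g x j i"
  using G_sym[OF _ unit_vec_Rn unit_vec_Rn] by (metis bil_unit)

lemma G_pos: "x \<in> U \<Longrightarrow> u \<in> Rn N \<Longrightarrow> u \<noteq> (\<lambda>_. 0) \<Longrightarrow> G x u u > 0"
  using w_pos by (simp add: G_w)

lemma smooth_w: "smooth_on N U (\<lambda>y. bil N (w y) u v)"
  by (intro smooth_on_bil U w_smooth smooth_on_const)

lemma g_smooth: "smooth_on N U (\<lambda>x. g x i j)"
  unfolding g_def by (rule smooth_w)

lemma g_nonzero: "x \<in> U \<Longrightarrow> dt N (g x) \<noteq> 0"
proof -
  assume x: "x \<in> U"
  have "v = (\<lambda>_. 0)" if "v \<in> Rn N" "\<forall>i<N. (\<Sum>j<N. g x i j * v j) = 0" for v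
  proof (rule ccontr)
    assume "v \<noteq> (\<lambda>_. 0)"
    then have "G x v v > 0" using G_pos x that by blast
    moreover have "G x v v = 0" unfolding bil_row using that by simp
    ultimately show False by simp
  qed
  then show ?thesis unfolding dt_nonzero_iff by blast
qed

text \<open>Positivity makes the metric nondegenerate; identities between vectors are proved by
  pairing with an arbitrary z.\<close>

lemma G_eqI:
  assumes x: "x \<in> U" and a: "a \<in> Rn N" and b: "b \<in> Rn N" and e: "\<And>z. z \<in> Rn N \<Longrightarrow> G x a z = G x b z"
  shows "a = b"
proof (rule ccontr)
  assume ne: "a \<noteq> b"
  define c where "c = (\<lambda>k. a k + - b k)"
  have c: "c \<in> Rn N" unfolding c_def by (intro Rn_add Rn_minus a b)
  have "c \<noteq> (\<lambda>_. 0)" using ne by (force simp: c_def fun_eq_iff)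
  then have "G x c c > 0" using G_pos x c by blast
  moreover have "G x c c = G x a c - G x b c" unfolding c_def[of] bil_add1 bil_minus1 by simp
  ultimately show False using e[OF c] by simp
qed

section \<open>The Levi-Civita connection of a Kaehler metric and its Ricci tensor\<close>

abbreviation mi where "mi x \<equiv> mat_inv N (g x)"

lemma mi_smooth: "i < N \<Longrightarrow> j < N \<Longrightarrow> smooth_on N U (\<lambda>x. mi x i j)"
  by (rule smooth_on_mat_inv[OF U g_smooth g_nonzero])

abbreviation chr where "chr \<equiv> christoffel N g"

lemma chr_smooth: "k < N \<Longrightarrow> i < N \<Longrightarrow> j < N \<Longrightarrow> smooth_on N U (\<lambda>x. chr x k i j)"
  unfolding christoffel_def
  by (intro smooth_on_cmult smooth_on_sum[OF U] smooth_on_mult mi_smooth smooth_on_diff smooth_on_add smooth_on_pd g_smooth) auto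

text \<open>The covariant derivative in direction u of the constant vector field v. Working with
  vectors instead of indices allows J to be inserted into the arguments.\<close>

definition Gam :: "(nat \<Rightarrow> real) \<Rightarrow> (nat \<Rightarrow> real) \<Rightarrow> (nat \<Rightarrow> real) \<Rightarrow> nat \<Rightarrow> real" where
  "Gam x u v = (\<lambda>k. if k < N then bil N (chr x k) u v else 0)"

lemma Gam_Rn: "Gam x u v \<in> Rn N"
  by (simp add: Gam_def Rn_iff)

lemma Gam_smooth: "smooth_on N U (\<lambda>x. Gam x u v k)"
  by (cases "k < N") (auto simp: Gam_def intro!: smooth_on_bil U chr_smooth smooth_on_const)

lemma chr_sym: "x \<in> U \<Longrightarrow> i < N \<Longrightarrow> j < N \<Longrightarrow> chr x k i j = chr x k j i"
proof -
  assume x: "x \<in> U" and ij: "i < N" "j < N"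
  have "pd l (\<lambda>y. g y i j) x = pd l (\<lambda>y. g y j i) x" if "l < N" for l
    by (rule pd_cong[OF U _ x that]) (use g_sym ij in auto)
  then show ?thesis unfolding christoffel_def by (intro arg_cong2[where f = "(*)"] refl sum.cong) auto
qed

lemma Gam_sym: "x \<in> U \<Longrightarrow> Gam x u v = Gam x v u"
proof -
  assume x: "x \<in> U"
  have "bil N (chr x k) u v = bil N (chr x k) v u" for k
  proof -
    have "bil N (chr x k) u v = bil N (\<lambda>i j. chr x k j i) u v" by (rule bil_cong) (use chr_sym[OF x] in auto)
    then show ?thesis unfolding bil_transpose[of N "chr x k"] .
  qed
  then show ?thesis unfolding Gam_def by presburger
qed

lemma koszul_index:
  assumes x: "x \<in> U" and "m < N"
  shows "(\<Sum>k<N. g x m k * chr x k i j) = 1/2 * (pd i (\<lambda>y. g y j m) x + pd j (\<lambda>y. g y i m) x - pd m (\<lambda>y. g y i j) x)"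
proof -
  let ?T = "\<lambda>l. pd i (\<lambda>y. g y j l) x + pd j (\<lambda>y. g y i l) x - pd l (\<lambda>y. g y i j) x"
  have "(\<Sum>k<N. g x m k * chr x k i j) = 1/2 * (\<Sum>k<N. (\<Sum>l<N. g x m k * mi x k l * ?T l))"
    unfolding christoffel_def by (simp add: sum_distrib_left mult_ac)
  also have "(\<Sum>k<N. (\<Sum>l<N. g x m k * mi x k l * ?T l)) = (\<Sum>l<N. (\<Sum>k<N. g x m k * mi x k l) * ?T l)"
    by (subst sum.swap) (simp add: sum_distrib_right)
  also have "\<dots> = (\<Sum>l<N. (if m = l then 1 else 0) * ?T l)"
    using mat_inv_mult(1)[OF g_nonzero[OF x] assms(2)] by (intro sum.cong refl) simp
  also have "\<dots> = ?T m" by (rule sum_delta_left[OF assms(2)])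
  finally show ?thesis .
qed

text \<open>For constant vector fields the bracket terms of the Koszul formula vanish, so only the
  three derivatives of the metric remain.\<close>

lemma koszul:
  assumes x: "x \<in> U"
  shows "2 * G x (Gam x u v) z = dd N (\<lambda>y. G y v z) x u + dd N (\<lambda>y. G y u z) x v - dd N (\<lambda>y. G y u v) x z"
proof -
  define q where "q i j l = pd i (\<lambda>y. g y j l) x" for i j l
  have "2 * G x (Gam x u v) z = (\<Sum>l<N. 2 * (\<Sum>k<N. g x k l * bil N (chr x k) u v) * z l)"
    unfolding bil_col[of N "g x"] by (simp add: Gam_def sum_distrib_left mult_ac)
  also have "\<dots> = (\<Sum>l<N. z l * bil N (\<lambda>i j. q i j l + q j i l - q l i j) u v)"
  proof (intro sum.cong refl)
    fix l assume "l \<in> {..<N}"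
    then have l: "l < N" by simp
    have "2 * (\<Sum>k<N. g x k l * bil N (chr x k) u v) = 2 * bil N (\<lambda>i j. \<Sum>k<N. g x k l * chr x k i j) u v"
      unfolding bil_sum_mat ..
    also have "\<dots> = bil N (\<lambda>i j. 2 * (\<Sum>k<N. g x k l * chr x k i j)) u v" unfolding bil_cmult_mat ..
    also have "\<dots> = bil N (\<lambda>i j. q i j l + q j i l - q l i j) u v"
    proof (rule bil_cong)
      fix i j
      have "(\<Sum>k<N. g x k l * chr x k i j) = (\<Sum>k<N. g x l k * chr x k i j)"
        using g_sym[OF x] l by (intro sum.cong refl) auto
      then show "2 * (\<Sum>k<N. g x k l * chr x k i j) = q i j l + q j i l - q l i j"
        using koszul_index[OF x l, of i j] by (simp add: q_def)
    qed auto
    finally show "2 * (\<Sum>k<N. g x k l * bil N (chr x k) u v) * z l = z l * bil N (\<lambda>i j. q i j l + q j i l - q l i j) u v"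
      by simp
  qed
  also have "\<dots> = tri N (\<lambda>l i j. q i j l + q j i l - q l i j) z u v"
    unfolding bil_def tri_def by (simp add: sum_distrib_left mult_ac)
  also have "\<dots> = tri N (\<lambda>i j l. q i j l + q j i l - q l i j) u v z"
    by (subst tri_rot[of N _ u v z]) simp
  also have "\<dots> = tri N q u v z + tri N q v u z - tri N q z u v"
    unfolding tri_diff tri_add
    using tri_swap[of N q v u z] tri_rot[of N q z u v] tri_rot[of N "\<lambda>i j l. q j l i" v z u] by simp
  also have "tri N q u v z = dd N (\<lambda>y. G y v z) x u"
    unfolding q_def by (rule dd_bil_tri[symmetric, OF g_smooth x])
  also have "tri N q v u z = dd N (\<lambda>y. G y u z) x v"
    unfolding q_def by (rule dd_bil_tri[symmetric, OF g_smooth x])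
  also have "tri N q z u v = dd N (\<lambda>y. G y u v) x z"
    unfolding q_def by (rule dd_bil_tri[symmetric, OF g_smooth x])
  finally show ?thesis .
qed

text \<open>The pointwise identities of w, differentiated on constant vectors, together with dw = 0:
  the input on derivatives of w for \<open>Gam_J\<close>.\<close>

lemma dw_facts:
  assumes x: "x \<in> U"
  shows dw_J: "p \<in> Rn N \<Longrightarrow> q \<in> Rn N \<Longrightarrow> dd N (\<lambda>y. bil N (w y) (J p) (J q)) x u = dd N (\<lambda>y. bil N (w y) p q) x u"
    and dw_swap: "dd N (\<lambda>y. bil N (w y) p q) x u = - dd N (\<lambda>y. bil N (w y) q p) x u"
    and dw_JJ: "dd N (\<lambda>y. bil N (w y) p (J (J q))) x u = - dd N (\<lambda>y. bil N (w y) p q) x u"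
    and dw_closed: "dd N (\<lambda>y. bil N (w y) v z) x u + dd N (\<lambda>y. bil N (w y) z u) x v + dd N (\<lambda>y. bil N (w y) u v) x z = 0"
    and dG_dw: "p \<in> Rn N \<Longrightarrow> q \<in> Rn N \<Longrightarrow> dd N (\<lambda>y. G y p q) x u = dd N (\<lambda>y. bil N (w y) p (J q)) x u"
proof -
  show "p \<in> Rn N \<Longrightarrow> q \<in> Rn N \<Longrightarrow> dd N (\<lambda>y. bil N (w y) (J p) (J q)) x u = dd N (\<lambda>y. bil N (w y) p q) x u"
    by (rule dd_cong[OF U _ x]) (rule w_J)
  show "dd N (\<lambda>y. bil N (w y) p q) x u = - dd N (\<lambda>y. bil N (w y) q p) x u"
    unfolding dd_minus[OF smooth_w x, symmetric] by (rule dd_cong[OF U _ x]) (rule w_swap)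
  show "dd N (\<lambda>y. bil N (w y) p (J (J q))) x u = - dd N (\<lambda>y. bil N (w y) p q) x u"
    unfolding dd_minus[OF smooth_w x, symmetric] J_J bil_minus2 ..
  show "p \<in> Rn N \<Longrightarrow> q \<in> Rn N \<Longrightarrow> dd N (\<lambda>y. G y p q) x u = dd N (\<lambda>y. bil N (w y) p (J q)) x u"
    by (rule dd_cong[OF U _ x]) (rule G_w)
  define p where "p i j l = pd i (\<lambda>y. w y j l) x" for i j l
  have e: "dd N (\<lambda>y. bil N (w y) v z) x u = tri N p u v z" for u v z
    unfolding p_def by (rule dd_bil_tri[OF w_smooth x])
  have "tri N p u v z + tri N p v z u + tri N p z u v = tri N (\<lambda>i j l. p i j l + p j l i + p l i j) u v z"
    unfolding tri_add using tri_rot[of N p v z u] tri_rot[of N p z u v] tri_rot[of N "\<lambda>i j l. p j l i" v z u] by simp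
  also have "\<dots> = tri N (\<lambda>i j l. 0) u v z" by (rule tri_cong) (use w_closed[OF x] in \<open>simp add: p_def\<close>)
  finally show "dd N (\<lambda>y. bil N (w y) v z) x u + dd N (\<lambda>y. bil N (w y) z u) x v + dd N (\<lambda>y. bil N (w y) u v) x z = 0"
    unfolding e by (simp add: tri_def)
qed

text \<open>This is \<nabla>J = 0. Koszul's formula turns both sides into derivatives of w;
  closedness for the triples (u, v, z) and (u, J v, J z) then makes them agree.\<close>

lemma Gam_J:
  assumes x: "x \<in> U" and u: "u \<in> Rn N" and v: "v \<in> Rn N"
  shows "Gam x u (J v) = J (Gam x u v)"
proof (rule G_eqI[OF x Gam_Rn JR[OF Gam_Rn]])
  fix z assume z: "z \<in> Rn N"
  define w' where "w' u p q = dd N (\<lambda>y. bil N (w y) p q) x u" for u p q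
  note dG = dG_dw[OF x, folded w'_def]
  have "2 * G x (Gam x u (J v)) z = w' u (J v) (J z) + w' (J v) u (J z) - w' z u (J (J v))"
    unfolding koszul[OF x] using dG u v z JR by simp
  also have "\<dots> = w' u v z + w' (J v) u (J z) + w' z u v"
    unfolding w'_def using dw_J[OF x v z] dw_JJ[OF x] by simp
  finally have 1: "2 * G x (Gam x u (J v)) z = w' u v z + w' (J v) u (J z) + w' z u v" .
  have "2 * G x (Gam x u v) (J z) = w' u v (J (J z)) + w' v u (J (J z)) - w' (J z) u (J v)"
    unfolding koszul[OF x] using dG u v z JR by simp
  also have "\<dots> = - w' u v z - w' v u z - w' (J z) u (J v)"
    unfolding w'_def using dw_JJ[OF x] by simp
  finally have 2: "2 * G x (Gam x u v) (J z) = - w' u v z - w' v u z - w' (J z) u (J v)" .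
  have 3: "w' u v z + w' v z u + w' z u v = 0" "w' u (J v) (J z) + w' (J v) (J z) u + w' (J z) u (J v) = 0"
    unfolding w'_def using dw_closed[OF x] by blast+
  have 4: "w' v z u = - w' v u z" "w' (J v) (J z) u = - w' (J v) u (J z)" "w' u (J v) (J z) = w' u v z"
    unfolding w'_def using dw_swap[OF x] dw_J[OF x v z] by blast+
  have "G x (J (Gam x u v)) z = - G x (Gam x u v) (J z)" using G_J1[OF x Gam_Rn z] .
  then show "G x (Gam x u (J v)) z = G x (J (Gam x u v)) z" using 1 2 3 4 by linarith
qed

lemma Gam_J': "x \<in> U \<Longrightarrow> u \<in> Rn N \<Longrightarrow> v \<in> Rn N \<Longrightarrow> Gam x (J u) v = J (Gam x u v)"
  using Gam_J Gam_sym by metis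

text \<open>The contracted connection \<Gamma>^i_ik v^k, which is the derivative in direction v of
  the logarithm of the Riemannian volume density. It is the term that turns the coordinate
  divergence into the Riemannian one.\<close>

definition th :: "(nat \<Rightarrow> real) \<Rightarrow> (nat \<Rightarrow> real) \<Rightarrow> real" where
  "th x v = (\<Sum>k<N. v k * (\<Sum>i<N. chr x i i k))"

lemma Gam_unit: "i < N \<Longrightarrow> k < N \<Longrightarrow> Gam x (unit_vec i) v k = (\<Sum>l<N. chr x k i l * v l)"
  unfolding Gam_def bil_row unit_vec_def using sum_delta_right[of i N "\<lambda>i. \<Sum>l<N. chr x k i l * v l"]
  by (simp add: mult.commute)

lemma th_smooth: "smooth_on N U (\<lambda>x. th x v)"
  unfolding th_def by (intro smooth_on_sum[OF U] smooth_on_cmult chr_smooth) auto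

lemma th_lin: "th x (\<lambda>k. \<Sum>m\<in>A. c m * u m k) = (\<Sum>m\<in>A. c m * th x (u m))"
proof -
  define S where "S k = (\<Sum>i<N. chr x i i k)" for k
  have "(\<Sum>k<N. (\<Sum>m\<in>A. c m * u m k) * S k) = (\<Sum>m\<in>A. c m * (\<Sum>k<N. u m k * S k))"
    unfolding sum_distrib_right by (subst sum.swap) (simp add: sum_distrib_left mult_ac)
  then show ?thesis unfolding th_def S_def .
qed

lemma th_minus: "th x (\<lambda>k. - u k) = - th x u"
  unfolding th_def by (simp_all add: algebra_simps sum.distrib sum_negf)

text \<open>The index formula regrouped for constant fields: coordinate divergence of
  \<open>Gam\<close>, derivative of its trace, and two quadratic terms. In this shape the behaviour
  of each term under u, v to J u, J v is visible.\<close>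

lemma ricci_vec:
  assumes x: "x \<in> U"
  shows "bil N (ricci N g x) u v = (\<Sum>i<N. pd i (\<lambda>y. Gam y u v i) x) - dd N (\<lambda>y. th y v) x u
    + th x (Gam x u v) - tr N (\<lambda>z. Gam x u (Gam x z v))"
proof -
  \<comment> \<open>The factors 1 bring the sums into the shape that \<open>bil_sum_mat\<close>
    expects.\<close>
  have r: "ricci N g x = (\<lambda>j k. ((\<Sum>i<N. 1 * pd i (\<lambda>y. chr y i j k) x) - (\<Sum>i<N. pd j (\<lambda>y. chr y i i k) x))
     + ((\<Sum>m<N. (\<Sum>i<N. chr x i i m) * chr x m j k) - (\<Sum>i<N. 1 * (\<Sum>m<N. chr x i j m * chr x m i k))))"
  proof (intro ext)
    fix j k
    have "(\<Sum>i<N. \<Sum>m<N. chr x i i m * chr x m j k) = (\<Sum>m<N. (\<Sum>i<N. chr x i i m) * chr x m j k)"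
      by (subst sum.swap) (simp add: sum_distrib_right)
    then show "ricci N g x j k = ((\<Sum>i<N. 1 * pd i (\<lambda>y. chr y i j k) x) - (\<Sum>i<N. pd j (\<lambda>y. chr y i i k) x))
     + ((\<Sum>m<N. (\<Sum>i<N. chr x i i m) * chr x m j k) - (\<Sum>i<N. 1 * (\<Sum>m<N. chr x i j m * chr x m i k)))"
      unfolding ricci_def riemann_def by (simp add: sum.distrib sum_subtractf)
  qed
  have 1: "bil N (\<lambda>j k. \<Sum>i<N. 1 * pd i (\<lambda>y. chr y i j k) x) u v = (\<Sum>i<N. pd i (\<lambda>y. Gam y u v i) x)"
    unfolding bil_sum_mat
  proof (intro sum.cong refl)
    fix i assume "i \<in> {..<N}"
    then have i: "i < N" by simp
    have "dd N (\<lambda>y. bil N (chr y i) u v) x (unit_vec i) = bil N (\<lambda>j k. dd N (\<lambda>y. chr y i j k) x (unit_vec i)) u v"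
      by (rule dd_bil_const[OF chr_smooth x]) (use i in auto)
    then show "1 * bil N (\<lambda>j k. pd i (\<lambda>y. chr y i j k) x) u v = pd i (\<lambda>y. Gam y u v i) x"
      using i by (simp add: dd_unit Gam_def)
  qed
  have 2: "bil N (\<lambda>j k. \<Sum>i<N. pd j (\<lambda>y. chr y i i k) x) u v = dd N (\<lambda>y. th y v) x u"
  proof -
    have "pd j (\<lambda>y. th y v) x = (\<Sum>k<N. v k * (\<Sum>i<N. pd j (\<lambda>y. chr y i i k) x))" if j: "j < N" for j
    proof -
      have "pd j (\<lambda>y. th y v) x = (\<Sum>k<N. pd j (\<lambda>y. v k * (\<Sum>i<N. chr y i i k)) x)"
        unfolding th_def by (rule pd_sum[OF _ x j]) (intro smooth_on_sum[OF U] smooth_on_cmult chr_smooth, auto)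
      also have "\<dots> = (\<Sum>k<N. v k * pd j (\<lambda>y. \<Sum>i<N. chr y i i k) x)"
        by (intro sum.cong refl pd_cmult[OF _ x j] smooth_on_sum[OF U] chr_smooth) auto
      also have "\<dots> = (\<Sum>k<N. v k * (\<Sum>i<N. pd j (\<lambda>y. chr y i i k) x))"
        by (intro sum.cong refl arg_cong2[where f = "(*)"] pd_sum[OF _ x j] chr_smooth) auto
      finally show ?thesis .
    qed
    then show ?thesis unfolding dd_def bil_def by (simp add: sum_distrib_left sum_distrib_right mult_ac)
  qed
  have 3: "bil N (\<lambda>j k. \<Sum>m<N. (\<Sum>i<N. chr x i i m) * chr x m j k) u v = th x (Gam x u v)"
    unfolding bil_sum_mat th_def by (simp add: Gam_def mult.commute)
  have 4: "bil N (\<lambda>j k. \<Sum>i<N. 1 * (\<Sum>m<N. chr x i j m * chr x m i k)) u v = tr N (\<lambda>z. Gam x u (Gam x z v))"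
    unfolding bil_sum_mat tr_def
  proof (intro sum.cong refl)
    fix i assume "i \<in> {..<N}"
    then have i: "i < N" by simp
    have "bil N (\<lambda>j k. \<Sum>m<N. chr x i j m * chr x m i k) u v
        = (\<Sum>j<N. u j * (\<Sum>k<N. \<Sum>m<N. chr x i j m * (chr x m i k * v k)))"
      unfolding bil_row by (simp add: sum_distrib_right sum_distrib_left mult_ac)
    also have "\<dots> = (\<Sum>j<N. u j * (\<Sum>m<N. chr x i j m * (\<Sum>k<N. chr x m i k * v k)))"
      by (rule sum.cong[OF refl], subst sum.swap) (simp add: sum_distrib_left)
    also have "\<dots> = (\<Sum>j<N. u j * (\<Sum>m<N. chr x i j m * Gam x (unit_vec i) v m))"
      using Gam_unit i by simp
    also have "\<dots> = Gam x u (Gam x (unit_vec i) v) i" using i by (simp add: Gam_def[of x u] bil_row)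
    finally show "1 * bil N (\<lambda>j k. \<Sum>m<N. chr x i j m * chr x m i k) u v = Gam x u (Gam x (unit_vec i) v) i" by simp
  qed
  show ?thesis unfolding r bil_add_mat bil_diff_mat 1 2 3 4 by simp
qed

text \<open>The terms of the Ricci tensor that are complex bilinear cancel in this average.\<close>

lemma ricci_J_average:
  assumes x: "x \<in> U" and u: "u \<in> Rn N" and v: "v \<in> Rn N"
  shows "bil N (ricci N g x) u v + bil N (ricci N g x) (J u) (J v)
    = - (dd N (\<lambda>y. th y v) x u + dd N (\<lambda>y. th y (J v)) x (J u))"
proof -
  have JJ: "Gam y (J u) (J v) = (\<lambda>k. - Gam y u v k)" if "y \<in> U" for y
    using Gam_J[OF that JR[OF u] v] Gam_J'[OF that u v] by (simp add: J_J)
  have 1: "(\<Sum>i<N. pd i (\<lambda>y. Gam y (J u) (J v) i) x) = - (\<Sum>i<N. pd i (\<lambda>y. Gam y u v i) x)"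
    unfolding sum_negf[symmetric]
  proof (intro sum.cong refl)
    fix i assume "i \<in> {..<N}"
    then have i: "i < N" by simp
    have "pd i (\<lambda>y. Gam y (J u) (J v) i) x = pd i (\<lambda>y. - Gam y u v i) x"
      by (rule pd_cong[OF U _ x i]) (simp add: JJ)
    then show "pd i (\<lambda>y. Gam y (J u) (J v) i) x = - pd i (\<lambda>y. Gam y u v i) x"
      by (simp add: pd_minus[OF Gam_smooth x i])
  qed
  have 2: "tr N (\<lambda>z. Gam x (J u) (Gam x z (J v))) = - tr N (\<lambda>z. Gam x u (Gam x z v))"
    unfolding tr_def sum_negf[symmetric]
  proof (intro sum.cong refl)
    fix i assume "i \<in> {..<N}"
    then have e: "unit_vec i \<in> Rn N" using unit_vec_Rn by auto
    show "Gam x (J u) (Gam x (unit_vec i) (J v)) i = - Gam x u (Gam x (unit_vec i) v) i"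
      using Gam_J[OF x e v] Gam_J[OF x JR[OF u] Gam_Rn] Gam_J'[OF x u Gam_Rn] by (simp add: J_J)
  qed
  show ?thesis unfolding ricci_vec[OF x] 1 2 JJ[OF x] th_minus by simp
qed

end

section \<open>Divergence of holomorphic Killing fields\<close>

definition vd :: "nat \<Rightarrow> ((nat \<Rightarrow> real) \<Rightarrow> nat \<Rightarrow> real) \<Rightarrow> (nat \<Rightarrow> real) \<Rightarrow> (nat \<Rightarrow> real) \<Rightarrow> nat \<Rightarrow> real" where
  "vd n X x u = (\<lambda>k. if k < n then dd n (\<lambda>y. X y k) x u else 0)"

lemma vd_Rn: "vd n X x u \<in> Rn n"
  by (simp add: vd_def Rn_iff)

lemma vd_lin: "vd n X x (\<lambda>k. \<Sum>m\<in>A. c m * u m k) = (\<lambda>k. \<Sum>m\<in>A. c m * vd n X x (u m) k)"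
  by (auto simp: vd_def dd_lin)

lemma vd_J:
  assumes n: "even n" and X: "\<And>k. k < n \<Longrightarrow> smooth_on n W (\<lambda>y. X y k)" and x: "x \<in> W"
    and R: "\<And>y. y \<in> W \<Longrightarrow> X y \<in> Rn n"
  shows "vd n (\<lambda>y. J (X y)) x u = J (vd n X x u)"
proof (rule Rn_eqI[OF vd_Rn J_Rn[OF n vd_Rn]])
  fix k assume k: "k < n"
  show "vd n (\<lambda>y. J (X y)) x u k = J (vd n X x u) k"
  proof (cases "even k")
    case True
    then have k1: "k + 1 < n" using n k by (metis Suc_eq_plus1 Suc_lessI even_Suc)
    have "dd n (\<lambda>y. - X y (k + 1)) x u = - dd n (\<lambda>y. X y (k + 1)) x u" by (rule dd_minus[OF X[OF k1] x])
    then show ?thesis using True k k1 by (simp add: vd_def J_def)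
  next
    case False
    then have "k - 1 < n" using k by auto
    then show ?thesis using False k by (simp add: vd_def J_def)
  qed
qed

context kaehler_chart
begin

definition field_on :: "((nat \<Rightarrow> real) \<Rightarrow> nat \<Rightarrow> real) \<Rightarrow> bool" where
  "field_on X \<longleftrightarrow> (\<forall>k<N. smooth_on N U (\<lambda>y. X y k)) \<and> (\<forall>y\<in>U. X y \<in> Rn N)"

definition holomorphic_field :: "((nat \<Rightarrow> real) \<Rightarrow> nat \<Rightarrow> real) \<Rightarrow> bool" where
  "holomorphic_field X \<longleftrightarrow> field_on X \<and> (\<forall>x\<in>U. \<forall>u\<in>Rn N. vd N X x (J u) = J (vd N X x u))"

text \<open>The Lie derivative of the metric along X, evaluated on constant vectors u and v; their
  brackets with X are where the derivatives of X come from.\<close>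

definition killing_field :: "((nat \<Rightarrow> real) \<Rightarrow> nat \<Rightarrow> real) \<Rightarrow> bool" where
  "killing_field X \<longleftrightarrow> field_on X \<and> (\<forall>x\<in>U. \<forall>u\<in>Rn N. \<forall>v\<in>Rn N.
     dd N (\<lambda>y. G y u v) x (X x) + G x (vd N X x u) v + G x u (vd N X x v) = 0)"

text \<open>Divergence with respect to the Riemannian volume: the trace of the covariant derivative
  of X, split into the coordinate part and the connection part.\<close>

definition dv :: "((nat \<Rightarrow> real) \<Rightarrow> nat \<Rightarrow> real) \<Rightarrow> (nat \<Rightarrow> real) \<Rightarrow> real" where
  "dv X x = tr N (vd N X x) + th x (X x)"

lemma field_onD: "field_on X \<Longrightarrow> k < N \<Longrightarrow> smooth_on N U (\<lambda>y. X y k)"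
  "field_on X \<Longrightarrow> y \<in> U \<Longrightarrow> X y \<in> Rn N"
  by (auto simp: field_on_def)

lemma field_on_J: "field_on X \<Longrightarrow> field_on (\<lambda>y. J (X y))"
proof -
  assume X: "field_on X"
  have "smooth_on N U (\<lambda>y. J (X y) k)" if "k < N" for k
  proof (cases "even k")
    case True
    then have "k + 1 < N" using evenN that by (metis Suc_eq_plus1 Suc_lessI even_Suc)
    then show ?thesis using True field_onD(1)[OF X] by (simp add: J_def smooth_on_minus)
  next
    case False
    then show ?thesis using that field_onD(1)[OF X, of "k - 1"] by (simp add: J_def)
  qed
  then show ?thesis using X JR by (auto simp: field_on_def)
qed

lemma vd_J_field: "field_on X \<Longrightarrow> x \<in> U \<Longrightarrow> vd N (\<lambda>y. J (X y)) x u = J (vd N X x u)"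
  by (rule vd_J[OF evenN]) (auto simp: field_on_def)

lemma inverse_metric_trace:
  "x \<in> U \<Longrightarrow> (\<Sum>i<N. \<Sum>j<N. mi x i j * bil N (g x) (f (unit_vec i)) (unit_vec j)) = tr N f"
proof -
  assume x: "x \<in> U"
  have "(\<Sum>j<N. mi x i j * bil N (g x) (f (unit_vec i)) (unit_vec j)) = f (unit_vec i) i" if i: "i < N" for i
  proof -
    have e: "bil N (g x) u (unit_vec j) = (\<Sum>k<N. g x j k * u k)" if "j < N" for u j
      unfolding bil_col unit_vec_def sum_delta_right[OF that] using g_sym[OF x] that by (intro sum.cong refl) auto
    have "(\<Sum>j<N. mi x i j * bil N (g x) (f (unit_vec i)) (unit_vec j)) = (\<Sum>j<N. mi x i j * (\<Sum>k<N. g x j k * f (unit_vec i) k))"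
      by (intro sum.cong refl) (simp add: e)
    also have "\<dots> = (\<Sum>k<N. (\<Sum>j<N. mi x i j * g x j k) * f (unit_vec i) k)"
      by (rule sum_mult_assoc[symmetric])
    also have "\<dots> = (\<Sum>k<N. (if i = k then 1 else 0) * f (unit_vec i) k)"
      using mat_inv_mult(2)[OF g_nonzero[OF x] i] by (intro sum.cong refl) simp
    also have "\<dots> = f (unit_vec i) i" by (rule sum_delta_left[OF i])
    finally show ?thesis .
  qed
  then show ?thesis by (simp add: tr_def)
qed

lemma mi_sym: assumes x: "x \<in> U" and ij: "i < N" "j < N" shows "mi x i j = mi x j i"
proof -
  have "mi x j i = (\<Sum>k<N. mi x j k * (if k = i then 1 else 0))" by (rule sum_delta_right[symmetric, OF ij(1)])
  also have "\<dots> = (\<Sum>k<N. mi x j k * (\<Sum>l<N. g x k l * mi x i l))"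
  proof (intro sum.cong refl)
    fix k assume "k \<in> {..<N}"
    then have k: "k < N" by simp
    have "(\<Sum>l<N. g x k l * mi x i l) = (\<Sum>l<N. mi x i l * g x l k)"
      using g_sym[OF x k] by (intro sum.cong refl) (auto simp: mult.commute)
    then show "mi x j k * (if k = i then 1 else 0) = mi x j k * (\<Sum>l<N. g x k l * mi x i l)"
      using mat_inv_mult(2)[OF g_nonzero[OF x] ij(1) k] by auto
  qed
  also have "\<dots> = (\<Sum>l<N. (\<Sum>k<N. mi x j k * g x k l) * mi x i l)" by (rule sum_mult_assoc[symmetric])
  also have "\<dots> = (\<Sum>l<N. (if j = l then 1 else 0) * mi x i l)"
    using mat_inv_mult(2)[OF g_nonzero[OF x] ij(2)] by (intro sum.cong refl) simp
  also have "\<dots> = mi x i j" by (rule sum_delta_left[OF ij(2)])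
  finally show ?thesis by simp
qed

text \<open>In the trace of the Christoffel symbols two of the three derivative terms cancel by
  symmetry of the inverse metric; the rest is the logarithmic derivative of the determinant of
  g.\<close>

lemma th_metric:
  assumes x: "x \<in> U"
  shows "2 * th x v = (\<Sum>i<N. \<Sum>j<N. mi x i j * dd N (\<lambda>y. g y i j) x v)"
proof -
  have 1: "2 * (\<Sum>i<N. chr x i i k) = (\<Sum>i<N. \<Sum>l<N. mi x i l * pd k (\<lambda>y. g y i l) x)" if k: "k < N" for k
  proof -
    have "2 * (\<Sum>i<N. chr x i i k) = (\<Sum>i<N. \<Sum>l<N. mi x i l * (pd i (\<lambda>y. g y k l) x + pd k (\<lambda>y. g y i l) x - pd l (\<lambda>y. g y i k) x))"
      unfolding christoffel_def by (simp add: sum_distrib_left)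
    also have "\<dots> = (\<Sum>i<N. \<Sum>l<N. mi x i l * pd i (\<lambda>y. g y k l) x) + (\<Sum>i<N. \<Sum>l<N. mi x i l * pd k (\<lambda>y. g y i l) x)
       - (\<Sum>i<N. \<Sum>l<N. mi x i l * pd l (\<lambda>y. g y i k) x)"
      by (simp add: algebra_simps sum.distrib sum_subtractf)
    also have "(\<Sum>i<N. \<Sum>l<N. mi x i l * pd l (\<lambda>y. g y i k) x) = (\<Sum>i<N. \<Sum>l<N. mi x i l * pd i (\<lambda>y. g y k l) x)"
    proof (subst sum.swap, intro sum.cong refl)
      fix l i assume "l \<in> {..<N}" "i \<in> {..<N}"
      then have li: "l < N" "i < N" by auto
      have "pd l (\<lambda>y. g y i k) x = pd l (\<lambda>y. g y k i) x"
        by (rule pd_cong[OF U _ x li(1)]) (use g_sym li k in auto)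
      then show "mi x i l * pd l (\<lambda>y. g y i k) x = mi x l i * pd l (\<lambda>y. g y k i) x" using mi_sym[OF x li] by simp
    qed
    finally show ?thesis by simp
  qed
  have "2 * th x v = (\<Sum>k<N. v k * (2 * (\<Sum>i<N. chr x i i k)))" unfolding th_def by (simp add: sum_distrib_left mult_ac)
  also have "\<dots> = (\<Sum>k<N. v k * (\<Sum>i<N. \<Sum>l<N. mi x i l * pd k (\<lambda>y. g y i l) x))"
    by (intro sum.cong refl) (simp add: 1)
  also have "\<dots> = (\<Sum>k<N. \<Sum>i<N. \<Sum>l<N. mi x i l * (pd k (\<lambda>y. g y i l) x * v k))"
    by (simp add: sum_distrib_left mult_ac)
  also have "\<dots> = (\<Sum>i<N. \<Sum>k<N. \<Sum>l<N. mi x i l * (pd k (\<lambda>y. g y i l) x * v k))" by (rule sum.swap)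
  also have "\<dots> = (\<Sum>i<N. \<Sum>l<N. \<Sum>k<N. mi x i l * (pd k (\<lambda>y. g y i l) x * v k))"
    by (rule sum.cong[OF refl], rule sum.swap)
  finally show ?thesis by (simp add: dd_def sum_distrib_left)
qed

text \<open>The Killing equation contracted with the inverse metric: its three terms contribute 2
  \<open>th\<close>, the trace and the trace once more, that is twice the divergence.\<close>

lemma killing_dv: assumes X: "killing_field X" and x: "x \<in> U" shows "dv X x = 0"
proof -
  have K: "dd N (\<lambda>y. G y u v) x (X x) + G x (vd N X x u) v + G x u (vd N X x v) = 0"
    if "u \<in> Rn N" "v \<in> Rn N" for u v using X x that by (auto simp: killing_field_def)
  have "0 = (\<Sum>i<N. \<Sum>j<N. mi x i j * (dd N (\<lambda>y. G y (unit_vec i) (unit_vec j)) x (X x)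
      + G x (vd N X x (unit_vec i)) (unit_vec j) + G x (unit_vec i) (vd N X x (unit_vec j))))"
    by (intro sum.neutral[symmetric] ballI) (use K unit_vec_Rn in simp)
  also have "\<dots> = (\<Sum>i<N. \<Sum>j<N. mi x i j * dd N (\<lambda>y. G y (unit_vec i) (unit_vec j)) x (X x))
     + (\<Sum>i<N. \<Sum>j<N. mi x i j * G x (vd N X x (unit_vec i)) (unit_vec j))
     + (\<Sum>i<N. \<Sum>j<N. mi x i j * G x (unit_vec i) (vd N X x (unit_vec j)))"
    by (simp add: algebra_simps sum.distrib)
  also have "(\<Sum>i<N. \<Sum>j<N. mi x i j * dd N (\<lambda>y. G y (unit_vec i) (unit_vec j)) x (X x)) = 2 * th x (X x)"
    unfolding th_metric[OF x] by (intro sum.cong refl) (simp add: bil_unit)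
  also have "(\<Sum>i<N. \<Sum>j<N. mi x i j * G x (vd N X x (unit_vec i)) (unit_vec j)) = tr N (vd N X x)"
    by (rule inverse_metric_trace[OF x])
  also have "(\<Sum>i<N. \<Sum>j<N. mi x i j * G x (unit_vec i) (vd N X x (unit_vec j)))
      = (\<Sum>j<N. \<Sum>i<N. mi x j i * G x (vd N X x (unit_vec j)) (unit_vec i))"
    by (subst sum.swap, intro sum.cong refl) (use G_sym[OF x unit_vec_Rn vd_Rn] mi_sym[OF x] in auto)
  also have "\<dots> = tr N (vd N X x)" by (rule inverse_metric_trace[OF x])
  finally show ?thesis by (simp add: dv_def)
qed

lemma dd_th_field:
  assumes X: "field_on X"
  shows th_field_smooth: "smooth_on N U (\<lambda>y. th y (X y))"
    and "x \<in> U \<Longrightarrow> dd N (\<lambda>y. th y (X y)) x u = dd N (\<lambda>y. th y (X x)) x u + th x (vd N X x u)"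
proof -
  define S where "S k y = (\<Sum>i<N. chr y i i k)" for k y
  have S: "smooth_on N U (S k)" if "k < N" for k
    unfolding S_def by (intro smooth_on_sum[OF U] chr_smooth) (use that in auto)
  have sm: "smooth_on N U (\<lambda>y. X y k * S k y)" if "k < N" for k
    by (intro smooth_on_mult S field_onD(1)[OF X] that)
  show "smooth_on N U (\<lambda>y. th y (X y))"
    unfolding th_def S_def[symmetric] by (intro smooth_on_sum[OF U] sm) auto
  assume x: "x \<in> U"
  have "dd N (\<lambda>y. th y (X y)) x u = (\<Sum>k<N. dd N (\<lambda>y. X y k * S k y) x u)"
    unfolding th_def S_def[symmetric] by (rule dd_sum[OF _ x]) (use sm in auto)
  also have "\<dots> = (\<Sum>k<N. X x k * dd N (S k) x u) + (\<Sum>k<N. dd N (\<lambda>y. X y k) x u * S k x)"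
    unfolding sum.distrib[symmetric]
    by (intro sum.cong refl) (simp add: dd_mult[OF field_onD(1)[OF X] S x])
  also have "(\<Sum>k<N. X x k * dd N (S k) x u) = dd N (\<lambda>y. th y (X x)) x u"
  proof -
    have "dd N (\<lambda>y. th y (X x)) x u = (\<Sum>k<N. dd N (\<lambda>y. X x k * S k y) x u)"
      unfolding th_def S_def[symmetric] by (rule dd_sum[OF _ x]) (intro smooth_on_cmult S, auto)
    also have "\<dots> = (\<Sum>k<N. X x k * dd N (S k) x u)"
      by (intro sum.cong refl dd_cmult[OF S x]) auto
    finally show ?thesis by simp
  qed
  also have "(\<Sum>k<N. dd N (\<lambda>y. X y k) x u * S k x) = th x (vd N X x u)"
    unfolding th_def S_def by (simp add: vd_def)
  finally show "dd N (\<lambda>y. th y (X y)) x u = dd N (\<lambda>y. th y (X x)) x u + th x (vd N X x u)" .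
qed

lemma smooth_on_vd: "field_on X \<Longrightarrow> k < N \<Longrightarrow> smooth_on N U (\<lambda>y. vd N X y u k)"
  by (simp add: vd_def smooth_on_dd field_onD)

lemma dv_smooth: "field_on X \<Longrightarrow> smooth_on N U (dv X)"
  unfolding dv_def tr_def by (intro smooth_on_add smooth_on_sum[OF U] smooth_on_vd th_field_smooth) auto

text \<open>Second derivatives commute, so u can be moved inside: the derivative of the trace is the
  coordinate divergence of the derivative of X in direction u, where holomorphy can act on
  u.\<close>

lemma dd_tr:
  assumes X: "field_on X" and x: "x \<in> U"
  shows "dd N (\<lambda>y. tr N (vd N X y)) x u = (\<Sum>i<N. dd N (\<lambda>y. dd N (\<lambda>z. X z i) y u) x (unit_vec i))"
proof -
  have "dd N (\<lambda>y. tr N (vd N X y)) x u = (\<Sum>i<N. dd N (\<lambda>y. vd N X y (unit_vec i) i) x u)"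
    unfolding tr_def by (rule dd_sum[OF _ x]) (use smooth_on_vd[OF X] in auto)
  also have "\<dots> = (\<Sum>i<N. dd N (\<lambda>y. dd N (\<lambda>z. X z i) y u) x (unit_vec i))"
    by (intro sum.cong refl) (simp add: vd_def dd_commute[OF field_onD(1)[OF X] x])
  finally show ?thesis .
qed

end

locale kaehler_einstein_chart = kaehler_chart +
  fixes r :: real
  assumes einstein: "\<And>x i j. x \<in> U \<Longrightarrow> i < N \<Longrightarrow> j < N \<Longrightarrow>
      bil N (ricci N g x) (J (unit_vec i)) (unit_vec j) = r * w x i j"
begin

text \<open>The hypothesis \<open>einstein\<close> is the Ricci form, with J in the first slot.
  Writing u as - J (J u) and using J-invariance of the metric gives Ric = r g.\<close>

lemma ricci_metric:
  assumes x: "x \<in> U" and u: "u \<in> Rn N" and v: "v \<in> Rn N"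
  shows "bil N (ricci N g x) u v = r * G x u v"
proof -
  have *: "bil N (ricci N g x) (J u) v = r * bil N (w x) u v" if u: "u \<in> Rn N" for u
  proof -
    have "bil N (ricci N g x) (\<lambda>k. \<Sum>i<N. u i * J (unit_vec i) k) (\<lambda>k. \<Sum>j<N. v j * unit_vec j k)
       = r * bil N (w x) u v"
      unfolding bil_lin1 unfolding bil_lin2 unfolding bil_def[of N "w x"]
      by (simp add: einstein[OF x] sum_distrib_left mult_ac)
    moreover have "(\<lambda>k. \<Sum>i<N. u i * J (unit_vec i) k) = J u" using J_expand[OF u] by (simp add: fun_eq_iff)
    ultimately show ?thesis using Rn_expand[OF v] by simp
  qed
  have "bil N (ricci N g x) u v = - bil N (ricci N g x) (J (J u)) v" by (simp add: J_J bil_minus1)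
  also have "\<dots> = - r * bil N (w x) (J u) v" using *[OF JR[OF u]] by simp
  also have "\<dots> = r * G x (J u) (J v)" using w_G[OF x JR[OF u] v] by simp
  finally show ?thesis using G_J[OF x u v] by simp
qed

lemma th_einstein:
  assumes x: "x \<in> U" and u: "u \<in> Rn N" and v: "v \<in> Rn N"
  shows "dd N (\<lambda>y. th y v) x u + dd N (\<lambda>y. th y (J v)) x (J u) = - 2 * r * G x u v"
  using ricci_J_average[OF x u v] ricci_metric[OF x u v] ricci_metric[OF x JR[OF u] JR[OF v]] G_J[OF x u v] by simp

text \<open>Both divergences are expanded by \<open>dvd\<close>. The trace terms cancel because X is
  holomorphic, so do the derivatives of X under \<open>th\<close>, and the remaining frozen terms
  form the J-average that the Einstein equation evaluates.\<close>

lemma dd_dv_J: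
  assumes X: "holomorphic_field X" and K: "killing_field X" and x: "x \<in> U" and u: "u \<in> Rn N"
  shows "dd N (dv (\<lambda>y. J (X y))) x u = - 2 * r * G x u (J (X x))"
proof -
  have fX: "field_on X" using X by (simp add: holomorphic_field_def)
  have hX: "vd N X y (J u) = J (vd N X y u)" if "y \<in> U" "u \<in> Rn N" for y u
    using X that by (auto simp: holomorphic_field_def)
  note fJ = field_on_J[OF fX]
  have XR: "X x \<in> Rn N" using field_onD(2)[OF fX x] .
  have sm_tr: "smooth_on N U (\<lambda>y. tr N (vd N Y y))" if "field_on Y" for Y
    unfolding tr_def by (intro smooth_on_sum[OF U] smooth_on_vd that) auto
  have dvd: "dd N (dv Y) x z = dd N (\<lambda>y. tr N (vd N Y y)) x z + dd N (\<lambda>y. th y (Y x)) x z + th x (vd N Y x z)"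
    if Y: "field_on Y" for Y z
    unfolding dv_def using dd_add[OF sm_tr[OF Y] th_field_smooth[OF Y] x] dd_th_field(2)[OF Y x] by simp
  have "dd N (dv X) x (J u) = dd N (\<lambda>y. 0) x (J u)"
    by (rule dd_cong[OF U killing_dv[OF K] x])
  also have "\<dots> = 0" by (simp add: dd_def pd_def)
  finally have 0: "dd N (dv X) x (J u) = 0" .
  \<comment> \<open>J composed with the derivative of X in direction u is its derivative in
    direction J u, so the second-order part of div JX along u is that of div X along J u.\<close>
  have "dd N (\<lambda>y. tr N (vd N (\<lambda>y. J (X y)) y)) x u = (\<Sum>i<N. dd N (\<lambda>y. vd N (\<lambda>z. J (X z)) y u i) x (unit_vec i))"
    unfolding dd_tr[OF fJ x] by (simp add: vd_def)
  also have "\<dots> = (\<Sum>i<N. dd N (\<lambda>y. vd N X y (J u) i) x (unit_vec i))"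
    by (intro sum.cong refl dd_cong[OF U _ x]) (simp add: vd_J_field[OF fX] hX u)
  also have "\<dots> = dd N (\<lambda>y. tr N (vd N X y)) x (J u)"
    unfolding dd_tr[OF fX x] by (simp add: vd_def)
  finally have t: "dd N (\<lambda>y. tr N (vd N (\<lambda>y. J (X y)) y)) x u = dd N (\<lambda>y. tr N (vd N X y)) x (J u)" .
  have "dd N (dv (\<lambda>y. J (X y))) x u = dd N (dv (\<lambda>y. J (X y))) x u - dd N (dv X) x (J u)" using 0 by simp
  also have "\<dots> = dd N (\<lambda>y. th y (J (X x))) x u - dd N (\<lambda>y. th y (X x)) x (J u)"
    unfolding dvd[OF fJ] dvd[OF fX] t by (simp add: vd_J_field[OF fX x] hX[OF x u])
  \<comment> \<open>The sign is absorbed as J (J X) = - X, which produces the left side of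
    \<open>th_einstein\<close> with v = JX.\<close>
  also have "\<dots> = dd N (\<lambda>y. th y (J (X x))) x u + dd N (\<lambda>y. th y (J (J (X x)))) x (J u)"
    unfolding J_J th_minus dd_minus[OF th_smooth x] by simp
  also have "\<dots> = - 2 * r * G x u (J (X x))" by (rule th_einstein[OF x u JR[OF XR]])
  finally show ?thesis .
qed

end

section \<open>Gram determinants of frames\<close>

lemma sum_lessThan_add: "(\<Sum>i<k + (l::nat). f i) = (\<Sum>i<k. f i) + (\<Sum>i<l. (f (k + i) :: real))"
  by (induction l) (auto simp: add.assoc)

lemma mat_inv_unique:
  assumes r: "\<And>i j. i < n \<Longrightarrow> j < n \<Longrightarrow> (\<Sum>k<n. a i k * b k j) = (if i = j then 1 else 0)"
    and ij: "i < n" "j < n"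
  shows "mat_inv n a i j = b i j"
proof -
  have d: "dt n a \<noteq> 0" by (rule right_inverse_imp_nonzero(1)[OF r])
  have "mat_inv n a i j = (\<Sum>k<n. mat_inv n a i k * (if k = j then 1 else 0))" by (rule sum_delta_right[symmetric, OF ij(2)])
  also have "\<dots> = (\<Sum>k<n. mat_inv n a i k * (\<Sum>l<n. a k l * b l j))"
    using r ij by (intro sum.cong refl) auto
  also have "\<dots> = (\<Sum>l<n. (\<Sum>k<n. mat_inv n a i k * a k l) * b l j)" by (rule sum_mult_assoc[symmetric])
  also have "\<dots> = (\<Sum>l<n. (if i = l then 1 else 0) * b l j)"
    using mat_inv_mult(2)[OF d ij(1)] by (intro sum.cong refl) auto
  also have "\<dots> = b i j" by (rule sum_delta_left[OF ij(1)])
  finally show ?thesis .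
qed

lemma mat_inv_sym:
  assumes d: "dt n a \<noteq> 0" and s: "\<And>i j. i < n \<Longrightarrow> j < n \<Longrightarrow> a i j = a j i" and ij: "i < n" "j < n"
  shows "mat_inv n a i j = mat_inv n a j i"
proof (rule mat_inv_unique[OF _ ij])
  fix i j assume ij: "i < n" "j < n"
  have "(\<Sum>k<n. a i k * mat_inv n a j k) = (\<Sum>k<n. mat_inv n a j k * a k i)"
    using s ij by (intro sum.cong refl) (auto simp: mult.commute)
  then show "(\<Sum>k<n. a i k * mat_inv n a j k) = (if i = j then 1 else 0)"
    using mat_inv_mult(2)[OF d ij(2,1)] by auto
qed

lemma dd_dt:
  assumes a: "\<And>i j. i < m \<Longrightarrow> j < m \<Longrightarrow> smooth_on n W (\<lambda>x. a x i j)" and x: "x \<in> W" and nz: "dt m (a x) \<noteq> 0"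
  shows "dd n (\<lambda>y. dt m (a y)) x v = dt m (a x) * (\<Sum>i<m. \<Sum>k<m. mat_inv m (a x) i k * dd n (\<lambda>y. a y k i) x v)"
proof -
  have "pd l (\<lambda>y. dt m (a y)) x = dt m (a x) * (\<Sum>i<m. \<Sum>k<m. mat_inv m (a x) i k * pd l (\<lambda>y. a y k i) x)"
    if l: "l < n" for l
  proof (rule pd_eqI)
    have "((\<lambda>t. dt m (a (x(l := t)))) has_real_derivative
       dt m (a (x(l := x l))) * (\<Sum>i<m. \<Sum>k<m. mat_inv m (a (x(l := x l))) i k * pd l (\<lambda>y. a y k i) x)) (at (x l))"
      by (rule dt_deriv[where a' = "\<lambda>k i. pd l (\<lambda>y. a y k i) x"]) (use smooth_on_deriv[OF a l x] nz in auto)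
    then show "((\<lambda>t. dt m (a (x(l := t)))) has_real_derivative
       dt m (a x) * (\<Sum>i<m. \<Sum>k<m. mat_inv m (a x) i k * pd l (\<lambda>y. a y k i) x)) (at (x l))" by simp
  qed
  then have "dd n (\<lambda>y. dt m (a y)) x v
      = (\<Sum>l<n. \<Sum>i<m. \<Sum>k<m. dt m (a x) * (mat_inv m (a x) i k * (pd l (\<lambda>y. a y k i) x * v l)))"
    unfolding dd_def by (simp add: sum_distrib_left sum_distrib_right mult_ac)
  also have "\<dots> = (\<Sum>i<m. \<Sum>l<n. \<Sum>k<m. dt m (a x) * (mat_inv m (a x) i k * (pd l (\<lambda>y. a y k i) x * v l)))"
    by (rule sum.swap)
  also have "\<dots> = (\<Sum>i<m. \<Sum>k<m. \<Sum>l<n. dt m (a x) * (mat_inv m (a x) i k * (pd l (\<lambda>y. a y k i) x * v l)))"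
    by (rule sum.cong[OF refl], rule sum.swap)
  finally show ?thesis by (simp add: dd_def sum_distrib_left)
qed

text \<open>With the frame as the columns of P, the Gram matrix is the product of the transpose of
  P, b and P.\<close>

lemma frame_gram_dt:
  "dt n (\<lambda>\<alpha> \<beta>. bil n b (f \<alpha>) (f \<beta>)) = dt n b * (dt n (\<lambda>i \<alpha>. f \<alpha> i))\<^sup>2"
proof -
  have "dt n (\<lambda>\<alpha> \<beta>. bil n b (f \<alpha>) (f \<beta>)) = dt n (\<lambda>\<alpha> \<beta>. \<Sum>i<n. f \<alpha> i * (\<Sum>j<n. b i j * f \<beta> j))"
    by (rule dt_cong) (simp add: bil_row)
  also have "\<dots> = dt n (\<lambda>\<alpha> i. f \<alpha> i) * (dt n b * dt n (\<lambda>i \<alpha>. f \<alpha> i))"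
    unfolding dt_mult[where a = "\<lambda>\<alpha> i. f \<alpha> i" and b = "\<lambda>i \<beta>. \<Sum>j<n. b i j * f \<beta> j"]
    unfolding dt_mult[where b = "\<lambda>i \<alpha>. f \<alpha> i"] ..
  also have "dt n (\<lambda>\<alpha> i. f \<alpha> i) = dt n (\<lambda>i \<alpha>. f \<alpha> i)" by (rule dt_transpose)
  finally show ?thesis by (simp add: power2_eq_square)
qed

section \<open>Traces and Gram determinants with respect to a moving frame\<close>

context kaehler_chart
begin

text \<open>The metric trace does not depend on the frame. With P the frame matrix and B the inverse
  Gram matrix, K is P B times the transpose of P; one finds K g P = P, then K g = 1 because P is
  invertible, hence K is the inverse of g.\<close>

lemma frame_trace:
  assumes x: "x \<in> U" and nz: "dt N (\<lambda>\<alpha> \<beta>. G x (f \<alpha>) (f \<beta>)) \<noteq> 0"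
  shows "(\<Sum>\<alpha><N. \<Sum>\<beta><N. mat_inv N (\<lambda>\<alpha> \<beta>. G x (f \<alpha>) (f \<beta>)) \<alpha> \<beta> * bil N b (f \<alpha>) (f \<beta>)) = (\<Sum>i<N. \<Sum>j<N. mi x i j * b i j)"
proof -
  define A where "A = (\<lambda>\<alpha> \<beta>. G x (f \<alpha>) (f \<beta>))"
  define P where "P = (\<lambda>i \<alpha>. f \<alpha> i)"
  define B where "B = mat_inv N A"
  define Q where "Q = mat_inv N P"
  have A: "dt N A \<noteq> 0" using nz by (simp add: A_def)
  have P: "dt N P \<noteq> 0" using nz unfolding frame_gram_dt P_def by auto
  define K where "K i j = (\<Sum>\<alpha><N. P i \<alpha> * (\<Sum>\<beta><N. B \<alpha> \<beta> * P j \<beta>))" for i j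
  have KgP: "(\<Sum>j<N. K i j * (\<Sum>k<N. g x j k * P k \<gamma>)) = P i \<gamma>" if i: "i < N" and \<gamma>: "\<gamma> < N" for i \<gamma>
  proof -
    have "(\<Sum>j<N. K i j * (\<Sum>k<N. g x j k * P k \<gamma>)) = (\<Sum>\<alpha><N. P i \<alpha> * (\<Sum>j<N. (\<Sum>\<beta><N. B \<alpha> \<beta> * P j \<beta>) * (\<Sum>k<N. g x j k * P k \<gamma>)))"
      unfolding K_def by (rule sum_mult_assoc)
    also have "\<dots> = (\<Sum>\<alpha><N. P i \<alpha> * (\<Sum>\<beta><N. B \<alpha> \<beta> * (\<Sum>j<N. P j \<beta> * (\<Sum>k<N. g x j k * P k \<gamma>))))"
      by (intro sum.cong refl arg_cong2[where f = "(*)"] sum_mult_assoc)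
    also have "\<dots> = (\<Sum>\<alpha><N. P i \<alpha> * (\<Sum>\<beta><N. B \<alpha> \<beta> * A \<beta> \<gamma>))"
      unfolding A_def bil_row P_def ..
    also have "\<dots> = (\<Sum>\<alpha><N. P i \<alpha> * (if \<alpha> = \<gamma> then 1 else 0))"
      using mat_inv_mult(2)[OF A _ \<gamma>] unfolding B_def by (intro sum.cong refl) simp
    also have "\<dots> = P i \<gamma>" by (rule sum_delta_right[OF \<gamma>])
    finally show ?thesis .
  qed
  have Kg: "(\<Sum>j<N. K i j * g x j k) = (if i = k then 1 else 0)" if i: "i < N" and k: "k < N" for i k
  proof -
    have "(\<Sum>j<N. K i j * g x j k) = (\<Sum>l<N. (\<Sum>j<N. K i j * g x j l) * (if l = k then 1 else 0))"
      by (rule sum_delta_right[symmetric, OF k])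
    also have "\<dots> = (\<Sum>l<N. (\<Sum>j<N. K i j * g x j l) * (\<Sum>\<gamma><N. P l \<gamma> * Q \<gamma> k))"
      using mat_inv_mult(1)[OF P _ k] unfolding Q_def by (intro sum.cong refl) simp
    also have "\<dots> = (\<Sum>\<gamma><N. (\<Sum>l<N. (\<Sum>j<N. K i j * g x j l) * P l \<gamma>) * Q \<gamma> k)" by (rule sum_mult_assoc[symmetric])
    also have "\<dots> = (\<Sum>\<gamma><N. (\<Sum>j<N. K i j * (\<Sum>l<N. g x j l * P l \<gamma>)) * Q \<gamma> k)"
      by (intro sum.cong refl arg_cong2[where f = "(*)"] sum_mult_assoc)
    also have "\<dots> = (\<Sum>\<gamma><N. P i \<gamma> * Q \<gamma> k)" using KgP[OF i] by (intro sum.cong refl) simp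
    also have "\<dots> = (if i = k then 1 else 0)" unfolding Q_def by (rule mat_inv_mult(1)[OF P i k])
    finally show ?thesis .
  qed
  have K: "K i j = mi x i j" if i: "i < N" and j: "j < N" for i j
  proof -
    have "K i j = (\<Sum>k<N. K i k * (if k = j then 1 else 0))" by (rule sum_delta_right[symmetric, OF j])
    also have "\<dots> = (\<Sum>k<N. K i k * (\<Sum>l<N. g x k l * mi x l j))"
      using mat_inv_mult(1)[OF g_nonzero[OF x] _ j] by (intro sum.cong refl) simp
    also have "\<dots> = (\<Sum>l<N. (\<Sum>k<N. K i k * g x k l) * mi x l j)" by (rule sum_mult_assoc[symmetric])
    also have "\<dots> = (\<Sum>l<N. (if i = l then 1 else 0) * mi x l j)" using Kg[OF i] by (intro sum.cong refl) simp
    also have "\<dots> = mi x i j" by (rule sum_delta_left[OF i])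
    finally show ?thesis .
  qed
  have "(\<Sum>\<alpha><N. \<Sum>\<beta><N. B \<alpha> \<beta> * bil N b (f \<alpha>) (f \<beta>)) = (\<Sum>\<alpha><N. \<Sum>\<beta><N. \<Sum>i<N. \<Sum>j<N. b i j * (P i \<alpha> * (B \<alpha> \<beta> * P j \<beta>)))"
    unfolding bil_def P_def by (simp add: sum_distrib_left mult_ac)
  also have "\<dots> = (\<Sum>\<alpha><N. \<Sum>i<N. \<Sum>\<beta><N. \<Sum>j<N. b i j * (P i \<alpha> * (B \<alpha> \<beta> * P j \<beta>)))"
    by (rule sum.cong[OF refl], rule sum.swap)
  also have "\<dots> = (\<Sum>i<N. \<Sum>\<alpha><N. \<Sum>j<N. \<Sum>\<beta><N. b i j * (P i \<alpha> * (B \<alpha> \<beta> * P j \<beta>)))"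
    by (subst sum.swap) (rule sum.cong[OF refl], rule sum.cong[OF refl], rule sum.swap)
  also have "\<dots> = (\<Sum>i<N. \<Sum>j<N. \<Sum>\<alpha><N. \<Sum>\<beta><N. b i j * (P i \<alpha> * (B \<alpha> \<beta> * P j \<beta>)))"
    by (rule sum.cong[OF refl], rule sum.swap)
  also have "\<dots> = (\<Sum>i<N. \<Sum>j<N. b i j * K i j)"
    unfolding K_def by (simp add: sum_distrib_left)
  also have "\<dots> = (\<Sum>i<N. \<Sum>j<N. mi x i j * b i j)" using K by (intro sum.cong refl) simp
  finally show ?thesis unfolding B_def A_def .
qed

lemma frame_nondegenerate:
  assumes x: "x \<in> U" and nz: "dt N (\<lambda>\<alpha> \<beta>. G x (f \<alpha>) (f \<beta>)) \<noteq> 0" and h: "h \<in> Rn N"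
    and z: "\<And>\<alpha>. \<alpha> < N \<Longrightarrow> G x h (f \<alpha>) = 0"
  shows "h = (\<lambda>_. 0)"
proof -
  have "dt N (\<lambda>i \<alpha>. f \<alpha> i) \<noteq> 0" using nz unfolding frame_gram_dt by auto
  then have "dt N (\<lambda>\<alpha> i. f \<alpha> i) \<noteq> 0" by (subst dt_transpose)
  then have "dt N (\<lambda>\<alpha> j. \<Sum>i<N. f \<alpha> i * g x i j) \<noteq> 0" using g_nonzero[OF x] unfolding dt_mult by simp
  moreover have "(\<Sum>j<N. (\<Sum>i<N. f \<alpha> i * g x i j) * h j) = 0" if "\<alpha> < N" for \<alpha>
  proof -
    have "(\<Sum>j<N. (\<Sum>i<N. f \<alpha> i * g x i j) * h j) = bil N (\<lambda>i j. g x j i) h (f \<alpha>)"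
      unfolding bil_transpose[of N "g x"] unfolding bil_col by (simp add: mult.commute)
    also have "\<dots> = G x h (f \<alpha>)" by (rule bil_cong) (use g_sym[OF x] in auto)
    finally show ?thesis using z that by simp
  qed
  ultimately show ?thesis using h unfolding dt_nonzero_iff by blast
qed

text \<open>The hypothesis \<open>br\<close> says that the bracket of V with each frame field is a
  combination of the frame with matrix C. The logarithmic derivative of the Gram determinant is
  therefore the trace of the Lie derivative of g along V, which is twice the divergence, plus twice
  the trace of C.\<close>

lemma gram_derivative:
  assumes x: "x \<in> U" and f: "\<And>\<alpha>. \<alpha> < N \<Longrightarrow> field_on (f \<alpha>)" and V: "field_on V"
    and nz: "dt N (\<lambda>\<alpha> \<beta>. G x (f \<alpha> x) (f \<beta> x)) \<noteq> 0"
    and br: "\<And>\<alpha>. \<alpha> < N \<Longrightarrow> vd N (f \<alpha>) x (V x) = (\<lambda>k. vd N V x (f \<alpha> x) k + (\<Sum>\<beta><N. C \<alpha> \<beta> * f \<beta> x k))"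
    and C: "(\<Sum>\<alpha><N. C \<alpha> \<alpha>) = 0"
  shows "dd N (\<lambda>y. dt N (\<lambda>\<alpha> \<beta>. G y (f \<alpha> y) (f \<beta> y))) x (V x)
    = 2 * dv V x * dt N (\<lambda>\<alpha> \<beta>. G x (f \<alpha> x) (f \<beta> x))"
proof -
  define A where "A y = (\<lambda>\<alpha> \<beta>. G y (f \<alpha> y) (f \<beta> y))" for y
  define B where "B = mat_inv N (A x)"
  have fR: "f \<alpha> x \<in> Rn N" if "\<alpha> < N" for \<alpha> using field_onD(2)[OF f[OF that] x] .
  have nz': "dt N (A x) \<noteq> 0" using nz by (simp add: A_def)
  have Asym: "A x \<alpha> \<beta> = A x \<beta> \<alpha>" if "\<alpha> < N" "\<beta> < N" for \<alpha> \<beta>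
    unfolding A_def using G_sym[OF x fR fR] that by blast
  have Bsym: "B \<alpha> \<beta> = B \<beta> \<alpha>" if "\<alpha> < N" "\<beta> < N" for \<alpha> \<beta>
    unfolding B_def by (rule mat_inv_sym[OF nz' Asym that])
  have sm: "smooth_on N U (\<lambda>y. A y \<alpha> \<beta>)" if "\<alpha> < N" "\<beta> < N" for \<alpha> \<beta>
    unfolding A_def by (intro smooth_on_bil U g_smooth field_onD(1) f that)
  define c where "c \<alpha> = (\<lambda>k. \<Sum>\<beta><N. C \<alpha> \<beta> * f \<beta> x k)" for \<alpha>
  \<comment> \<open>The bilinear form whose metric trace is the trace of the derivative of
    V.\<close>
  define b where "b i j = G x (vd N V x (unit_vec i)) (unit_vec j)" for i j
  have bb: "bil N b u v = G x (vd N V x u) v" if "u \<in> Rn N" "v \<in> Rn N" for u v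
  proof -
    have "G x (vd N V x (\<lambda>k. \<Sum>i<N. u i * unit_vec i k)) (\<lambda>k. \<Sum>j<N. v j * unit_vec j k) = bil N b u v"
      unfolding vd_lin bil_lin1 unfolding bil_lin2 b_def bil_def[of N _ u v] by (simp add: sum_distrib_left mult_ac)
    then show ?thesis using Rn_expand that by simp
  qed
  have dA: "dd N (\<lambda>y. A y \<beta> \<alpha>) x (V x) = bil N (\<lambda>i j. dd N (\<lambda>y. g y i j) x (V x)) (f \<alpha> x) (f \<beta> x)
      + bil N b (f \<beta> x) (f \<alpha> x) + bil N b (f \<alpha> x) (f \<beta> x) + G x (c \<beta>) (f \<alpha> x) + G x (c \<alpha>) (f \<beta> x)"
    if ab: "\<alpha> < N" "\<beta> < N" for \<alpha> \<beta>
  proof -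
    have eq: "A y \<beta> \<alpha> = G y (f \<alpha> y) (f \<beta> y)" if "y \<in> U" for y
      unfolding A_def using G_sym[OF that] field_onD(2)[OF f that] ab by blast
    have "dd N (\<lambda>y. A y \<beta> \<alpha>) x (V x) = dd N (\<lambda>y. G y (f \<alpha> y) (f \<beta> y)) x (V x)"
      by (rule dd_cong[OF U eq x])
    also have "\<dots> = bil N (\<lambda>i j. dd N (\<lambda>y. g y i j) x (V x)) (f \<alpha> x) (f \<beta> x)
       + G x (\<lambda>i. dd N (\<lambda>y. f \<alpha> y i) x (V x)) (f \<beta> x) + G x (f \<alpha> x) (\<lambda>i. dd N (\<lambda>y. f \<beta> y i) x (V x))"
      by (rule dd_bil[OF U g_smooth field_onD(1)[OF f] field_onD(1)[OF f] x]) (use ab in auto)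
    also have "G x (\<lambda>i. dd N (\<lambda>y. f \<alpha> y i) x (V x)) (f \<beta> x) = G x (vd N (f \<alpha>) x (V x)) (f \<beta> x)"
      by (rule bil_cong) (auto simp: vd_def)
    also have "G x (f \<alpha> x) (\<lambda>i. dd N (\<lambda>y. f \<beta> y i) x (V x)) = G x (vd N (f \<beta>) x (V x)) (f \<alpha> x)"
      unfolding G_sym[OF x vd_Rn fR[OF ab(1)]] by (rule bil_cong) (auto simp: vd_def)
    finally show ?thesis
      unfolding br[OF ab(1)] br[OF ab(2)] c_def[symmetric] bil_add1 using bb[OF fR fR] ab by simp
  qed
  have t1: "(\<Sum>\<alpha><N. \<Sum>\<beta><N. B \<alpha> \<beta> * bil N (\<lambda>i j. dd N (\<lambda>y. g y i j) x (V x)) (f \<alpha> x) (f \<beta> x)) = 2 * th x (V x)"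
    unfolding th_metric[OF x] B_def A_def by (rule frame_trace[OF x nz])
  have t2: "(\<Sum>\<alpha><N. \<Sum>\<beta><N. B \<alpha> \<beta> * bil N b (f \<alpha> x) (f \<beta> x)) = tr N (vd N V x)"
    unfolding inverse_metric_trace[OF x, symmetric] b_def[symmetric] B_def A_def by (rule frame_trace[OF x nz])
  have t3: "(\<Sum>\<alpha><N. \<Sum>\<beta><N. B \<alpha> \<beta> * G x (c \<alpha>) (f \<beta> x)) = 0"
  proof -
    have "(\<Sum>\<alpha><N. \<Sum>\<beta><N. B \<alpha> \<beta> * G x (c \<alpha>) (f \<beta> x)) = (\<Sum>\<alpha><N. \<Sum>\<beta><N. (\<Sum>\<gamma><N. C \<alpha> \<gamma> * A x \<gamma> \<beta>) * B \<beta> \<alpha>)"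
      unfolding c_def bil_lin1 A_def[symmetric] by (intro sum.cong refl) (use Bsym in \<open>simp add: A_def mult.commute\<close>)
    also have "\<dots> = (\<Sum>\<alpha><N. \<Sum>\<gamma><N. C \<alpha> \<gamma> * (\<Sum>\<beta><N. A x \<gamma> \<beta> * B \<beta> \<alpha>))"
      by (intro sum.cong refl sum_mult_assoc)
    also have "\<dots> = (\<Sum>\<alpha><N. \<Sum>\<gamma><N. C \<alpha> \<gamma> * (if \<gamma> = \<alpha> then 1 else 0))"
      unfolding B_def using mat_inv_mult(1)[OF nz'] by (intro sum.cong refl) simp
    also have "\<dots> = (\<Sum>\<alpha><N. C \<alpha> \<alpha>)" by (intro sum.cong refl sum_delta_right) auto
    finally show ?thesis using C by simp
  qed
  have sw: "(\<Sum>\<alpha><N. \<Sum>\<beta><N. B \<alpha> \<beta> * F \<beta> \<alpha>) = (\<Sum>\<alpha><N. \<Sum>\<beta><N. B \<alpha> \<beta> * F \<alpha> \<beta>)" for F :: "nat \<Rightarrow> nat \<Rightarrow> real"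
    by (subst sum.swap, intro sum.cong refl) (use Bsym in simp)
  have "(\<Sum>\<alpha><N. \<Sum>\<beta><N. B \<alpha> \<beta> * dd N (\<lambda>y. A y \<beta> \<alpha>) x (V x))
     = (\<Sum>\<alpha><N. \<Sum>\<beta><N. B \<alpha> \<beta> * bil N (\<lambda>i j. dd N (\<lambda>y. g y i j) x (V x)) (f \<alpha> x) (f \<beta> x))
      + (\<Sum>\<alpha><N. \<Sum>\<beta><N. B \<alpha> \<beta> * bil N b (f \<beta> x) (f \<alpha> x)) + (\<Sum>\<alpha><N. \<Sum>\<beta><N. B \<alpha> \<beta> * bil N b (f \<alpha> x) (f \<beta> x))
      + (\<Sum>\<alpha><N. \<Sum>\<beta><N. B \<alpha> \<beta> * G x (c \<beta>) (f \<alpha> x)) + (\<Sum>\<alpha><N. \<Sum>\<beta><N. B \<alpha> \<beta> * G x (c \<alpha>) (f \<beta> x))"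
    unfolding sum.distrib[symmetric] by (intro sum.cong refl) (simp add: dA algebra_simps)
  also have "\<dots> = 2 * th x (V x) + tr N (vd N V x) + tr N (vd N V x) + 0 + 0"
    unfolding sw[of "\<lambda>\<alpha> \<beta>. bil N b (f \<alpha> x) (f \<beta> x)"] sw[of "\<lambda>\<alpha> \<beta>. G x (c \<alpha>) (f \<beta> x)"] t1 t2 t3 ..
  finally have "(\<Sum>\<alpha><N. \<Sum>\<beta><N. B \<alpha> \<beta> * dd N (\<lambda>y. A y \<beta> \<alpha>) x (V x)) = 2 * dv V x" by (simp add: dv_def)
  then show ?thesis
    using dd_dt[of N N U A, OF sm x nz'] unfolding B_def A_def by simp
qed

end

section \<open>Mean curvature of Lagrangian immersions\<close>

context kaehler_chart
begin

text \<open>Adding the Koszul formula for (u, p, q) to that for (u, q, p) leaves twice the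
  derivative in direction u.\<close>

lemma metric_compat:
  assumes x: "x \<in> U" and p: "p \<in> Rn N" and q: "q \<in> Rn N"
  shows "bil N (\<lambda>i j. dd N (\<lambda>y. g y i j) x u) p q = G x (Gam x u p) q + G x p (Gam x u q)"
proof -
  have e: "bil N (\<lambda>i j. dd N (\<lambda>y. g y i j) x u) p q = dd N (\<lambda>y. G y p q) x u"
    by (rule dd_bil_const[symmetric, OF g_smooth x])
  have "dd N (\<lambda>y. G y q p) x u = dd N (\<lambda>y. G y p q) x u" by (rule dd_cong[OF U G_sym[OF _ q p] x])
  then show ?thesis using koszul[OF x, of u p q] koszul[OF x, of u q p] G_sym[OF x p Gam_Rn] unfolding e by simp
qed

lemma Gam_lin1: "Gam x (\<lambda>k. \<Sum>m\<in>A. c m * u m k) v = (\<lambda>k. \<Sum>m\<in>A. c m * Gam x (u m) v k)"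
  by (auto simp: Gam_def bil_lin1)

lemma th_tr: "th x v = tr N (\<lambda>z. Gam x z v)"
proof -
  have "tr N (\<lambda>z. Gam x z v) = (\<Sum>i<N. \<Sum>l<N. chr x i i l * v l)"
    unfolding tr_def by (intro sum.cong refl) (simp add: Gam_unit)
  also have "\<dots> = th x v" unfolding th_def by (subst sum.swap) (simp add: sum_distrib_left mult_ac)
  finally show ?thesis by simp
qed

text \<open>Isotropy makes t a orthogonal to J (t b), so the Gram matrix of the doubled frame
  consists of two copies of the small one and its inverse likewise. A J-invariant form has the same
  trace over both halves, whence the factor 2.\<close>

lemma isotropic_frame:
  assumes x: "x \<in> U" and N: "N = k + k" and t: "\<And>a. a < k \<Longrightarrow> t a \<in> Rn N"
    and nz: "dt k (\<lambda>a b. G x (t a) (t b)) \<noteq> 0"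
    and iso: "\<And>a b. a < k \<Longrightarrow> b < k \<Longrightarrow> G x (t a) (J (t b)) = 0"
  defines "f \<equiv> \<lambda>\<alpha>. if \<alpha> < k then t \<alpha> else J (t (\<alpha> - k))"
  shows isotropic_frame_nz: "dt N (\<lambda>\<alpha> \<beta>. G x (f \<alpha>) (f \<beta>)) \<noteq> 0"
    and isotropic_trace: "\<And>b. (\<And>u v. u \<in> Rn N \<Longrightarrow> v \<in> Rn N \<Longrightarrow> bil N b (J u) (J v) = bil N b u v) \<Longrightarrow>
      2 * (\<Sum>a<k. \<Sum>c<k. mat_inv k (\<lambda>a b. G x (t a) (t b)) a c * bil N b (t a) (t c)) = (\<Sum>i<N. \<Sum>j<N. mi x i j * b i j)"
proof -
  define m where "m = (\<lambda>a b. G x (t a) (t b))"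
  define A where "A = (\<lambda>\<alpha> \<beta>. G x (f \<alpha>) (f \<beta>))"
  define B where "B \<alpha> \<beta> = (if \<alpha> < k \<and> \<beta> < k then mat_inv k m \<alpha> \<beta>
    else if \<not> \<alpha> < k \<and> \<not> \<beta> < k then mat_inv k m (\<alpha> - k) (\<beta> - k) else 0)" for \<alpha> \<beta>
  have A: "A \<alpha> \<beta> = (if \<alpha> < k \<and> \<beta> < k then m \<alpha> \<beta> else if \<not> \<alpha> < k \<and> \<not> \<beta> < k then m (\<alpha> - k) (\<beta> - k) else 0)"
    if ab: "\<alpha> < N" "\<beta> < N" for \<alpha> \<beta>
  proof -
    have "\<alpha> - k < k" if "\<not> \<alpha> < k" using that ab N by simp
    moreover have "\<beta> - k < k" if "\<not> \<beta> < k" using that ab N by simp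
    ultimately show ?thesis
      using G_J[OF x t t] iso G_sym[OF x JR[OF t] t] unfolding A_def m_def f_def by auto
  qed
  have nzm: "dt k m \<noteq> 0" using nz by (simp add: m_def)
  have AB: "(\<Sum>\<gamma><N. A \<alpha> \<gamma> * B \<gamma> \<beta>) = (if \<alpha> = \<beta> then 1 else 0)" if ab: "\<alpha> < N" "\<beta> < N" for \<alpha> \<beta>
  proof -
    have "(\<Sum>\<gamma><N. A \<alpha> \<gamma> * B \<gamma> \<beta>) = (\<Sum>\<gamma><k. A \<alpha> \<gamma> * B \<gamma> \<beta>) + (\<Sum>\<gamma><k. A \<alpha> (k + \<gamma>) * B (k + \<gamma>) \<beta>)"
      unfolding N by (rule sum_lessThan_add)
    also have "(\<Sum>\<gamma><k. A \<alpha> \<gamma> * B \<gamma> \<beta>) = (if \<alpha> < k \<and> \<beta> < k then (\<Sum>\<gamma><k. m \<alpha> \<gamma> * mat_inv k m \<gamma> \<beta>) else 0)"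
      using ab N by (auto simp: A B_def intro!: sum.cong sum.neutral)
    also have "(\<Sum>\<gamma><k. A \<alpha> (k + \<gamma>) * B (k + \<gamma>) \<beta>)
        = (if \<not> \<alpha> < k \<and> \<not> \<beta> < k then (\<Sum>\<gamma><k. m (\<alpha> - k) \<gamma> * mat_inv k m \<gamma> (\<beta> - k)) else 0)"
      using ab N by (auto simp: A B_def intro!: sum.cong sum.neutral)
    finally show ?thesis
      using mat_inv_mult(1)[OF nzm, of \<alpha> \<beta>] mat_inv_mult(1)[OF nzm, of "\<alpha> - k" "\<beta> - k"] ab N by auto
  qed
  then have nzA: "dt N A \<noteq> 0" by (rule right_inverse_imp_nonzero(1))
  then show "dt N (\<lambda>\<alpha> \<beta>. G x (f \<alpha>) (f \<beta>)) \<noteq> 0" by (simp add: A_def)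
  fix b assume bJ: "\<And>u v. u \<in> Rn N \<Longrightarrow> v \<in> Rn N \<Longrightarrow> bil N b (J u) (J v) = bil N b u v"
  have inv: "mat_inv N A \<alpha> \<beta> = B \<alpha> \<beta>" if "\<alpha> < N" "\<beta> < N" for \<alpha> \<beta>
    by (rule mat_inv_unique[OF AB that])
  have "(\<Sum>i<N. \<Sum>j<N. mi x i j * b i j) = (\<Sum>\<alpha><N. \<Sum>\<beta><N. mat_inv N A \<alpha> \<beta> * bil N b (f \<alpha>) (f \<beta>))"
    unfolding A_def by (rule frame_trace[symmetric, OF x nzA[unfolded A_def]])
  also have "\<dots> = (\<Sum>\<alpha><k + k. \<Sum>\<beta><k + k. B \<alpha> \<beta> * bil N b (f \<alpha>) (f \<beta>))"
    using inv unfolding N by (intro sum.cong refl) simp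
  also have "\<dots> = (\<Sum>a<k. \<Sum>c<k. mat_inv k m a c * bil N b (t a) (t c)) + (\<Sum>a<k. \<Sum>c<k. mat_inv k m a c * bil N b (J (t a)) (J (t c)))"
    unfolding sum_lessThan_add by (simp add: B_def f_def)
  also have "(\<Sum>a<k. \<Sum>c<k. mat_inv k m a c * bil N b (J (t a)) (J (t c))) = (\<Sum>a<k. \<Sum>c<k. mat_inv k m a c * bil N b (t a) (t c))"
    by (intro sum.cong refl) (simp add: bJ t)
  finally show "2 * (\<Sum>a<k. \<Sum>c<k. mat_inv k (\<lambda>a b. G x (t a) (t b)) a c * bil N b (t a) (t c)) = (\<Sum>i<N. \<Sum>j<N. mi x i j * b i j)"
    by (simp add: m_def)
qed

end

text \<open>A half-dimensional smooth map read in one chart of the target. Immersivity is not part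
  of the locale; where it matters it appears as a nonzero Gram determinant of the tangent
  vectors.\<close>

locale immersion_in_chart = kaehler_chart +
  fixes k :: nat and W :: "(nat \<Rightarrow> real) set" and s :: "(nat \<Rightarrow> real) \<Rightarrow> nat \<Rightarrow> real"
  assumes N_k: "N = k + k" and W: "openin (Euclidean_space k) W"
    and s_smooth: "\<And>i. i < N \<Longrightarrow> smooth_on k W (\<lambda>y. s y i)"
    and s_U: "\<And>y. y \<in> W \<Longrightarrow> s y \<in> U"
begin

abbreviation T where "T \<equiv> tangent_vec s"

lemma T_Rn: "y \<in> W \<Longrightarrow> a < k \<Longrightarrow> T y a \<in> Rn N"
proof -
  assume y: "y \<in> W" and a: "a < k"
  have "T y a i = 0" if i: "N \<le> i" for i
  proof -
    have "pd a (\<lambda>y. s y i) y = pd a (\<lambda>y. 0) y"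
      by (rule pd_cong[OF W _ y a]) (use s_U U_Rn i in \<open>auto simp: Rn_iff\<close>)
    then show ?thesis by (simp add: tangent_vec_def pd_def)
  qed
  then show ?thesis by (simp add: Rn_iff)
qed

lemma pd_comp_s:
  assumes f: "smooth_on N U f" and x: "x \<in> W" and a: "a < k"
  shows "pd a (\<lambda>y. f (s y)) x = dd N f (s x) (T x a)"
  unfolding dd_def tangent_vec_def
  by (rule pd_eqI[OF pd_chain[OF f s_U[OF x] a x s_smooth W]]) (use s_U U_Rn in auto)

lemma smooth_comp_s: "smooth_on N U f \<Longrightarrow> smooth_on k W (\<lambda>y. f (s y))"
  by (rule smooth_on_compose[OF _ s_smooth s_U W])

lemma T_smooth: "a < k \<Longrightarrow> i < N \<Longrightarrow> smooth_on k W (\<lambda>y. T y a i)"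
  unfolding tangent_vec_def using smooth_on_pd[OF s_smooth] by simp

text \<open>V is orthogonal to the image along the whole immersion, so the product G(T b, V) may be
  differentiated in direction a; metric compatibility distributes the derivative over both
  factors.\<close>

lemma second_deriv_normal:
  assumes V: "field_on V" and n: "\<And>y b. y \<in> W \<Longrightarrow> b < k \<Longrightarrow> G (s y) (T y b) (V (s y)) = 0"
    and x: "x \<in> W" and ab: "a < k" "b < k"
  shows "G (s x) (second_deriv N g s x a b) (V (s x))
    = - G (s x) (T x b) (\<lambda>k. vd N V (s x) (T x a) k + Gam (s x) (T x a) (V (s x)) k)"
proof -
  note su = s_U[OF x]
  have VR: "V (s x) \<in> Rn N" using field_onD(2)[OF V su] .
  have 0: "dd k (\<lambda>y. G (s y) (T y b) (V (s y))) x (unit_vec a) = dd k (\<lambda>y. 0) x (unit_vec a)"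
    by (rule dd_cong[OF W _ x]) (rule n[OF _ ab(2)])
  have Vs: "smooth_on k W (\<lambda>y. V (s y) i)" if "i < N" for i
    by (rule smooth_comp_s[OF field_onD(1)[OF V that]])
  have "dd k (\<lambda>y. G (s y) (T y b) (V (s y))) x (unit_vec a)
     = bil N (\<lambda>i j. dd k (\<lambda>y. g (s y) i j) x (unit_vec a)) (T x b) (V (s x))
      + G (s x) (\<lambda>i. dd k (\<lambda>y. T y b i) x (unit_vec a)) (V (s x))
      + G (s x) (T x b) (\<lambda>i. dd k (\<lambda>y. V (s y) i) x (unit_vec a))"
    by (rule dd_bil[OF W smooth_comp_s[OF g_smooth] T_smooth[OF ab(2)] Vs x])
  also have "bil N (\<lambda>i j. dd k (\<lambda>y. g (s y) i j) x (unit_vec a)) (T x b) (V (s x))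
      = bil N (\<lambda>i j. dd N (\<lambda>y. g y i j) (s x) (T x a)) (T x b) (V (s x))"
    by (rule bil_cong) (auto simp: dd_unit[OF ab(1)] pd_comp_s[OF g_smooth x ab(1)])
  also have "\<dots> = G (s x) (Gam (s x) (T x a) (T x b)) (V (s x)) + G (s x) (T x b) (Gam (s x) (T x a) (V (s x)))"
    by (rule metric_compat[OF su T_Rn[OF x ab(2)] VR])
  also have "G (s x) (T x b) (\<lambda>i. dd k (\<lambda>y. V (s y) i) x (unit_vec a)) = G (s x) (T x b) (vd N V (s x) (T x a))"
    by (rule bil_cong) (auto simp: dd_unit[OF ab(1)] vd_def pd_comp_s[OF field_onD(1)[OF V] x ab(1)])
  also have "G (s x) (\<lambda>i. dd k (\<lambda>y. T y b i) x (unit_vec a)) (V (s x)) = G (s x) (\<lambda>i. pd a (pd b (\<lambda>y. s y i)) x) (V (s x))"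
    unfolding dd_unit[OF ab(1)] tangent_vec_def by simp
  finally have 1: "G (s x) (Gam (s x) (T x a) (T x b)) (V (s x)) + G (s x) (\<lambda>i. pd a (pd b (\<lambda>y. s y i)) x) (V (s x))
     = - (G (s x) (T x b) (Gam (s x) (T x a) (V (s x))) + G (s x) (T x b) (vd N V (s x) (T x a)))"
    using 0 by (simp add: dd_def pd_def)
  have "G (s x) (second_deriv N g s x a b) (V (s x)) = G (s x) (\<lambda>i. pd a (pd b (\<lambda>y. s y i)) x + Gam (s x) (T x a) (T x b) i) (V (s x))"
    by (rule bil_cong) (auto simp: second_deriv_def Gam_def bil_def)
  also have "\<dots> = - G (s x) (T x b) (\<lambda>k. vd N V (s x) (T x a) k + Gam (s x) (T x a) (V (s x)) k)"
    unfolding bil_add1 bil_add2 using 1 by simp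
  finally show ?thesis .
qed

text \<open>The mean curvature is a combination of normal parts, and subtracting the expansion by
  the inverse induced metric is the orthogonal projection off the tangent space.\<close>

lemma mean_curvature_tangential:
  assumes x: "x \<in> W" and nz: "dt k (\<lambda>a b. G (s x) (T x a) (T x b)) \<noteq> 0" and c: "c < k"
  shows "G (s x) (mean_curvature N k g s x) (T x c) = 0"
proof -
  let ?m = "\<lambda>a b. G (s x) (T x a) (T x b)"
  have im: "induced_metric N g s x = ?m" by (intro ext) (simp add: induced_metric_def)
  have n0: "G (s x) (normal_part N k g s x v) (T x c) = 0" for v
  proof -
    have "normal_part N k g s x v = (\<lambda>i. v i + - (\<Sum>b<k. (\<Sum>a<k. G (s x) v (T x a) * mat_inv k ?m a b) * T x b i))"
      unfolding normal_part_def im by (subst sum.swap) (simp add: sum_distrib_right sum_distrib_left mult_ac)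
    then have "G (s x) (normal_part N k g s x v) (T x c)
       = G (s x) v (T x c) - (\<Sum>b<k. (\<Sum>a<k. G (s x) v (T x a) * mat_inv k ?m a b) * ?m b c)"
      by (simp only: bil_add1 bil_minus1 bil_lin1)
    also have "(\<Sum>b<k. (\<Sum>a<k. G (s x) v (T x a) * mat_inv k ?m a b) * ?m b c)
      = (\<Sum>a<k. G (s x) v (T x a) * (\<Sum>b<k. mat_inv k ?m a b * ?m b c))" by (rule sum_mult_assoc)
    also have "\<dots> = (\<Sum>a<k. G (s x) v (T x a) * (if a = c then 1 else 0))"
      using mat_inv_mult(2)[OF nz _ c] by (intro sum.cong refl) simp
    also have "\<dots> = G (s x) v (T x c)" by (rule sum_delta_right[OF c])
    finally show ?thesis by simp
  qed
  have "mean_curvature N k g s x = (\<lambda>i. \<Sum>a<k. 1 * (\<Sum>b<k. mat_inv k ?m a b * normal_part N k g s x (second_deriv N g s x a b) i))"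
    by (intro ext) (simp add: mean_curvature_def second_fundamental_form_def im)
  then show ?thesis by (simp only: bil_lin1 n0) simp
qed

text \<open>A tangent frame and its image under \<open>J\<close> form a frame of the ambient space with block diagonal Gram
  matrix, so the trace of a \<open>J\<close>-invariant form over the tangent space is half its full trace; for
  \<open>\<nabla>JX\<close> the latter is the divergence.\<close>

lemma mean_curvature_normal:
  assumes X: "holomorphic_field X" and n: "\<And>y b. y \<in> W \<Longrightarrow> b < k \<Longrightarrow> G (s y) (T y b) (J (X (s y))) = 0"
    and x: "x \<in> W" and nz: "dt k (\<lambda>a b. G (s x) (T x a) (T x b)) \<noteq> 0"
    and iso: "\<And>a b. a < k \<Longrightarrow> b < k \<Longrightarrow> G (s x) (T x a) (J (T x b)) = 0"
  shows "2 * G (s x) (mean_curvature N k g s x) (J (X (s x))) = - dv (\<lambda>y. J (X y)) (s x)"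
proof -
  let ?m = "\<lambda>a b. G (s x) (T x a) (T x b)"
  define V where "V = (\<lambda>y. J (X y))"
  have fX: "field_on X" using X by (simp add: holomorphic_field_def)
  have V: "field_on V" unfolding V_def by (rule field_on_J[OF fX])
  note su = s_U[OF x]
  \<comment> \<open>The covariant derivative of V = JX in direction u; its trace is the
    divergence.\<close>
  define D where "D u = (\<lambda>k. vd N V (s x) u k + Gam (s x) u (V (s x)) k)" for u
  have DR: "D u \<in> Rn N" for u unfolding D_def by (intro Rn_add vd_Rn Gam_Rn)
  have VR: "V (s x) \<in> Rn N" using field_onD(2)[OF V su] .
  \<comment> \<open>Holomorphy of X handles the derivative and \<nabla>J = 0 the connection
    term.\<close>
  have DJ: "D (J u) = J (D u)" if u: "u \<in> Rn N" for u
  proof -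
    have "vd N V (s x) (J u) = J (vd N V (s x) u)"
      using X su u unfolding V_def vd_J_field[OF fX su] by (simp add: holomorphic_field_def)
    then show ?thesis unfolding D_def Gam_J'[OF su u VR] J_add by simp
  qed
  have Dlin: "D (\<lambda>k. \<Sum>m\<in>A. c m * u m k) = (\<lambda>k. \<Sum>m\<in>A. c m * D (u m) k)" for A :: "nat set" and c u
    unfolding D_def vd_lin Gam_lin1 by (simp add: sum.distrib distrib_left)
  define b where "b i j = G (s x) (D (unit_vec i)) (unit_vec j)" for i j
  have bb: "bil N b u v = G (s x) (D u) v" if "u \<in> Rn N" "v \<in> Rn N" for u v
  proof -
    have "G (s x) (D (\<lambda>k. \<Sum>i<N. u i * unit_vec i k)) (\<lambda>k. \<Sum>j<N. v j * unit_vec j k) = bil N b u v"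
      unfolding Dlin bil_lin1 unfolding bil_lin2 b_def bil_def[of N _ u v] by (simp add: sum_distrib_left mult_ac)
    then show ?thesis using Rn_expand that by simp
  qed
  have "bil N b (J u) (J v) = bil N b u v" if "u \<in> Rn N" "v \<in> Rn N" for u v
    using that by (simp add: bb JR DJ G_J[OF su DR])
  from isotropic_trace[OF su N_k T_Rn[OF x] nz iso this]
  have "2 * (\<Sum>a<k. \<Sum>c<k. mat_inv k ?m a c * bil N b (T x a) (T x c)) = (\<Sum>i<N. \<Sum>j<N. mi (s x) i j * b i j)" .
  also have "\<dots> = tr N D" unfolding b_def by (rule inverse_metric_trace[OF su])
  also have "\<dots> = dv V (s x)" unfolding dv_def th_tr by (simp add: tr_def D_def sum.distrib)
  finally have 1: "2 * (\<Sum>a<k. \<Sum>c<k. mat_inv k ?m a c * bil N b (T x a) (T x c)) = dv V (s x)" .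
  have im: "induced_metric N g s x = ?m" by (intro ext) (simp add: induced_metric_def)
  \<comment> \<open>The field V is normal to the immersion, so projection to the normal space does
    not affect pairings with it.\<close>
  have nV: "G (s x) (normal_part N k g s x v) (V (s x)) = G (s x) v (V (s x))" for v
  proof -
    have "normal_part N k g s x v = (\<lambda>i. v i + - (\<Sum>b<k. (\<Sum>a<k. G (s x) v (T x a) * mat_inv k ?m a b) * T x b i))"
      unfolding normal_part_def im by (subst sum.swap) (simp add: sum_distrib_right sum_distrib_left mult_ac)
    then have "G (s x) (normal_part N k g s x v) (V (s x))
       = G (s x) v (V (s x)) - (\<Sum>b<k. (\<Sum>a<k. G (s x) v (T x a) * mat_inv k ?m a b) * G (s x) (T x b) (V (s x)))"
      by (simp only: bil_add1 bil_minus1 bil_lin1)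
    then show ?thesis using n[OF x] by (simp add: V_def)
  qed
  have "mean_curvature N k g s x = (\<lambda>i. \<Sum>a<k. 1 * (\<Sum>b<k. mat_inv k ?m a b * normal_part N k g s x (second_deriv N g s x a b) i))"
    by (intro ext) (simp add: mean_curvature_def second_fundamental_form_def im)
  then have "G (s x) (mean_curvature N k g s x) (V (s x)) = (\<Sum>a<k. \<Sum>b<k. mat_inv k ?m a b * G (s x) (second_deriv N g s x a b) (V (s x)))"
    by (simp only: bil_lin1 nV) simp
  also have "\<dots> = (\<Sum>a<k. \<Sum>c<k. - (mat_inv k ?m a c * bil N b (T x a) (T x c)))"
  proof (intro sum.cong refl)
    fix a c assume "a \<in> {..<k}" "c \<in> {..<k}"
    then have ac: "a < k" "c < k" by auto
    have "G (s x) (second_deriv N g s x a c) (V (s x)) = - G (s x) (T x c) (D (T x a))"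
      unfolding D_def by (rule second_deriv_normal[OF V _ x ac]) (simp add: V_def n)
    also have "\<dots> = - bil N b (T x a) (T x c)"
      unfolding bb[OF T_Rn[OF x ac(1)] T_Rn[OF x ac(2)]] by (simp add: G_sym[OF su DR T_Rn[OF x ac(2)]])
    finally show "mat_inv k ?m a c * G (s x) (second_deriv N g s x a c) (V (s x)) = - (mat_inv k ?m a c * bil N b (T x a) (T x c))"
      by simp
  qed
  also have "\<dots> = - (\<Sum>a<k. \<Sum>c<k. mat_inv k ?m a c * bil N b (T x a) (T x c))" by (simp add: sum_negf)
  finally show ?thesis using 1 by (simp add: V_def)
qed

text \<open>The vectors T a and J (T a) form a frame of the ambient space. The pairings with T a
  vanish automatically, so those with J (T a) decide. The cut-off h is needed because entries of the
  mean curvature beyond N are not controlled.\<close>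

lemma mean_curvature_zeroI:
  assumes x: "x \<in> W" and nz: "dt k (\<lambda>a b. G (s x) (T x a) (T x b)) \<noteq> 0"
    and iso: "\<And>a b. a < k \<Longrightarrow> b < k \<Longrightarrow> G (s x) (T x a) (J (T x b)) = 0"
    and z: "\<And>a. a < k \<Longrightarrow> G (s x) (mean_curvature N k g s x) (J (T x a)) = 0" and i: "i < N"
  shows "mean_curvature N k g s x i = 0"
proof -
  define h where "h i = (if i < N then mean_curvature N k g s x i else 0)" for i
  have Gh: "G (s x) h v = G (s x) (mean_curvature N k g s x) v" for v
    by (rule bil_cong) (auto simp: h_def)
  have "h = (\<lambda>_. 0)"
  proof (rule frame_nondegenerate[OF s_U[OF x] isotropic_frame_nz[OF s_U[OF x] N_k T_Rn[OF x] nz iso]])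
    show "h \<in> Rn N" by (simp add: h_def Rn_iff)
    fix \<alpha> assume "\<alpha> < N"
    then show "G (s x) h (if \<alpha> < k then T x \<alpha> else J (T x (\<alpha> - k))) = 0"
      unfolding Gh using mean_curvature_tangential[OF x nz] z N_k by auto
  qed
  then show ?thesis using i by (simp add: h_def fun_eq_iff split: if_splits)
qed

end

section \<open>Charts, differentials and products\<close>

text \<open>The part of \<open>smooth_manifold\<close> used by the differential calculus: charts
  that cover. Products and open sets of coordinates inherit it directly, without a discussion of
  separation, countability or coordinate changes.\<close>

definition charted :: "'a mfd \<Rightarrow> bool" where
  "charted X \<longleftrightarrow> (\<forall>c\<in>atlas X. is_chart (mtop X) (mdim X) c) \<and> (\<Union>c\<in>atlas X. fst c) = topspace (mtop X)"

lemma smooth_manifold_charted: "smooth_manifold X \<Longrightarrow> charted X"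
  by (simp add: smooth_manifold_def charted_def)

lemma charted_cover:
  assumes "charted X" "p \<in> topspace (mtop X)"
  obtains c where "c \<in> atlas X" "p \<in> fst c"
  using assms unfolding charted_def by blast

context
  fixes X :: "'a mfd" and c :: "'a chart"
  assumes X: "charted X" and c: "c \<in> atlas X"
begin

lemma chart_props:
  shows chart_open: "openin (mtop X) (fst c)"
    and chart_image_open: "openin (Euclidean_space (mdim X)) (snd c ` fst c)"
    and chart_homeo: "homeomorphic_map (subtopology (mtop X) (fst c)) (subtopology (Euclidean_space (mdim X)) (snd c ` fst c)) (snd c)"
  using X c by (auto simp: charted_def is_chart_def)

lemma chart_topspace: "topspace (subtopology (mtop X) (fst c)) = fst c"
  using openin_subset[OF chart_open] by auto

lemma chart_mem: "p \<in> fst c \<Longrightarrow> p \<in> topspace (mtop X)"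
  using openin_subset[OF chart_open] by auto

lemma chart_inj: "inj_on (snd c) (fst c)"
  using homeomorphic_imp_injective_map[OF chart_homeo] unfolding chart_topspace .

lemma chart_Rn: "p \<in> fst c \<Longrightarrow> snd c p \<in> Rn (mdim X)"
  using openin_subset[OF chart_image_open] by blast

lemma chart_inv_left [simp]: "p \<in> fst c \<Longrightarrow> chart_inv c (snd c p) = p"
  unfolding chart_inv_def using chart_inj by (simp add: inv_into_f_f)

lemma chart_inv_right: "x \<in> snd c ` fst c \<Longrightarrow> snd c (chart_inv c x) = x"
  and chart_inv_in: "x \<in> snd c ` fst c \<Longrightarrow> chart_inv c x \<in> fst c"
  by auto

lemma chart_cont: "continuous_map (subtopology (mtop X) (fst c)) (Euclidean_space (mdim X)) (snd c)"
  using homeomorphic_imp_continuous_map[OF chart_homeo] continuous_map_in_subtopology by blast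

lemma chart_inv_cont: "continuous_map (subtopology (Euclidean_space (mdim X)) (snd c ` fst c)) (mtop X) (chart_inv c)"
proof -
  obtain g where g: "homeomorphic_maps (subtopology (mtop X) (fst c)) (subtopology (Euclidean_space (mdim X)) (snd c ` fst c)) (snd c) g"
    using chart_homeo homeomorphic_map_maps by blast
  have t: "topspace (subtopology (Euclidean_space (mdim X)) (snd c ` fst c)) = snd c ` fst c"
    using openin_subset[OF chart_image_open] by auto
  have "continuous_map (subtopology (Euclidean_space (mdim X)) (snd c ` fst c)) (mtop X) g"
    using g unfolding homeomorphic_maps_def by (metis continuous_map_in_subtopology)
  moreover have "g x = chart_inv c x" if "x \<in> topspace (subtopology (Euclidean_space (mdim X)) (snd c ` fst c))" for x
  proof -
    obtain p where p: "p \<in> fst c" "x = snd c p" using \<open>x \<in> topspace _\<close> unfolding t by blast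
    then have "g (snd c p) = p" using g chart_topspace unfolding homeomorphic_maps_def by blast
    then show ?thesis using p by simp
  qed
  ultimately show ?thesis by (rule continuous_map_eq)
qed

lemma chart_open_image:
  assumes "openin (mtop X) S" "S \<subseteq> fst c"
  shows "openin (Euclidean_space (mdim X)) (snd c ` S)"
proof -
  have "openin (subtopology (mtop X) (fst c)) S" using assms by (metis openin_subset_topspace_eq openin_open_subtopology chart_open)
  then have "openin (subtopology (Euclidean_space (mdim X)) (snd c ` fst c)) (snd c ` S)"
    using homeomorphic_map_openness_eq[OF chart_homeo] by blast
  then show ?thesis using chart_image_open openin_trans_full by blast
qed

lemma chart_inv_open_image:
  assumes "openin (Euclidean_space (mdim X)) S" "S \<subseteq> snd c ` fst c"
  shows "openin (mtop X) (chart_inv c ` S)"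
proof -
  have "openin (mtop X) {p \<in> topspace (subtopology (mtop X) (fst c)). snd c p \<in> S}"
    using openin_continuous_map_preimage[OF chart_cont assms(1)] chart_open openin_trans_full by blast
  moreover have "{p \<in> topspace (subtopology (mtop X) (fst c)). snd c p \<in> S} = chart_inv c ` S"
    unfolding chart_topspace
  proof (intro equalityI subsetI)
    fix p assume "p \<in> {p \<in> fst c. snd c p \<in> S}"
    then show "p \<in> chart_inv c ` S" by (intro image_eqI[of _ _ "snd c p"]) auto
  next
    fix p assume "p \<in> chart_inv c ` S"
    then show "p \<in> {p \<in> fst c. snd c p \<in> S}" using assms(2) by auto
  qed
  ultimately show ?thesis by simp
qed

lemma chart_pullback_open:
  assumes "continuous_map (mtop X) T F" "openin T S"
  shows "openin (Euclidean_space (mdim X)) (snd c ` (fst c \<inter> F -` S))"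
proof (rule chart_open_image)
  have "openin (mtop X) (fst c \<inter> {p \<in> topspace (mtop X). F p \<in> S})"
    by (rule openin_Int[OF chart_open openin_continuous_map_preimage[OF assms]])
  moreover have "fst c \<inter> {p \<in> topspace (mtop X). F p \<in> S} = fst c \<inter> F -` S" using chart_mem by auto
  ultimately show "openin (mtop X) (fst c \<inter> F -` S)" by simp
qed auto

end

lemma smooth_mapD:
  assumes "smooth_map X Y F"
  shows smooth_map_cont: "continuous_map (mtop X) (mtop Y) F"
    and smooth_map_rep: "c \<in> atlas X \<Longrightarrow> d \<in> atlas Y \<Longrightarrow> k < mdim Y \<Longrightarrow>
      smooth_on (mdim X) (snd c ` (fst c \<inter> F -` fst d)) (\<lambda>x. snd d (F (chart_inv c x)) k)"
  using assms by (auto simp: smooth_map_def)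

lemma rep_Rn:
  assumes "charted X" "charted Y" "c \<in> atlas X" "d \<in> atlas Y" "x \<in> snd c ` (fst c \<inter> F -` fst d)"
  shows "snd d (F (chart_inv c x)) \<in> Rn (mdim Y)"
proof -
  obtain p where "p \<in> fst c" "F p \<in> fst d" "x = snd c p" using assms(5) by auto
  then show ?thesis using chart_inv_left[OF assms(1,3)] chart_Rn[OF assms(2,4)] by simp
qed

lemma differential_Rn: "differential X Y F c d p v \<in> Rn (mdim Y)"
  by (simp add: differential_def Rn_iff)

lemma differential_alt:
  "differential X Y F c d p v = (\<lambda>k. if k < mdim Y then dd (mdim X) (\<lambda>x. snd d (F (chart_inv c x)) k) (snd c p) v else 0)"
  unfolding differential_def dd_def ..

lemma differential_lin:
  "differential X Y F c d p (\<lambda>k. \<Sum>m\<in>A. a m * u m k) = (\<lambda>k. \<Sum>m\<in>A. a m * differential X Y F c d p (u m) k)"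
  by (auto simp: differential_alt dd_lin)

lemma differential_add:
  "differential X Y F c d p (\<lambda>k. u k + v k) = (\<lambda>k. differential X Y F c d p u k + differential X Y F c d p v k)"
  by (auto simp: differential_alt dd_vadd)

lemma differential_minus:
  "differential X Y F c d p (\<lambda>k. - v k) = (\<lambda>k. - differential X Y F c d p v k)"
  by (auto simp: differential_alt dd_vminus)

lemma differential_zero: "differential X Y F c d p (\<lambda>k. 0) = (\<lambda>k. 0)"
  by (auto simp: differential_alt dd_def)

section \<open>Composition of maps between manifolds\<close>

context
  fixes X :: "'a mfd" and Y :: "'b mfd" and Z :: "'c mfd" and F G
  assumes X: "charted X" and Y: "charted Y" and Z: "charted Z"
    and F: "smooth_map X Y F" and G: "smooth_map Y Z G"
begin

text \<open>A chart d of the middle manifold need not contain the whole image, so the coordinate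
  formula for the composite is valid only on W; the charts d are then varied from point to
  point.\<close>

lemma comp_domain:
  assumes c: "c \<in> atlas X" and d: "d \<in> atlas Y" and e: "e \<in> atlas Z"
  defines "W \<equiv> snd c ` (fst c \<inter> F -` (fst d \<inter> G -` fst e))"
  shows "openin (Euclidean_space (mdim X)) W"
    and "\<And>x. x \<in> W \<Longrightarrow> snd d (F (chart_inv c x)) \<in> snd d ` (fst d \<inter> G -` fst e)"
    and "\<And>x. x \<in> W \<Longrightarrow> snd e (G (chart_inv d (snd d (F (chart_inv c x))))) = snd e (G (F (chart_inv c x)))"
    and "W \<subseteq> snd c ` (fst c \<inter> F -` fst d)"
    and "\<And>i. i < mdim Y \<Longrightarrow> smooth_on (mdim X) W (\<lambda>x. snd d (F (chart_inv c x)) i)"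
proof -
  have "openin (mtop Y) (fst d \<inter> {p \<in> topspace (mtop Y). G p \<in> fst e})"
    by (intro openin_Int chart_open[OF Y d] openin_continuous_map_preimage[OF smooth_map_cont[OF G]] chart_open[OF Z e])
  moreover have "fst d \<inter> {p \<in> topspace (mtop Y). G p \<in> fst e} = fst d \<inter> G -` fst e" using chart_mem[OF Y d] by auto
  ultimately have "openin (mtop Y) (fst d \<inter> G -` fst e)" by simp
  then show o: "openin (Euclidean_space (mdim X)) W"
    unfolding W_def by (rule chart_pullback_open[OF X c smooth_map_cont[OF F]])
  show s: "W \<subseteq> snd c ` (fst c \<inter> F -` fst d)" unfolding W_def by auto
  show "smooth_on (mdim X) W (\<lambda>x. snd d (F (chart_inv c x)) i)" if "i < mdim Y" for i
    by (rule smooth_on_subset[OF smooth_map_rep[OF F c d that] s o])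
  show "snd d (F (chart_inv c x)) \<in> snd d ` (fst d \<inter> G -` fst e)" if "x \<in> W" for x
    using that chart_inv_left[OF X c] by (auto simp: W_def)
  show "snd e (G (chart_inv d (snd d (F (chart_inv c x))))) = snd e (G (F (chart_inv c x)))" if "x \<in> W" for x
    using that chart_inv_left[OF X c] chart_inv_left[OF Y d] by (auto simp: W_def)
qed

lemma smooth_map_compose: "smooth_map X Z (\<lambda>p. G (F p))"
  unfolding smooth_map_def
proof (intro conjI ballI allI impI)
  show "continuous_map (mtop X) (mtop Z) (\<lambda>p. G (F p))"
    using continuous_map_compose[OF smooth_map_cont[OF F] smooth_map_cont[OF G]] by (simp add: o_def)
  fix c e k assume c: "c \<in> atlas X" and e: "e \<in> atlas Z" and k: "k < mdim Z"
  show "smooth_on (mdim X) (snd c ` (fst c \<inter> (\<lambda>p. G (F p)) -` fst e)) (\<lambda>x. snd e (G (F (chart_inv c x))) k)"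
  proof (rule smooth_on_local)
    fix x assume "x \<in> snd c ` (fst c \<inter> (\<lambda>p. G (F p)) -` fst e)"
    then obtain p where p: "p \<in> fst c" "G (F p) \<in> fst e" "x = snd c p" by auto
    have "F p \<in> topspace (mtop Y)"
      using smooth_map_cont[OF F] chart_mem[OF X c p(1)] by (auto simp: continuous_map_def)
    then obtain d where d: "d \<in> atlas Y" "F p \<in> fst d" using charted_cover[OF Y] by blast
    note D = comp_domain[OF c d(1) e]
    let ?W = "snd c ` (fst c \<inter> F -` (fst d \<inter> G -` fst e))"
    have "smooth_on (mdim X) ?W (\<lambda>x. snd e (G (chart_inv d (snd d (F (chart_inv c x))))) k)"
      by (rule smooth_on_compose[OF smooth_map_rep[OF G d(1) e k] D(5,2,1)])
    then have "smooth_on (mdim X) ?W (\<lambda>x. snd e (G (F (chart_inv c x))) k)"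
      by (rule smooth_on_cong) (simp add: D(3))
    moreover have "x \<in> ?W" using p d by auto
    ultimately show "\<exists>V. x \<in> V \<and> V \<subseteq> snd c ` (fst c \<inter> (\<lambda>p. G (F p)) -` fst e)
      \<and> smooth_on (mdim X) V (\<lambda>x. snd e (G (F (chart_inv c x))) k)"
      by (intro exI[of _ ?W]) auto
  qed
qed

lemma differential_compose:
  assumes c: "c \<in> atlas X" "p \<in> fst c" and d: "d \<in> atlas Y" "F p \<in> fst d" and e: "e \<in> atlas Z" "G (F p) \<in> fst e"
  shows "differential X Z (\<lambda>p. G (F p)) c e p v = differential Y Z G d e (F p) (differential X Y F c d p v)"
proof -
  note D = comp_domain[OF c(1) d(1) e(1)]
  let ?W = "snd c ` (fst c \<inter> F -` (fst d \<inter> G -` fst e))"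
  have x: "snd c p \<in> ?W" using c d e by auto
  have Fx: "snd d (F (chart_inv c (snd c p))) = snd d (F p)" using chart_inv_left[OF X c(1) c(2)] by simp
  have R: "snd d (F (chart_inv c x)) \<in> Rn (mdim Y)" if "x \<in> ?W" for x
    using rep_Rn[OF X Y c(1) d(1)] that D(4) by blast
  have "pd i (\<lambda>x. snd e (G (F (chart_inv c x))) k) (snd c p)
      = (\<Sum>j<mdim Y. pd j (\<lambda>y. snd e (G (chart_inv d y)) k) (snd d (F p)) * pd i (\<lambda>x. snd d (F (chart_inv c x)) j) (snd c p))"
    if k: "k < mdim Z" and i: "i < mdim X" for k i
  proof -
    have "pd i (\<lambda>x. snd e (G (F (chart_inv c x))) k) (snd c p)
        = pd i (\<lambda>x. snd e (G (chart_inv d (snd d (F (chart_inv c x))))) k) (snd c p)"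
      by (rule pd_cong[OF D(1) _ x i]) (simp add: D(3))
    also have "\<dots> = (\<Sum>j<mdim Y. pd j (\<lambda>y. snd e (G (chart_inv d y)) k) (snd d (F (chart_inv c (snd c p))))
         * pd i (\<lambda>x. snd d (F (chart_inv c x)) j) (snd c p))"
      by (rule pd_eqI[OF pd_chain[OF smooth_map_rep[OF G d(1) e(1) k] D(2)[OF x] i x D(5) D(1) R]])
    finally show ?thesis unfolding Fx .
  qed
  then have "(\<Sum>i<mdim X. pd i (\<lambda>x. snd e (G (F (chart_inv c x))) k) (snd c p) * v i)
      = (\<Sum>j<mdim Y. pd j (\<lambda>y. snd e (G (chart_inv d y)) k) (snd d (F p)) *
          (\<Sum>i<mdim X. pd i (\<lambda>x. snd d (F (chart_inv c x)) j) (snd c p) * v i))" if "k < mdim Z" for k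
    using that by (simp add: sum_mult_assoc[symmetric] mult.commute mult.left_commute sum_distrib_left sum_distrib_right)
      (subst sum.swap, simp)
  then show ?thesis by (auto simp: differential_def fun_eq_iff)
qed

lemma commutes_with_J_compose:
  assumes "commutes_with_J X Y F" "commutes_with_J Y Z G"
  shows "commutes_with_J X Z (\<lambda>p. G (F p))"
  unfolding commutes_with_J_def
proof (intro ballI)
  fix c e p v assume c: "c \<in> atlas X" and e: "e \<in> atlas Z" and p: "p \<in> fst c \<inter> (\<lambda>p. G (F p)) -` fst e" and v: "v \<in> Rn (mdim X)"
  have "F p \<in> topspace (mtop Y)"
    using smooth_map_cont[OF F] chart_mem[OF X c] p by (auto simp: continuous_map_def)
  then obtain d where d: "d \<in> atlas Y" "F p \<in> fst d" using charted_cover[OF Y] by blast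
  have *: "differential X Z (\<lambda>p. G (F p)) c e p v = differential Y Z G d e (F p) (differential X Y F c d p v)" for v
    by (rule differential_compose) (use c d e p in auto)
  have "differential X Y F c d p (J v) = J (differential X Y F c d p v)"
    using assms(1) c d p v unfolding commutes_with_J_def by blast
  moreover have "differential Y Z G d e (F p) (J (differential X Y F c d p v)) = J (differential Y Z G d e (F p) (differential X Y F c d p v))"
  proof -
    have "\<forall>p\<in>fst d \<inter> G -` fst e. \<forall>v\<in>Rn (mdim Y). differential Y Z G d e p (J v) = J (differential Y Z G d e p v)"
      using assms(2) d(1) e unfolding commutes_with_J_def by simp
    moreover have "F p \<in> fst d \<inter> G -` fst e" using d(2) p by simp
    ultimately show ?thesis using differential_Rn[of X Y F c d p v] by simp
  qed
  ultimately show "differential X Z (\<lambda>p. G (F p)) c e p (J v) = J (differential X Z (\<lambda>p. G (F p)) c e p v)"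
    unfolding * by simp
qed

end

lemma holomorphic_map_compose:
  assumes "charted X" "charted Y" "charted Z" "holomorphic_map X Y F" "holomorphic_map Y Z G"
  shows "holomorphic_map X Z (\<lambda>p. G (F p))"
  using smooth_map_compose[OF assms(1-3)] commutes_with_J_compose[OF assms(1-3)] assms(4,5) by (auto simp: holomorphic_map_def)

lemma smooth_map_id: "smooth_manifold X \<Longrightarrow> smooth_map X X (\<lambda>p. p)"
  by (auto simp: smooth_map_def smooth_manifold_def vimage_def)

lemma holomorphic_map_id: "complex_manifold X \<Longrightarrow> holomorphic_map X X (\<lambda>p. p)"
  by (auto simp: holomorphic_map_def complex_manifold_def smooth_map_id)

section \<open>Product coordinates and product charts\<close>

definition cat :: "nat \<Rightarrow> (nat \<Rightarrow> real) \<Rightarrow> (nat \<Rightarrow> real) \<Rightarrow> nat \<Rightarrow> real" where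
  "cat m x y = (\<lambda>i. if i < m then x i else y (i - m))"

definition lft :: "nat \<Rightarrow> (nat \<Rightarrow> real) \<Rightarrow> nat \<Rightarrow> real" where
  "lft m z = (\<lambda>i. if i < m then z i else 0)"

definition rgt :: "nat \<Rightarrow> (nat \<Rightarrow> real) \<Rightarrow> nat \<Rightarrow> real" where
  "rgt m z = (\<lambda>i. z (m + i))"

lemma lft_cat: "x \<in> Rn m \<Longrightarrow> lft m (cat m x y) = x"
  by (force simp: lft_def cat_def Rn_iff fun_eq_iff)

lemma rgt_cat: "rgt m (cat m x y) = y"
  by (simp add: rgt_def cat_def)

lemma cat_lft_rgt: "cat m (lft m z) (rgt m z) = z"
  by (auto simp: lft_def rgt_def cat_def fun_eq_iff)

lemma cat_Rn: "y \<in> Rn n \<Longrightarrow> cat m x y \<in> Rn (m + n)"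
  by (auto simp: cat_def Rn_iff)

lemma lft_Rn: "lft m z \<in> Rn m"
  by (simp add: lft_def Rn_iff)

lemma rgt_Rn: "z \<in> Rn (m + n) \<Longrightarrow> rgt m z \<in> Rn n"
  by (simp add: rgt_def Rn_iff)

text \<open>For even m the index pairs on which J acts do not straddle the cut between the two
  factors.\<close>

lemma J_cat: "even m \<Longrightarrow> J (cat m u v) = cat m (J u) (J v)"
proof
  fix k assume m: "even m"
  show "J (cat m u v) k = cat m (J u) (J v) k"
  proof (cases "k < m")
    case True
    then have "k + 1 < m" if "even k" using m that by (metis Suc_eq_plus1 Suc_lessI even_Suc)
    then show ?thesis using True by (auto simp: J_def cat_def)
  next
    case False
    then have "k - 1 - m = k - m - 1" "k + 1 - m = k - m + 1" by auto
    moreover have "\<not> k - 1 < m" if "odd k" using that False m by (cases "k = m") auto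
    moreover have "even (k - m) = even k" using False m by (simp add: even_diff_nat)
    ultimately show ?thesis using False by (auto simp: J_def cat_def)
  qed
qed

lemma lft_cont: "continuous_map (Euclidean_space (m + n)) (Euclidean_space m) (lft m)"
  unfolding lft_def[abs_def] continuous_map_componentwise_Euclidean_space by (simp add: continuous_map_coord)

lemma rgt_cont: "continuous_map (Euclidean_space (m + n)) (Euclidean_space n) (rgt m)"
proof -
  have "continuous_map (Euclidean_space (m + n)) (Euclidean_space n) (\<lambda>z i. if i < n then z (m + i) else 0)"
    unfolding continuous_map_componentwise_Euclidean_space by (simp add: continuous_map_coord)
  then show ?thesis by (rule continuous_map_eq) (auto simp: rgt_def Rn_iff fun_eq_iff)
qed

lemma snd_prod_chart: "snd (prod_chart m c d) (p, q) = cat m (snd c p) (snd d q)"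
  by (simp add: prod_chart_def cat_def)

lemma fst_prod_chart: "fst (prod_chart m c d) = fst c \<times> fst d"
  by (simp add: prod_chart_def)

lemma prod_mfd_simps [simp]:
  "mtop (prod_mfd X Y) = prod_topology (mtop X) (mtop Y)" "mdim (prod_mfd X Y) = mdim X + mdim Y"
  by (simp_all add: prod_mfd_def)

lemma atlas_prod: "P \<in> atlas (prod_mfd X Y) \<longleftrightarrow> (\<exists>c\<in>atlas X. \<exists>d\<in>atlas Y. P = prod_chart (mdim X) c d)"
  by (auto simp: prod_mfd_def)

context
  fixes X :: "'a mfd" and Y :: "'b mfd"
  assumes X: "charted X" and Y: "charted Y"
begin

context
  fixes c d
  assumes c: "c \<in> atlas X" and d: "d \<in> atlas Y"
begin

lemma prod_chart_image:
  assumes "A \<subseteq> fst c" "B \<subseteq> fst d"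
  shows "snd (prod_chart (mdim X) c d) ` (A \<times> B) = {z \<in> Rn ((mdim X) + (mdim Y)). lft (mdim X) z \<in> snd c ` A \<and> rgt (mdim X) z \<in> snd d ` B}"
proof (intro equalityI subsetI)
  fix z assume "z \<in> snd (prod_chart (mdim X) c d) ` (A \<times> B)"
  then obtain p q where pq: "p \<in> A" "q \<in> B" "z = cat (mdim X) (snd c p) (snd d q)" by (auto simp: snd_prod_chart)
  have "snd c p \<in> Rn (mdim X)" "snd d q \<in> Rn (mdim Y)" using chart_Rn[OF X c] chart_Rn[OF Y d] pq assms by blast+
  then show "z \<in> {z \<in> Rn ((mdim X) + (mdim Y)). lft (mdim X) z \<in> snd c ` A \<and> rgt (mdim X) z \<in> snd d ` B}"
    using pq by (simp add: lft_cat rgt_cat cat_Rn)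
next
  fix z assume "z \<in> {z \<in> Rn ((mdim X) + (mdim Y)). lft (mdim X) z \<in> snd c ` A \<and> rgt (mdim X) z \<in> snd d ` B}"
  then obtain p q where pq: "p \<in> A" "q \<in> B" "lft (mdim X) z = snd c p" "rgt (mdim X) z = snd d q" by auto
  have "z = snd (prod_chart (mdim X) c d) (p, q)" unfolding snd_prod_chart pq(3,4)[symmetric] cat_lft_rgt ..
  then show "z \<in> snd (prod_chart (mdim X) c d) ` (A \<times> B)" using pq by blast
qed

lemma is_chart_prod: "is_chart (prod_topology (mtop X) (mtop Y)) ((mdim X) + (mdim Y)) (prod_chart (mdim X) c d)"
proof -
  let ?E = "Euclidean_space ((mdim X) + (mdim Y))"
  let ?I = "snd (prod_chart (mdim X) c d) ` (fst c \<times> fst d)"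
  let ?g = "\<lambda>z. (chart_inv c (lft (mdim X) z), chart_inv d (rgt (mdim X) z))"
  have I: "?I = {z \<in> Rn ((mdim X) + (mdim Y)). lft (mdim X) z \<in> snd c ` fst c \<and> rgt (mdim X) z \<in> snd d ` fst d}"
    by (rule prod_chart_image) auto
  have o: "openin (prod_topology (mtop X) (mtop Y)) (fst c \<times> fst d)"
    by (intro openin_prod_Times_iff[THEN iffD2] disjI2 conjI chart_open[OF X c] chart_open[OF Y d])
  have "openin ?E ({z \<in> topspace ?E. lft (mdim X) z \<in> snd c ` fst c} \<inter> {z \<in> topspace ?E. rgt (mdim X) z \<in> snd d ` fst d})"
    by (intro openin_Int openin_continuous_map_preimage[OF lft_cont] openin_continuous_map_preimage[OF rgt_cont]
        chart_image_open[OF X c] chart_image_open[OF Y d])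
  then have oI: "openin ?E ?I" unfolding I by (simp add: Int_def conj_ac cong: conj_cong)
  have top1: "topspace (subtopology (prod_topology (mtop X) (mtop Y)) (fst c \<times> fst d)) = fst c \<times> fst d"
    using openin_subset[OF o] by auto
  have top2: "topspace (subtopology ?E ?I) = ?I" using openin_subset[OF oI] by auto
  have T: "subtopology (prod_topology (mtop X) (mtop Y)) (fst c \<times> fst d) = prod_topology (subtopology (mtop X) (fst c)) (subtopology (mtop Y) (fst d))"
    by (rule subtopology_Times)
  have cc: "continuous_map (subtopology (mtop X) (fst c)) euclideanreal (\<lambda>p. snd c p i)" for i
    using continuous_map_compose[OF chart_cont[OF X c] continuous_map_coord] by (simp add: o_def)
  have cd: "continuous_map (subtopology (mtop Y) (fst d)) euclideanreal (\<lambda>p. snd d p i)" for i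
    using continuous_map_compose[OF chart_cont[OF Y d] continuous_map_coord] by (simp add: o_def)
  have "continuous_map (subtopology (prod_topology (mtop X) (mtop Y)) (fst c \<times> fst d)) euclideanreal (\<lambda>z. snd (prod_chart (mdim X) c d) z i)" for i
  proof (cases "i < (mdim X)")
    case True
    have "continuous_map (subtopology (prod_topology (mtop X) (mtop Y)) (fst c \<times> fst d)) euclideanreal ((\<lambda>p. snd c p i) \<circ> fst)"
      unfolding T by (rule continuous_map_compose[OF continuous_map_fst cc])
    then show ?thesis by (rule continuous_map_eq) (use True in \<open>auto simp: snd_prod_chart cat_def\<close>)
  next
    case False
    have "continuous_map (subtopology (prod_topology (mtop X) (mtop Y)) (fst c \<times> fst d)) euclideanreal ((\<lambda>p. snd d p (i - (mdim X))) \<circ> snd)"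
      unfolding T by (rule continuous_map_compose[OF continuous_map_snd cd])
    then show ?thesis by (rule continuous_map_eq) (use False in \<open>auto simp: snd_prod_chart cat_def\<close>)
  qed
  then have "continuous_map (subtopology (prod_topology (mtop X) (mtop Y)) (fst c \<times> fst d)) ?E (\<lambda>z i. if i < (mdim X) + (mdim Y) then snd (prod_chart (mdim X) c d) z i else 0)"
    unfolding continuous_map_componentwise_Euclidean_space by blast
  then have "continuous_map (subtopology (prod_topology (mtop X) (mtop Y)) (fst c \<times> fst d)) ?E (snd (prod_chart (mdim X) c d))"
  proof (rule continuous_map_eq)
    fix z assume "z \<in> topspace (subtopology (prod_topology (mtop X) (mtop Y)) (fst c \<times> fst d))"
    then have "z \<in> fst c \<times> fst d" unfolding top1 .
    then have "snd (prod_chart (mdim X) c d) z \<in> Rn ((mdim X) + (mdim Y))" using I by blast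
    then show "(\<lambda>i. if i < (mdim X) + (mdim Y) then snd (prod_chart (mdim X) c d) z i else 0) = snd (prod_chart (mdim X) c d) z" by (auto simp: Rn_iff fun_eq_iff)
  qed
  then have 1: "continuous_map (subtopology (prod_topology (mtop X) (mtop Y)) (fst c \<times> fst d)) (subtopology ?E ?I) (snd (prod_chart (mdim X) c d))"
    unfolding continuous_map_in_subtopology top1 by blast
  have l: "continuous_map (subtopology ?E ?I) (subtopology (Euclidean_space (mdim X)) (snd c ` fst c)) (lft (mdim X))"
    unfolding continuous_map_in_subtopology top2 using I by (auto intro: continuous_map_from_subtopology[OF lft_cont])
  have r: "continuous_map (subtopology ?E ?I) (subtopology (Euclidean_space (mdim Y)) (snd d ` fst d)) (rgt (mdim X))"
    unfolding continuous_map_in_subtopology top2 using I by (auto intro: continuous_map_from_subtopology[OF rgt_cont])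
  have "continuous_map (subtopology ?E ?I) (prod_topology (mtop X) (mtop Y)) ?g"
    using continuous_map_compose[OF l chart_inv_cont[OF X c]] continuous_map_compose[OF r chart_inv_cont[OF Y d]]
    by (intro continuous_map_pairedI) (simp_all add: o_def)
  then have 2: "continuous_map (subtopology ?E ?I) (subtopology (prod_topology (mtop X) (mtop Y)) (fst c \<times> fst d)) ?g"
    unfolding continuous_map_in_subtopology top2 using I chart_inv_in[OF X c] chart_inv_in[OF Y d] by auto
  have "homeomorphic_maps (subtopology (prod_topology (mtop X) (mtop Y)) (fst c \<times> fst d)) (subtopology ?E ?I) (snd (prod_chart (mdim X) c d)) ?g"
    unfolding homeomorphic_maps_def top1 top2
  proof (intro conjI 1 2 ballI)
    fix z assume "z \<in> fst c \<times> fst d"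
    then show "?g (snd (prod_chart (mdim X) c d) z) = z"
      using chart_Rn[OF X c] by (auto simp: snd_prod_chart lft_cat rgt_cat chart_inv_left[OF X c] chart_inv_left[OF Y d])
  next
    fix z assume "z \<in> ?I"
    then have "lft (mdim X) z \<in> snd c ` fst c" "rgt (mdim X) z \<in> snd d ` fst d" using I by auto
    then show "snd (prod_chart (mdim X) c d) (?g z) = z"
      by (simp add: snd_prod_chart chart_inv_right[OF X c] chart_inv_right[OF Y d] cat_lft_rgt)
  qed
  then show ?thesis unfolding is_chart_def fst_prod_chart using o oI homeomorphic_maps_imp_map by blast
qed

end

lemma charted_prod: "charted (prod_mfd X Y)"
  unfolding charted_def
proof
  show "\<forall>c\<in>atlas (prod_mfd X Y). is_chart (mtop (prod_mfd X Y)) (mdim (prod_mfd X Y)) c"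
    by (auto simp: atlas_prod is_chart_prod)
  have "(\<Union>c\<in>atlas (prod_mfd X Y). fst c) = (\<Union>c\<in>atlas X. fst c) \<times> (\<Union>c\<in>atlas Y. fst c)"
  proof (intro equalityI subsetI)
    fix z assume "z \<in> (\<Union>c\<in>atlas (prod_mfd X Y). fst c)"
    then obtain Q where "Q \<in> atlas (prod_mfd X Y)" "z \<in> fst Q" by blast
    then obtain c d where "c \<in> atlas X" "d \<in> atlas Y" "z \<in> fst (prod_chart (mdim X) c d)"
      using atlas_prod[of Q X Y] by blast
    then show "z \<in> (\<Union>c\<in>atlas X. fst c) \<times> (\<Union>c\<in>atlas Y. fst c)" unfolding fst_prod_chart by blast
  next
    fix z assume "z \<in> (\<Union>c\<in>atlas X. fst c) \<times> (\<Union>c\<in>atlas Y. fst c)"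
    then obtain c d where "c \<in> atlas X" "d \<in> atlas Y" "z \<in> fst (prod_chart (mdim X) c d)" by (auto simp: fst_prod_chart)
    then show "z \<in> (\<Union>c\<in>atlas (prod_mfd X Y). fst c)" using atlas_prod by blast
  qed
  then show "(\<Union>c\<in>atlas (prod_mfd X Y). fst c) = topspace (mtop (prod_mfd X Y))"
    using X Y by (simp add: charted_def)
qed

lemma chart_inv_prod:
  assumes "c \<in> atlas X" "d \<in> atlas Y" "z \<in> Rn (mdim X + mdim Y)" "lft (mdim X) z \<in> snd c ` fst c" "rgt (mdim X) z \<in> snd d ` fst d"
  shows "chart_inv (prod_chart (mdim X) c d) z = (chart_inv c (lft (mdim X) z), chart_inv d (rgt (mdim X) z))"
proof -
  let ?P = "prod_chart (mdim X) c d"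
  let ?q = "(chart_inv c (lft (mdim X) z), chart_inv d (rgt (mdim X) z))"
  have q: "?q \<in> fst ?P" using assms by (auto simp: fst_prod_chart chart_inv_in[OF X] chart_inv_in[OF Y])
  have "snd ?P ?q = z"
    using assms by (simp add: snd_prod_chart chart_inv_right[OF X] chart_inv_right[OF Y] cat_lft_rgt)
  then show ?thesis using chart_inv_left[OF charted_prod _ q] assms(1,2) atlas_prod by metis
qed

lemma chart_inv_prod_cat:
  assumes "c \<in> atlas X" "d \<in> atlas Y" "x \<in> snd c ` fst c" "y \<in> snd d ` fst d"
  shows "chart_inv (prod_chart (mdim X) c d) (cat (mdim X) x y) = (chart_inv c x, chart_inv d y)"
proof -
  have "x \<in> Rn (mdim X)" "y \<in> Rn (mdim Y)" using assms chart_Rn[OF X assms(1)] chart_Rn[OF Y assms(2)] by blast+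
  then show ?thesis using chart_inv_prod[OF assms(1,2), of "cat (mdim X) x y"] assms by (simp add: lft_cat rgt_cat cat_Rn)
qed

end

lemma smooth_map_const:
  assumes X: "charted X" and Y: "charted Y" and p: "p \<in> topspace (mtop Y)"
  shows "smooth_map X Y (\<lambda>_. p)"
proof -
  have c: "continuous_map (mtop X) (mtop Y) (\<lambda>_. p)" using p by simp
  then show ?thesis unfolding smooth_map_def
    by (intro conjI ballI allI impI smooth_on_const chart_pullback_open[OF X _ c] chart_open[OF Y])
qed

lemma differential_const: "differential X Y (\<lambda>_. p) c d q v = (\<lambda>k. 0)"
  by (auto simp: differential_def pd_def)

lemma smooth_map_pair:
  assumes X: "charted X" and Y: "charted Y" and Z: "charted Z"
    and F: "smooth_map Z X F" and G: "smooth_map Z Y G"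
  shows "smooth_map Z (prod_mfd X Y) (\<lambda>z. (F z, G z))"
  unfolding smooth_map_def
proof (intro conjI ballI allI impI)
  show C: "continuous_map (mtop Z) (mtop (prod_mfd X Y)) (\<lambda>z. (F z, G z))"
    using smooth_map_cont[OF F] smooth_map_cont[OF G] by (simp add: continuous_map_pairedI)
  fix c P k assume c: "c \<in> atlas Z" and P: "P \<in> atlas (prod_mfd X Y)" and k: "k < mdim (prod_mfd X Y)"
  obtain a b where ab: "a \<in> atlas X" "b \<in> atlas Y" "P = prod_chart (mdim X) a b" using P atlas_prod by blast
  let ?W = "snd c ` (fst c \<inter> (\<lambda>z. (F z, G z)) -` fst P)"
  have o: "openin (Euclidean_space (mdim Z)) ?W"
    by (rule chart_pullback_open[OF Z c C chart_open[OF charted_prod[OF X Y] P]])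
  show "smooth_on (mdim Z) ?W (\<lambda>x. snd P (F (chart_inv c x), G (chart_inv c x)) k)"
  proof (cases "k < mdim X")
    case True
    have "smooth_on (mdim Z) ?W (\<lambda>x. snd a (F (chart_inv c x)) k)"
      by (rule smooth_on_subset[OF smooth_map_rep[OF F c ab(1) True] _ o]) (auto simp: ab(3) fst_prod_chart)
    then show ?thesis using True by (simp add: ab(3) snd_prod_chart cat_def)
  next
    case False
    then have k': "k - mdim X < mdim Y" using k by auto
    have "smooth_on (mdim Z) ?W (\<lambda>x. snd b (G (chart_inv c x)) (k - mdim X))"
      by (rule smooth_on_subset[OF smooth_map_rep[OF G c ab(2) k'] _ o]) (auto simp: ab(3) fst_prod_chart)
    then show ?thesis using False by (simp add: ab(3) snd_prod_chart cat_def)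
  qed
qed

lemma differential_pair:
  "differential Z (prod_mfd X Y) (\<lambda>z. (F z, G z)) c (prod_chart (mdim X) a b) p v
     = cat (mdim X) (differential Z X F c a p v) (differential Z Y G c b p v)"
  by (rule ext) (auto simp: differential_def snd_prod_chart cat_def)

lemma commutes_with_J_pair:
  assumes "even (mdim X)" "commutes_with_J Z X F" "commutes_with_J Z Y G"
  shows "commutes_with_J Z (prod_mfd X Y) (\<lambda>z. (F z, G z))"
  unfolding commutes_with_J_def
proof (intro ballI)
  fix c P p v assume c: "c \<in> atlas Z" and P: "P \<in> atlas (prod_mfd X Y)" and p: "p \<in> fst c \<inter> (\<lambda>z. (F z, G z)) -` fst P" and v: "v \<in> Rn (mdim Z)"
  obtain a b where ab: "a \<in> atlas X" "b \<in> atlas Y" "P = prod_chart (mdim X) a b" using P atlas_prod by blast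
  have pp: "p \<in> fst c \<inter> F -` fst a" "p \<in> fst c \<inter> G -` fst b" using p by (auto simp: ab fst_prod_chart)
  have "differential Z X F c a p (J v) = J (differential Z X F c a p v)"
    using assms(2) c ab(1) pp(1) v by (simp add: commutes_with_J_def)
  moreover have "differential Z Y G c b p (J v) = J (differential Z Y G c b p v)"
    using assms(3) c ab(2) pp(2) v by (simp add: commutes_with_J_def)
  ultimately show "differential Z (prod_mfd X Y) (\<lambda>z. (F z, G z)) c P p (J v) = J (differential Z (prod_mfd X Y) (\<lambda>z. (F z, G z)) c P p v)"
    by (simp add: ab differential_pair J_cat[OF assms(1)])
qed

lemma commutes_with_J_const: "commutes_with_J Z X (\<lambda>_. p)"
  by (simp add: commutes_with_J_def differential_const J_zero)

lemma smooth_map_fst: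
  assumes X: "smooth_manifold X" and Y: "charted Y"
  shows "smooth_map (prod_mfd X Y) X fst"
  unfolding smooth_map_def
proof (intro conjI ballI allI impI)
  have cX: "charted X" using X by (rule smooth_manifold_charted)
  show C: "continuous_map (mtop (prod_mfd X Y)) (mtop X) fst" by (simp add: continuous_map_fst)
  fix P c' k assume P: "P \<in> atlas (prod_mfd X Y)" and c': "c' \<in> atlas X" and k: "k < mdim X"
  obtain a b where ab: "a \<in> atlas X" "b \<in> atlas Y" "P = prod_chart (mdim X) a b" using P atlas_prod by blast
  let ?W = "snd P ` (fst P \<inter> fst -` fst c')"
  have o: "openin (Euclidean_space (mdim (prod_mfd X Y))) ?W"
    by (rule chart_pullback_open[OF charted_prod[OF cX Y] P C chart_open[OF cX c']])
  have W: "?W = {z \<in> Rn (mdim X + mdim Y). lft (mdim X) z \<in> snd a ` (fst a \<inter> fst c') \<and> rgt (mdim X) z \<in> snd b ` fst b}"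
  proof -
    have "fst P \<inter> fst -` fst c' = (fst a \<inter> fst c') \<times> fst b" by (auto simp: ab fst_prod_chart)
    then show ?thesis unfolding ab(3) using prod_chart_image[OF cX Y ab(1,2), of "fst a \<inter> fst c'" "fst b"] by simp
  qed
  have "smooth_on (mdim X + mdim Y) ?W (\<lambda>z. snd c' (chart_inv a (lft (mdim X) z)) k)"
  proof (rule smooth_on_compose[where f = "\<lambda>x. snd c' (chart_inv a x) k" and \<Phi> = "lft (mdim X)"])
    show "smooth_on (mdim X) (snd a ` (fst a \<inter> fst c')) (\<lambda>x. snd c' (chart_inv a x) k)"
      using X ab(1) c' k by (simp add: smooth_manifold_def)
    show "smooth_on (mdim X + mdim Y) ?W (\<lambda>x. lft (mdim X) x i)" if "i < mdim X" for i
      using smooth_on_coord[of "mdim X + mdim Y" ?W i] o that by (simp add: lft_def)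
  qed (use W o in auto)
  then show "smooth_on (mdim (prod_mfd X Y)) ?W (\<lambda>x. snd c' (fst (chart_inv P x)) k)"
    unfolding prod_mfd_simps
  proof (rule smooth_on_cong)
    fix z assume "z \<in> ?W"
    then have "z \<in> Rn (mdim X + mdim Y)" "lft (mdim X) z \<in> snd a ` fst a" "rgt (mdim X) z \<in> snd b ` fst b" unfolding W by auto
    then show "snd c' (chart_inv a (lft (mdim X) z)) k = snd c' (fst (chart_inv P z)) k"
      unfolding ab(3) using chart_inv_prod[OF cX Y ab(1,2)] by simp
  qed
qed

lemma smooth_map_snd:
  assumes X: "charted X" and Y: "smooth_manifold Y"
  shows "smooth_map (prod_mfd X Y) Y snd"
  unfolding smooth_map_def
proof (intro conjI ballI allI impI)
  have cY: "charted Y" using Y by (rule smooth_manifold_charted)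
  show C: "continuous_map (mtop (prod_mfd X Y)) (mtop Y) snd" by (simp add: continuous_map_snd)
  fix P c' k assume P: "P \<in> atlas (prod_mfd X Y)" and c': "c' \<in> atlas Y" and k: "k < mdim Y"
  obtain a b where ab: "a \<in> atlas X" "b \<in> atlas Y" "P = prod_chart (mdim X) a b" using P atlas_prod by blast
  let ?W = "snd P ` (fst P \<inter> snd -` fst c')"
  have o: "openin (Euclidean_space (mdim (prod_mfd X Y))) ?W"
    by (rule chart_pullback_open[OF charted_prod[OF X cY] P C chart_open[OF cY c']])
  have W: "?W = {z \<in> Rn (mdim X + mdim Y). lft (mdim X) z \<in> snd a ` fst a \<and> rgt (mdim X) z \<in> snd b ` (fst b \<inter> fst c')}"
  proof -
    have "fst P \<inter> snd -` fst c' = fst a \<times> (fst b \<inter> fst c')" by (auto simp: ab fst_prod_chart)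
    then show ?thesis unfolding ab(3) using prod_chart_image[OF X cY ab(1,2), of "fst a" "fst b \<inter> fst c'"] by simp
  qed
  have "smooth_on (mdim X + mdim Y) ?W (\<lambda>z. snd c' (chart_inv b (rgt (mdim X) z)) k)"
  proof (rule smooth_on_compose[where f = "\<lambda>x. snd c' (chart_inv b x) k" and \<Phi> = "rgt (mdim X)"])
    show "smooth_on (mdim Y) (snd b ` (fst b \<inter> fst c')) (\<lambda>x. snd c' (chart_inv b x) k)"
      using Y ab(2) c' k by (simp add: smooth_manifold_def)
    show "smooth_on (mdim X + mdim Y) ?W (\<lambda>x. rgt (mdim X) x i)" if "i < mdim Y" for i
      using smooth_on_coord[of "mdim X + mdim Y" ?W "mdim X + i"] o that by (simp add: rgt_def)
  qed (use W o in auto)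
  then show "smooth_on (mdim (prod_mfd X Y)) ?W (\<lambda>x. snd c' (snd (chart_inv P x)) k)"
    unfolding prod_mfd_simps
  proof (rule smooth_on_cong)
    fix z assume "z \<in> ?W"
    then have "z \<in> Rn (mdim X + mdim Y)" "lft (mdim X) z \<in> snd a ` fst a" "rgt (mdim X) z \<in> snd b ` fst b" unfolding W by auto
    then show "snd c' (chart_inv b (rgt (mdim X) z)) k = snd c' (snd (chart_inv P z)) k"
      unfolding ab(3) using chart_inv_prod[OF X cY ab(1,2)] by simp
  qed
qed

section \<open>Fundamental vector fields\<close>

lemma smooth_continuous_map:
  assumes W: "openin (Euclidean_space n) W" and s: "\<And>i. i < k \<Longrightarrow> smooth_on n W (\<lambda>x. \<Phi> x i)"
    and R: "\<And>x. x \<in> W \<Longrightarrow> \<Phi> x \<in> Rn k"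
  shows "continuous_map (subtopology (Euclidean_space n) W) (Euclidean_space k) \<Phi>"
proof -
  have "continuous_map (subtopology (Euclidean_space n) W) (Euclidean_space k) (\<lambda>x i. if i < k then \<Phi> x i else 0)"
    unfolding continuous_map_componentwise_Euclidean_space using s smooth_on_cont by blast
  then show ?thesis by (rule continuous_map_eq) (use R in \<open>force simp: Rn_iff fun_eq_iff\<close>)
qed

lemma smooth_preimage_open:
  assumes W: "openin (Euclidean_space n) W" and s: "\<And>i. i < k \<Longrightarrow> smooth_on n W (\<lambda>x. \<Phi> x i)"
    and R: "\<And>x. x \<in> W \<Longrightarrow> \<Phi> x \<in> Rn k" and V: "openin (Euclidean_space k) V"
  shows "openin (Euclidean_space n) {x \<in> W. \<Phi> x \<in> V}"
proof -
  have "openin (subtopology (Euclidean_space n) W) {x \<in> topspace (subtopology (Euclidean_space n) W). \<Phi> x \<in> V}"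
    by (rule openin_continuous_map_preimage[OF smooth_continuous_map[OF W s R] V])
  moreover have "{x \<in> topspace (subtopology (Euclidean_space n) W). \<Phi> x \<in> V} = {x \<in> W. \<Phi> x \<in> V}"
    using openin_subset[OF W] by auto
  ultimately show ?thesis using openin_trans_full[OF _ W] by simp
qed

lemma openin_Rn_UNIV: "openin (Euclidean_space n) (Rn n)"
  by simp

lemma smooth_cat_left: "openin (Euclidean_space n) W \<Longrightarrow> y \<in> Rn k \<Longrightarrow> i < n + k \<Longrightarrow> smooth_on n W (\<lambda>x. cat n x y i)"
  by (cases "i < n") (auto simp: cat_def intro: smooth_on_coord smooth_on_const)

lemma smooth_cat_right: "openin (Euclidean_space k) W \<Longrightarrow> i < n + k \<Longrightarrow> smooth_on k W (\<lambda>y. cat n x y i)"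
  by (cases "i < n") (auto simp: cat_def intro: smooth_on_coord smooth_on_const)

lemma cat_upd_left: "i < n \<Longrightarrow> cat n (x(i := t)) y = (cat n x y)(i := t)"
  by (auto simp: cat_def fun_eq_iff)

lemma cat_upd_right: "cat n x (y(j := t)) = (cat n x y)(n + j := t)"
  by (auto simp: cat_def fun_eq_iff)

lemma pd_cat_left: "i < n \<Longrightarrow> pd i (\<lambda>x. f (cat n x y)) x = pd i f (cat n x y)"
  unfolding pd_def by (simp add: cat_upd_left) (simp add: cat_def)

lemma pd_cat_right: "pd j (\<lambda>y. f (cat n x y)) y = pd (n + j) f (cat n x y)"
  unfolding pd_def by (simp add: cat_upd_right) (simp add: cat_def)

lemma open_cat_right:
  assumes "openin (Euclidean_space (n + k)) S"
  shows "openin (Euclidean_space k) {y \<in> Rn k. cat n x y \<in> S}"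
  by (rule smooth_preimage_open[where k = "n + k"]) (auto intro: smooth_cat_right cat_Rn assms)

text \<open>The right action \<open>\<alpha>\<close> of a group and its multiplication
  \<open>\<mu>\<close>, read in charts. A point \<open>cat N x y\<close> combines coordinates x on
  the manifold with coordinates y on the group, and y0 is the identity. S and Q are the open sets
  where the image stays in the charts, so every law carries its membership conditions;
  \<open>\<alpha>_\<mu>\<close> says that acting by y and then by y' is acting by the
  product.\<close>

locale local_isometries = kaehler_chart +
  fixes n :: nat and y0 :: "nat \<Rightarrow> real" and S Q :: "(nat \<Rightarrow> real) set" and \<alpha> \<mu> :: "(nat \<Rightarrow> real) \<Rightarrow> nat \<Rightarrow> real"
  assumes y0: "y0 \<in> Rn n"
    and \<alpha>_smooth: "\<And>k. k < N \<Longrightarrow> smooth_on (N + n) S (\<lambda>z. \<alpha> z k)" and S_open: "openin (Euclidean_space (N + n)) S"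
    and S_y0: "\<And>x. x \<in> U \<Longrightarrow> cat N x y0 \<in> S" and \<alpha>_y0: "\<And>x. x \<in> U \<Longrightarrow> \<alpha> (cat N x y0) = x"
    and \<alpha>_U: "\<And>z. z \<in> S \<Longrightarrow> \<alpha> z \<in> U"
    and \<alpha>_J: "\<And>z u k. z \<in> S \<Longrightarrow> u \<in> Rn N \<Longrightarrow> k < N \<Longrightarrow>
      (\<Sum>i<N. pd i (\<lambda>z. \<alpha> z k) z * J u i) = J (\<lambda>k. if k < N then \<Sum>i<N. pd i (\<lambda>z. \<alpha> z k) z * u i else 0) k"
    and \<alpha>_w: "\<And>z u v. z \<in> S \<Longrightarrow> u \<in> Rn N \<Longrightarrow> v \<in> Rn N \<Longrightarrow>
      bil N (w (\<alpha> z)) (\<lambda>k. if k < N then \<Sum>i<N. pd i (\<lambda>z. \<alpha> z k) z * u i else 0)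
        (\<lambda>k. if k < N then \<Sum>i<N. pd i (\<lambda>z. \<alpha> z k) z * v i else 0) = bil N (w (lft N z)) u v"
    and \<mu>_smooth: "\<And>c. c < n \<Longrightarrow> smooth_on (n + n) Q (\<lambda>z. \<mu> z c)" and Q_open: "openin (Euclidean_space (n + n)) Q"
    and Q_y0: "cat n y0 y0 \<in> Q" and \<mu>_Rn: "\<And>z. z \<in> Q \<Longrightarrow> \<mu> z \<in> Rn n"
    and \<mu>_left: "\<And>y. y \<in> Rn n \<Longrightarrow> cat n y0 y \<in> Q \<Longrightarrow> \<mu> (cat n y0 y) = y"
    and \<mu>_right: "\<And>y. y \<in> Rn n \<Longrightarrow> cat n y y0 \<in> Q \<Longrightarrow> \<mu> (cat n y y0) = y"
    and \<alpha>_\<mu>: "\<And>x y y'. x \<in> U \<Longrightarrow> y \<in> Rn n \<Longrightarrow> y' \<in> Rn n \<Longrightarrow> cat N x y \<in> S \<Longrightarrow> cat n y y' \<in> Q \<Longrightarrow>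
      cat N x (\<mu> (cat n y y')) \<in> S \<Longrightarrow> cat N (\<alpha> (cat N x y)) y' \<in> S \<Longrightarrow>
      \<alpha> (cat N (\<alpha> (cat N x y)) y') = \<alpha> (cat N x (\<mu> (cat n y y')))"
begin

text \<open>The fundamental field of the a-th basis vector of the Lie algebra: the derivative of the
  action in that group direction at the identity.\<close>

definition Xf :: "nat \<Rightarrow> (nat \<Rightarrow> real) \<Rightarrow> nat \<Rightarrow> real" where
  "Xf a x = (\<lambda>k. if k < N then pd (N + a) (\<lambda>z. \<alpha> z k) (cat N x y0) else 0)"

definition Dx :: "(nat \<Rightarrow> real) \<Rightarrow> (nat \<Rightarrow> real) \<Rightarrow> nat \<Rightarrow> real" where
  "Dx z u = (\<lambda>k. if k < N then \<Sum>i<N. pd i (\<lambda>z. \<alpha> z k) z * u i else 0)"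

lemma smooth_slice: "smooth_on (N + n) S f \<Longrightarrow> smooth_on N U (\<lambda>x. f (cat N x y0))"
  by (rule smooth_on_compose[OF _ smooth_cat_left[OF U y0] S_y0 U])

lemma Xf_smooth: "a < n \<Longrightarrow> k < N \<Longrightarrow> smooth_on N U (\<lambda>x. Xf a x k)"
  unfolding Xf_def using smooth_slice[OF smooth_on_pd[OF \<alpha>_smooth]] by simp

lemma Xf_field: "a < n \<Longrightarrow> field_on (Xf a)"
  unfolding field_on_def using Xf_smooth by (simp add: Xf_def Rn_iff)

lemma Dx_smooth: "k < N \<Longrightarrow> smooth_on (N + n) S (\<lambda>z. Dx z u k)"
  unfolding Dx_def by (simp, intro smooth_on_sum[OF S_open] smooth_on_mult smooth_on_pd \<alpha>_smooth smooth_on_const[OF S_open]) auto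

text \<open>Mixed partial derivatives commute: the variation of the derivative of the action in a
  group direction is the derivative of the fundamental field.\<close>

lemma pd_Dx:
  assumes x: "x \<in> U" and a: "a < n" and k: "k < N"
  shows "pd (N + a) (\<lambda>z. Dx z u k) (cat N x y0) = vd N (Xf a) x u k"
proof -
  note z = S_y0[OF x]
  have a': "N + a < N + n" using a by simp
  have "pd (N + a) (\<lambda>z. Dx z u k) (cat N x y0) = pd (N + a) (\<lambda>z. \<Sum>i<N. u i * pd i (\<lambda>z. \<alpha> z k) z) (cat N x y0)"
    using k by (simp add: Dx_def mult.commute)
  also have "\<dots> = (\<Sum>i<N. pd (N + a) (\<lambda>z. u i * pd i (\<lambda>z. \<alpha> z k) z) (cat N x y0))"
    by (rule pd_sum[OF _ z a']) (intro smooth_on_cmult smooth_on_pd \<alpha>_smooth k, auto)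
  also have "\<dots> = (\<Sum>i<N. u i * pd (N + a) (pd i (\<lambda>z. \<alpha> z k)) (cat N x y0))"
    by (intro sum.cong refl pd_cmult[OF _ z a'] smooth_on_pd \<alpha>_smooth k) auto
  also have "\<dots> = (\<Sum>i<N. u i * pd i (pd (N + a) (\<lambda>z. \<alpha> z k)) (cat N x y0))"
    by (intro sum.cong refl arg_cong2[where f = "(*)"] pd_commute[OF \<alpha>_smooth[OF k] z a']) auto
  also have "\<dots> = (\<Sum>i<N. u i * pd i (\<lambda>x. pd (N + a) (\<lambda>z. \<alpha> z k) (cat N x y0)) x)"
    by (intro sum.cong refl) (simp add: pd_cat_left)
  finally show ?thesis using k by (simp add: vd_def dd_def Xf_def mult.commute)
qed

text \<open>The action is holomorphic for every group element, so \<open>Dx\<close> commutes with J;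
  differentiating this identity in the group direction at the identity gives the claim.\<close>

lemma Xf_holomorphic:
  assumes a: "a < n"
  shows "holomorphic_field (Xf a)"
  unfolding holomorphic_field_def
proof (intro conjI Xf_field a ballI)
  fix x u assume x: "x \<in> U" and u: "u \<in> Rn N"
  have a': "N + a < N + n" using a by simp
  note z = S_y0[OF x]
  show "vd N (Xf a) x (J u) = J (vd N (Xf a) x u)"
  proof (rule Rn_eqI[OF vd_Rn JR[OF vd_Rn]])
    fix k assume k: "k < N"
    have "vd N (Xf a) x (J u) k = pd (N + a) (\<lambda>z. J (Dx z u) k) (cat N x y0)"
      unfolding pd_Dx[OF x a k, symmetric]
      by (rule pd_cong[OF S_open _ z a']) (use \<alpha>_J[OF _ u k] k in \<open>simp add: Dx_def\<close>)
    also have "\<dots> = J (vd N (Xf a) x u) k"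
    proof (cases "even k")
      case True
      then have k1: "k + 1 < N" using evenN k by (metis Suc_eq_plus1 Suc_lessI even_Suc)
      then show ?thesis
        using True pd_minus[OF Dx_smooth[OF k1] z a'] pd_Dx[OF x a k1] by (simp add: J_def)
    next
      case False
      then have "k - 1 < N" using k by simp
      then show ?thesis using False pd_Dx[OF x a] by (simp add: J_def)
    qed
    finally show "vd N (Xf a) x (J u) k = J (vd N (Xf a) x u) k" .
  qed
qed

lemma Dx_id: assumes x: "x \<in> U" and u: "u \<in> Rn N" shows "Dx (cat N x y0) u = u"
proof (rule Rn_eqI[OF _ u])
  show "Dx (cat N x y0) u \<in> Rn N" by (simp add: Dx_def Rn_iff)
  fix k assume k: "k < N"
  have "pd i (\<lambda>z. \<alpha> z k) (cat N x y0) = (if k = i then 1 else 0)" if i: "i < N" for i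
  proof -
    have "pd i (\<lambda>z. \<alpha> z k) (cat N x y0) = pd i (\<lambda>x. x k) x"
      unfolding pd_cat_left[OF i, symmetric] by (rule pd_cong[OF U _ x i]) (simp add: \<alpha>_y0)
    also have "\<dots> = (if k = i then 1 else 0)" by (rule pd_eqI) (auto intro!: derivative_eq_intros)
    finally show ?thesis .
  qed
  then show "Dx (cat N x y0) u k = u k" using k sum_delta_left[OF k, of u] by (simp add: Dx_def)
qed

text \<open>Invariance of w is differentiated in the group direction; its right side depends only on
  the point coordinates. Since g(u, v) = w(u, J v), holomorphy of the field carries the result over
  to the metric.\<close>

lemma Xf_killing:
  assumes a: "a < n"
  shows "killing_field (Xf a)"
  unfolding killing_field_def
proof (intro conjI Xf_field a ballI)
  fix x u v assume x: "x \<in> U" and u: "u \<in> Rn N" and v0: "v \<in> Rn N"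
  have a': "N + a < N + n" using a by simp
  note z = S_y0[OF x]
  let ?z = "cat N x y0"
  have W: "dd N (\<lambda>y. bil N (w y) u v) x (Xf a x) + bil N (w x) (vd N (Xf a) x u) v + bil N (w x) u (vd N (Xf a) x v) = 0"
    if v: "v \<in> Rn N" for v
  proof -
    have sw: "smooth_on (N + n) S (\<lambda>z. w (\<alpha> z) i j)" if "i < N" "j < N" for i j
      by (rule smooth_on_compose[OF w_smooth[OF that] \<alpha>_smooth \<alpha>_U S_open])
    have dw: "pd (N + a) (\<lambda>z. w (\<alpha> z) i j) ?z = dd N (\<lambda>y. w y i j) x (Xf a x)" if ij: "i < N" "j < N" for i j
    proof -
      have "pd (N + a) (\<lambda>z. w (\<alpha> z) i j) ?z = (\<Sum>k<N. pd k (\<lambda>y. w y i j) (\<alpha> ?z) * pd (N + a) (\<lambda>z. \<alpha> z k) ?z)"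
        by (rule pd_eqI[OF pd_chain[OF w_smooth[OF ij] \<alpha>_U[OF z] a' z \<alpha>_smooth S_open]]) (use \<alpha>_U U_Rn in auto)
      then show ?thesis by (simp add: \<alpha>_y0[OF x] dd_def Xf_def)
    qed
    have "dd (N + n) (\<lambda>z. bil N (w (\<alpha> z)) (Dx z u) (Dx z v)) ?z (unit_vec (N + a))
        = bil N (\<lambda>i j. dd (N + n) (\<lambda>z. w (\<alpha> z) i j) ?z (unit_vec (N + a))) (Dx ?z u) (Dx ?z v)
         + bil N (w (\<alpha> ?z)) (\<lambda>i. dd (N + n) (\<lambda>z. Dx z u i) ?z (unit_vec (N + a))) (Dx ?z v)
         + bil N (w (\<alpha> ?z)) (Dx ?z u) (\<lambda>i. dd (N + n) (\<lambda>z. Dx z v i) ?z (unit_vec (N + a)))"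
      by (rule dd_bil[OF S_open sw Dx_smooth Dx_smooth z])
    also have "\<dots> = bil N (\<lambda>i j. dd N (\<lambda>y. w y i j) x (Xf a x)) u v
         + bil N (w x) (vd N (Xf a) x u) v + bil N (w x) u (vd N (Xf a) x v)"
      unfolding Dx_id[OF x u] Dx_id[OF x v] \<alpha>_y0[OF x] dd_unit[OF a']
      by (intro arg_cong2[where f = "(+)"] bil_cong) (auto simp: dw pd_Dx[OF x a])
    also have "bil N (\<lambda>i j. dd N (\<lambda>y. w y i j) x (Xf a x)) u v = dd N (\<lambda>y. bil N (w y) u v) x (Xf a x)"
      by (rule dd_bil_const[symmetric, OF w_smooth x])
    also have "dd (N + n) (\<lambda>z. bil N (w (\<alpha> z)) (Dx z u) (Dx z v)) ?z (unit_vec (N + a))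
       = pd (N + a) (\<lambda>z. bil N (w (lft N z)) u v) ?z"
      unfolding dd_unit[OF a'] by (rule pd_cong[OF S_open _ z a']) (use \<alpha>_w[OF _ u v] in \<open>simp add: Dx_def\<close>)
    also have "\<dots> = 0"
    proof -
      have "lft N (?z(N + a := t)) = lft N ?z" for t by (auto simp: lft_def)
      then show ?thesis by (simp add: pd_def)
    qed
    finally show ?thesis by simp
  qed
  have "dd N (\<lambda>y. G y u v) x (Xf a x) = dd N (\<lambda>y. bil N (w y) u (J v)) x (Xf a x)"
    by (rule dd_cong[OF U _ x]) (simp add: G_w u v0)
  moreover have "G x (vd N (Xf a) x u) v = bil N (w x) (vd N (Xf a) x u) (J v)" by (rule G_w[OF vd_Rn v0])
  moreover have "G x u (vd N (Xf a) x v) = bil N (w x) u (vd N (Xf a) x (J v))"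
    using Xf_holomorphic[OF a] x v0 by (simp add: G_w[OF u vd_Rn] holomorphic_field_def)
  ultimately show "dd N (\<lambda>y. G y u v) x (Xf a x) + G x (vd N (Xf a) x u) v + G x u (vd N (Xf a) x v) = 0"
    using W[OF JR[OF v0]] by simp
qed

text \<open>The mixed second-order coefficient of the multiplication at the identity. Its
  antisymmetrization in a and b gives the structure constants of the Lie algebra.\<close>

definition structure_const :: "nat \<Rightarrow> nat \<Rightarrow> nat \<Rightarrow> real" where
  "structure_const a b c = pd a (\<lambda>y. pd (n + b) (\<lambda>z. \<mu> z c) (cat n y y0)) y0"

text \<open>The action law is differentiated in y' and then in y, both at the identity. The first
  derivative expresses the field at a moved point by derivatives of \<open>\<alpha>\<close> at x;
  the second produces a term symmetric in a and b and a combination of the fields.\<close>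

lemma Xf_deriv:
  assumes x: "x \<in> U" and a: "a < n" and b: "b < n" and k: "k < N"
  shows "vd N (Xf b) x (Xf a x) k = pd (N + a) (pd (N + b) (\<lambda>z. \<alpha> z k)) (cat N x y0) + (\<Sum>c<n. structure_const a b c * Xf c x k)"
proof -
  \<comment> \<open>The group elements y for which both the action on x and the product with the
    identity are covered by the charts.\<close>
  define Y where "Y = {y \<in> Rn n. cat N x y \<in> S} \<inter> {y \<in> Rn n. cat n y y0 \<in> Q}"
  have Yo: "openin (Euclidean_space n) Y"
    unfolding Y_def
    by (intro openin_Int open_cat_right[OF S_open]
        smooth_preimage_open[OF openin_Rn_UNIV smooth_cat_left[OF openin_Rn_UNIV y0] cat_Rn[OF y0] Q_open])
  have y0Y: "y0 \<in> Y" unfolding Y_def using y0 S_y0[OF x] Q_y0 by simp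
  have aN: "N + a < N + n" "n + b < n + n" "N + b < N + n" using a b by auto
  have key: "Xf b (\<alpha> (cat N x y)) k = (\<Sum>c<n. pd (N + c) (\<lambda>z. \<alpha> z k) (cat N x y) * pd (n + b) (\<lambda>z. \<mu> z c) (cat n y y0))"
    if y: "y \<in> Y" for y
  proof -
    have yR: "y \<in> Rn n" and yS: "cat N x y \<in> S" and yQ: "cat n y y0 \<in> Q" using y by (auto simp: Y_def)
    note x' = \<alpha>_U[OF yS]
    define Y1 where "Y1 = {y' \<in> Rn n. cat n y y' \<in> Q}"
    have Y1o: "openin (Euclidean_space n) Y1" unfolding Y1_def by (rule open_cat_right[OF Q_open])
    have \<mu>1: "smooth_on n Y1 (\<lambda>y'. \<mu> (cat n y y') c)" if "c < n" for c
      by (rule smooth_on_compose[OF \<mu>_smooth[OF that] smooth_cat_right[OF Y1o] _ Y1o]) (auto simp: Y1_def)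
    have c1: "smooth_on n Y1 (\<lambda>y'. cat N x (\<mu> (cat n y y')) i)" if "i < N + n" for i
      using \<mu>1[of "i - N"] that by (cases "i < N") (auto simp: cat_def[of N] intro: smooth_on_const[OF Y1o])
    have c1R: "cat N x (\<mu> (cat n y y')) \<in> Rn (N + n)" if "y' \<in> Y1" for y'
      by (rule cat_Rn, rule \<mu>_Rn) (use that in \<open>simp add: Y1_def\<close>)
    \<comment> \<open>On this neighbourhood of y0 both sides of the action law are defined, so their
      derivatives in y' may be compared.\<close>
    define Y2 where "Y2 = {y' \<in> Y1. cat N x (\<mu> (cat n y y')) \<in> S} \<inter> {y' \<in> Rn n. cat N (\<alpha> (cat N x y)) y' \<in> S}"
    have Y2o: "openin (Euclidean_space n) Y2"
      unfolding Y2_def by (intro openin_Int open_cat_right[OF S_open] smooth_preimage_open[OF Y1o c1 c1R S_open])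
    have y0Y2: "y0 \<in> Y2" using y0 yQ yS S_y0[OF x'] \<mu>_right[OF yR yQ] by (simp add: Y2_def Y1_def)
    have Y21: "Y2 \<subseteq> Y1" by (auto simp: Y2_def)
    have "Xf b (\<alpha> (cat N x y)) k = pd b (\<lambda>y'. \<alpha> (cat N (\<alpha> (cat N x y)) y') k) y0"
      using k by (simp add: Xf_def pd_cat_right[where f = "\<lambda>z. \<alpha> z k"])
    also have "\<dots> = pd b (\<lambda>y'. \<alpha> (cat N x (\<mu> (cat n y y'))) k) y0"
    proof (rule pd_cong[OF Y2o _ y0Y2 b])
      fix y' assume "y' \<in> Y2"
      then show "\<alpha> (cat N (\<alpha> (cat N x y)) y') k = \<alpha> (cat N x (\<mu> (cat n y y'))) k"
        using \<alpha>_\<mu>[OF x yR _ yS, of y'] by (simp add: Y2_def Y1_def)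
    qed
    also have "\<dots> = (\<Sum>i<N + n. pd i (\<lambda>z. \<alpha> z k) (cat N x (\<mu> (cat n y y0))) * pd b (\<lambda>y'. cat N x (\<mu> (cat n y y')) i) y0)"
    proof (rule pd_eqI, rule pd_chain[OF \<alpha>_smooth[OF k] _ b y0Y2 _ Y2o])
      show "cat N x (\<mu> (cat n y y0)) \<in> S" using y0Y2 by (simp add: Y2_def)
      show "smooth_on n Y2 (\<lambda>y'. cat N x (\<mu> (cat n y y')) i)" if "i < N + n" for i
        by (rule smooth_on_subset[OF c1[OF that] Y21 Y2o])
      show "cat N x (\<mu> (cat n y y')) \<in> Rn (N + n)" if "y' \<in> Y2" for y' using c1R Y21 that by blast
    qed
    also have "\<dots> = (\<Sum>c<n. pd (N + c) (\<lambda>z. \<alpha> z k) (cat N x y) * pd b (\<lambda>y'. \<mu> (cat n y y') c) y0)"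
      unfolding sum_lessThan_add \<mu>_right[OF yR yQ] by (simp add: cat_def[of N x] pd_def)
    finally show ?thesis by (simp add: pd_cat_right[where f = "\<lambda>z. \<mu> z c" for c])
  qed
  note z = S_y0[OF x]
  have sx: "smooth_on n Y (\<lambda>y. f (cat N x y))" if "smooth_on (N + n) S f" for f
    by (rule smooth_on_compose[OF that smooth_cat_right[OF Yo] _ Yo]) (auto simp: Y_def)
  have "vd N (Xf b) x (Xf a x) k = (\<Sum>i<N. pd i (\<lambda>x. Xf b x k) (\<alpha> (cat N x y0)) * pd a (\<lambda>y. \<alpha> (cat N x y) i) y0)"
    using k by (simp add: vd_def dd_def \<alpha>_y0[OF x] pd_cat_right[where f = "\<lambda>z. \<alpha> z i" for i] Xf_def[of a])
  also have "\<dots> = pd a (\<lambda>y. Xf b (\<alpha> (cat N x y)) k) y0"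
  proof (rule pd_eqI[symmetric], rule pd_chain[OF Xf_smooth[OF b k] _ a y0Y _ Yo])
    show "\<alpha> (cat N x y0) \<in> U" using x \<alpha>_y0 by simp
    show "smooth_on n Y (\<lambda>y. \<alpha> (cat N x y) i)" if "i < N" for i by (rule sx[OF \<alpha>_smooth[OF that]])
    show "\<alpha> (cat N x y) \<in> Rn N" if "y \<in> Y" for y using that \<alpha>_U U_Rn by (simp add: Y_def)
  qed
  also have "\<dots> = pd a (\<lambda>y. \<Sum>c<n. pd (N + c) (\<lambda>z. \<alpha> z k) (cat N x y) * pd (n + b) (\<lambda>z. \<mu> z c) (cat n y y0)) y0"
    by (rule pd_cong[OF Yo key y0Y a])
  also have "\<dots> = (\<Sum>c<n. pd a (\<lambda>y. pd (N + c) (\<lambda>z. \<alpha> z k) (cat N x y) * pd (n + b) (\<lambda>z. \<mu> z c) (cat n y y0)) y0)"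
  proof (rule pd_sum[OF _ y0Y a])
    fix c assume "c \<in> {..<n}"
    then have c: "c < n" by simp
    show "smooth_on n Y (\<lambda>y. pd (N + c) (\<lambda>z. \<alpha> z k) (cat N x y) * pd (n + b) (\<lambda>z. \<mu> z c) (cat n y y0))"
      by (intro smooth_on_mult sx smooth_on_pd \<alpha>_smooth k smooth_on_compose[OF smooth_on_pd[OF \<mu>_smooth[OF c] aN(2)] smooth_cat_left[OF Yo y0] _ Yo])
         (use c in \<open>auto simp: Y_def\<close>)
  qed
  also have "\<dots> = (\<Sum>c<n. pd (N + a) (pd (N + c) (\<lambda>z. \<alpha> z k)) (cat N x y0) * (if c = b then 1 else 0) + structure_const a b c * Xf c x k)"
  proof (intro sum.cong refl)
    fix c assume "c \<in> {..<n}"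
    then have c: "c < n" by simp
    \<comment> \<open>With the identity as first argument, \<open>\<mu>\<close> returns its second
      argument, so its first derivatives there form the unit matrix.\<close>
    have 1: "pd (n + b) (\<lambda>z. \<mu> z c) (cat n y0 y0) = (if c = b then 1 else 0)"
    proof -
      let ?Y = "{y \<in> Rn n. cat n y0 y \<in> Q}"
      have "pd (n + b) (\<lambda>z. \<mu> z c) (cat n y0 y0) = pd b (\<lambda>y. \<mu> (cat n y0 y) c) y0" by (rule pd_cat_right[symmetric])
      also have "\<dots> = pd b (\<lambda>y. y c) y0"
        by (rule pd_cong[OF open_cat_right[OF Q_open] _ _ b]) (use \<mu>_left y0 Q_y0 in auto)
      also have "\<dots> = (if c = b then 1 else 0)" by (rule pd_eqI) (auto intro!: derivative_eq_intros)
      finally show ?thesis .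
    qed
    have "pd a (\<lambda>y. pd (N + c) (\<lambda>z. \<alpha> z k) (cat N x y) * pd (n + b) (\<lambda>z. \<mu> z c) (cat n y y0)) y0
       = pd a (\<lambda>y. pd (N + c) (\<lambda>z. \<alpha> z k) (cat N x y)) y0 * pd (n + b) (\<lambda>z. \<mu> z c) (cat n y0 y0)
        + pd (N + c) (\<lambda>z. \<alpha> z k) (cat N x y0) * pd a (\<lambda>y. pd (n + b) (\<lambda>z. \<mu> z c) (cat n y y0)) y0"
      by (rule pd_mult[OF sx[OF smooth_on_pd[OF \<alpha>_smooth[OF k]]] smooth_on_compose[OF smooth_on_pd[OF \<mu>_smooth[OF c] aN(2)] smooth_cat_left[OF Yo y0] _ Yo] y0Y a])
         (use c in \<open>auto simp: Y_def\<close>)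
    then show "pd a (\<lambda>y. pd (N + c) (\<lambda>z. \<alpha> z k) (cat N x y) * pd (n + b) (\<lambda>z. \<mu> z c) (cat n y y0)) y0
       = pd (N + a) (pd (N + c) (\<lambda>z. \<alpha> z k)) (cat N x y0) * (if c = b then 1 else 0) + structure_const a b c * Xf c x k"
      unfolding 1 pd_cat_right using k by (simp add: structure_const_def Xf_def)
  qed
  also have "\<dots> = pd (N + a) (pd (N + b) (\<lambda>z. \<alpha> z k)) (cat N x y0) + (\<Sum>c<n. structure_const a b c * Xf c x k)"
    unfolding sum.distrib sum_delta_right[OF b] ..
  finally show ?thesis .
qed

text \<open>The second derivatives of \<open>\<alpha>\<close> in \<open>Xf_deriv\<close> are
  symmetric in a and b and drop out of the difference.\<close>

lemma Xf_bracket: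
  assumes x: "x \<in> U" and a: "a < n" and b: "b < n"
  shows "vd N (Xf b) x (Xf a x) = (\<lambda>k. vd N (Xf a) x (Xf b x) k + (\<Sum>c<n. (structure_const a b c - structure_const b a c) * Xf c x k))"
proof
  fix k
  show "vd N (Xf b) x (Xf a x) k = vd N (Xf a) x (Xf b x) k + (\<Sum>c<n. (structure_const a b c - structure_const b a c) * Xf c x k)"
  proof (cases "k < N")
    case True
    have "pd (N + a) (pd (N + b) (\<lambda>z. \<alpha> z k)) (cat N x y0) = pd (N + b) (pd (N + a) (\<lambda>z. \<alpha> z k)) (cat N x y0)"
      by (rule pd_commute[OF \<alpha>_smooth[OF True] S_y0[OF x]]) (use a b in auto)
    then show ?thesis unfolding Xf_deriv[OF x a b True] Xf_deriv[OF x b a True]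
      by (simp add: left_diff_distrib sum_subtractf)
  qed (simp add: vd_def Xf_def)
qed

end

section \<open>The action on the compactification\<close>

lemma holomorphic_map_pair:
  assumes "charted X" "charted Y" "charted Z" "even (mdim X)" "holomorphic_map Z X F" "holomorphic_map Z Y G"
  shows "holomorphic_map Z (prod_mfd X Y) (\<lambda>z. (F z, G z))"
  using assms smooth_map_pair[of X Y Z F G] commutes_with_J_pair[of X Z F Y G] by (simp add: holomorphic_map_def)

lemma holomorphic_map_const:
  "charted X \<Longrightarrow> charted Y \<Longrightarrow> p \<in> topspace (mtop Y) \<Longrightarrow> holomorphic_map X Y (\<lambda>_. p)"
  by (simp add: holomorphic_map_def smooth_map_const commutes_with_J_const)

lemma prod_rep:
  assumes X: "charted X" and Y: "charted Y" and c: "c \<in> atlas X" and e: "e \<in> atlas Y"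
    and p: "p \<in> fst c" and q: "q \<in> fst e"
  shows "chart_inv (prod_chart (mdim X) c e) (cat (mdim X) (snd c p) (snd e q)) = (p, q)"
  using chart_inv_prod_cat[OF X Y c e, of "snd c p" "snd e q"] p q chart_inv_left[OF X c p] chart_inv_left[OF Y e q] by simp

lemma prod_rep_domain:
  assumes X: "charted X" and Y: "charted Y" and c: "c \<in> atlas X" and e: "e \<in> atlas Y"
  defines "P \<equiv> prod_chart (mdim X) c e"
  shows "z \<in> snd P ` (fst P \<inter> F -` T) \<longleftrightarrow>
    (\<exists>p q. p \<in> fst c \<and> q \<in> fst e \<and> F (p, q) \<in> T \<and> z = cat (mdim X) (snd c p) (snd e q))"
  unfolding P_def fst_prod_chart by (force simp: snd_prod_chart image_iff)

lemma cat_eq_iff: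
  assumes "x \<in> Rn m" "x' \<in> Rn m"
  shows "cat m x y = cat m x' y' \<longleftrightarrow> x = x' \<and> y = y'"
  using lft_cat[OF assms(1)] lft_cat[OF assms(2)] rgt_cat by metis

lemma differential_cong:
  assumes X: "charted X" and c: "c \<in> atlas X" and p: "p \<in> fst c"
    and e: "\<And>q. q \<in> topspace (mtop X) \<Longrightarrow> F q = F' q"
  shows "differential X Y F c d p v = differential X Y F' c d p v"
proof -
  have "pd i (\<lambda>x. snd d (F (chart_inv c x)) k) (snd c p) = pd i (\<lambda>x. snd d (F' (chart_inv c x)) k) (snd c p)" if "i < mdim X" for i k
    by (rule pd_cong[OF chart_image_open[OF X c] _ _ that])
       (use e chart_mem[OF X c] chart_inv_in[OF X c] p in auto)
  then show ?thesis by (auto simp: differential_def fun_eq_iff)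
qed

text \<open>The image under left multiplication by y is the preimage under left multiplication by
  its inverse, so continuity is enough.\<close>

lemma group_left_mult_open:
  fixes G (structure)
  assumes "group G" and top: "carrier G = topspace T"
    and c: "\<And>y. y \<in> carrier G \<Longrightarrow> continuous_map T T (\<lambda>x. y \<otimes> x)" and y: "y \<in> carrier G" and B: "openin T B"
  shows "openin T ((\<lambda>x. y \<otimes> x) ` B)"
proof -
  interpret group G by fact
  have Bc: "B \<subseteq> carrier G" using openin_subset[OF B] top by simp
  have "(\<lambda>x. y \<otimes> x) ` B = {x \<in> topspace T. inv y \<otimes> x \<in> B}"
  proof (intro equalityI subsetI)
    fix x assume "x \<in> (\<lambda>x. y \<otimes> x) ` B"
    then show "x \<in> {x \<in> topspace T. inv y \<otimes> x \<in> B}"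
      unfolding top[symmetric] using y Bc by (auto simp: m_assoc[symmetric] subset_iff)
  next
    fix x assume x: "x \<in> {x \<in> topspace T. inv y \<otimes> x \<in> B}"
    then have "x = y \<otimes> (inv y \<otimes> x)" unfolding top[symmetric] using y by (simp add: m_assoc[symmetric])
    then show "x \<in> (\<lambda>x. y \<otimes> x) ` B" using x by blast
  qed
  then show ?thesis using openin_continuous_map_preimage[OF c B, of "inv y"] y by simp
qed

text \<open>Fixes the data that the hypotheses provide only existentially or for every choice:
  charts e and d at the identities, the exponential E belonging to them, and the Einstein constant
  r. The inclusion L of Lie algebras is then one fixed linear map.\<close>

locale orbit_setting =
  fixes G :: "'g monoid" and XG :: "'g mfd" and Gc :: "'c monoid" and XGc :: "'c mfd" and \<iota> :: "'g \<Rightarrow> 'c"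
    and M :: "'m mfd" and act :: "'c \<Rightarrow> 'm \<Rightarrow> 'm" and \<Omega> :: "'m set" and \<omega> :: "'m tensor2" and r :: real
    and e :: "'g chart" and d :: "'c chart" and E :: "(nat \<Rightarrow> real) \<Rightarrow> 'c"
  assumes G_compact: "compact_lie_group G XG"
    and G_complexification: "complexification G XG Gc XGc \<iota>"
    and M_compactification: "compactification Gc XGc M act \<Omega>"
    and finite_stab: "\<forall>p\<in>\<Omega>. finite (stabilizer Gc act p)"
    and kaehler: "kaehler_form M \<omega>"
    and invariant: "invariant_form G M (\<lambda>g. act (\<iota> g)) \<omega>"
    and r_pos: "r > 0"
    and ricci: "\<And>c p i j. c \<in> atlas M \<Longrightarrow> p \<in> fst c \<Longrightarrow> i < mdim M \<Longrightarrow> j < mdim M \<Longrightarrow> ricci_form M \<omega> c p i j = r * \<omega> c p i j"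
    and e: "e \<in> atlas XG" "\<one>\<^bsub>G\<^esub> \<in> fst e" and d: "d \<in> atlas XGc" "\<one>\<^bsub>Gc\<^esub> \<in> fst d"
    and L_bij: "bij_betw (\<lambda>(u, v). \<lambda>k. differential XG XGc \<iota> e d \<one>\<^bsub>G\<^esub> u k + J (differential XG XGc \<iota> e d \<one>\<^bsub>G\<^esub> v) k)
             (Rn (mdim XG) \<times> Rn (mdim XG)) (Rn (mdim XGc))"
    and E_exp: "lie_exp Gc XGc d E"
    and E_polar: "diffeomorphism (prod_mfd (open_mfd (mdim XG) (Rn (mdim XG))) XG) XGc
                (\<lambda>(v, g). E (J (differential XG XGc \<iota> e d \<one>\<^bsub>G\<^esub> v)) \<otimes>\<^bsub>Gc\<^esub> \<iota> g)"
begin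

abbreviation "N \<equiv> mdim M"
abbreviation "n \<equiv> mdim XG"
abbreviation "A \<equiv> topspace (mtop M)"
abbreviation "L \<equiv> differential XG XGc \<iota> e d \<one>\<^bsub>G\<^esub>"

lemma basics:
  shows G_group: "group G" and Gc_group: "group Gc" and XG_smooth: "smooth_manifold XG"
    and XGc_complex: "complex_manifold XGc" and G_top: "carrier G = topspace (mtop XG)" and Gc_top: "carrier Gc = topspace (mtop XGc)"
    and mult_smooth: "smooth_map (prod_mfd XG XG) XG (\<lambda>(g, h). g \<otimes>\<^bsub>G\<^esub> h)"
    and XG_compact: "compact_space (mtop XG)"
    and Gc_mult_hol: "holomorphic_map (prod_mfd XGc XGc) XGc (\<lambda>(g, h). g \<otimes>\<^bsub>Gc\<^esub> h)"
    and \<iota>_hom: "\<iota> \<in> hom G Gc" and \<iota>_smooth: "smooth_map XG XGc \<iota>"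
    and M_complex: "complex_manifold M" and M_compact: "compact_space (mtop M)"
    and act_hol: "holomorphic_map (prod_mfd M XGc) M (\<lambda>(p, g). act g p)"
    and \<Omega>_open: "openin (mtop M) \<Omega>" and \<Omega>_dense: "(mtop M) closure_of \<Omega> = A"
  using G_compact G_complexification M_compactification
  by (auto simp: compact_lie_group_def lie_group_def complexification_def complex_lie_group_def compactification_def)

lemma charted_facts: "charted XG" "charted XGc" "charted M" "even N" "smooth_manifold M" "smooth_manifold XGc"
  using XG_smooth XGc_complex M_complex smooth_manifold_charted by (auto simp: complex_manifold_def)

lemmas cG = charted_facts(1) and cGc = charted_facts(2) and cM = charted_facts(3) and evN = charted_facts(4)
  and M_smooth = charted_facts(5) and Gc_smooth = charted_facts(6)

lemma \<iota>_facts: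
  shows \<iota>_closed: "g \<in> carrier G \<Longrightarrow> \<iota> g \<in> carrier Gc"
    and \<iota>_mult: "g \<in> carrier G \<Longrightarrow> h \<in> carrier G \<Longrightarrow> \<iota> (g \<otimes>\<^bsub>G\<^esub> h) = \<iota> g \<otimes>\<^bsub>Gc\<^esub> \<iota> h"
    and \<iota>_one: "\<iota> \<one>\<^bsub>G\<^esub> = \<one>\<^bsub>Gc\<^esub>"
  using \<iota>_hom hom_one[OF \<iota>_hom G_group Gc_group] by (auto simp: hom_def)

lemma act_facts:
  shows act_closed: "g \<in> carrier Gc \<Longrightarrow> p \<in> A \<Longrightarrow> act g p \<in> A"
    and act_one: "p \<in> A \<Longrightarrow> act \<one>\<^bsub>Gc\<^esub> p = p"
    and act_mult: "g \<in> carrier Gc \<Longrightarrow> h \<in> carrier Gc \<Longrightarrow> p \<in> A \<Longrightarrow> act (g \<otimes>\<^bsub>Gc\<^esub> h) p = act h (act g p)"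
  using M_compactification by (auto simp: compactification_def right_action_def)

lemma one_carrier: "\<one>\<^bsub>G\<^esub> \<in> carrier G" "\<one>\<^bsub>Gc\<^esub> \<in> carrier Gc"
  using G_group Gc_group by (simp_all add: group.is_monoid monoid.one_closed)

lemma orbit_map_hol: "p \<in> A \<Longrightarrow> holomorphic_map XGc M (\<lambda>y. act y p)"
  using holomorphic_map_compose[OF cGc charted_prod[OF cM cGc] cM
      holomorphic_map_pair[OF cM cGc cGc evN holomorphic_map_const[OF cGc cM] holomorphic_map_id[OF XGc_complex]] act_hol] by simp

lemma act_map_hol: "y \<in> carrier Gc \<Longrightarrow> holomorphic_map M M (act y)"
  using holomorphic_map_compose[OF cM charted_prod[OF cM cGc] cM
      holomorphic_map_pair[OF cM cGc cM evN holomorphic_map_id[OF M_complex] holomorphic_map_const[OF cM cGc]] act_hol] Gc_top by simp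

lemma orbit_map_smooth: "p \<in> A \<Longrightarrow> smooth_map XG M (\<lambda>g. act (\<iota> g) p)"
  using smooth_map_compose[OF cG cGc cM \<iota>_smooth] orbit_map_hol by (auto simp: holomorphic_map_def)

definition \<beta> :: "'m \<times> 'g \<Rightarrow> 'm" where "\<beta> z = act (\<iota> (snd z)) (fst z)"

lemma \<beta>_smooth: "smooth_map (prod_mfd M XG) M \<beta>"
proof -
  have a: "smooth_map (prod_mfd M XGc) M (\<lambda>(p, g). act g p)" using act_hol by (simp add: holomorphic_map_def)
  have "smooth_map (prod_mfd M XG) (prod_mfd M XGc) (\<lambda>z. (fst z, \<iota> (snd z)))"
    by (intro smooth_map_pair[OF cM cGc charted_prod[OF cM cG]] smooth_map_fst[OF M_smooth cG]
        smooth_map_compose[OF charted_prod[OF cM cG] cG cGc smooth_map_snd[OF cM XG_smooth] \<iota>_smooth])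
  from smooth_map_compose[OF charted_prod[OF cM cG] charted_prod[OF cM cGc] cM this a]
  show ?thesis by (simp add: \<beta>_def[abs_def])
qed

lemma left_mult_smooth: "g \<in> carrier G \<Longrightarrow> smooth_map XG XG (\<lambda>h. g \<otimes>\<^bsub>G\<^esub> h)"
  using smooth_map_compose[OF cG charted_prod[OF cG cG] cG
      smooth_map_pair[OF cG cG cG smooth_map_const[OF cG cG] smooth_map_id[OF XG_smooth]] mult_smooth] G_top by simp

lemma right_mult_smooth: "g \<in> carrier G \<Longrightarrow> smooth_map XG XG (\<lambda>h. h \<otimes>\<^bsub>G\<^esub> g)"
  using smooth_map_compose[OF cG charted_prod[OF cG cG] cG
      smooth_map_pair[OF cG cG cG smooth_map_id[OF XG_smooth] smooth_map_const[OF cG cG]] mult_smooth] G_top by simp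

abbreviation U where "U c \<equiv> snd c ` fst c"
abbreviation w where "w c \<equiv> in_coords \<omega> c"

lemma w_eq: "c \<in> atlas M \<Longrightarrow> p \<in> fst c \<Longrightarrow> w c (snd c p) = \<omega> c p"
  using chart_inv_left[OF cM] by (simp add: in_coords_def)

lemma kaehler_chart: "c \<in> atlas M \<Longrightarrow> kaehler_chart N (U c) (w c)"
proof
  assume c: "c \<in> atlas M"
  have K: "closed_2form M \<omega>" using kaehler by (simp add: kaehler_form_def)
  show "even N" by (rule evN)
  show "openin (Euclidean_space N) (U c)" by (rule chart_image_open[OF cM c])
  show "smooth_on N (U c) (\<lambda>x. w c x i j)" if "i < N" "j < N" for i j
    using K c that by (simp add: closed_2form_def)
  fix x assume x: "x \<in> U c"
  then have p: "chart_inv c x \<in> fst c" by (rule chart_inv_in[OF cM c])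
  show "w c x i j = - w c x j i" if "i < N" "j < N" for i j
    using K c p that unfolding closed_2form_def in_coords_def by blast
  show "pd i (\<lambda>y. w c y j k) x + pd j (\<lambda>y. w c y k i) x + pd k (\<lambda>y. w c y i j) x = 0"
    if "i < N" "j < N" "k < N" for i j k
    using K c x that unfolding closed_2form_def by blast
  show "bil N (w c x) (J u) (J v) = bil N (w c x) u v" if "u \<in> Rn N" "v \<in> Rn N" for u v
    using kaehler c p that by (simp add: kaehler_form_def in_coords_def)
  show "0 < bil N (w c x) u (J u)" if "u \<in> Rn N" "u \<noteq> (\<lambda>_. 0)" for u
    using kaehler c p that by (simp add: kaehler_form_def in_coords_def)
qed

abbreviation gc where "gc c \<equiv> kaehler_chart.g N (w c)"

lemma gc_eq: "c \<in> atlas M \<Longrightarrow> gc c = in_coords (kaehler_metric M \<omega>) c"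
  by (intro ext) (simp add: kaehler_chart.g_def[OF kaehler_chart] in_coords_def kaehler_metric_def)

lemma einstein_chart: "c \<in> atlas M \<Longrightarrow> kaehler_einstein_chart N (U c) (w c) r"
proof -
  assume c: "c \<in> atlas M"
  interpret kaehler_chart N "U c" "w c" by (rule kaehler_chart[OF c])
  show ?thesis
  proof
    fix x i j assume "x \<in> U c" "i < N" "j < N"
    then obtain p where p: "p \<in> fst c" "x = snd c p" by blast
    show "bil N (ricci N (gc c) x) (J (unit_vec i)) (unit_vec j) = r * w c x i j"
      using ricci[OF c p(1) \<open>i < N\<close> \<open>j < N\<close>] w_eq[OF c p(1)] unfolding gc_eq[OF c] by (simp add: ricci_form_def p(2))
  qed
qed

text \<open>Together with \<open>S\<close>, \<open>\<mu>\<close> and \<open>Q\<close> the instance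
  of \<open>local_isometries\<close>: the action of G on M in the chart c, used for source and
  target, and the multiplication of G in the chart e.\<close>

definition \<alpha> :: "'m chart \<Rightarrow> (nat \<Rightarrow> real) \<Rightarrow> nat \<Rightarrow> real" where
  "\<alpha> c z = snd c (\<beta> (chart_inv (prod_chart N c e) z))"

definition S where "S c = snd (prod_chart N c e) ` (fst (prod_chart N c e) \<inter> \<beta> -` fst c)"

definition \<mu> :: "(nat \<Rightarrow> real) \<Rightarrow> nat \<Rightarrow> real" where
  "\<mu> z = snd e ((\<lambda>(g, h). g \<otimes>\<^bsub>G\<^esub> h) (chart_inv (prod_chart n e e) z))"

definition Q where "Q = snd (prod_chart n e e) ` (fst (prod_chart n e e) \<inter> (\<lambda>(g, h). g \<otimes>\<^bsub>G\<^esub> h) -` fst e)"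

lemma S_iff: "c \<in> atlas M \<Longrightarrow> z \<in> S c \<longleftrightarrow>
    (\<exists>p g. p \<in> fst c \<and> g \<in> fst e \<and> act (\<iota> g) p \<in> fst c \<and> z = cat N (snd c p) (snd e g))"
  unfolding S_def prod_rep_domain[OF cM cG _ e(1)] \<beta>_def by simp

lemma Q_iff: "z \<in> Q \<longleftrightarrow> (\<exists>g h. g \<in> fst e \<and> h \<in> fst e \<and> g \<otimes>\<^bsub>G\<^esub> h \<in> fst e \<and> z = cat n (snd e g) (snd e h))"
  unfolding Q_def prod_rep_domain[OF cG cG e(1) e(1)] by simp

lemma \<alpha>_cat: "c \<in> atlas M \<Longrightarrow> p \<in> fst c \<Longrightarrow> g \<in> fst e \<Longrightarrow> \<alpha> c (cat N (snd c p) (snd e g)) = snd c (act (\<iota> g) p)"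
  unfolding \<alpha>_def by (simp add: prod_rep[OF cM cG _ e(1)] \<beta>_def)

lemma \<mu>_cat: "g \<in> fst e \<Longrightarrow> h \<in> fst e \<Longrightarrow> \<mu> (cat n (snd e g) (snd e h)) = snd e (g \<otimes>\<^bsub>G\<^esub> h)"
  unfolding \<mu>_def by (simp add: prod_rep[OF cG cG e(1) e(1)])

abbreviation "y0 \<equiv> snd e \<one>\<^bsub>G\<^esub>"

lemma e_carrier: "g \<in> fst e \<Longrightarrow> g \<in> carrier G"
  using chart_mem[OF cG e(1)] G_top by simp

lemma c_mem: "c \<in> atlas M \<Longrightarrow> p \<in> fst c \<Longrightarrow> p \<in> A"
  using chart_mem[OF cM] by blast

lemma \<alpha>_differential:
  assumes c: "c \<in> atlas M" and p: "p \<in> fst c" and g: "g \<in> fst e"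
  shows "(\<lambda>k. if k < N then \<Sum>i<N. pd i (\<lambda>z. \<alpha> c z k) (cat N (snd c p) (snd e g)) * u i else 0)
    = differential M M (act (\<iota> g)) c c p u"
proof -
  have "pd i (\<lambda>z. \<alpha> c z k) (cat N (snd c p) (snd e g)) = pd i (\<lambda>x. snd c (act (\<iota> g) (chart_inv c x)) k) (snd c p)"
    if i: "i < N" for i k
  proof -
    have "pd i (\<lambda>z. \<alpha> c z k) (cat N (snd c p) (snd e g)) = pd i (\<lambda>x. \<alpha> c (cat N x (snd e g)) k) (snd c p)"
      by (rule pd_cat_left[OF i, symmetric, of "\<lambda>z. \<alpha> c z k"])
    also have "\<dots> = pd i (\<lambda>x. snd c (act (\<iota> g) (chart_inv c x)) k) (snd c p)"
    proof (rule pd_cong[OF chart_image_open[OF cM c] _ _ i])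
      fix x assume "x \<in> U c"
      then obtain q where "q \<in> fst c" "x = snd c q" by blast
      then show "\<alpha> c (cat N x (snd e g)) k = snd c (act (\<iota> g) (chart_inv c x)) k"
        using \<alpha>_cat[OF c _ g] chart_inv_left[OF cM c] by simp
    qed (use p in auto)
    finally show ?thesis .
  qed
  then show ?thesis by (auto simp: differential_def fun_eq_iff)
qed

lemma local_isometries: "c \<in> atlas M \<Longrightarrow> local_isometries N (U c) (w c) n y0 (S c) Q (\<alpha> c) \<mu>"
proof -
  assume c: "c \<in> atlas M"
  interpret kaehler_chart N "U c" "w c" by (rule kaehler_chart[OF c])
  have P: "prod_chart N c e \<in> atlas (prod_mfd M XG)" using c e atlas_prod by blast
  have PG: "prod_chart n e e \<in> atlas (prod_mfd XG XG)" using e atlas_prod by blast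
  note cR = chart_Rn[OF cM c] and eR = chart_Rn[OF cG e(1)]
  show ?thesis
  proof
    show "y0 \<in> Rn n" by (rule eR[OF e(2)])
    show "smooth_on (N + n) (S c) (\<lambda>z. \<alpha> c z k)" if "k < N" for k
      using smooth_map_rep[OF \<beta>_smooth P c that] by (simp add: \<alpha>_def S_def)
    show "openin (Euclidean_space (N + n)) (S c)"
      using chart_pullback_open[OF charted_prod[OF cM cG] P smooth_map_cont[OF \<beta>_smooth] chart_open[OF cM c]] by (simp add: S_def)
    show "smooth_on (n + n) Q (\<lambda>z. \<mu> z k)" if "k < n" for k
      using smooth_map_rep[OF mult_smooth PG e(1) that] by (simp add: \<mu>_def Q_def)
    show "openin (Euclidean_space (n + n)) Q"
      using chart_pullback_open[OF charted_prod[OF cG cG] PG smooth_map_cont[OF mult_smooth] chart_open[OF cG e(1)]] by (simp add: Q_def)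
    show "cat n y0 y0 \<in> Q" unfolding Q_iff using e(2) one_carrier monoid.l_one[OF group.is_monoid[OF G_group]] by metis
    show "\<mu> z \<in> Rn n" if "z \<in> Q" for z using that unfolding Q_iff by (auto simp: \<mu>_cat eR)
    show "\<mu> (cat n y0 y) = y" if y: "y \<in> Rn n" "cat n y0 y \<in> Q" for y
    proof -
      obtain g h where gh: "g \<in> fst e" "h \<in> fst e" "cat n y0 y = cat n (snd e g) (snd e h)" using y(2) Q_iff by blast
      then have yh: "y = snd e h" using cat_eq_iff[OF eR[OF e(2)] eR[OF gh(1)]] by blast
      show ?thesis unfolding yh using gh e(2) e_carrier G_group by (simp add: \<mu>_cat group.is_monoid monoid.l_one)
    qed
    show "\<mu> (cat n y y0) = y" if y: "y \<in> Rn n" "cat n y y0 \<in> Q" for y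
    proof -
      obtain g h where gh: "g \<in> fst e" "h \<in> fst e" "cat n y y0 = cat n (snd e g) (snd e h)" using y(2) Q_iff by blast
      then have yg: "y = snd e g" using cat_eq_iff[OF y(1) eR[OF gh(1)]] by blast
      show ?thesis unfolding yg using gh e(2) e_carrier G_group by (simp add: \<mu>_cat group.is_monoid monoid.r_one)
    qed
    show "cat N x y0 \<in> S c" if x: "x \<in> U c" for x
    proof -
      obtain p where "p \<in> fst c" "x = snd c p" using x by blast
      then show ?thesis unfolding S_iff[OF c] using e(2) \<iota>_one act_one c_mem[OF c] by metis
    qed
    show "\<alpha> c (cat N x y0) = x" if x: "x \<in> U c" for x
    proof -
      obtain p where "p \<in> fst c" "x = snd c p" using x by blast
      then show ?thesis using e(2) \<iota>_one act_one c_mem[OF c] \<alpha>_cat[OF c] by simp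
    qed
    show "\<alpha> c z \<in> U c" if "z \<in> S c" for z using that unfolding S_iff[OF c] by (auto simp: \<alpha>_cat[OF c])
    show "(\<Sum>i<N. pd i (\<lambda>z. \<alpha> c z k) z * J u i) = J (\<lambda>k. if k < N then \<Sum>i<N. pd i (\<lambda>z. \<alpha> c z k) z * u i else 0) k"
      if z: "z \<in> S c" and u: "u \<in> Rn N" and k: "k < N" for z u k
    proof -
      obtain p g where pg: "p \<in> fst c" "g \<in> fst e" "act (\<iota> g) p \<in> fst c" "z = cat N (snd c p) (snd e g)"
        using z S_iff[OF c] by blast
      have "commutes_with_J M M (act (\<iota> g))"
        using act_map_hol[OF \<iota>_closed[OF e_carrier[OF pg(2)]]] by (simp add: holomorphic_map_def)
      then have "differential M M (act (\<iota> g)) c c p (J u) = J (differential M M (act (\<iota> g)) c c p u)"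
        using c pg u unfolding commutes_with_J_def by blast
      then show ?thesis
        using fun_cong[OF \<alpha>_differential[OF c pg(1,2), of "J u"], of k] k
        unfolding pg(4) \<alpha>_differential[OF c pg(1,2), of u] by simp
    qed
    show "bil N (w c (\<alpha> c z)) (\<lambda>k. if k < N then \<Sum>i<N. pd i (\<lambda>z. \<alpha> c z k) z * u i else 0)
        (\<lambda>k. if k < N then \<Sum>i<N. pd i (\<lambda>z. \<alpha> c z k) z * v i else 0) = bil N (w c (lft N z)) u v"
      if z: "z \<in> S c" and uv: "u \<in> Rn N" "v \<in> Rn N" for z u v
    proof -
      obtain p g where pg: "p \<in> fst c" "g \<in> fst e" "act (\<iota> g) p \<in> fst c" "z = cat N (snd c p) (snd e g)"
        using z S_iff[OF c] by blast
      have "preserves_tensor M \<omega> (act (\<iota> g))" using invariant e_carrier[OF pg(2)] by (simp add: invariant_form_def)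
      then have "bil N (\<omega> c (act (\<iota> g) p)) (differential M M (act (\<iota> g)) c c p u) (differential M M (act (\<iota> g)) c c p v) = bil N (\<omega> c p) u v"
        using c pg uv unfolding preserves_tensor_def by blast
      then show ?thesis
        unfolding pg(4) \<alpha>_differential[OF c pg(1,2)] \<alpha>_cat[OF c pg(1,2)] lft_cat[OF cR[OF pg(1)]] w_eq[OF c pg(3)] w_eq[OF c pg(1)] .
    qed
    show "\<alpha> c (cat N (\<alpha> c (cat N x y)) y') = \<alpha> c (cat N x (\<mu> (cat n y y')))"
      if x: "x \<in> U c" and y: "y \<in> Rn n" "y' \<in> Rn n" and S1: "cat N x y \<in> S c" and Q1: "cat n y y' \<in> Q"
        and S2: "cat N x (\<mu> (cat n y y')) \<in> S c" and S3: "cat N (\<alpha> c (cat N x y)) y' \<in> S c" for x y y'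
    proof -
      obtain p where p: "p \<in> fst c" "x = snd c p" using x by blast
      obtain g h where gh: "g \<in> fst e" "h \<in> fst e" "g \<otimes>\<^bsub>G\<^esub> h \<in> fst e" "cat n y y' = cat n (snd e g) (snd e h)"
        using Q1 Q_iff by blast
      have yy: "y = snd e g" "y' = snd e h" using gh(4) cat_eq_iff[OF y(1) eR[OF gh(1)]] by auto
      obtain p' g' where pg: "p' \<in> fst c" "g' \<in> fst e" "act (\<iota> g') p' \<in> fst c" "cat N x y = cat N (snd c p') (snd e g')"
        using S1 S_iff[OF c] by blast
      have "x = snd c p'" "y = snd e g'" using pg(4) p cat_eq_iff[OF cR[OF p(1)] cR[OF pg(1)]] by auto
      \<comment> \<open>Charts are injective, so the points obtained from membership in
        \<open>S c\<close> are those obtained from x and from \<open>Q\<close>.\<close>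
      then have "p = p'" "g = g'" using p pg yy gh inj_onD[OF chart_inj[OF cM c]] inj_onD[OF chart_inj[OF cG e(1)]] by metis+
      then have a1: "act (\<iota> g) p \<in> fst c" using pg by simp
      have "act (\<iota> (g \<otimes>\<^bsub>G\<^esub> h)) p = act (\<iota> h) (act (\<iota> g) p)"
        using \<iota>_mult[OF e_carrier[OF gh(1)] e_carrier[OF gh(2)]] act_mult \<iota>_closed e_carrier gh c_mem[OF c p(1)] by simp
      then show ?thesis
        unfolding p(2) yy \<mu>_cat[OF gh(1,2)] \<alpha>_cat[OF c p(1) gh(1)] \<alpha>_cat[OF c p(1) gh(3)] \<alpha>_cat[OF c a1 gh(2)] by simp
    qed
  qed
qed

end

section \<open>The Gram determinant on the manifold and its behaviour under the group\<close>

context orbit_setting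
begin

definition gm :: "'m chart \<Rightarrow> 'm \<Rightarrow> (nat \<Rightarrow> real) \<Rightarrow> (nat \<Rightarrow> real) \<Rightarrow> real" where
  "gm c p u v = bil N (kaehler_metric M \<omega> c p) u v"

text \<open>The fundamental vector of v at p in components of c. It agrees with \<open>Xf\<close> on
  basis vectors by \<open>Xf_xi\<close>, but the definition through the orbit map makes naturality
  under maps of M a matter of the chain rule.\<close>

definition xv :: "'m chart \<Rightarrow> 'm \<Rightarrow> (nat \<Rightarrow> real) \<Rightarrow> nat \<Rightarrow> real" where
  "xv c p v = differential XG M (\<lambda>g. act (\<iota> g) p) e c \<one>\<^bsub>G\<^esub> v"

abbreviation "xi c p a \<equiv> xv c p (unit_vec a)"

definition fr :: "'m chart \<Rightarrow> 'm \<Rightarrow> nat \<Rightarrow> nat \<Rightarrow> real" where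
  "fr c p i = (if i < n then xi c p i else J (xi c p (i - n)))"

text \<open>The determinant D of the overview. Its size is n + n and not N, because the equality of
  the two is proved later, with the help of this determinant.\<close>

definition gram :: "'m chart \<Rightarrow> 'm \<Rightarrow> real" where
  "gram c p = dt (n + n) (\<lambda>\<alpha> \<beta>. gm c p (fr c p \<alpha>) (fr c p \<beta>))"

lemma xv_Rn: "xv c p v \<in> Rn N"
  unfolding xv_def by (rule differential_Rn)

lemma fr_Rn: "fr c p i \<in> Rn N"
  using xv_Rn J_Rn[OF evN] by (simp add: fr_def)

lemma xv_sum: assumes "v \<in> Rn n" shows "xv c p v = (\<lambda>k. \<Sum>a<n. v a * xi c p a k)"
  using differential_lin[where A = "{..<n}" and a = v and u = unit_vec and X = XG and Y = M and c = e and d = c] Rn_expand[OF assms] unfolding xv_def by simp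

lemma gm_chart: "c \<in> atlas M \<Longrightarrow> p \<in> fst c \<Longrightarrow> gm c p u v = bil N (gc c (snd c p)) u v"
  unfolding gm_def gc_eq by (simp add: in_coords_def chart_inv_left[OF cM])

lemma gm_\<omega>: "c \<in> atlas M \<Longrightarrow> p \<in> fst c \<Longrightarrow> u \<in> Rn N \<Longrightarrow> v \<in> Rn N \<Longrightarrow> gm c p u v = bil N (\<omega> c p) u (J v)"
  using kaehler_chart.G_w[OF kaehler_chart] w_eq by (simp add: gm_chart)

lemma gm_pos: "c \<in> atlas M \<Longrightarrow> p \<in> fst c \<Longrightarrow> u \<in> Rn N \<Longrightarrow> u \<noteq> (\<lambda>_. 0) \<Longrightarrow> gm c p u u > 0"
  using kaehler_chart.G_pos[OF kaehler_chart] by (simp add: gm_chart)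

text \<open>The metric is \<omega>(u, J v), so a map that preserves \<omega> and commutes with J is
  an isometry.\<close>

lemma metric_pullback:
  assumes F: "holomorphic_map M M F" "preserves_tensor M \<omega> F" and c: "c \<in> atlas M" "p \<in> fst c" and c': "c' \<in> atlas M" "F p \<in> fst c'"
    and u: "u \<in> Rn N" and v: "v \<in> Rn N"
  shows "gm c' (F p) (differential M M F c c' p u) (differential M M F c c' p v) = gm c p u v"
proof -
  have "J (differential M M F c c' p v) = differential M M F c c' p (J v)"
    using F(1) c c' v by (simp add: holomorphic_map_def commutes_with_J_def)
  then have "gm c' (F p) (differential M M F c c' p u) (differential M M F c c' p v)
      = bil N (\<omega> c' (F p)) (differential M M F c c' p u) (differential M M F c c' p (J v))"
    by (simp add: gm_\<omega>[OF c' differential_Rn differential_Rn])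
  also have "\<dots> = bil N (\<omega> c p) u (J v)"
    using F(2) c c' u J_Rn[OF evN v] by (simp add: preserves_tensor_def)
  finally show ?thesis by (simp add: gm_\<omega>[OF c u v])
qed

lemma id_isometry: "holomorphic_map M M (\<lambda>p. p)" "preserves_tensor M \<omega> (\<lambda>p. p)"
  using holomorphic_map_id[OF M_complex] kaehler by (auto simp: kaehler_form_def closed_2form_def)

lemma act_isometry: "g \<in> carrier G \<Longrightarrow> holomorphic_map M M (act (\<iota> g))" "g \<in> carrier G \<Longrightarrow> preserves_tensor M \<omega> (act (\<iota> g))"
  using act_map_hol[OF \<iota>_closed] invariant by (auto simp: invariant_form_def)

definition block :: "(nat \<Rightarrow> nat \<Rightarrow> real) \<Rightarrow> nat \<Rightarrow> nat \<Rightarrow> real" where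
  "block K i j = (if i < n \<and> j < n then K i j else if \<not> i < n \<and> \<not> j < n then K (i - n) (j - n) else 0)"

text \<open>An isometry carries the frame at p to the frame at its image up to the matrix K, which
  acts in the same way on the X half and, by holomorphy, on the JX half. Used with the identity map
  for changes of charts and with a group element for equivariance.\<close>

lemma gram_pullback:
  assumes F: "holomorphic_map M M F" "preserves_tensor M \<omega> F" and c: "c \<in> atlas M" "p \<in> fst c" and c': "c' \<in> atlas M" "F p \<in> fst c'"
    and K: "\<And>a. a < n \<Longrightarrow> xi c' (F p) a = differential M M F c c' p (\<lambda>k. \<Sum>b<n. K b a * xi c p b k)"
  shows "gram c' (F p) = (dt (n + n) (block K))\<^sup>2 * gram c p"
proof -
  let ?D = "differential M M F c c' p"
  define Gr where "Gr \<alpha> \<beta> = gm c p (fr c p \<alpha>) (fr c p \<beta>)" for \<alpha> \<beta>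
  define h where "h \<alpha> = (\<lambda>k. \<Sum>\<gamma><n + n. block K \<gamma> \<alpha> * fr c p \<gamma> k)" for \<alpha>
  have hR: "h \<alpha> \<in> Rn N" for \<alpha> unfolding h_def by (rule Rn_sum[OF fr_Rn])
  have fr': "fr c' (F p) \<alpha> = ?D (h \<alpha>)" if \<alpha>: "\<alpha> < n + n" for \<alpha>
  proof (cases "\<alpha> < n")
    case True
    then have "h \<alpha> = (\<lambda>k. \<Sum>b<n. K b \<alpha> * xi c p b k)"
      unfolding h_def sum_lessThan_add by (simp add: block_def fr_def)
    then show ?thesis using True K by (simp add: fr_def)
  next
    case False
    let ?a = "\<alpha> - n"
    have a: "?a < n" using False \<alpha> by simp
    have "h \<alpha> = (\<lambda>k. \<Sum>b<n. K b ?a * J (xi c p b) k)"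
      unfolding h_def sum_lessThan_add using False by (simp add: block_def fr_def)
    also have "\<dots> = J (\<lambda>k. \<Sum>b<n. K b ?a * xi c p b k)" by (rule J_lin[symmetric])
    finally have "?D (h \<alpha>) = J (?D (\<lambda>k. \<Sum>b<n. K b ?a * xi c p b k))"
      using F(1) c c' Rn_sum[where A = "{..<n}" and f = "xi c p", OF xv_Rn] by (simp add: holomorphic_map_def commutes_with_J_def)
    then show ?thesis using False K[OF a] by (simp add: fr_def)
  qed
  have "gram c' (F p) = dt (n + n) (\<lambda>\<alpha> \<beta>. bil (n + n) Gr (\<lambda>\<gamma>. block K \<gamma> \<alpha>) (\<lambda>\<gamma>. block K \<gamma> \<beta>))"
    unfolding gram_def
  proof (rule dt_cong)
    fix \<alpha> \<beta> assume ab: "\<alpha> < n + n" "\<beta> < n + n"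
    have "gm c' (F p) (fr c' (F p) \<alpha>) (fr c' (F p) \<beta>) = gm c p (h \<alpha>) (h \<beta>)"
      unfolding fr'[OF ab(1)] fr'[OF ab(2)] by (rule metric_pullback[OF F c c' hR hR])
    also have "\<dots> = bil (n + n) Gr (\<lambda>\<gamma>. block K \<gamma> \<alpha>) (\<lambda>\<gamma>. block K \<gamma> \<beta>)"
      unfolding h_def gm_def bil_lin1 unfolding bil_lin2 Gr_def gm_def bil_def[of "n + n"] by (simp add: sum_distrib_left mult_ac)
    finally show "gm c' (F p) (fr c' (F p) \<alpha>) (fr c' (F p) \<beta>) = bil (n + n) Gr (\<lambda>\<gamma>. block K \<gamma> \<alpha>) (\<lambda>\<gamma>. block K \<gamma> \<beta>)" .
  qed
  also have "\<dots> = dt (n + n) Gr * (dt (n + n) (\<lambda>i \<alpha>. block K i \<alpha>))\<^sup>2"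
    by (rule frame_gram_dt)
  finally show ?thesis by (simp add: gram_def Gr_def[abs_def])
qed

lemma xv_chart:
  assumes c: "c \<in> atlas M" "p \<in> fst c" and c': "c' \<in> atlas M" "p \<in> fst c'"
  shows "xv c' p v = differential M M (\<lambda>p. p) c c' p (xv c p v)"
proof -
  have p: "p \<in> A" using c c_mem by blast
  have 1: "act (\<iota> \<one>\<^bsub>G\<^esub>) p = p" using p act_one \<iota>_one by simp
  show ?thesis
    unfolding xv_def using differential_compose[OF cG cM cM orbit_map_smooth[OF p] smooth_map_id[OF M_smooth] e c(1) _ c'(1)] 1 c c' by simp
qed

lemma gram_chart:
  assumes c: "c \<in> atlas M" "p \<in> fst c" and c': "c' \<in> atlas M" "p \<in> fst c'"
  shows "gram c' p = gram c p"
proof -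
  let ?K = "\<lambda>b a. if b = a then 1 else (0::real)"
  have "gram c' p = (dt (n + n) (block ?K))\<^sup>2 * gram c p"
  proof (rule gram_pullback[OF id_isometry c c'])
    fix a assume "a < n"
    then have "(\<lambda>k. \<Sum>b<n. ?K b a * xi c p b k) = xi c p a"
      using sum_delta_right[of a n "\<lambda>b. xi c p b k" for k] by (simp add: mult.commute)
    then show "xi c' p a = differential M M (\<lambda>p. p) c c' p (\<lambda>k. \<Sum>b<n. ?K b a * xi c p b k)"
      using xv_chart[OF c c'] by simp
  qed
  moreover have "dt (n + n) (block ?K) = dt (n + n) (\<lambda>i j. if i = j then 1 else 0)"
    by (rule dt_cong) (auto simp: block_def)
  ultimately show ?thesis by (simp add: dt_id)
qed

text \<open>For a right action, acting by g and then by h is acting by g h g^-1 and then by g. Hence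
  the fundamental field of v at the moved point is the image of the one of Ad(g) v at p.\<close>

lemma xv_act:
  assumes g: "g \<in> carrier G" and c: "c \<in> atlas M" "p \<in> fst c" and c': "c' \<in> atlas M" "act (\<iota> g) p \<in> fst c'"
  defines "Ad \<equiv> differential XG XG (\<lambda>h. g \<otimes>\<^bsub>G\<^esub> h \<otimes>\<^bsub>G\<^esub> inv\<^bsub>G\<^esub> g) e e \<one>\<^bsub>G\<^esub>"
  shows "xv c' (act (\<iota> g) p) v = differential M M (act (\<iota> g)) c c' p (xv c p (Ad v))"
proof -
  interpret GG: group G by (rule G_group)
  have p: "p \<in> A" using c c_mem by blast
  let ?conj = "\<lambda>h. g \<otimes>\<^bsub>G\<^esub> h \<otimes>\<^bsub>G\<^esub> inv\<^bsub>G\<^esub> g"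
  have ig: "inv\<^bsub>G\<^esub> g \<in> carrier G" using g by simp
  have sconj: "smooth_map XG XG ?conj"
    by (rule smooth_map_compose[OF cG cG cG left_mult_smooth[OF g] right_mult_smooth[OF ig]])
  have c1: "?conj \<one>\<^bsub>G\<^esub> = \<one>\<^bsub>G\<^esub>" using g by simp
  have s1: "smooth_map XG M (\<lambda>h. act (\<iota> (?conj h)) p)"
    by (rule smooth_map_compose[OF cG cG cM sconj orbit_map_smooth[OF p]])
  have sF: "smooth_map M M (act (\<iota> g))" using act_isometry(1)[OF g] by (simp add: holomorphic_map_def)
  have a1: "act (\<iota> \<one>\<^bsub>G\<^esub>) p = p" using p act_one \<iota>_one by simp
  have "xv c' (act (\<iota> g) p) v = differential XG M (\<lambda>h. act (\<iota> g) (act (\<iota> (?conj h)) p)) e c' \<one>\<^bsub>G\<^esub> v"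
    unfolding xv_def
  proof (rule differential_cong[OF cG e])
    fix h assume "h \<in> topspace (mtop XG)"
    then have h: "h \<in> carrier G" using G_top by simp
    have "?conj h \<otimes>\<^bsub>G\<^esub> g = g \<otimes>\<^bsub>G\<^esub> h" using g h by (simp add: GG.m_assoc)
    then show "act (\<iota> h) (act (\<iota> g) p) = act (\<iota> g) (act (\<iota> (?conj h)) p)"
      using act_mult[OF \<iota>_closed \<iota>_closed p] \<iota>_mult g h by (metis GG.m_closed ig)
  qed
  also have "\<dots> = differential M M (act (\<iota> g)) c c' p (differential XG M (\<lambda>h. act (\<iota> (?conj h)) p) e c \<one>\<^bsub>G\<^esub> v)"
    using differential_compose[OF cG cM cM s1 sF e c(1) _ c'(1)] c c' c1 a1 by simp
  also have "differential XG M (\<lambda>h. act (\<iota> (?conj h)) p) e c \<one>\<^bsub>G\<^esub> v = xv c p (Ad v)"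
    unfolding xv_def Ad_def using differential_compose[OF cG cG cM sconj orbit_map_smooth[OF p] e e(1) _ c(1)] c c1 a1 e by simp
  finally show ?thesis .
qed

text \<open>By \<open>gram_chart\<close> the value is the same in every chart around p, so the
  choice defines a function on M.\<close>

definition gramM :: "'m \<Rightarrow> real" where
  "gramM p = gram (SOME c. c \<in> atlas M \<and> p \<in> fst c) p"

lemma gramM_chart: "c \<in> atlas M \<Longrightarrow> p \<in> fst c \<Longrightarrow> gramM p = gram c p"
  unfolding gramM_def using someI[of "\<lambda>c. c \<in> atlas M \<and> p \<in> fst c" c] gram_chart by blast

text \<open>The factor is the squared determinant of Ad(g) acting on both halves of the frame, which
  does not involve the point.\<close>

lemma gramM_act:
  assumes g: "g \<in> carrier G"
  obtains l where "\<And>p. p \<in> A \<Longrightarrow> gramM (act (\<iota> g) p) = l * gramM p"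
proof -
  define Ad where "Ad = differential XG XG (\<lambda>h. g \<otimes>\<^bsub>G\<^esub> h \<otimes>\<^bsub>G\<^esub> inv\<^bsub>G\<^esub> g) e e \<one>\<^bsub>G\<^esub>"
  define K where "K b a = Ad (unit_vec a) b" for a b
  show thesis
  proof (rule that[of "(dt (n + n) (block K))\<^sup>2"])
    fix p assume p: "p \<in> A"
    obtain c where c: "c \<in> atlas M" "p \<in> fst c" using p charted_cover[OF cM] by blast
    have "act (\<iota> g) p \<in> A" using act_closed \<iota>_closed g p by blast
    then obtain c' where c': "c' \<in> atlas M" "act (\<iota> g) p \<in> fst c'" using charted_cover[OF cM] by blast
    have "gram c' (act (\<iota> g) p) = (dt (n + n) (block K))\<^sup>2 * gram c p"
    proof (rule gram_pullback[OF act_isometry[OF g] c c'])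
      fix a assume "a < n"
      have "Ad (unit_vec a) \<in> Rn n" unfolding Ad_def by (rule differential_Rn)
      then have "xv c p (Ad (unit_vec a)) = (\<lambda>k. \<Sum>b<n. K b a * xi c p b k)" unfolding K_def by (rule xv_sum)
      then show "xi c' (act (\<iota> g) p) a = differential M M (act (\<iota> g)) c c' p (\<lambda>k. \<Sum>b<n. K b a * xi c p b k)"
        using xv_act[OF g c c', of "unit_vec a"] by (simp add: Ad_def)
    qed
    then show "gramM (act (\<iota> g) p) = (dt (n + n) (block K))\<^sup>2 * gramM p"
      using gramM_chart c c' by simp
  qed
qed

lemma Xf_xi: "c \<in> atlas M \<Longrightarrow> p \<in> fst c \<Longrightarrow> a < n \<Longrightarrow> local_isometries.Xf N y0 (\<alpha> c) a (snd c p) = xi c p a"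
proof
  fix k assume c: "c \<in> atlas M" "p \<in> fst c" and a: "a < n"
  have "pd (N + a) (\<lambda>z. \<alpha> c z k) (cat N (snd c p) y0) = pd a (\<lambda>y. \<alpha> c (cat N (snd c p) y) k) y0"
    by (rule pd_cat_right[symmetric, where f = "\<lambda>z. \<alpha> c z k"])
  also have "\<dots> = pd a (\<lambda>y. snd c (act (\<iota> (chart_inv e y)) p) k) y0"
  proof (rule pd_cong[OF chart_image_open[OF cG e(1)] _ _ a])
    fix y assume "y \<in> snd e ` fst e"
    then obtain g where "g \<in> fst e" "y = snd e g" by blast
    then show "\<alpha> c (cat N (snd c p) y) k = snd c (act (\<iota> (chart_inv e y)) p) k"
      using \<alpha>_cat[OF c] chart_inv_left[OF cG e(1)] by simp
  qed (use e in auto)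
  finally show "local_isometries.Xf N y0 (\<alpha> c) a (snd c p) k = xi c p a k"
    unfolding local_isometries.Xf_def[OF local_isometries[OF c(1)]] xv_def differential_alt dd_unit[OF a] by simp
qed

end

section \<open>Constant linear combinations of holomorphic and Killing fields\<close>

context kaehler_chart
begin

lemma field_on_sum:
  assumes "\<And>a. a \<in> B \<Longrightarrow> field_on (X a)"
  shows "field_on (\<lambda>x k. \<Sum>a\<in>B. v a * X a x k)"
  using assms unfolding field_on_def
  by (auto intro!: smooth_on_sum[OF U] smooth_on_cmult Rn_sum)

lemma vd_sum:
  assumes X: "\<And>a. a \<in> B \<Longrightarrow> field_on (X a)" and x: "x \<in> U"
  shows "vd N (\<lambda>x k. \<Sum>a\<in>B. v a * X a x k) x u = (\<lambda>k. \<Sum>a\<in>B. v a * vd N (X a) x u k)"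
proof
  fix k
  show "vd N (\<lambda>x k. \<Sum>a\<in>B. v a * X a x k) x u k = (\<Sum>a\<in>B. v a * vd N (X a) x u k)"
  proof (cases "k < N")
    case True
    have "dd N (\<lambda>y. \<Sum>a\<in>B. v a * X a y k) x u = (\<Sum>a\<in>B. dd N (\<lambda>y. v a * X a y k) x u)"
      by (rule dd_sum[OF _ x]) (intro smooth_on_cmult field_onD(1)[OF X True])
    also have "\<dots> = (\<Sum>a\<in>B. v a * dd N (\<lambda>y. X a y k) x u)"
      by (intro sum.cong refl dd_cmult[OF field_onD(1)[OF X True] x])
    finally show ?thesis using True by (simp add: vd_def)
  qed (simp add: vd_def)
qed

lemma holomorphic_field_sum:
  assumes X: "\<And>a. a \<in> B \<Longrightarrow> holomorphic_field (X a)"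
  shows "holomorphic_field (\<lambda>x k. \<Sum>a\<in>B. v a * X a x k)"
proof -
  have f: "field_on (X a)" if "a \<in> B" for a using X[OF that] by (simp add: holomorphic_field_def)
  show ?thesis unfolding holomorphic_field_def
  proof (intro conjI ballI field_on_sum f)
    fix x u assume x: "x \<in> U" and u: "u \<in> Rn N"
    have vs: "vd N (\<lambda>x k. \<Sum>a\<in>B. v a * X a x k) x u = (\<lambda>k. \<Sum>a\<in>B. v a * vd N (X a) x u k)" for u
      by (rule vd_sum[OF f x])
    have "vd N (X a) x (J u) = J (vd N (X a) x u)" if "a \<in> B" for a
      using X[OF that] x u by (simp add: holomorphic_field_def)
    then show "vd N (\<lambda>x k. \<Sum>a\<in>B. v a * X a x k) x (J u) = J (vd N (\<lambda>x k. \<Sum>a\<in>B. v a * X a x k) x u)"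
      unfolding vs J_lin by simp
  qed
qed

lemma killing_field_sum:
  assumes X: "\<And>a. a \<in> B \<Longrightarrow> killing_field (X a)"
  shows "killing_field (\<lambda>x k. \<Sum>a\<in>B. v a * X a x k)"
proof -
  have f: "field_on (X a)" if "a \<in> B" for a using X[OF that] by (simp add: killing_field_def)
  show ?thesis unfolding killing_field_def
  proof (intro conjI ballI field_on_sum f)
    fix x p q assume x: "x \<in> U" and p: "p \<in> Rn N" and q: "q \<in> Rn N"
    have vs: "vd N (\<lambda>x k. \<Sum>a\<in>B. v a * X a x k) x u = (\<lambda>k. \<Sum>a\<in>B. v a * vd N (X a) x u k)" for u
      by (rule vd_sum[OF f x])
    have "dd N (\<lambda>y. G y p q) x (\<lambda>k. \<Sum>a\<in>B. v a * X a x k) + G x (vd N (\<lambda>x k. \<Sum>a\<in>B. v a * X a x k) x p) q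
        + G x p (vd N (\<lambda>x k. \<Sum>a\<in>B. v a * X a x k) x q)
       = (\<Sum>a\<in>B. v a * (dd N (\<lambda>y. G y p q) x (X a x) + G x (vd N (X a) x p) q + G x p (vd N (X a) x q)))"
      unfolding vs bil_lin1 bil_lin2 dd_lin by (simp add: distrib_left sum.distrib)
    also have "\<dots> = 0"
      by (intro sum.neutral ballI) (use X x p q in \<open>simp add: killing_field_def\<close>)
    finally show "dd N (\<lambda>y. G y p q) x (\<lambda>k. \<Sum>a\<in>B. v a * X a x k) + G x (vd N (\<lambda>x k. \<Sum>a\<in>B. v a * X a x k) x p) q
        + G x p (vd N (\<lambda>x k. \<Sum>a\<in>B. v a * X a x k) x q) = 0" .
  qed
qed

lemma dv_sum:
  assumes X: "\<And>a. a \<in> B \<Longrightarrow> field_on (X a)" and x: "x \<in> U"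
  shows "dv (\<lambda>x k. \<Sum>a\<in>B. v a * X a x k) x = (\<Sum>a\<in>B. v a * dv (X a) x)"
proof -
    have vs: "vd N (\<lambda>x k. \<Sum>a\<in>B. v a * X a x k) x u = (\<lambda>k. \<Sum>a\<in>B. v a * vd N (X a) x u k)" for u
      by (rule vd_sum[OF X x])
  have "tr N (vd N (\<lambda>x k. \<Sum>a\<in>B. v a * X a x k) x) = (\<Sum>a\<in>B. v a * tr N (vd N (X a) x))"
    unfolding tr_def vs by (subst sum.swap) (simp add: sum_distrib_left)
  then show ?thesis unfolding dv_def th_lin by (simp add: distrib_left sum.distrib)
qed

end

context local_isometries
begin

text \<open>Holomorphy gives [JX_c, X_a] = J [X_c, X_a] and [JX_c, JX_a] = - [X_c, X_a]; both are
  combinations of the opposite half of the frame.\<close>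

lemma gram_derivative_basis:
  assumes x: "x \<in> U" and N: "N = n + n" and c: "c < n"
  defines "f \<equiv> \<lambda>i y. if i < n then Xf i y else J (Xf (i - n) y)"
  assumes nz: "dt N (\<lambda>i j. G x (f i x) (f j x)) \<noteq> 0"
  shows "dd N (\<lambda>y. dt N (\<lambda>i j. G y (f i y) (f j y))) x (J (Xf c x)) = 2 * dv (\<lambda>y. J (Xf c y)) x * dt N (\<lambda>i j. G x (f i x) (f j x))"
proof -
  define \<kappa> where "\<kappa> a b = structure_const c a b - structure_const a c b" for a b
  \<comment> \<open>Only the off-diagonal blocks are nonzero, so the trace required by
    \<open>gram_derivative\<close> vanishes whatever the structure constants are.\<close>
  define C where "C i j = (if i < n \<and> \<not> j < n then \<kappa> i (j - n) else if \<not> i < n \<and> j < n then - \<kappa> (i - n) j else 0)" for i j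
  let ?V = "\<lambda>y. J (Xf c y)"
  have sN: "(\<Sum>i<N. F i) = (\<Sum>i<n. F i) + (\<Sum>i<n. F (n + i))" for F :: "nat \<Rightarrow> real"
    by (simp only: N sum_lessThan_add)
  have XR: "Xf a x \<in> Rn N" for a by (simp add: Xf_def Rn_iff)
  have h: "vd N (Xf a) x (J u) = J (vd N (Xf a) x u)" if "a < n" "u \<in> Rn N" for a u
    using Xf_holomorphic[OF that(1)] x that(2) by (simp add: holomorphic_field_def)
  have br: "vd N (Xf a) x (Xf c x) = (\<lambda>k. vd N (Xf c) x (Xf a x) k + (\<Sum>b<n. \<kappa> a b * Xf b x k))" if "a < n" for a
    unfolding \<kappa>_def by (rule Xf_bracket[OF x c that])
  have sumJ: "J (\<lambda>k. \<Sum>b<n. \<kappa> a b * Xf b x k) = (\<lambda>k. \<Sum>b<n. \<kappa> a b * J (Xf b x) k)" for a by (rule J_lin)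
  show ?thesis
  proof (rule gram_derivative[where f = f and V = ?V and C = C, OF x _ field_on_J[OF Xf_field[OF c]] nz])
    show "field_on (f i)" if "i < N" for i
    proof (cases "i < n")
      case True
      then show ?thesis using Xf_field by (simp add: f_def)
    next
      case False
      then have "i - n < n" using that N by simp
      then show ?thesis using False field_on_J[OF Xf_field] by (simp add: f_def)
    qed
    show "(\<Sum>i<N. C i i) = 0" by (simp add: C_def)
    fix i assume i: "i < N"
    show "vd N (f i) x (?V x) = (\<lambda>k. vd N ?V x (f i x) k + (\<Sum>j<N. C i j * f j x k))"
    proof (cases "i < n")
      case True
      have "vd N (f i) x (?V x) = J (vd N (Xf i) x (Xf c x))" using True h[OF True XR] by (simp add: f_def)
      also have "\<dots> = (\<lambda>k. J (vd N (Xf c) x (Xf i x)) k + (\<Sum>b<n. \<kappa> i b * J (Xf b x) k))"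
        unfolding br[OF True] J_add sumJ ..
      also have "J (vd N (Xf c) x (Xf i x)) = vd N ?V x (f i x)"
        using True by (simp add: f_def vd_J_field[OF Xf_field[OF c] x])
      also have "(\<lambda>k. vd N ?V x (f i x) k + (\<Sum>b<n. \<kappa> i b * J (Xf b x) k)) = (\<lambda>k. vd N ?V x (f i x) k + (\<Sum>j<N. C i j * f j x k))"
        unfolding sN using True by (simp add: C_def f_def)
      finally show ?thesis .
    next
      case False
      define a where "a = i - n"
      have a: "a < n" using False i N by (simp add: a_def)
      have fi: "f i = (\<lambda>y. J (Xf a y))" using False by (simp add: f_def a_def)
      have "vd N (f i) x (?V x) = (\<lambda>k. - vd N (Xf a) x (Xf c x) k)"
        unfolding fi vd_J_field[OF Xf_field[OF a] x] h[OF a XR] J_J ..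
      also have "\<dots> = (\<lambda>k. - vd N (Xf c) x (Xf a x) k - (\<Sum>b<n. \<kappa> a b * Xf b x k))"
        unfolding br[OF a] by simp
      also have "(\<lambda>k. - vd N (Xf c) x (Xf a x) k) = vd N ?V x (f i x)"
        unfolding fi vd_J_field[OF Xf_field[OF c] x] h[OF c XR] J_J ..
      then have "(\<lambda>k. - vd N (Xf c) x (Xf a x) k - (\<Sum>b<n. \<kappa> a b * Xf b x k))
          = (\<lambda>k. vd N ?V x (f i x) k - (\<Sum>b<n. \<kappa> a b * Xf b x k))" by (simp add: fun_eq_iff)
      also have "\<dots> = (\<lambda>k. vd N ?V x (f i x) k + (\<Sum>j<N. C i j * f j x k))"
        unfolding sN using False by (simp add: C_def f_def a_def sum_negf)
      finally show ?thesis .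
    qed
  qed
qed

end

section \<open>The divergence of JX and the derivative of the Gram determinant on the
  manifold\<close>

context orbit_setting
begin

definition XF :: "'m chart \<Rightarrow> (nat \<Rightarrow> real) \<Rightarrow> (nat \<Rightarrow> real) \<Rightarrow> nat \<Rightarrow> real" where
  "XF c v x = (\<lambda>k. \<Sum>a<n. v a * local_isometries.Xf N y0 (\<alpha> c) a x k)"

definition dvJ :: "'m chart \<Rightarrow> (nat \<Rightarrow> real) \<Rightarrow> (nat \<Rightarrow> real) \<Rightarrow> real" where
  "dvJ c v = kaehler_chart.dv N (w c) (\<lambda>y. J (XF c v y))"

lemma XF_xv: "c \<in> atlas M \<Longrightarrow> p \<in> fst c \<Longrightarrow> v \<in> Rn n \<Longrightarrow> XF c v (snd c p) = xv c p v"
  unfolding XF_def xv_sum by (simp add: Xf_xi)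

lemma XF_props:
  assumes c: "c \<in> atlas M"
  shows "kaehler_chart.holomorphic_field N (U c) (XF c v)" and "kaehler_chart.killing_field N (U c) (w c) (XF c v)"
proof -
  interpret local_isometries N "U c" "w c" n y0 "S c" Q "\<alpha> c" \<mu> by (rule local_isometries[OF c])
  show "holomorphic_field (XF c v)" "killing_field (XF c v)"
    unfolding XF_def[abs_def] by (auto intro!: holomorphic_field_sum killing_field_sum Xf_holomorphic Xf_killing)
qed

lemma dvJ_smooth: "c \<in> atlas M \<Longrightarrow> smooth_on N (U c) (dvJ c v)"
proof -
  assume c: "c \<in> atlas M"
  interpret kaehler_chart N "U c" "w c" by (rule kaehler_chart[OF c])
  show ?thesis unfolding dvJ_def
    using dv_smooth field_on_J XF_props(1)[OF c] by (auto simp: holomorphic_field_def)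
qed

lemma dvJ_derivative:
  assumes c: "c \<in> atlas M" and p: "p \<in> fst c" and u: "u \<in> Rn N" and v: "v \<in> Rn n"
  shows "dd N (dvJ c v) (snd c p) u = - 2 * r * gm c p u (J (xv c p v))"
proof -
  interpret kaehler_einstein_chart N "U c" "w c" r by (rule einstein_chart[OF c])
  show ?thesis
    unfolding dvJ_def using dd_dv_J[OF XF_props[OF c] _ u, of "snd c p"] p by (simp add: XF_xv[OF c p v] gm_chart[OF c p])
qed

lemma gram_in_chart:
  assumes c: "c \<in> atlas M" and y: "y \<in> U c"
  shows "gram c (chart_inv c y) = dt (n + n) (\<lambda>i j. bil N (gc c y)
    (if i < n then local_isometries.Xf N y0 (\<alpha> c) i y else J (local_isometries.Xf N y0 (\<alpha> c) (i - n) y))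
    (if j < n then local_isometries.Xf N y0 (\<alpha> c) j y else J (local_isometries.Xf N y0 (\<alpha> c) (j - n) y)))"
proof -
  obtain p where p: "p \<in> fst c" "y = snd c p" using y by blast
  have "i - n < n" if "i < n + n" "\<not> i < n" for i using that by simp
  then show ?thesis unfolding gram_def p(2) chart_inv_left[OF cM c p(1)]
    by (intro dt_cong) (simp add: gm_chart[OF c p(1)] fr_def Xf_xi[OF c p(1)])
qed

lemma gram_smooth: "c \<in> atlas M \<Longrightarrow> smooth_on N (U c) (\<lambda>y. gram c (chart_inv c y))"
proof -
  assume c: "c \<in> atlas M"
  interpret local_isometries N "U c" "w c" n y0 "S c" Q "\<alpha> c" \<mu> by (rule local_isometries[OF c])
  have f: "smooth_on N (U c) (\<lambda>y. (if i < n then Xf i y else J (Xf (i - n) y)) k)" if "i < n + n" "k < N" for i k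
    using Xf_smooth[of i k] field_onD(1)[OF field_on_J[OF Xf_field[of "i - n"]], of k] that by (cases "i < n") auto
  have "smooth_on N (U c) (\<lambda>y. dt (n + n) (\<lambda>i j. bil N (gc c y) (if i < n then Xf i y else J (Xf (i - n) y)) (if j < n then Xf j y else J (Xf (j - n) y))))"
    by (intro smooth_on_dt[OF U] smooth_on_bil[OF U] g_smooth f)
  then show ?thesis by (rule smooth_on_cong) (simp add: gram_in_chart[OF c])
qed

text \<open>Linear extension of \<open>gram_derivative_basis\<close> from the basis to all v. The
  hypothesis N = n + n is discharged later by \<open>dim_M\<close>, whose proof itself goes through
  \<open>gram\<close>.\<close>

lemma gram_derivative_J:
  assumes c: "c \<in> atlas M" and p: "p \<in> fst c" and N: "N = n + n" and nz: "gram c p \<noteq> 0" and v: "v \<in> Rn n"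
  shows "dd N (\<lambda>y. gram c (chart_inv c y)) (snd c p) (J (xv c p v)) = 2 * dvJ c v (snd c p) * gram c p"
proof -
  interpret local_isometries N "U c" "w c" n y0 "S c" Q "\<alpha> c" \<mu> by (rule local_isometries[OF c])
  let ?f = "\<lambda>i y. if i < n then Xf i y else J (Xf (i - n) y)"
  let ?D = "\<lambda>y. dt (n + n) (\<lambda>i j. bil N (gc c y) (?f i y) (?f j y))"
  have x: "snd c p \<in> U c" using p by simp
  have gp: "?D (snd c p) = gram c p" using gram_in_chart[OF c x] chart_inv_left[OF cM c p] by simp
  have b: "dd N (\<lambda>y. gram c (chart_inv c y)) (snd c p) (J (Xf a (snd c p))) = 2 * dv (\<lambda>y. J (Xf a y)) (snd c p) * gram c p" if a: "a < n" for a
  proof -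
    have "dd N (\<lambda>y. gram c (chart_inv c y)) (snd c p) (J (Xf a (snd c p))) = dd N ?D (snd c p) (J (Xf a (snd c p)))"
      by (rule dd_cong[OF U gram_in_chart[OF c] x])
    then show ?thesis using gram_derivative_basis[OF x N a] gp nz N by simp
  qed
  have "J (xv c p v) = (\<lambda>k. \<Sum>a<n. v a * J (Xf a (snd c p)) k)"
    unfolding XF_xv[OF c p v, symmetric] XF_def by (rule J_lin)
  moreover have "dvJ c v (snd c p) = (\<Sum>a<n. v a * dv (\<lambda>y. J (Xf a y)) (snd c p))"
    unfolding dvJ_def XF_def J_lin by (rule dv_sum[OF _ x]) (use field_on_J[OF Xf_field] in auto)
  ultimately show ?thesis
    by (simp add: dd_lin b sum_distrib_left sum_distrib_right mult_ac)
qed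

end

section \<open>Immersions and one-parameter subgroups\<close>

text \<open>With s the product of the transpose of a with a, injectivity makes s invertible, since s
  v = 0 forces a v to have square sum zero; s^-1 times the transpose of a is then a left
  inverse.\<close>

lemma left_inverse_exists:
  fixes a :: "nat \<Rightarrow> nat \<Rightarrow> real"
  assumes ker: "\<And>v. v \<in> Rn k \<Longrightarrow> (\<And>i. i < m \<Longrightarrow> (\<Sum>j<k. a i j * v j) = 0) \<Longrightarrow> v = (\<lambda>_. 0)"
  obtains b where "\<And>v j. j < k \<Longrightarrow> (\<Sum>i<m. b j i * (\<Sum>l<k. a i l * v l)) = v j"
proof -
  define s where "s j l = (\<Sum>i<m. a i j * a i l)" for j l
  have sv: "(\<Sum>l<k. s j l * v l) = (\<Sum>i<m. a i j * (\<Sum>l<k. a i l * v l))" for v j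
    unfolding s_def by (rule sum_mult_assoc)
  have nz: "dt k s \<noteq> 0" unfolding dt_nonzero_iff
  proof (intro ballI impI)
    fix v assume v: "v \<in> Rn k" "\<forall>j<k. (\<Sum>l<k. s j l * v l) = 0"
    have "(\<Sum>i<m. (\<Sum>l<k. a i l * v l)\<^sup>2) = (\<Sum>i<m. (\<Sum>j<k. v j * a i j) * (\<Sum>l<k. a i l * v l))"
      by (simp add: power2_eq_square mult.commute)
    also have "\<dots> = (\<Sum>j<k. v j * (\<Sum>i<m. a i j * (\<Sum>l<k. a i l * v l)))" by (rule sum_mult_assoc)
    also have "\<dots> = 0" using v(2) by (simp add: sv)
    finally have "\<forall>i\<in>{..<m}. (\<Sum>l<k. a i l * v l)\<^sup>2 = 0" by (subst (asm) sum_nonneg_eq_0_iff) auto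
    then show "v = (\<lambda>_. 0)" using ker[OF v(1)] by simp
  qed
  show thesis
  proof (rule that[of "\<lambda>j i. \<Sum>l<k. mat_inv k s j l * a i l"])
    fix v :: "nat \<Rightarrow> real" and j assume j: "j < k"
    have "(\<Sum>i<m. (\<Sum>l<k. mat_inv k s j l * a i l) * (\<Sum>l<k. a i l * v l)) = (\<Sum>l<k. mat_inv k s j l * (\<Sum>l'<k. s l l' * v l'))"
      unfolding sv by (rule sum_mult_assoc)
    also have "\<dots> = (\<Sum>l'<k. (\<Sum>l<k. mat_inv k s j l * s l l') * v l')" by (rule sum_mult_assoc[symmetric])
    also have "\<dots> = (\<Sum>l'<k. (if j = l' then 1 else 0) * v l')" using mat_inv_mult(2)[OF nz j] by (intro sum.cong refl) simp
    also have "\<dots> = v j" by (rule sum_delta_left[OF j])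
    finally show "(\<Sum>i<m. (\<Sum>l<k. mat_inv k s j l * a i l) * (\<Sum>l<k. a i l * v l)) = v j" .
  qed
qed

text \<open>If k exceeded m, padding with zero rows would give a square injective matrix with a zero
  row at index m, contradicting that it has a right inverse.\<close>

lemma injective_imp_dim_le:
  fixes a :: "nat \<Rightarrow> nat \<Rightarrow> real"
  assumes ker: "\<And>v. v \<in> Rn k \<Longrightarrow> (\<And>i. i < m \<Longrightarrow> (\<Sum>j<k. a i j * v j) = 0) \<Longrightarrow> v = (\<lambda>_. 0)"
  shows "k \<le> m"
proof (rule ccontr)
  assume "\<not> k \<le> m"
  define a' where "a' i j = (if i < m then a i j else 0)" for i j
  have nz: "dt k a' \<noteq> 0" unfolding dt_nonzero_iff
  proof (intro ballI impI)
    fix v assume v: "v \<in> Rn k" "\<forall>i<k. (\<Sum>j<k. a' i j * v j) = 0"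
    have "(\<Sum>j<k. a i j * v j) = 0" if "i < m" for i
      using spec[OF v(2), of i] that \<open>\<not> k \<le> m\<close> by (simp add: a'_def)
    then show "v = (\<lambda>_. 0)" using ker v(1) by blast
  qed
  have "(\<Sum>j<k. a' m j * mat_inv k a' j m) = 1" using mat_inv_mult(1)[OF nz, of m m] \<open>\<not> k \<le> m\<close> by simp
  then show False by (simp add: a'_def)
qed

text \<open>A left inverse of the derivative at x bounds y - z by the derivative of f on y - z, and
  strict differentiability replaces the latter by f y - f z up to a small multiple of y - z, which
  is absorbed on the left.\<close>

lemma immersion_bound:
  assumes f: "\<And>i. i < m \<Longrightarrow> smooth_on k W (f i)" and x: "x \<in> W" and W: "openin (Euclidean_space k) W"
    and ker: "\<And>v. v \<in> Rn k \<Longrightarrow> (\<And>i. i < (m::nat) \<Longrightarrow> dd k (f i) x v = 0) \<Longrightarrow> v = (\<lambda>_. 0)"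
  obtains \<delta> C where "\<delta> > 0" "C > 0" "cube k x \<delta> \<subseteq> W"
    "\<And>y z. y \<in> cube k x \<delta> \<Longrightarrow> z \<in> cube k x \<delta> \<Longrightarrow> (\<Sum>j<k. \<bar>y j - z j\<bar>) \<le> C * (\<Sum>i<m. \<bar>f i y - f i z\<bar>)"
proof -
  obtain b where b: "\<And>v j. j < k \<Longrightarrow> (\<Sum>i<m. b j i * (\<Sum>l<k. pd l (f i) x * v l)) = v j"
  proof (rule left_inverse_exists[where k = k and m = m and a = "\<lambda>i l. pd l (f i) x"])
    fix v assume "v \<in> Rn k" "\<And>i. i < m \<Longrightarrow> (\<Sum>j<k. pd j (f i) x * v j) = 0"
    then show "v = (\<lambda>_. 0)" by (intro ker) (auto simp: dd_def)
  qed (rule that)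
  define c where "c = (\<Sum>j<k. \<Sum>i<m. \<bar>b j i\<bar>)"
  have c0: "c \<ge> 0" unfolding c_def by (intro sum_nonneg) auto
  have cb: "(\<Sum>j<k. \<bar>b j i\<bar>) \<le> c" if "i < m" for i
    unfolding c_def using that by (intro sum_mono) (auto intro: member_le_sum)
  \<comment> \<open>Small enough that c m \<epsilon> is at most 1/2, so the error term moves to the
    left side below; the added ones keep the denominator positive.\<close>
  define \<epsilon> where "\<epsilon> = 1 / (2 * (c + 1) * (real m + 1))"
  have e0: "\<epsilon> > 0" using c0 by (simp add: \<epsilon>_def)
  have "\<exists>d>0. \<forall>d'. 0 < d' \<and> d' \<le> d \<longrightarrow> (cube k x d' \<subseteq> W \<and> (\<forall>y\<in>cube k x d'. \<forall>z\<in>cube k x d'.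
       \<bar>f i y - f i z - dd k (f i) x (\<lambda>i. y i - z i)\<bar> \<le> \<epsilon> * (\<Sum>i<k. \<bar>y i - z i\<bar>)))" if "i < m" for i
    using smooth_on_strict[OF f[OF that] x e0] cube_mono[of _ _ k x] by (meson subset_iff)
  then have "\<exists>d>0. \<forall>d'. 0 < d' \<and> d' \<le> d \<longrightarrow> (\<forall>i<m. cube k x d' \<subseteq> W \<and> (\<forall>y\<in>cube k x d'. \<forall>z\<in>cube k x d'.
       \<bar>f i y - f i z - dd k (f i) x (\<lambda>i. y i - z i)\<bar> \<le> \<epsilon> * (\<Sum>i<k. \<bar>y i - z i\<bar>)))"
    by (rule finite_min_pos)
  then obtain d1 where d1: "d1 > 0" and H: "\<forall>d'. 0 < d' \<and> d' \<le> d1 \<longrightarrow> (\<forall>i<m. cube k x d' \<subseteq> W \<and> (\<forall>y\<in>cube k x d'. \<forall>z\<in>cube k x d'.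
       \<bar>f i y - f i z - dd k (f i) x (\<lambda>i. y i - z i)\<bar> \<le> \<epsilon> * (\<Sum>i<k. \<bar>y i - z i\<bar>)))" by (elim exE conjE)
  obtain d2 where d2: "d2 > 0" "cube k x d2 \<subseteq> W" using openin_cubeD[OF W x] by blast
  define \<delta> where "\<delta> = min d1 d2"
  show thesis
  proof (rule that[of \<delta> "2 * c + 1"])
    show "\<delta> > 0" "2 * c + 1 > 0" using d1 d2 c0 by (auto simp: \<delta>_def)
    show "cube k x \<delta> \<subseteq> W" using d2 cube_mono[of \<delta> d2 k x] by (auto simp: \<delta>_def)
    fix y z assume yz: "y \<in> cube k x \<delta>" "z \<in> cube k x \<delta>"
    define s where "s = (\<Sum>j<k. \<bar>y j - z j\<bar>)"
    define F where "F = (\<Sum>i<m. \<bar>f i y - f i z\<bar>)"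
    have s0: "s \<ge> 0" and F0: "F \<ge> 0" unfolding s_def F_def by (auto intro: sum_nonneg)
    have A: "\<bar>dd k (f i) x (\<lambda>i. y i - z i)\<bar> \<le> \<bar>f i y - f i z\<bar> + \<epsilon> * s" if "i < m" for i
    proof -
      have "\<bar>f i y - f i z - dd k (f i) x (\<lambda>i. y i - z i)\<bar> \<le> \<epsilon> * s"
        using spec[OF H, of \<delta>] that yz d1 d2(1) by (simp add: \<delta>_def s_def)
      then show ?thesis by linarith
    qed
    have "s = (\<Sum>j<k. \<bar>\<Sum>i<m. b j i * dd k (f i) x (\<lambda>i. y i - z i)\<bar>)"
      unfolding s_def dd_def using b[of _ "\<lambda>l. y l - z l"] by simp
    also have "\<dots> \<le> (\<Sum>j<k. \<Sum>i<m. \<bar>b j i\<bar> * \<bar>dd k (f i) x (\<lambda>i. y i - z i)\<bar>)"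
      by (intro sum_mono order_trans[OF sum_abs]) (simp add: abs_mult)
    also have "\<dots> = (\<Sum>i<m. (\<Sum>j<k. \<bar>b j i\<bar>) * \<bar>dd k (f i) x (\<lambda>i. y i - z i)\<bar>)"
      by (subst sum.swap) (simp add: sum_distrib_right)
    also have "\<dots> \<le> (\<Sum>i<m. c * (\<bar>f i y - f i z\<bar> + \<epsilon> * s))"
      using A cb c0 by (intro sum_mono mult_mono) (auto intro: sum_nonneg)
    also have "\<dots> = c * F + (c * real m * \<epsilon>) * s"
      unfolding F_def sum_distrib_left[symmetric] by (simp add: sum.distrib algebra_simps)
    also have "(c * real m * \<epsilon>) * s \<le> (1 / 2) * s"
    proof (rule mult_right_mono[OF _ s0])
      have "c * real m \<le> (c + 1) * (real m + 1)" using c0 by (simp add: algebra_simps)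
      then have "c * real m * \<epsilon> \<le> (c + 1) * (real m + 1) * \<epsilon>" using e0 by (intro mult_right_mono) auto
      also have "\<dots> = 1 / 2" using c0 by (simp add: \<epsilon>_def field_simps add_nonneg_eq_0_iff)
      finally show "c * real m * \<epsilon> \<le> 1 / 2" .
    qed
    finally have "s \<le> c * F + (1 / 2) * s" by simp
    then have "s \<le> 2 * c * F" by simp
    also have "\<dots> \<le> (2 * c + 1) * F" using F0 by (simp add: algebra_simps)
    finally show "(\<Sum>j<k. \<bar>y j - z j\<bar>) \<le> (2 * c + 1) * (\<Sum>i<m. \<bar>f i y - f i z\<bar>)" by (simp add: s_def F_def)
  qed
qed

lemma bound_imp_inj:
  assumes "\<And>y z. y \<in> K \<Longrightarrow> z \<in> K \<Longrightarrow> (\<Sum>j<k. \<bar>y j - z j\<bar>) \<le> C * (\<Sum>i<m. \<bar>f i y - f i z\<bar>)"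
    and K: "K \<subseteq> Rn k" and yz: "y \<in> K" "z \<in> K" and e: "\<And>i. i < m \<Longrightarrow> f i y = f i z"
  shows "y = z"
proof -
  have "(\<Sum>j<k. \<bar>y j - z j\<bar>) \<le> C * (\<Sum>i<m. \<bar>f i y - f i z\<bar>)" by (rule assms(1)[OF yz])
  also have "\<dots> = 0" using e by simp
  finally have "(\<Sum>j<k. \<bar>y j - z j\<bar>) = 0" by (intro antisym sum_nonneg) auto
  then have "\<forall>j\<in>{..<k}. \<bar>y j - z j\<bar> = 0" by (subst (asm) sum_nonneg_eq_0_iff) auto
  then have "y j = z j" if "j < k" for j using that by simp
  then show ?thesis using Rn_eqI yz K by blast
qed

text \<open>Along the line x + t v the values of f would change by o(t), while the bound asks for a
  change of at least a multiple of |t|. Thus the two-point estimate, obtained at one point, yields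
  an injective derivative at every point of K.\<close>

lemma bound_imp_kernel:
  assumes f: "\<And>i. i < m \<Longrightarrow> smooth_on k K (f i)" and K: "openin (Euclidean_space k) K" and x: "x \<in> K" and C: "C > 0"
    and bd: "\<And>y z. y \<in> K \<Longrightarrow> z \<in> K \<Longrightarrow> (\<Sum>j<k. \<bar>y j - z j\<bar>) \<le> C * (\<Sum>i<m. \<bar>f i y - f i z\<bar>)"
    and v: "v \<in> Rn k" and z: "\<And>i. i < m \<Longrightarrow> dd k (f i) x v = 0"
  shows "v = (\<lambda>_. 0)"
proof (rule ccontr)
  assume ne: "v \<noteq> (\<lambda>_. 0)"
  let ?\<gamma> = "\<lambda>t::real. \<lambda>j. x j + t * v j"
  have R: "?\<gamma> t \<in> Rn k" for t using v openin_Rn_subset[OF K x] by (simp add: Rn_iff)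
  have "((\<lambda>t. f i (?\<gamma> t)) has_real_derivative dd k (f i) (?\<gamma> 0) v) (at 0)" if "i < m" for i
    by (rule smooth_on_curve_cong[OF f[OF that]]) (use x R in \<open>auto intro!: derivative_eq_intros\<close>)
  then have "((\<lambda>t. (f i (?\<gamma> t) - f i x) / t) \<longlongrightarrow> 0) (at 0)" if "i < m" for i
    using that z by (simp add: has_field_derivative_iff)
  then have "((\<lambda>t. C * (\<Sum>i<m. \<bar>(f i (?\<gamma> t) - f i x) / t\<bar>)) \<longlongrightarrow> C * (\<Sum>i<m. \<bar>0\<bar>)) (at 0)"
    by (intro tendsto_intros) auto
  then have T: "((\<lambda>t. C * (\<Sum>i<m. \<bar>(f i (?\<gamma> t) - f i x) / t\<bar>)) \<longlongrightarrow> 0) (at 0)" by simp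
  define s where "s = (\<Sum>j<k. \<bar>v j\<bar>)"
  obtain j where "v j \<noteq> 0" using ne by auto
  then have "j < k" using v unfolding Rn_iff by (metis not_less)
  then have s: "s > 0" unfolding s_def using \<open>v j \<noteq> 0\<close> by (intro sum_pos2[of _ j]) auto
  have e1: "eventually (\<lambda>t. C * (\<Sum>i<m. \<bar>(f i (?\<gamma> t) - f i x) / t\<bar>) < s) (at 0)"
    by (rule order_tendstoD(2)[OF T s])
  have cont: "continuous_map euclideanreal (Euclidean_space k) ?\<gamma>"
  proof -
    have "continuous_map euclideanreal (Euclidean_space k) (\<lambda>t i. if i < k then ?\<gamma> t i else 0)"
      unfolding continuous_map_componentwise_Euclidean_space by (auto intro!: continuous_intros)
    then show ?thesis by (rule continuous_map_eq) (use R in \<open>force simp: Rn_iff fun_eq_iff\<close>)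
  qed
  have "open {t. ?\<gamma> t \<in> K}" using openin_continuous_map_preimage[OF cont K] by simp
  moreover have "0 \<in> {t. ?\<gamma> t \<in> K}" using x by simp
  ultimately have "eventually (\<lambda>t. t \<in> {t. ?\<gamma> t \<in> K}) (at 0)" by (rule eventually_at_topological[THEN iffD2, OF exI, OF conjI, OF _ conjI]) auto
  then have e2: "eventually (\<lambda>t. ?\<gamma> t \<in> K) (at 0)" by simp
  have e3: "eventually (\<lambda>t. t \<noteq> (0::real)) (at 0)" by (simp add: eventually_neq_at_within)
  have "eventually (\<lambda>t::real. False) (at 0)"
    using e1 e2 e3
  proof eventually_elim
    case (elim t)
    have "(\<Sum>j<k. \<bar>?\<gamma> t j - x j\<bar>) \<le> C * (\<Sum>i<m. \<bar>f i (?\<gamma> t) - f i x\<bar>)" by (rule bd[OF elim(2) x])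
    then have "\<bar>t\<bar> * s \<le> C * (\<Sum>i<m. \<bar>f i (?\<gamma> t) - f i x\<bar>)" by (simp add: s_def abs_mult sum_distrib_left)
    also have "\<dots> = \<bar>t\<bar> * (C * (\<Sum>i<m. \<bar>(f i (?\<gamma> t) - f i x) / t\<bar>))"
      using elim(3) by (simp add: abs_divide sum_divide_distrib[symmetric])
    finally show ?case using elim by simp
  qed
  then show False by simp
qed

text \<open>The set of times at which the curve sits at its starting point is closed, because the
  space is Hausdorff, and open, because coordinates are locally constant; the real line is
  connected.\<close>

lemma chart_kernel_const:
  fixes \<gamma> :: "real \<Rightarrow> 'a"
  assumes X: "charted X" and H: "Hausdorff_space (mtop X)" and \<gamma>: "continuous_map euclideanreal (mtop X) \<gamma>"
    and d: "\<And>t c k. c \<in> atlas X \<Longrightarrow> \<gamma> t \<in> fst c \<Longrightarrow> k < mdim X \<Longrightarrow> ((\<lambda>s. snd c (\<gamma> s) k) has_real_derivative 0) (at t)"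
  shows "\<gamma> t = \<gamma> 0"
proof -
  define S where "S = {t. \<gamma> t = \<gamma> 0}"
  have mem: "\<gamma> t \<in> topspace (mtop X)" for t using \<gamma> by (auto simp: continuous_map_def)
  have "closedin euclideanreal {t \<in> topspace euclideanreal. \<gamma> t \<in> {\<gamma> 0}}"
    by (rule closedin_continuous_map_preimage[OF \<gamma>]) (simp add: closedin_Hausdorff_sing_eq[OF H] mem)
  then have cl: "closed S" by (simp add: S_def)
  have op: "open S"
    unfolding open_dist
  proof
    fix t assume t: "t \<in> S"
    obtain c where c: "c \<in> atlas X" "\<gamma> t \<in> fst c" using charted_cover[OF X mem] by blast
    have "open {s. \<gamma> s \<in> fst c}" using openin_continuous_map_preimage[OF \<gamma> chart_open[OF X c(1)]] by simp
    moreover have "t \<in> {s. \<gamma> s \<in> fst c}" using c by simp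
    ultimately obtain \<delta> where \<delta>: "\<delta> > 0" "ball t \<delta> \<subseteq> {s. \<gamma> s \<in> fst c}" using open_contains_ball by blast
    have "s \<in> S" if s: "dist s t < \<delta>" for s
    proof -
      have B: "s \<in> ball t \<delta>" "t \<in> ball t \<delta>" using s \<delta> by (auto simp: dist_commute)
      have "snd c (\<gamma> s) k = snd c (\<gamma> t) k" if k: "k < mdim X" for k
      proof -
        have "\<exists>D. \<forall>u\<in>ball t \<delta>. snd c (\<gamma> u) k = D"
        proof (rule has_field_derivative_zero_constant[OF convex_ball])
          fix u assume "u \<in> ball t \<delta>"
          then have "\<gamma> u \<in> fst c" using \<delta> by blast
          from d[OF c(1) this k] show "((\<lambda>s. snd c (\<gamma> s) k) has_real_derivative 0) (at u within ball t \<delta>)"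
            by (rule has_field_derivative_at_within)
        qed
        then show ?thesis using B by metis
      qed
      then have "snd c (\<gamma> s) = snd c (\<gamma> t)"
        using B \<delta> by (intro Rn_eqI[OF chart_Rn[OF X c(1)] chart_Rn[OF X c(1)]]) blast+
      then have "\<gamma> s = \<gamma> t" using inj_onD[OF chart_inj[OF X c(1)]] B \<delta> by blast
      then show ?thesis using t by (simp add: S_def)
    qed
    then show "\<exists>e>0. \<forall>y. dist y t < e \<longrightarrow> y \<in> S" using \<delta> by blast
  qed
  have "S \<noteq> {}" by (auto simp: S_def)
  then have "S = UNIV" using clopen[of S] cl op by auto
  then show ?thesis by (auto simp: S_def)
qed

lemma velocity_map:
  fixes \<gamma> :: "real \<Rightarrow> 'a"
  assumes X: "charted X" and Y: "charted Y" and F: "smooth_map X Y F" and \<gamma>: "continuous_map euclideanreal (mtop X) \<gamma>"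
    and c: "c \<in> atlas X" "\<gamma> t \<in> fst c" and c': "c' \<in> atlas Y" "F (\<gamma> t) \<in> fst c'"
    and d: "\<And>k. k < mdim X \<Longrightarrow> ((\<lambda>s. snd c (\<gamma> s) k) has_real_derivative v k) (at t)" and k: "k < mdim Y"
  shows "((\<lambda>s. snd c' (F (\<gamma> s)) k) has_real_derivative differential X Y F c c' (\<gamma> t) v k) (at t)"
proof -
  have "open {s. \<gamma> s \<in> fst c}" using openin_continuous_map_preimage[OF \<gamma> chart_open[OF X c(1)]] by simp
  then have ev0: "eventually (\<lambda>s. \<gamma> s \<in> fst c) (nhds t)" using c(2) eventually_nhds by blast
  then have ev: "eventually (\<lambda>s. \<gamma> s \<in> fst c) (at t)" by (rule eventually_nhds_conv_at[THEN iffD1, THEN conjunct1])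
  have D1: "((\<lambda>s. snd c' (F (chart_inv c (snd c (\<gamma> s)))) k) has_real_derivative
      dd (mdim X) (\<lambda>x. snd c' (F (chart_inv c x)) k) (snd c (\<gamma> t)) v) (at t)"
  proof (rule smooth_on_curve[OF smooth_map_rep[OF F c(1) c'(1) k]])
    show "snd c (\<gamma> t) \<in> snd c ` (fst c \<inter> F -` fst c')" using c c' by blast
    show "eventually (\<lambda>s. snd c (\<gamma> s) \<in> Rn (mdim X)) (at t)"
      using ev by eventually_elim (rule chart_Rn[OF X c(1)])
  qed (rule d)
  have D2: "eventually (\<lambda>s. snd c' (F (chart_inv c (snd c (\<gamma> s)))) k = snd c' (F (\<gamma> s)) k) (nhds t)"
    using ev0 by eventually_elim (simp add: chart_inv_left[OF X c(1)])
  have "((\<lambda>s. snd c' (F (\<gamma> s)) k) has_real_derivative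
      dd (mdim X) (\<lambda>x. snd c' (F (chart_inv c x)) k) (snd c (\<gamma> t)) v) (at t)"
    by (rule DERIV_cong_ev[OF refl D2 refl, THEN iffD1, OF D1])
  then show ?thesis using k by (simp add: differential_alt)
qed

section \<open>The Lie algebra of the complexified group and its infinitesimal action\<close>

context orbit_setting
begin

abbreviation "NC \<equiv> mdim XGc"

lemma L_Rn: "L v \<in> Rn NC" by (rule differential_Rn)

text \<open>The isomorphism from pairs (X, Y) to X + i Y in the Lie algebra of \<open>Gc\<close>,
  with the pair stored in one vector of length n + n; its basis vectors correspond to those of the
  frame \<open>fr\<close>.\<close>

definition comb :: "(nat \<Rightarrow> real) \<Rightarrow> nat \<Rightarrow> real" where
  "comb v = (\<lambda>k. L (lft n v) k + J (L (rgt n v)) k)"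

lemma NC_even: "even NC"
  using XGc_complex by (simp add: complex_manifold_def)

lemma comb_Rn: "comb v \<in> Rn NC"
  unfolding comb_def by (intro Rn_add L_Rn J_Rn[OF NC_even])

lemma comb_onto: "x \<in> Rn NC \<Longrightarrow> \<exists>v\<in>Rn (n + n). comb v = x"
proof -
  assume "x \<in> Rn NC"
  then obtain u v where uv: "u \<in> Rn n" "v \<in> Rn n" "x = (\<lambda>k. L u k + J (L v) k)"
    using L_bij unfolding bij_betw_def by force
  then show ?thesis by (intro bexI[of _ "cat n u v"]) (auto simp: comb_def lft_cat rgt_cat cat_Rn)
qed

lemma L_zero: "L (\<lambda>_. 0) = (\<lambda>_. 0)"
  by (rule differential_zero)

lemma comb_kernel: "v \<in> Rn (n + n) \<Longrightarrow> comb v = (\<lambda>_. 0) \<Longrightarrow> v = (\<lambda>_. 0)"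
proof -
  assume v: "v \<in> Rn (n + n)" and z: "comb v = (\<lambda>_. 0)"
  have i: "inj_on (\<lambda>(u, v). \<lambda>k. L u k + J (L v) k) (Rn n \<times> Rn n)" using L_bij by (simp add: bij_betw_def)
  have "(\<lambda>(u, v). \<lambda>k. L u k + J (L v) k) (lft n v, rgt n v) = (\<lambda>(u, v). \<lambda>k. L u k + J (L v) k) ((\<lambda>_. 0), (\<lambda>_. 0))"
    using z by (simp add: comb_def L_zero J_zero)
  then have "(lft n v, rgt n v) = ((\<lambda>_. 0), (\<lambda>_. 0))"
    by (rule inj_onD[OF i]) (auto intro: lft_Rn rgt_Rn v Rn_zero)
  then have "lft n v = (\<lambda>_. 0)" "rgt n v = (\<lambda>_. 0)" by auto
  then have "v = cat n (\<lambda>_. 0) (\<lambda>_. 0)" using cat_lft_rgt by metis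
  then show ?thesis by (auto simp: cat_def)
qed

lemma comb_sum:
  assumes v: "v \<in> Rn (n + n)"
  shows "comb v = (\<lambda>k. \<Sum>i<n + n. v i * comb (unit_vec i) k)"
proof -
  have 1: "comb (unit_vec i) = L (unit_vec i)" if "i < n" for i
  proof -
    have "lft n (unit_vec i) = unit_vec i" "rgt n (unit_vec i) = (\<lambda>_. 0)"
      using that by (auto simp: lft_def rgt_def unit_vec_def fun_eq_iff)
    then show ?thesis by (simp add: comb_def L_zero J_zero)
  qed
  have 2: "comb (unit_vec (n + i)) = J (L (unit_vec i))" for i
  proof -
    have "lft n (unit_vec (n + i)) = (\<lambda>_. 0)" "rgt n (unit_vec (n + i)) = unit_vec i"
      by (auto simp: lft_def rgt_def unit_vec_def fun_eq_iff)
    then show ?thesis by (simp add: comb_def L_zero)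
  qed
  have Ls: "L u = (\<lambda>k. \<Sum>a<n. u a * L (unit_vec a) k)" if "u \<in> Rn n" for u
    using differential_lin[where A = "{..<n}" and a = u and u = unit_vec and X = XG and Y = XGc and c = e and d = d] Rn_expand[OF that] by simp
  have "comb v = (\<lambda>k. (\<Sum>i<n. v i * L (unit_vec i) k) + J (\<lambda>k. \<Sum>i<n. v (n + i) * L (unit_vec i) k) k)"
    unfolding comb_def Ls[OF lft_Rn] Ls[OF rgt_Rn[OF v]] by (simp add: lft_def rgt_def)
  also have "\<dots> = (\<lambda>k. \<Sum>i<n + n. v i * comb (unit_vec i) k)"
    unfolding J_lin sum_lessThan_add by (simp add: 1 2)
  finally show ?thesis .
qed

lemma NC_eq: "NC = n + n"
proof (rule antisym)
  show "n + n \<le> NC"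
  proof (rule injective_imp_dim_le[where a = "\<lambda>i j. comb (unit_vec j) i"])
    fix v assume v: "v \<in> Rn (n + n)" and z: "\<And>i. i < NC \<Longrightarrow> (\<Sum>j<n + n. comb (unit_vec j) i * v j) = 0"
    have "comb v = (\<lambda>_. 0)"
      by (rule Rn_eqI[OF comb_Rn Rn_zero]) (use z in \<open>simp add: comb_sum[OF v] mult.commute\<close>)
    then show "v = (\<lambda>_. 0)" by (rule comb_kernel[OF v])
  qed
  \<comment> \<open>A section of \<open>comb\<close>, not known to be linear. Its values at unit
    vectors form a matrix, and since \<open>comb\<close> is linear, applying it shows that this
    matrix is injective.\<close>
  obtain f where f: "\<And>x. x \<in> Rn NC \<Longrightarrow> f x \<in> Rn (n + n) \<and> comb (f x) = x"
    using comb_onto by metis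
  show "NC \<le> n + n"
  proof (rule injective_imp_dim_le[where a = "\<lambda>i j. f (unit_vec j) i"])
    fix v assume v: "v \<in> Rn NC" and z: "\<And>i. i < n + n \<Longrightarrow> (\<Sum>j<NC. f (unit_vec j) i * v j) = 0"
    have fu: "f (unit_vec j) \<in> Rn (n + n)" "comb (f (unit_vec j)) = unit_vec j" if "j < NC" for j
      using f[OF unit_vec_Rn[OF that]] by auto
    show "v = (\<lambda>_. 0)"
    proof
      fix k
      have "v k = (\<Sum>j<NC. v j * unit_vec j k)" using Rn_sum_unit[OF v] by simp
      also have "\<dots> = (\<Sum>j<NC. v j * (\<Sum>i<n + n. f (unit_vec j) i * comb (unit_vec i) k))"
      proof (intro sum.cong refl arg_cong2[where f = "(*)"])
        fix j assume "j \<in> {..<NC}"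
        then have j: "j < NC" by simp
        show "unit_vec j k = (\<Sum>i<n + n. f (unit_vec j) i * comb (unit_vec i) k)"
          using comb_sum[OF fu(1)[OF j]] fu(2)[OF j] by metis
      qed
      also have "\<dots> = (\<Sum>i<n + n. (\<Sum>j<NC. v j * f (unit_vec j) i) * comb (unit_vec i) k)"
        by (rule sum_mult_assoc[symmetric])
      also have "\<dots> = 0" using z by (intro sum.neutral) (simp add: mult.commute)
      finally show "v k = 0" .
    qed
  qed
qed

text \<open>The infinitesimal action of the complexified Lie algebra at p. Being complex linear, it
  sends L v to the fundamental vector of v and J (L v) to J of that vector.\<close>

definition zv :: "'m chart \<Rightarrow> 'm \<Rightarrow> (nat \<Rightarrow> real) \<Rightarrow> nat \<Rightarrow> real" where
  "zv c p v = differential XGc M (\<lambda>y. act y p) d c \<one>\<^bsub>Gc\<^esub> v"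

lemma zv_L: assumes c: "c \<in> atlas M" "p \<in> fst c" shows "zv c p (L v) = xv c p v"
proof -
  have p: "p \<in> A" using c_mem c by blast
  have s: "smooth_map XGc M (\<lambda>y. act y p)" using orbit_map_hol[OF p] by (simp add: holomorphic_map_def)
  show ?thesis unfolding zv_def xv_def
    using differential_compose[OF cG cGc cM \<iota>_smooth s e d(1) _ c(1)] d c act_one[OF p] \<iota>_one by simp
qed

lemma zv_J: assumes c: "c \<in> atlas M" "p \<in> fst c" and v: "v \<in> Rn NC" shows "zv c p (J v) = J (zv c p v)"
proof -
  have p: "p \<in> A" using c_mem c by blast
  have "commutes_with_J XGc M (\<lambda>y. act y p)" using orbit_map_hol[OF p] by (simp add: holomorphic_map_def)
  then show ?thesis unfolding zv_def using c d v act_one[OF p] by (simp add: commutes_with_J_def)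
qed

lemma zv_comb:
  assumes c: "c \<in> atlas M" "p \<in> fst c" and v: "v \<in> Rn (n + n)"
  shows "zv c p (comb v) = (\<lambda>k. \<Sum>i<n + n. v i * fr c p i k)"
proof -
  have "zv c p (comb v) = (\<lambda>k. zv c p (L (lft n v)) k + zv c p (J (L (rgt n v))) k)"
    unfolding zv_def comb_def by (rule differential_add)
  also have "\<dots> = (\<lambda>k. xv c p (lft n v) k + J (xv c p (rgt n v)) k)"
    unfolding zv_J[OF c L_Rn] zv_L[OF c] ..
  also have "\<dots> = (\<lambda>k. \<Sum>i<n + n. v i * fr c p i k)"
    unfolding xv_sum[OF lft_Rn] xv_sum[OF rgt_Rn[OF v]] J_lin sum_lessThan_add by (simp add: lft_def rgt_def fr_def)
  finally show ?thesis .
qed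

text \<open>For a positive definite metric the Gram determinant tests linear independence of the
  frame, and \<open>zv_comb\<close> identifies a relation in the frame with a kernel element of the
  infinitesimal action.\<close>

lemma gram_nonzero_iff:
  assumes c: "c \<in> atlas M" "p \<in> fst c"
  shows "gram c p \<noteq> 0 \<longleftrightarrow> (\<forall>x\<in>Rn NC. zv c p x = (\<lambda>_. 0) \<longrightarrow> x = (\<lambda>_. 0))"
proof -
  define F where "F v = (\<lambda>k. \<Sum>i<n + n. v i * fr c p i k)" for v
  have FR: "F v \<in> Rn N" for v unfolding F_def by (rule Rn_sum[OF fr_Rn])
  have s: "(\<Sum>j<n + n. gm c p (fr c p i) (fr c p j) * v j) = gm c p (fr c p i) (F v)" for i v
    unfolding F_def gm_def bil_lin2 by (simp add: mult.commute)
  have F0: "(\<forall>i<n + n. (\<Sum>j<n + n. gm c p (fr c p i) (fr c p j) * v j) = 0) \<longleftrightarrow> F v = (\<lambda>_. 0)" for v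
  proof
    assume z: "\<forall>i<n + n. (\<Sum>j<n + n. gm c p (fr c p i) (fr c p j) * v j) = 0"
    have "gm c p (F v) (F v) = (\<Sum>i<n + n. v i * gm c p (fr c p i) (F v))"
      unfolding F_def[of v] gm_def bil_lin1 ..
    then have "gm c p (F v) (F v) = 0" using z s by simp
    then show "F v = (\<lambda>_. 0)" using gm_pos[OF c FR] by force
  next
    assume "F v = (\<lambda>_. 0)"
    then show "\<forall>i<n + n. (\<Sum>j<n + n. gm c p (fr c p i) (fr c p j) * v j) = 0"
      unfolding s by (simp add: gm_def bil_zero2)
  qed
  have "gram c p \<noteq> 0 \<longleftrightarrow> (\<forall>v\<in>Rn (n + n). F v = (\<lambda>_. 0) \<longrightarrow> v = (\<lambda>_. 0))"
    unfolding gram_def dt_nonzero_iff F0 ..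
  also have "\<dots> \<longleftrightarrow> (\<forall>x\<in>Rn NC. zv c p x = (\<lambda>_. 0) \<longrightarrow> x = (\<lambda>_. 0))"
  proof (intro iffI ballI impI)
    fix x assume H: "\<forall>v\<in>Rn (n + n). F v = (\<lambda>_. 0) \<longrightarrow> v = (\<lambda>_. 0)" and x: "x \<in> Rn NC" and z: "zv c p x = (\<lambda>_. 0)"
    obtain v where v: "v \<in> Rn (n + n)" "comb v = x" using comb_onto[OF x] by blast
    have "F v = (\<lambda>_. 0)" using zv_comb[OF c v(1)] z v(2) by (simp add: F_def)
    then have v0: "v = (\<lambda>_. 0)" using H v(1) by blast
    show "x = (\<lambda>_. 0)" unfolding v(2)[symmetric] comb_sum[OF v(1)] by (simp add: v0)
  next
    fix v assume H: "\<forall>x\<in>Rn NC. zv c p x = (\<lambda>_. 0) \<longrightarrow> x = (\<lambda>_. 0)" and v: "v \<in> Rn (n + n)" and z: "F v = (\<lambda>_. 0)"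
    have "zv c p (comb v) = (\<lambda>_. 0)" using zv_comb[OF c v] z by (simp add: F_def)
    then show "v = (\<lambda>_. 0)" using H comb_Rn comb_kernel[OF v] by blast
  qed
  finally show ?thesis .
qed

lemma \<Omega>_sub: "\<Omega> \<subseteq> A"
  using openin_subset[OF \<Omega>_open] .

lemma \<Omega>_orbit: "p \<in> \<Omega> \<Longrightarrow> \<Omega> = (\<lambda>y. act y p) ` carrier Gc"
proof -
  assume p: "p \<in> \<Omega>"
  interpret group Gc by (rule Gc_group)
  obtain p0 where p0: "p0 \<in> A" "\<Omega> = orbit Gc act p0" using M_compactification by (auto simp: compactification_def)
  then have \<Omega>: "\<Omega> = (\<lambda>y. act y p0) ` carrier Gc" by (auto simp: orbit_def)
  obtain h where h: "h \<in> carrier Gc" "p = act h p0" using p \<Omega> by blast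
  have "act y p0 = act (inv\<^bsub>Gc\<^esub> h \<otimes>\<^bsub>Gc\<^esub> y) p" if "y \<in> carrier Gc" for y
    using that h p0 act_mult[of h "inv\<^bsub>Gc\<^esub> h \<otimes>\<^bsub>Gc\<^esub> y" p0] by (simp add: m_assoc[symmetric])
  moreover have "act y p = act (h \<otimes>\<^bsub>Gc\<^esub> y) p0" if "y \<in> carrier Gc" for y using that h p0 by (simp add: act_mult)
  moreover have "h \<otimes>\<^bsub>Gc\<^esub> y \<in> carrier Gc" "inv\<^bsub>Gc\<^esub> h \<otimes>\<^bsub>Gc\<^esub> y \<in> carrier Gc" if "y \<in> carrier Gc" for y
    using that h by auto
  ultimately show ?thesis unfolding \<Omega> by (intro equalityI image_subsetI) (metis image_eqI)+
qed

lemma \<Omega>_act: "p \<in> A \<Longrightarrow> y \<in> carrier Gc \<Longrightarrow> act y p \<in> \<Omega> \<longleftrightarrow> p \<in> \<Omega>"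
proof -
  assume p: "p \<in> A" and y: "y \<in> carrier Gc"
  interpret group Gc by (rule Gc_group)
  have "act (inv\<^bsub>Gc\<^esub> y) (act y p) = p" using act_mult[of y "inv\<^bsub>Gc\<^esub> y" p] p y act_one by simp
  then show ?thesis using \<Omega>_orbit y inv_closed by (metis image_eqI)
qed

section \<open>One-parameter subgroups and linear independence on the open orbit\<close>

abbreviation "ep v t \<equiv> E (\<lambda>i. t * v i)"

lemma ep_facts:
  assumes v: "v \<in> Rn NC"
  shows ep_cont: "continuous_map euclideanreal (mtop XGc) (ep v)"
    and ep_closed: "ep v t \<in> carrier Gc"
    and ep_add: "ep v (s + t) = ep v s \<otimes>\<^bsub>Gc\<^esub> ep v t"
    and ep_zero: "ep v 0 = \<one>\<^bsub>Gc\<^esub>"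
    and ep_deriv: "k < NC \<Longrightarrow> ((\<lambda>t. snd d (ep v t) k) has_real_derivative v k) (at 0)"
proof -
  interpret group Gc by (rule Gc_group)
  show c: "continuous_map euclideanreal (mtop XGc) (ep v)" using E_exp v unfolding lie_exp_def by blast
  show a: "ep v (s + t) = ep v s \<otimes>\<^bsub>Gc\<^esub> ep v t" for s t using E_exp v unfolding lie_exp_def by blast
  show "k < NC \<Longrightarrow> ((\<lambda>t. snd d (ep v t) k) has_real_derivative v k) (at 0)"
    using E_exp v unfolding lie_exp_def by blast
  show cl: "ep v t \<in> carrier Gc" for t using c Gc_top by (auto simp: continuous_map_def)
  have "ep v 0 \<otimes>\<^bsub>Gc\<^esub> ep v 0 = ep v 0" using a[of 0 0] by simp
  then show "ep v 0 = \<one>\<^bsub>Gc\<^esub>" using cl[of 0] l_cancel_one by blast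
qed

lemma curve_cont: "v \<in> Rn NC \<Longrightarrow> p \<in> A \<Longrightarrow> continuous_map euclideanreal (mtop M) (\<lambda>t. act (ep v t) p)"
  using continuous_map_compose[OF ep_cont smooth_map_cont] orbit_map_hol by (force simp: holomorphic_map_def o_def)

lemma curve_add: "v \<in> Rn NC \<Longrightarrow> p \<in> A \<Longrightarrow> act (ep v (s + t)) p = act (ep v t) (act (ep v s) p)"
  by (simp add: ep_add act_mult ep_closed)

lemma curve_velocity_0:
  assumes v: "v \<in> Rn NC" and p: "p \<in> A" and c: "c \<in> atlas M" "p \<in> fst c" and k: "k < N"
  shows "((\<lambda>t. snd c (act (ep v t) p) k) has_real_derivative zv c p v k) (at 0)"
proof -
  have s: "smooth_map XGc M (\<lambda>y. act y p)" using orbit_map_hol[OF p] by (simp add: holomorphic_map_def)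
  show ?thesis
    using velocity_map[OF cGc cM s ep_cont[OF v] d(1) _ c(1) _ ep_deriv[OF v] k] d(2) c(2)
    unfolding ep_zero[OF v] act_one[OF p] zv_def by blast
qed

lemma curve_velocity:
  assumes v: "v \<in> Rn NC" and p: "p \<in> A" and c: "c \<in> atlas M" "act (ep v t) p \<in> fst c" and k: "k < N"
  shows "((\<lambda>t. snd c (act (ep v t) p) k) has_real_derivative zv c (act (ep v t) p) v k) (at t)"
proof -
  have q: "act (ep v t) p \<in> A" using act_closed ep_closed v p by blast
  have "((\<lambda>s. snd c (act (ep v (s + t)) p) k) has_real_derivative zv c (act (ep v t) p) v k) (at 0)"
    using curve_velocity_0[OF v q c k] curve_add[OF v p, of t] by (simp add: add.commute)
  then show ?thesis using DERIV_shift[of "\<lambda>t. snd c (act (ep v t) p) k" _ 0 t] by simp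
qed

text \<open>A vanishing fundamental vector makes the curve of the one-parameter subgroup through p
  stationary, so the subgroup lies in the finite stabilizer; a nonzero velocity, however, makes the
  subgroup injective for small positive times.\<close>

lemma fundamental_injective:
  assumes p: "p \<in> \<Omega>" and c: "c \<in> atlas M" "p \<in> fst c" and v: "v \<in> Rn NC" and z: "zv c p v = (\<lambda>_. 0)"
  shows "v = (\<lambda>_. 0)"
proof (rule ccontr)
  assume ne: "v \<noteq> (\<lambda>_. 0)"
  interpret group Gc by (rule Gc_group)
  have pA: "p \<in> A" using p \<Omega>_sub by blast
  have H: "Hausdorff_space (mtop M)" using M_smooth by (simp add: smooth_manifold_def)
  have "((\<lambda>s. snd c' (act (ep v s) p) k) has_real_derivative 0) (at t)"
    if c': "c' \<in> atlas M" "act (ep v t) p \<in> fst c'" and k: "k < N" for t c' k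
  proof -
    have sF: "smooth_map M M (act (ep v t))" using act_map_hol[OF ep_closed[OF v]] by (simp add: holomorphic_map_def)
    have e0: "act (ep v 0) p = p" using ep_zero[OF v] act_one[OF pA] by simp
    \<comment> \<open>The action of \<open>ep v t\<close> carries the velocity at time 0 to the
      velocity at time t, which is therefore zero as well.\<close>
    have "((\<lambda>s. snd c' (act (ep v t) (act (ep v s) p)) k) has_real_derivative
        differential M M (act (ep v t)) c c' (act (ep v 0) p) (\<lambda>_. 0) k) (at 0)"
    proof (rule velocity_map[OF cM cM sF curve_cont[OF v pA] c(1) _ c'(1) _ _ k])
      show "act (ep v 0) p \<in> fst c" "act (ep v t) (act (ep v 0) p) \<in> fst c'" unfolding e0 using c c' by auto
      show "((\<lambda>s. snd c (act (ep v s) p) k) has_real_derivative 0) (at 0)" if "k < N" for k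
        using curve_velocity_0[OF v pA c that] by (simp add: z)
    qed
    then have "((\<lambda>s. snd c' (act (ep v (s + t)) p) k) has_real_derivative 0) (at 0)"
      unfolding curve_add[OF v pA] differential_zero .
    then show ?thesis using DERIV_shift[of "\<lambda>t. snd c' (act (ep v t) p) k" _ 0 t] by simp
  qed
  from chart_kernel_const[OF cM H curve_cont[OF v pA] this]
  have "act (ep v t) p = act (ep v 0) p" for t .
  then have st: "ep v t \<in> stabilizer Gc act p" for t
    using ep_zero[OF v] act_one[OF pA] ep_closed[OF v] by (simp add: stabilizer_def)
  obtain k where k: "v k \<noteq> 0" using ne by auto
  then have kN: "k < NC" using v unfolding Rn_iff by (metis not_less)
  define h where "h t = snd d (ep v t) k" for t
  have "((\<lambda>t. (h t - h 0) / (t - 0)) \<longlongrightarrow> v k) (at 0)"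
    using ep_deriv[OF v kN] unfolding h_def[symmetric] has_field_derivative_iff .
  from tendsto_imp_eventually_ne[OF this k]
  have "eventually (\<lambda>t. h t \<noteq> h 0) (at 0)" by eventually_elim auto
  then obtain \<delta> where \<delta>: "\<delta> > 0" "\<And>t. t \<noteq> 0 \<Longrightarrow> \<bar>t\<bar> < \<delta> \<Longrightarrow> h t \<noteq> h 0"
    unfolding eventually_at by (auto simp: dist_real_def)
  have ne1: "ep v t \<noteq> \<one>\<^bsub>Gc\<^esub>" if "t \<noteq> 0" "\<bar>t\<bar> < \<delta>" for t
    using \<delta>(2)[OF that] ep_zero[OF v] unfolding h_def by metis
  have "inj_on (ep v) {0<..<\<delta>}"
  proof (rule inj_onI, rule ccontr)
    fix s t assume st: "s \<in> {0<..<\<delta>}" "t \<in> {0<..<\<delta>}" "ep v s = ep v t" "s \<noteq> t"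
    have "ep v s = ep v (s - t) \<otimes>\<^bsub>Gc\<^esub> ep v t" using ep_add[OF v, of "s - t" t] by simp
    then have "ep v (s - t) = \<one>\<^bsub>Gc\<^esub>" using st(3) ep_closed[OF v] r_cancel_one' by metis
    moreover have "\<bar>s - t\<bar> < \<delta>" using st by auto
    ultimately show False using ne1[of "s - t"] st by simp
  qed
  moreover have "finite (ep v ` {0<..<\<delta>})"
    by (rule finite_subset[of _ "stabilizer Gc act p"]) (use st finite_stab p in auto)
  ultimately have "finite {0<..<\<delta>}" by (rule finite_imageD[rotated])
  then show False using \<delta>(1) by (simp add: infinite_Ioo)
qed

lemma gram_nonzero: "p \<in> \<Omega> \<Longrightarrow> c \<in> atlas M \<Longrightarrow> p \<in> fst c \<Longrightarrow> gram c p \<noteq> 0"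
  using fundamental_injective gram_nonzero_iff by blast

end

section \<open>The locus of the open orbit\<close>

lemma compactin_cube: "compactin (Euclidean_space k) {y \<in> Rn k. \<forall>i<k. \<bar>y i - x i\<bar> \<le> (\<delta>::real)}"
proof -
  let ?K = "\<lambda>i. if i < k then {x i - \<delta> .. x i + \<delta>} else {0::real}"
  have "compactin (powertop_real UNIV) (Pi\<^sub>E UNIV ?K)"
    unfolding compactin_PiE by auto
  moreover have "Pi\<^sub>E UNIV ?K = {y \<in> Rn k. \<forall>i<k. \<bar>y i - x i\<bar> \<le> \<delta>}"
  proof (intro equalityI subsetI)
    fix y assume y: "y \<in> Pi\<^sub>E UNIV ?K"
    then have *: "y i \<in> ?K i" for i by (rule PiE_mem) simp
    have "y i = 0" if "k \<le> i" for i using *[of i] that by simp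
    moreover have "\<bar>y i - x i\<bar> \<le> \<delta>" if "i < k" for i using *[of i] that by (simp add: abs_le_iff algebra_simps)
    ultimately show "y \<in> {y \<in> Rn k. \<forall>i<k. \<bar>y i - x i\<bar> \<le> \<delta>}" by (simp add: Rn_iff)
  next
    fix y assume "y \<in> {y \<in> Rn k. \<forall>i<k. \<bar>y i - x i\<bar> \<le> \<delta>}"
    then have y: "y \<in> Rn k" "\<And>i. i < k \<Longrightarrow> \<bar>y i - x i\<bar> \<le> \<delta>" by auto
    have "y i \<in> ?K i" for i
      using y(1) y(2)[of i] by (cases "i < k") (auto simp: Rn_iff abs_le_iff algebra_simps)
    then show "y \<in> Pi\<^sub>E UNIV ?K" by (auto simp: PiE_iff extensional_def)
  qed
  ultimately show ?thesis
    unfolding Euclidean_space_def compactin_subtopology by (auto simp: Rn_iff)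
qed

text \<open>Regarding R^k as a coordinate subspace of R^n, invariance of domain would make the image
  open in R^n.\<close>

lemma no_open_embedding:
  assumes kn: "k < n" and V: "openin (Euclidean_space n) V" "V \<noteq> {}"
    and h: "continuous_map (subtopology (Euclidean_space n) V) (Euclidean_space k) h" and inj: "inj_on h V"
  shows False
proof -
  have sub: "Euclidean_space k = subtopology (Euclidean_space n) (Rn k)"
  proof -
    have "{x. \<forall>i\<ge>n. x i = (0::real)} \<inter> Rn k = {x. \<forall>i\<ge>k. x i = 0}" using kn by (auto simp: Rn_iff)
    then show ?thesis by (simp add: Euclidean_space_def subtopology_subtopology)
  qed
  have "continuous_map (subtopology (Euclidean_space n) V) (Euclidean_space n) h"
  proof -
    have "continuous_map (subtopology (Euclidean_space n) V) (subtopology (Euclidean_space n) (Rn k)) h"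
      using h by (simp only: sub[symmetric])
    then show ?thesis by (simp only: continuous_map_in_subtopology)
  qed
  then have o: "openin (Euclidean_space n) (h ` V)" by (rule invariance_of_domain_Euclidean_space[OF V(1) _ inj])
  have im: "h ` V \<subseteq> Rn k"
    using continuous_map_image_subset_topspace[OF h] openin_subset[OF V(1)] by (simp add: Int_absorb1)
  obtain z where z: "z \<in> h ` V" using V(2) by blast
  then obtain \<delta> where \<delta>: "\<delta> > 0" "cube n z \<delta> \<subseteq> h ` V" using openin_cubeD[OF o] by blast
  \<comment> \<open>Every point of R^k has coordinate k equal to 0, so a small move in this
    coordinate leaves the image.\<close>
  have "z(k := z k + \<delta> / 2) \<in> cube n z \<delta>"
    by (rule upd_cube[OF cube_self kn]) (use \<delta> z o openin_Rn_subset in auto)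
  then have "z(k := z k + \<delta> / 2) \<in> Rn k" using \<delta> im by blast
  moreover have "z k = 0" using z im by (force simp: Rn_iff)
  ultimately show False using \<delta>(1) by (auto simp: Rn_iff dest: spec[of _ k])
qed

context orbit_setting
begin

lemma M_Hausdorff: "Hausdorff_space (mtop M)"
  using M_smooth by (simp add: smooth_manifold_def)

text \<open>A nonzero Gram determinant means that the orbit map has injective derivative at the
  identity, and \<open>immersion_bound\<close> upgrades this to injectivity on a cube.\<close>

lemma orbit_map_local:
  assumes p: "p \<in> A" and c: "c \<in> atlas M" "p \<in> fst c" and nz: "gram c p \<noteq> 0"
  obtains \<delta> where "\<delta> > 0" "cube NC (snd d \<one>\<^bsub>Gc\<^esub>) \<delta> \<subseteq> snd d ` (fst d \<inter> (\<lambda>y. act y p) -` fst c)"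
    "inj_on (\<lambda>x. snd c (act (chart_inv d x) p)) (cube NC (snd d \<one>\<^bsub>Gc\<^esub>) \<delta>)"
proof -
  let ?W = "snd d ` (fst d \<inter> (\<lambda>y. act y p) -` fst c)"
  let ?f = "\<lambda>i x. snd c (act (chart_inv d x) p) i"
  have s: "smooth_map XGc M (\<lambda>y. act y p)" using orbit_map_hol[OF p] by (simp add: holomorphic_map_def)
  have W: "openin (Euclidean_space NC) ?W"
    by (rule chart_pullback_open[OF cGc d(1) smooth_map_cont[OF s] chart_open[OF cM c(1)]])
  have x: "snd d \<one>\<^bsub>Gc\<^esub> \<in> ?W" using d c act_one[OF p] by auto
  have ker: "v = (\<lambda>_. 0)" if "v \<in> Rn NC" "\<And>i. i < N \<Longrightarrow> dd NC (?f i) (snd d \<one>\<^bsub>Gc\<^esub>) v = 0" for v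
  proof -
    have "zv c p v = (\<lambda>_. 0)" using that(2) by (auto simp: zv_def differential_alt)
    then show ?thesis using nz gram_nonzero_iff[OF c] that(1) by blast
  qed
  obtain \<delta> C where dC: "\<delta> > 0" "C > 0" "cube NC (snd d \<one>\<^bsub>Gc\<^esub>) \<delta> \<subseteq> ?W"
    "\<And>y z. y \<in> cube NC (snd d \<one>\<^bsub>Gc\<^esub>) \<delta> \<Longrightarrow> z \<in> cube NC (snd d \<one>\<^bsub>Gc\<^esub>) \<delta> \<Longrightarrow>
       (\<Sum>j<NC. \<bar>y j - z j\<bar>) \<le> C * (\<Sum>i<N. \<bar>?f i y - ?f i z\<bar>)"
  proof (rule immersion_bound[where f = ?f and m = N, OF smooth_map_rep[OF s d(1) c(1)] x W])
    fix v assume "v \<in> Rn NC" "\<And>i. i < N \<Longrightarrow> dd NC (?f i) (snd d \<one>\<^bsub>Gc\<^esub>) v = 0"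
    then show "v = (\<lambda>_. 0)" by (rule ker)
  qed (assumption, rule that)
  have "inj_on (\<lambda>x. snd c (act (chart_inv d x) p)) (cube NC (snd d \<one>\<^bsub>Gc\<^esub>) \<delta>)"
  proof (rule inj_onI)
    fix y z assume yz: "y \<in> cube NC (snd d \<one>\<^bsub>Gc\<^esub>) \<delta>" "z \<in> cube NC (snd d \<one>\<^bsub>Gc\<^esub>) \<delta>"
      and e: "snd c (act (chart_inv d y) p) = snd c (act (chart_inv d z) p)"
    show "y = z" by (rule bound_imp_inj[where f = ?f, OF dC(4) _ yz]) (use e cube_Rn in auto)
  qed
  then show thesis using that dC(1,3) by blast
qed

lemma dim_lower: "NC \<le> N"
proof -
  obtain p where p: "p \<in> \<Omega>" using M_compactification Gc_group one_carrier
    by (auto simp: compactification_def orbit_def)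
  then obtain c where c: "c \<in> atlas M" "p \<in> fst c" using charted_cover[OF cM] \<Omega>_sub by blast
  show ?thesis
  proof (rule injective_imp_dim_le[where a = "\<lambda>i j. pd j (\<lambda>x. snd c (act (chart_inv d x) p) i) (snd d \<one>\<^bsub>Gc\<^esub>)"])
    fix v assume v: "v \<in> Rn NC" "\<And>i. i < N \<Longrightarrow> (\<Sum>j<NC. pd j (\<lambda>x. snd c (act (chart_inv d x) p) i) (snd d \<one>\<^bsub>Gc\<^esub>) * v j) = 0"
    then have "zv c p v = (\<lambda>_. 0)" by (auto simp: zv_def differential_def)
    then show "v = (\<lambda>_. 0)" by (rule fundamental_injective[OF p c v(1)])
  qed
qed

lemma left_mult_Gc_open: "y \<in> carrier Gc \<Longrightarrow> openin (mtop XGc) B \<Longrightarrow> openin (mtop XGc) ((\<lambda>x. y \<otimes>\<^bsub>Gc\<^esub> x) ` B)"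
proof (rule group_left_mult_open[OF Gc_group Gc_top])
  fix y assume y: "y \<in> carrier Gc"
  have "holomorphic_map XGc XGc (\<lambda>x. y \<otimes>\<^bsub>Gc\<^esub> x)"
    using holomorphic_map_compose[OF cGc charted_prod[OF cGc cGc] cGc
      holomorphic_map_pair[OF cGc cGc cGc NC_even holomorphic_map_const[OF cGc cGc] holomorphic_map_id[OF XGc_complex]] Gc_mult_hol] y Gc_top by simp
  then show "continuous_map (mtop XGc) (mtop XGc) (\<lambda>x. y \<otimes>\<^bsub>Gc\<^esub> x)"
    by (simp add: holomorphic_map_def smooth_map_def)
qed

text \<open>Otherwise the open orbit is a countable union of injective images of cubes of dimension
  \<open>NC < N\<close>; by Baire one of them has interior points, against invariance of domain.\<close>

lemma dim_upper: "N \<le> NC"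
proof (rule ccontr)
  assume "\<not> N \<le> NC"
  then have lt: "NC < N" by simp
  obtain p where p: "p \<in> \<Omega>" using M_compactification Gc_group one_carrier
    by (auto simp: compactification_def orbit_def)
  let ?x = "snd d \<one>\<^bsub>Gc\<^esub>"
  \<comment> \<open>Closed cubes, since compactness makes their images closed in M, as Baire's
    theorem requires. Halving the radius places them inside an open cube of injectivity.\<close>
  define C where "C \<delta> = {y \<in> Rn NC. \<forall>i<NC. \<bar>y i - ?x i\<bar> \<le> \<delta>}" for \<delta> :: real
  have "\<exists>\<delta>>0. C \<delta> \<subseteq> snd d ` fst d \<and> inj_on (\<lambda>x. act (chart_inv d x) q) (C \<delta>)" if q: "q \<in> \<Omega>" for q
  proof -
    have qA: "q \<in> A" using q \<Omega>_sub by blast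
    then obtain c where c: "c \<in> atlas M" "q \<in> fst c" using charted_cover[OF cM] by blast
    obtain \<delta> where \<delta>: "\<delta> > 0" "cube NC ?x \<delta> \<subseteq> snd d ` (fst d \<inter> (\<lambda>y. act y q) -` fst c)"
      "inj_on (\<lambda>x. snd c (act (chart_inv d x) q)) (cube NC ?x \<delta>)"
      by (rule orbit_map_local[OF qA c gram_nonzero[OF q c]])
    have sub: "C (\<delta> / 2) \<subseteq> cube NC ?x \<delta>" using \<delta>(1) by (force simp: C_def cube_def)
    have "inj_on (\<lambda>x. act (chart_inv d x) q) (C (\<delta> / 2))"
      using inj_on_subset[OF \<delta>(3) sub] by (auto simp: inj_on_def)
    then show ?thesis using \<delta>(1,2) sub by (intro exI[of _ "\<delta> / 2"]) auto
  qed
  then obtain \<delta> where \<delta>: "\<And>q. q \<in> \<Omega> \<Longrightarrow> \<delta> q > 0" "\<And>q. q \<in> \<Omega> \<Longrightarrow> C (\<delta> q) \<subseteq> snd d ` fst d"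
    "\<And>q. q \<in> \<Omega> \<Longrightarrow> inj_on (\<lambda>x. act (chart_inv d x) q) (C (\<delta> q))" by metis
  have q\<Omega>: "act y p \<in> \<Omega>" if "y \<in> carrier Gc" for y using \<Omega>_act that p \<Omega>_sub by blast
  define B where "B y = (\<lambda>x. y \<otimes>\<^bsub>Gc\<^esub> x) ` chart_inv d ` cube NC ?x (\<delta> (act y p))" for y
  have cubeC: "cube NC ?x r \<subseteq> C r" for r by (auto simp: cube_def C_def)
  have Bo: "openin (mtop XGc) (B y)" if y: "y \<in> carrier Gc" for y
    unfolding B_def
    by (intro left_mult_Gc_open[OF y] chart_inv_open_image[OF cGc d(1) openin_cube])
       (use \<delta>(2)[OF q\<Omega>[OF y]] cubeC in blast)
  have xR: "?x \<in> Rn NC" by (rule chart_Rn[OF cGc d])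
  have yB: "y \<in> B y" if y: "y \<in> carrier Gc" for y
  proof -
    have "\<one>\<^bsub>Gc\<^esub> \<in> chart_inv d ` cube NC ?x (\<delta> (act y p))"
      using cube_self[OF xR \<delta>(1)[OF q\<Omega>[OF y]]] chart_inv_left[OF cGc d] by (metis image_eqI)
    then show ?thesis unfolding B_def using y monoid.r_one[OF group.is_monoid[OF Gc_group]] by (metis image_eqI)
  qed
  \<comment> \<open>Countably many of the open translates \<open>B y\<close> cover the group, and
    the compact sets \<open>K y\<close> belonging to them cover the open orbit.\<close>
  have "second_countable (mtop XGc)" using Gc_smooth by (simp add: smooth_manifold_def)
  then have "Lindelof_space (mtop XGc)" by (rule second_countable_imp_Lindelof_space)
  moreover have "\<forall>V\<in>B ` carrier Gc. openin (mtop XGc) V" "topspace (mtop XGc) \<subseteq> \<Union> (B ` carrier Gc)"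
    using Bo yB Gc_top by auto
  ultimately obtain V where V: "countable V" "V \<subseteq> B ` carrier Gc" "topspace (mtop XGc) \<subseteq> \<Union>V"
    unfolding Lindelof_space_alt by meson
  then obtain Y where Y: "countable Y" "Y \<subseteq> carrier Gc" "V = B ` Y"
    using countable_subset_image[of V B "carrier Gc"] by blast
  define K where "K y = (\<lambda>x. act (chart_inv d x) (act y p)) ` C (\<delta> (act y p))" for y
  have cont: "continuous_map (subtopology (Euclidean_space NC) (C (\<delta> q))) (mtop M) (\<lambda>x. act (chart_inv d x) q)" if q: "q \<in> \<Omega>" for q
  proof -
    have "q \<in> A" using q \<Omega>_sub by blast
    then have s: "continuous_map (mtop XGc) (mtop M) (\<lambda>y. act y q)" using orbit_map_hol by (simp add: holomorphic_map_def smooth_map_def)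
    have "continuous_map (subtopology (Euclidean_space NC) (C (\<delta> q))) (mtop XGc) (chart_inv d)"
      by (rule continuous_map_from_subtopology_mono[OF chart_inv_cont[OF cGc d(1)] \<delta>(2)[OF q]])
    from continuous_map_compose[OF this s] show ?thesis by (simp add: o_def)
  qed
  have Ccomp: "compact_space (subtopology (Euclidean_space NC) (C r))" for r
    using compactin_cube[of NC ?x r] unfolding C_def by (simp add: compact_space_subtopology)
  have Ctop: "topspace (subtopology (Euclidean_space NC) (C r)) = C r" for r by (auto simp: C_def)
  have Kc: "closedin (mtop M) (K y)" if y: "y \<in> carrier Gc" for y
  proof -
    have "compactin (mtop M) (K y)"
      unfolding K_def using image_compactin[OF _ cont[OF q\<Omega>[OF y]], of "C (\<delta> (act y p))"] Ccomp[of "\<delta> (act y p)"] unfolding compact_space_def Ctop by simp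
    then show ?thesis by (rule compactin_imp_closedin[OF M_Hausdorff])
  qed
  have cover: "\<Omega> \<subseteq> \<Union> (K ` Y)"
  proof
    fix q assume "q \<in> \<Omega>"
    then obtain z where z: "z \<in> carrier Gc" "q = act z p" using \<Omega>_orbit[OF p] by blast
    then obtain y where y: "y \<in> Y" "z \<in> B y" using V(3) Y(3) Gc_top by blast
    then obtain x where x: "x \<in> cube NC ?x (\<delta> (act y p))" "z = y \<otimes>\<^bsub>Gc\<^esub> chart_inv d x" by (auto simp: B_def)
    have yc: "y \<in> carrier Gc" using y Y by blast
    have xC: "x \<in> C (\<delta> (act y p))" using x cubeC by blast
    have "chart_inv d x \<in> carrier Gc"
      using chart_inv_in[OF cGc d(1)] chart_mem[OF cGc d(1)] \<delta>(2)[OF q\<Omega>[OF yc]] xC Gc_top by blast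
    then have "q = act (chart_inv d x) (act y p)" using z x act_mult[OF yc] p \<Omega>_sub by auto
    then show "q \<in> \<Union> (K ` Y)" using y xC by (auto simp: K_def)
  qed
  have "\<exists>y\<in>Y. (mtop M) interior_of (K y) \<noteq> {}"
  proof (rule ccontr)
    assume none: "\<not> ?thesis"
    have reg: "locally_compact_space (mtop M) \<and> regular_space (mtop M)"
      using M_compact M_Hausdorff compact_Hausdorff_imp_regular_space compact_imp_locally_compact_space by blast
    have "(mtop M) interior_of \<Union> (K ` Y) = {}"
      by (rule Baire_category_alt) (use reg Y Kc none in auto)
    moreover have "\<Omega> \<subseteq> (mtop M) interior_of \<Union> (K ` Y)" by (rule interior_of_maximal[OF cover \<Omega>_open])
    ultimately show False using p by blast
  qed
  then obtain y where y: "y \<in> Y" "(mtop M) interior_of (K y) \<noteq> {}" by blast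
  then have yc: "y \<in> carrier Gc" using Y by blast
  define q where "q = act y p"
  have q: "q \<in> \<Omega>" unfolding q_def by (rule q\<Omega>[OF yc])
  let ?\<phi> = "\<lambda>x. act (chart_inv d x) q"
  let ?C = "subtopology (Euclidean_space NC) (C (\<delta> q))"
  \<comment> \<open>A continuous injection of a compact space into a Hausdorff space is a
    homeomorphism onto its image. Its inverse h, precomposed with a chart at an interior point of
    \<open>K y\<close>, will embed an open set of R^N into R^NC.\<close>
  have "homeomorphic_map ?C (subtopology (mtop M) (?\<phi> ` C (\<delta> q))) ?\<phi>"
  proof (rule continuous_imp_homeomorphic_map[OF _ Ccomp Hausdorff_space_subtopology[OF M_Hausdorff]])
    show "continuous_map ?C (subtopology (mtop M) (?\<phi> ` C (\<delta> q))) ?\<phi>"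
      unfolding continuous_map_in_subtopology using cont[OF q] Ctop by blast
    have "?\<phi> ` C (\<delta> q) \<subseteq> A" using continuous_map_image_subset_topspace[OF cont[OF q]] Ctop by simp
    then show "?\<phi> ` topspace ?C = topspace (subtopology (mtop M) (?\<phi> ` C (\<delta> q)))" unfolding Ctop by auto
    show "inj_on ?\<phi> (topspace ?C)" unfolding Ctop by (rule \<delta>(3)[OF q])
  qed
  then obtain h where h: "homeomorphic_maps ?C (subtopology (mtop M) (?\<phi> ` C (\<delta> q))) ?\<phi> h" using homeomorphic_map_maps by blast
  have Kq: "K y = ?\<phi> ` C (\<delta> q)" by (simp add: K_def q_def)
  have hc: "continuous_map (subtopology (mtop M) (K y)) (Euclidean_space NC) h"
    using h unfolding homeomorphic_maps_def Kq continuous_map_in_subtopology by blast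
  have KA: "K y \<subseteq> A" using closedin_subset[OF Kc[OF yc]] .
  have hinj: "inj_on h (K y)"
  proof (rule inj_onI)
    fix a b assume "a \<in> K y" "b \<in> K y" "h a = h b"
    moreover have "?\<phi> (h a) = a" if "a \<in> K y" for a
      using h that KA unfolding homeomorphic_maps_def Kq by auto
    ultimately show "a = b" by metis
  qed
  let ?I = "(mtop M) interior_of (K y)"
  obtain m where m: "m \<in> ?I" using y by blast
  have IK: "?I \<subseteq> K y" by (rule interior_of_subset)
  then obtain c where c: "c \<in> atlas M" "m \<in> fst c" using m KA charted_cover[OF cM] by blast
  let ?V = "snd c ` (?I \<inter> fst c)"
  have Vo: "openin (Euclidean_space N) ?V"
    by (rule chart_open_image[OF cM c(1)]) (auto intro: chart_open[OF cM c(1)])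
  have ci: "continuous_map (subtopology (Euclidean_space N) ?V) (mtop M) (chart_inv c)"
    by (rule continuous_map_from_subtopology_mono[OF chart_inv_cont[OF cM c(1)]]) auto
  have cK: "chart_inv c x \<in> K y \<inter> fst c" if "x \<in> ?V" for x using that IK chart_inv_left[OF cM c(1)] by auto
  show False
  proof (rule no_open_embedding[OF lt Vo])
    show "?V \<noteq> {}" using m c by blast
    have "continuous_map (subtopology (Euclidean_space N) ?V) (subtopology (mtop M) (K y)) (chart_inv c)"
      unfolding continuous_map_in_subtopology using ci cK by auto
    from continuous_map_compose[OF this hc]
    show "continuous_map (subtopology (Euclidean_space N) ?V) (Euclidean_space NC) (h \<circ> chart_inv c)" .
    show "inj_on (h \<circ> chart_inv c) ?V"
    proof (rule inj_onI)
      fix a b assume ab: "a \<in> ?V" "b \<in> ?V" "(h \<circ> chart_inv c) a = (h \<circ> chart_inv c) b"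
      then have "chart_inv c a = chart_inv c b" using inj_onD[OF hinj] cK by simp
      then show "a = b" using ab by (auto simp: chart_inv_left[OF cM c(1)])
    qed
  qed
qed

lemma dim_M: "N = n + n"
  using dim_lower dim_upper NC_eq by simp

text \<open>Near the identity the orbit map of p is injective between spaces of equal dimension,
  hence open by invariance of domain; its image meets the dense orbit, and being in that orbit is
  invariant under \<open>Gc\<close>.\<close>

lemma gram_nonzero_\<Omega>:
  assumes p: "p \<in> A" and c: "c \<in> atlas M" "p \<in> fst c" and nz: "gram c p \<noteq> 0"
  shows "p \<in> \<Omega>"
proof -
  let ?x = "snd d \<one>\<^bsub>Gc\<^esub>"
  obtain \<delta> where \<delta>: "\<delta> > 0" "cube NC ?x \<delta> \<subseteq> snd d ` (fst d \<inter> (\<lambda>y. act y p) -` fst c)"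
    "inj_on (\<lambda>x. snd c (act (chart_inv d x) p)) (cube NC ?x \<delta>)"
    by (rule orbit_map_local[OF p c nz])
  have NN: "N = NC" using dim_M NC_eq by simp
  let ?f = "\<lambda>x. snd c (act (chart_inv d x) p)"
  have s: "smooth_map XGc M (\<lambda>y. act y p)" using orbit_map_hol[OF p] by (simp add: holomorphic_map_def)
  have sm: "smooth_on NC (cube NC ?x \<delta>) (\<lambda>x. ?f x i)" if "i < NC" for i
    by (rule smooth_on_subset[OF smooth_map_rep[OF s d(1) c(1)] \<delta>(2) openin_cube]) (use that NN in simp)
  have mem: "chart_inv d x \<in> carrier Gc" "act (chart_inv d x) p \<in> fst c" if "x \<in> cube NC ?x \<delta>" for x
    using that \<delta>(2) chart_inv_left[OF cGc d(1)] chart_mem[OF cGc d(1)] Gc_top by auto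
  have "openin (Euclidean_space NC) (?f ` cube NC ?x \<delta>)"
    by (rule invariance_of_domain_Euclidean_space[OF openin_cube smooth_continuous_map[OF openin_cube sm] \<delta>(3)])
       (use mem chart_Rn[OF cM c(1)] NN in auto)
  then have "openin (mtop M) (chart_inv c ` ?f ` cube NC ?x \<delta>)"
    by (intro chart_inv_open_image[OF cM c(1)]) (use mem NN in auto)
  moreover have "?x \<in> cube NC ?x \<delta>" using cube_self[OF chart_Rn[OF cGc d] \<delta>(1)] .
  then have "chart_inv c ` ?f ` cube NC ?x \<delta> \<noteq> {}" by blast
  ultimately have "\<Omega> \<inter> chart_inv c ` ?f ` cube NC ?x \<delta> \<noteq> {}"
    using \<Omega>_dense dense_intersects_open by blast
  then obtain x where x: "x \<in> cube NC ?x \<delta>" "chart_inv c (?f x) \<in> \<Omega>" by blast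
  then have "act (chart_inv d x) p \<in> \<Omega>" using chart_inv_left[OF cM c(1) mem(2)[OF x(1)]] by simp
  then show ?thesis using \<Omega>_act[OF p mem(1)[OF x(1)]] by blast
qed

end

section \<open>Orbits as embedded submanifolds\<close>

lemma open_mfd_simps [simp]:
  "mtop (open_mfd k W) = subtopology (Euclidean_space k) W" "mdim (open_mfd k W) = k" "atlas (open_mfd k W) = {(W, \<lambda>x. x)}"
  by (simp_all add: open_mfd_def)

lemma chart_inv_open_mfd: "x \<in> W \<Longrightarrow> chart_inv (W, \<lambda>x. x) x = x"
  unfolding chart_inv_def using inv_into_f_f[of "\<lambda>x. x" W x] by simp

lemma charted_open_mfd: "openin (Euclidean_space k) W \<Longrightarrow> charted (open_mfd k W)"
  using openin_subset[of "Euclidean_space k" W] homeomorphic_map_id[of "subtopology (Euclidean_space k) W" "subtopology (Euclidean_space k) W", unfolded id_def]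
  by (auto simp: charted_def is_chart_def subtopology_subtopology openin_subtopology_refl)

lemma smooth_map_chart_inv:
  assumes X: "smooth_manifold X" and c: "c \<in> atlas X" and W: "openin (Euclidean_space (mdim X)) W" "W \<subseteq> snd c ` fst c"
  shows "smooth_map (open_mfd (mdim X) W) X (chart_inv c)"
proof -
  have cX: "charted X" by (rule smooth_manifold_charted[OF X])
  have cont: "continuous_map (subtopology (Euclidean_space (mdim X)) W) (mtop X) (chart_inv c)"
    by (rule continuous_map_from_subtopology_mono[OF chart_inv_cont[OF cX c] W(2)])
  show ?thesis unfolding smooth_map_def
  proof (intro conjI ballI allI impI)
    show "continuous_map (mtop (open_mfd (mdim X) W)) (mtop X) (chart_inv c)" using cont by simp
    fix w c' k assume w: "w \<in> atlas (open_mfd (mdim X) W)" and c': "c' \<in> atlas X" and k: "k < mdim X"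
    let ?V = "snd w ` (fst w \<inter> chart_inv c -` fst c')"
    have V: "openin (Euclidean_space (mdim (open_mfd (mdim X) W))) ?V"
      by (rule chart_pullback_open[OF charted_open_mfd[OF W(1)] w _ chart_open[OF cX c']]) (use cont in simp)
    have Veq: "?V = W \<inter> chart_inv c -` fst c'" using w by auto
    have "smooth_on (mdim X) (snd c ` (fst c \<inter> fst c')) (\<lambda>x. snd c' (chart_inv c x) k)"
      using X c c' k by (simp add: smooth_manifold_def)
    then have "smooth_on (mdim X) ?V (\<lambda>x. snd c' (chart_inv c x) k)"
    proof (rule smooth_on_subset)
      show "?V \<subseteq> snd c ` (fst c \<inter> fst c')"
      proof
        fix x assume "x \<in> ?V"
        then have x: "x \<in> snd c ` fst c" "chart_inv c x \<in> fst c'" using W(2) Veq by auto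
        then show "x \<in> snd c ` (fst c \<inter> fst c')"
          using chart_inv_right[OF cX c x(1)] chart_inv_in[OF cX c x(1)] by (metis IntI image_eqI)
      qed
    qed (use V in simp)
    then show "smooth_on (mdim (open_mfd (mdim X) W)) ?V (\<lambda>x. snd c' (chart_inv c (chart_inv w x)) k)"
      unfolding open_mfd_simps by (rule smooth_on_cong) (use w in \<open>auto simp: chart_inv_open_mfd\<close>)
  qed
qed

lemma differential_open_mfd:
  assumes W: "openin (Euclidean_space k) W" and \<sigma>: "smooth_map (open_mfd k W) X \<sigma>" and X: "charted X"
    and c: "c \<in> atlas X" "\<sigma> x \<in> fst c" and x: "x \<in> W"
  shows "openin (Euclidean_space k) {y \<in> W. \<sigma> y \<in> fst c}"
    and "\<And>i. i < mdim X \<Longrightarrow> smooth_on k {y \<in> W. \<sigma> y \<in> fst c} (\<lambda>y. snd c (\<sigma> y) i)"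
    and "differential (open_mfd k W) X \<sigma> (W, \<lambda>x. x) c x v = (\<lambda>i. if i < mdim X then dd k (\<lambda>y. snd c (\<sigma> y) i) x v else 0)"
proof -
  let ?W = "{y \<in> W. \<sigma> y \<in> fst c}"
  have eq: "snd (W, \<lambda>x. x) ` (fst (W, \<lambda>x. x) \<inter> \<sigma> -` fst c) = ?W" by auto
  show o: "openin (Euclidean_space k) ?W"
    using chart_pullback_open[OF charted_open_mfd[OF W] _ smooth_map_cont[OF \<sigma>] chart_open[OF X c(1)], of "(W, \<lambda>x. x)"] eq by simp
  have "smooth_on k ?W (\<lambda>y. snd c (\<sigma> (chart_inv (W, \<lambda>x. x) y)) i)" if "i < mdim X" for i
    using smooth_map_rep[OF \<sigma> _ c(1) that, of "(W, \<lambda>x. x)"] eq by simp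
  then show "smooth_on k ?W (\<lambda>y. snd c (\<sigma> y) i)" if "i < mdim X" for i
    by (rule smooth_on_cong) (use that in \<open>auto simp: chart_inv_open_mfd\<close>)
  have "dd k (\<lambda>y. snd c (\<sigma> (chart_inv (W, \<lambda>x. x) y)) i) x v = dd k (\<lambda>y. snd c (\<sigma> y) i) x v" for i
    by (rule dd_cong[OF o]) (use x c in \<open>auto simp: chart_inv_open_mfd\<close>)
  then show "differential (open_mfd k W) X \<sigma> (W, \<lambda>x. x) c x v = (\<lambda>i. if i < mdim X then dd k (\<lambda>y. snd c (\<sigma> y) i) x v else 0)"
    unfolding differential_alt by (auto simp: fun_eq_iff)
qed

section \<open>Orbits of the compact group and their tangent spaces\<close>

context orbit_setting
begin

abbreviation "Orb p \<equiv> orbit G (\<lambda>g. act (\<iota> g)) p"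

lemma Orb_image: "Orb p = (\<lambda>g. act (\<iota> g) p) ` carrier G"
  by (auto simp: orbit_def)

lemma Orb_self: "p \<in> A \<Longrightarrow> p \<in> Orb p"
  unfolding Orb_image using one_carrier \<iota>_one act_one by (metis image_eqI)

lemma Orb_sub: "p \<in> A \<Longrightarrow> Orb p \<subseteq> A"
  unfolding Orb_image using act_closed \<iota>_closed by blast

lemma Orb_\<Omega>: "p \<in> \<Omega> \<Longrightarrow> Orb p \<subseteq> \<Omega>"
  unfolding Orb_image using \<Omega>_act \<iota>_closed \<Omega>_sub by blast

lemma act_mult_G: "g \<in> carrier G \<Longrightarrow> h \<in> carrier G \<Longrightarrow> p \<in> A \<Longrightarrow> act (\<iota> (g \<otimes>\<^bsub>G\<^esub> h)) p = act (\<iota> h) (act (\<iota> g) p)"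
  using \<iota>_mult act_mult \<iota>_closed by simp

lemma Orb_eq: assumes p: "p \<in> A" and q: "q \<in> Orb p" shows "Orb q = Orb p"
proof -
  interpret group G by (rule G_group)
  obtain h where h: "h \<in> carrier G" "q = act (\<iota> h) p" using q Orb_image by blast
  have 1: "act (\<iota> g) q \<in> Orb p" if "g \<in> carrier G" for g
    unfolding h(2) act_mult_G[OF h(1) that p, symmetric] Orb_image using h(1) that by blast
  have 2: "act (\<iota> g) p \<in> Orb q" if "g \<in> carrier G" for g
  proof -
    let ?k = "inv\<^bsub>G\<^esub> h \<otimes>\<^bsub>G\<^esub> g"
    have k: "?k \<in> carrier G" using that h by simp
    have "h \<otimes>\<^bsub>G\<^esub> ?k = g" using that h by (simp add: m_assoc[symmetric])
    then have "act (\<iota> g) p = act (\<iota> ?k) q" using act_mult_G[OF h(1) k p] h(2) by simp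
    then show ?thesis unfolding Orb_image using k by blast
  qed
  show ?thesis using 1 2 by (auto simp: Orb_image[of p] Orb_image[of q])
qed

lemma left_mult_open: "y \<in> carrier G \<Longrightarrow> openin (mtop XG) B \<Longrightarrow> openin (mtop XG) ((\<lambda>x. y \<otimes>\<^bsub>G\<^esub> x) ` B)"
  by (rule group_left_mult_open[OF G_group G_top]) (use left_mult_smooth smooth_map_def in blast)+

text \<open>Compactness of G does the work. The saturation S of B is the union of the translates of
  B by the stabilizer of p, hence open; its complement is compact with closed image, and that image
  cuts out exactly the points of the orbit outside the image of B.\<close>

lemma orbit_map_open:
  assumes p: "p \<in> A" and B: "openin (mtop XG) B"
  shows "openin (subtopology (mtop M) (Orb p)) ((\<lambda>g. act (\<iota> g) p) ` B)"
proof -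
  interpret group G by (rule G_group)
  let ?o = "\<lambda>g. act (\<iota> g) p"
  have Bc: "B \<subseteq> carrier G" using openin_subset[OF B] G_top by simp
  have c: "continuous_map (mtop XG) (mtop M) ?o" using orbit_map_smooth[OF p] by (simp add: smooth_map_def)
  define S where "S = {g \<in> carrier G. ?o g \<in> ?o ` B}"
  have "S = (\<Union>s\<in>{s \<in> carrier G. ?o s = p}. (\<lambda>x. s \<otimes>\<^bsub>G\<^esub> x) ` B)"
  proof (intro equalityI subsetI)
    fix g assume "g \<in> S"
    then obtain b where b: "b \<in> B" "?o g = ?o b" and g: "g \<in> carrier G" by (auto simp: S_def)
    have bc: "b \<in> carrier G" using b Bc by blast
    let ?s = "g \<otimes>\<^bsub>G\<^esub> inv\<^bsub>G\<^esub> b"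
    have ib: "inv\<^bsub>G\<^esub> b \<in> carrier G" using bc by simp
    have "?o ?s = p" using act_mult_G[OF g ib p] act_mult_G[OF bc ib p] b(2) bc p act_one \<iota>_one by simp
    moreover have "?s \<in> carrier G" using g ib by simp
    moreover have "g = ?s \<otimes>\<^bsub>G\<^esub> b" using g bc by (simp add: m_assoc)
    ultimately show "g \<in> (\<Union>s\<in>{s \<in> carrier G. ?o s = p}. (\<lambda>x. s \<otimes>\<^bsub>G\<^esub> x) ` B)"
      using b(1) by (intro UN_I[of ?s] image_eqI[of g _ b]) auto
  next
    fix g assume "g \<in> (\<Union>s\<in>{s \<in> carrier G. ?o s = p}. (\<lambda>x. s \<otimes>\<^bsub>G\<^esub> x) ` B)"
    then obtain s b where sb: "s \<in> carrier G" "?o s = p" "b \<in> B" "g = s \<otimes>\<^bsub>G\<^esub> b" by blast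
    have bc: "b \<in> carrier G" using sb Bc by blast
    have "?o g = ?o b" using act_mult_G[OF sb(1) bc p] sb by simp
    then show "g \<in> S" using sb bc by (auto simp: S_def)
  qed
  moreover have "openin (mtop XG) (\<Union>s\<in>{s \<in> carrier G. ?o s = p}. (\<lambda>x. s \<otimes>\<^bsub>G\<^esub> x) ` B)"
    by (intro openin_Union) (use left_mult_open[OF _ B] in auto)
  ultimately have "openin (mtop XG) S" by simp
  then have "closedin (mtop XG) (carrier G - S)" using G_top by auto
  then have "compactin (mtop XG) (carrier G - S)" using XG_compact closedin_compact_space by blast
  then have "compactin (mtop M) (?o ` (carrier G - S))" by (rule image_compactin[OF _ c])
  then have "closedin (mtop M) (?o ` (carrier G - S))" by (rule compactin_imp_closedin[OF M_Hausdorff])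
  then have "openin (mtop M) (A - ?o ` (carrier G - S))" by blast
  moreover have "?o ` B = (A - ?o ` (carrier G - S)) \<inter> Orb p"
  proof (intro equalityI subsetI)
    fix x assume x: "x \<in> ?o ` B"
    then have "x \<in> Orb p" using Bc Orb_image[of p] by blast
    moreover have "x \<notin> ?o ` (carrier G - S)"
    proof
      assume "x \<in> ?o ` (carrier G - S)"
      then obtain g where g: "g \<in> carrier G" "g \<notin> S" "x = ?o g" by blast
      show False using g x unfolding S_def g(3) by blast
    qed
    ultimately show "x \<in> (A - ?o ` (carrier G - S)) \<inter> Orb p" using Orb_sub[OF p] by blast
  next
    fix x assume x: "x \<in> (A - ?o ` (carrier G - S)) \<inter> Orb p"
    then obtain g where "g \<in> carrier G" "x = ?o g" using Orb_image[of p] by blast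
    then have "g \<in> S" using x by blast
    then show "x \<in> ?o ` B" using \<open>x = ?o g\<close> by (simp add: S_def)
  qed
  ultimately show ?thesis by (auto simp: openin_subtopology)
qed

lemma xv_kernel:
  assumes p: "p \<in> \<Omega>" and c: "c \<in> atlas M" "p \<in> fst c" and v: "v \<in> Rn n" and z: "xv c p v = (\<lambda>_. 0)"
  shows "v = (\<lambda>_. 0)"
proof -
  have "L v = (\<lambda>_. 0)" using fundamental_injective[OF p c L_Rn] zv_L[OF c] z by simp
  then have "comb (cat n v (\<lambda>_. 0)) = (\<lambda>_. 0)" by (simp add: comb_def lft_cat[OF v] rgt_cat L_zero J_zero)
  then have "cat n v (\<lambda>_. 0) = (\<lambda>_. 0)" by (rule comb_kernel[OF cat_Rn[OF Rn_zero]])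
  then have "lft n (cat n v (\<lambda>_. 0)) = lft n (\<lambda>_. 0)" by simp
  then show ?thesis unfolding lft_cat[OF v] by (auto simp: lft_def)
qed

definition \<tau> :: "'m \<Rightarrow> (nat \<Rightarrow> real) \<Rightarrow> 'm" where
  "\<tau> p x = act (\<iota> (chart_inv e x)) p"

lemma \<tau>_y0: "p \<in> A \<Longrightarrow> \<tau> p y0 = p"
  unfolding \<tau>_def chart_inv_left[OF cG e] \<iota>_one by (rule act_one)

text \<open>The immersion estimate at y0 holds between any two points of a cube. It yields
  injectivity of \<open>\<tau> p\<close> and of its differential throughout the cube, while relative
  openness comes from \<open>orbit_map_open\<close>. The estimate itself is passed on for the
  computation of tangent spaces.\<close>

lemma orbit_param:
  assumes p: "p \<in> \<Omega>" and c: "c \<in> atlas M" "p \<in> fst c"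
  obtains \<delta> C where "\<delta> > 0" "C > 0" "local_param M n (Orb p) (cube n y0 \<delta>) (\<tau> p)"
    "\<And>x. x \<in> cube n y0 \<delta> \<Longrightarrow> \<tau> p x \<in> fst c"
    "\<And>i. i < N \<Longrightarrow> smooth_on n (cube n y0 \<delta>) (\<lambda>x. snd c (\<tau> p x) i)"
    "\<And>y z. y \<in> cube n y0 \<delta> \<Longrightarrow> z \<in> cube n y0 \<delta> \<Longrightarrow>
       (\<Sum>j<n. \<bar>y j - z j\<bar>) \<le> C * (\<Sum>i<N. \<bar>snd c (\<tau> p y) i - snd c (\<tau> p z) i\<bar>)"
    "\<And>v i. i < N \<Longrightarrow> dd n (\<lambda>x. snd c (\<tau> p x) i) y0 v = xv c p v i"
proof -
  have pA: "p \<in> A" using p \<Omega>_sub by blast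
  let ?W = "snd e ` (fst e \<inter> (\<lambda>g. act (\<iota> g) p) -` fst c)"
  let ?f = "\<lambda>i x. snd c (\<tau> p x) i"
  note s = orbit_map_smooth[OF pA]
  have W: "openin (Euclidean_space n) ?W"
    by (rule chart_pullback_open[OF cG e(1) smooth_map_cont[OF s] chart_open[OF cM c(1)]])
  have x0: "y0 \<in> ?W" using e c act_one[OF pA] \<iota>_one by auto
  have sm: "smooth_on n ?W (?f i)" if "i < N" for i
    using smooth_map_rep[OF s e(1) c(1) that] by (simp add: \<tau>_def)
  have xvd: "dd n (?f i) y0 v = xv c p v i" if "i < N" for i v
    using that by (simp add: xv_def differential_alt \<tau>_def)
  obtain \<delta> C where dC: "\<delta> > 0" "C > 0" "cube n y0 \<delta> \<subseteq> ?W"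
    "\<And>y z. y \<in> cube n y0 \<delta> \<Longrightarrow> z \<in> cube n y0 \<delta> \<Longrightarrow> (\<Sum>j<n. \<bar>y j - z j\<bar>) \<le> C * (\<Sum>i<N. \<bar>?f i y - ?f i z\<bar>)"
  proof (rule immersion_bound[where f = ?f and m = N, OF sm x0 W])
    fix v assume v: "v \<in> Rn n" and z: "\<And>i. i < N \<Longrightarrow> dd n (?f i) y0 v = 0"
    have "xv c p v = (\<lambda>_. 0)" by (rule Rn_eqI[OF xv_Rn Rn_zero]) (use z xvd in simp)
    then show "v = (\<lambda>_. 0)" by (rule xv_kernel[OF p c v])
  qed (assumption, rule that)
  let ?K = "cube n y0 \<delta>"
  have Ke: "?K \<subseteq> snd e ` fst e" using dC(3) by blast
  have K\<tau>: "\<tau> p x \<in> fst c" if "x \<in> ?K" for x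
    using that dC(3) chart_inv_left[OF cG e(1)] by (auto simp: \<tau>_def)
  have smK: "smooth_on n ?K (?f i)" if "i < N" for i by (rule smooth_on_subset[OF sm[OF that] dC(3) openin_cube])
  have \<tau>s: "smooth_map (open_mfd n ?K) M (\<tau> p)"
    using smooth_map_compose[OF charted_open_mfd[OF openin_cube] cG cM smooth_map_chart_inv[OF XG_smooth e(1) openin_cube Ke] s]
    by (simp add: \<tau>_def[abs_def])
  have top: "topspace (subtopology (Euclidean_space n) ?K) = ?K" using cube_Rn by auto
  have inj: "inj_on (\<tau> p) ?K"
  proof (rule inj_onI)
    fix y z assume yz: "y \<in> ?K" "z \<in> ?K" and eq: "\<tau> p y = \<tau> p z"
    show "y = z" by (rule bound_imp_inj[where f = ?f, OF dC(4) _ yz]) (use eq cube_Rn in auto)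
  qed
  have op: "openin (subtopology (mtop M) (Orb p)) (\<tau> p ` V)" if "openin (Euclidean_space n) V" "V \<subseteq> ?K" for V
  proof -
    have "openin (mtop XG) (chart_inv e ` V)"
      by (rule chart_inv_open_image[OF cG e(1) that(1)]) (use that Ke in blast)
    from orbit_map_open[OF pA this] show ?thesis by (simp add: \<tau>_def[abs_def] image_image)
  qed
  have \<tau>O: "\<tau> p ` ?K \<subseteq> Orb p" using op[OF openin_cube order_refl] openin_imp_subset by blast
  have emb: "embedding_map (subtopology (Euclidean_space n) ?K) (mtop M) (\<tau> p)"
    unfolding embedding_map_def top
  proof (rule bijective_open_imp_homeomorphic_map)
    have "continuous_map (subtopology (Euclidean_space n) ?K) (mtop M) (\<tau> p)" using smooth_map_cont[OF \<tau>s] by simp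
    then show "continuous_map (subtopology (Euclidean_space n) ?K) (subtopology (mtop M) (\<tau> p ` ?K)) (\<tau> p)"
      unfolding continuous_map_in_subtopology top by blast
    show "open_map (subtopology (Euclidean_space n) ?K) (subtopology (mtop M) (\<tau> p ` ?K)) (\<tau> p)"
      unfolding open_map_def
    proof (intro allI impI)
      fix V assume "openin (subtopology (Euclidean_space n) ?K) V"
      then have V: "openin (Euclidean_space n) V" "V \<subseteq> ?K"
        using openin_open_subtopology[OF openin_cube] by auto
      then obtain T where "openin (mtop M) T" "\<tau> p ` V = T \<inter> Orb p" using op[OF V] unfolding openin_subtopology by blast
      then show "openin (subtopology (mtop M) (\<tau> p ` ?K)) (\<tau> p ` V)"
        unfolding openin_subtopology using V(2) \<tau>O by (intro exI[of _ T]) blast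
    qed
    show "\<tau> p ` topspace (subtopology (Euclidean_space n) ?K) = topspace (subtopology (mtop M) (\<tau> p ` ?K))"
      unfolding top using \<tau>O Orb_sub[OF pA] by auto
    show "inj_on (\<tau> p) (topspace (subtopology (Euclidean_space n) ?K))" unfolding top by (rule inj)
  qed
  \<comment> \<open>The chart c' is arbitrary; the differential is carried over to c, where the
    two-point estimate is available.\<close>
  have dinj: "inj_on (differential (open_mfd n ?K) M (\<tau> p) (?K, \<lambda>x. x) c' x) (Rn n)"
    if x: "x \<in> ?K" and c': "c' \<in> atlas M" "\<tau> p x \<in> fst c'" for x c'
  proof (rule inj_onI)
    let ?D = "\<lambda>c. differential (open_mfd n ?K) M (\<tau> p) (?K, \<lambda>x. x) c x"
    fix u v assume u: "u \<in> Rn n" and v: "v \<in> Rn n" and eq: "?D c' u = ?D c' v"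
    have tr: "?D c a = differential M M (\<lambda>p. p) c' c (\<tau> p x) (?D c' a)" for a
      using differential_compose[OF charted_open_mfd[OF openin_cube] cM cM \<tau>s smooth_map_id[OF M_smooth], of "(?K, \<lambda>x. x)" x c' c] x c' c(1) K\<tau>[OF x] by simp
    have "?D c (\<lambda>k. u k + - v k) = (\<lambda>k. ?D c u k + - ?D c v k)"
      unfolding differential_add differential_minus ..
    also have "\<dots> = (\<lambda>_. 0)" unfolding tr eq by simp
    finally have "?D c (\<lambda>k. u k + - v k) = (\<lambda>_. 0)" .
    then have z: "dd n (?f i) x (\<lambda>k. u k + - v k) = 0" if "i < N" for i
      using fun_cong[OF differential_open_mfd(3)[OF openin_cube \<tau>s cM c(1) K\<tau>[OF x] x, of "\<lambda>k. u k + - v k"], of i] that by simp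
    have "(\<lambda>k. u k + - v k) = (\<lambda>_. 0)"
      by (rule bound_imp_kernel[where f = ?f, OF smK openin_cube x dC(2) dC(4) Rn_add[OF u Rn_minus[OF v]] z])
    then show "u = v" by (simp add: fun_eq_iff)
  qed
  have "local_param M n (Orb p) ?K (\<tau> p)"
    unfolding local_param_def using openin_cube \<tau>s emb op[OF openin_cube order_refl] dinj by blast
  then show thesis using that dC K\<tau> smK xvd by blast
qed

lemma orbit_embedded: assumes p: "p \<in> \<Omega>" shows "embedded_submanifold M n (Orb p)"
  unfolding embedded_submanifold_def
proof (intro conjI ballI)
  have pA: "p \<in> A" using p \<Omega>_sub by blast
  show "Orb p \<subseteq> A" by (rule Orb_sub[OF pA])
  fix q assume q: "q \<in> Orb p"
  then have q\<Omega>: "q \<in> \<Omega>" using Orb_\<Omega>[OF p] by blast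
  then have qA: "q \<in> A" using \<Omega>_sub by blast
  obtain c where c: "c \<in> atlas M" "q \<in> fst c" using charted_cover[OF cM qA] .
  obtain \<delta> where d: "\<delta> > 0" "local_param M n (Orb q) (cube n y0 \<delta>) (\<tau> q)"
  proof (rule orbit_param[OF q\<Omega> c])
    fix \<delta> C :: real
    assume "\<delta> > 0" "local_param M n (Orb q) (cube n y0 \<delta>) (\<tau> q)"
    then show thesis by (rule that)
  qed
  have "q = \<tau> q y0" using \<tau>_y0[OF qA] by simp
  moreover have "y0 \<in> cube n y0 \<delta>" by (rule cube_self[OF chart_Rn[OF cG e] d(1)])
  ultimately show "\<exists>W \<sigma>. local_param M n (Orb p) W \<sigma> \<and> q \<in> \<sigma> ` W"
    using d(2) Orb_eq[OF pA q] by (metis image_eqI)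
qed

text \<open>A local parametrization \<open>\<sigma>\<close> factors through the orbit map only as a set function, so its derivative
  is obtained by bounding the difference quotients of the factor through the immersion estimate.\<close>

lemma orbit_tangent:
  assumes p: "p \<in> \<Omega>" and lp: "local_param M n (Orb p) W \<sigma>" and x: "x \<in> W" and c: "c \<in> atlas M" "\<sigma> x \<in> fst c" and v: "v \<in> Rn n"
  shows "\<exists>u\<in>Rn n. differential (open_mfd n W) M \<sigma> (W, \<lambda>x. x) c x v = xv c (\<sigma> x) u"
proof -
  have pA: "p \<in> A" using p \<Omega>_sub by blast
  have W: "openin (Euclidean_space n) W" and \<sigma>: "smooth_map (open_mfd n W) M \<sigma>"
    and \<sigma>O: "\<sigma> ` W \<subseteq> Orb p" using lp openin_imp_subset unfolding local_param_def by blast+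
  define q where "q = \<sigma> x"
  have qO: "q \<in> Orb p" using \<sigma>O x by (auto simp: q_def)
  have q\<Omega>: "q \<in> \<Omega>" using Orb_\<Omega>[OF p] qO by blast
  have qA: "q \<in> A" using q\<Omega> \<Omega>_sub by blast
  have cq: "q \<in> fst c" using c by (simp add: q_def)
  obtain \<delta> C where T: "\<delta> > 0" "C > 0" "local_param M n (Orb q) (cube n y0 \<delta>) (\<tau> q)"
    "\<And>x. x \<in> cube n y0 \<delta> \<Longrightarrow> \<tau> q x \<in> fst c"
    "\<And>i. i < N \<Longrightarrow> smooth_on n (cube n y0 \<delta>) (\<lambda>x. snd c (\<tau> q x) i)"
    "\<And>y z. y \<in> cube n y0 \<delta> \<Longrightarrow> z \<in> cube n y0 \<delta> \<Longrightarrow>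
       (\<Sum>j<n. \<bar>y j - z j\<bar>) \<le> C * (\<Sum>i<N. \<bar>snd c (\<tau> q y) i - snd c (\<tau> q z) i\<bar>)"
    "\<And>v i. i < N \<Longrightarrow> dd n (\<lambda>x. snd c (\<tau> q x) i) y0 v = xv c q v i"
    by (rule orbit_param[OF q\<Omega> c(1) cq]) (rule that)
  let ?K = "cube n y0 \<delta>"
  let ?f = "\<lambda>i x. snd c (\<tau> q x) i"
  define \<gamma> where "\<gamma> t = (\<lambda>j. x j + t * v j)" for t :: real
  have xR: "x \<in> Rn n" by (rule openin_Rn_subset[OF W x])
  have \<gamma>R: "\<gamma> t \<in> Rn n" for t using v xR by (simp add: \<gamma>_def Rn_iff)
  have \<gamma>0: "\<gamma> 0 = x" by (simp add: \<gamma>_def)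
  have \<gamma>c: "continuous_map euclideanreal (Euclidean_space n) \<gamma>"
  proof -
    have "continuous_map euclideanreal (Euclidean_space n) (\<lambda>t i. if i < n then \<gamma> t i else 0)"
      unfolding continuous_map_componentwise_Euclidean_space by (auto simp: \<gamma>_def intro!: continuous_intros)
    then show ?thesis by (rule continuous_map_eq) (use \<gamma>R in \<open>force simp: Rn_iff fun_eq_iff\<close>)
  qed
  note DO = differential_open_mfd[OF W \<sigma> cM c x]
  define s where "s i t = snd c (\<sigma> (\<gamma> t)) i" for i t
  define D where "D i = dd n (\<lambda>y. snd c (\<sigma> y) i) x v" for i
  have sD: "((\<lambda>t. (s i t - s i 0) / t) \<longlongrightarrow> D i) (at 0)" if i: "i < N" for i
  proof -
    have "((\<lambda>t. snd c (\<sigma> (\<gamma> t)) i) has_real_derivative dd n (\<lambda>y. snd c (\<sigma> y) i) (\<gamma> 0) v) (at 0)"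
      by (rule smooth_on_curve_cong[OF DO(2)[OF i]]) (use x c \<gamma>R \<gamma>0 in \<open>auto simp: \<gamma>_def intro!: derivative_eq_intros\<close>)
    then show ?thesis by (simp add: has_field_derivative_iff s_def D_def \<gamma>0)
  qed
  have "\<exists>T'. openin (mtop M) T' \<and> \<tau> q ` ?K = T' \<inter> Orb p"
    using T(3) Orb_eq[OF pA qO] by (auto simp: local_param_def openin_subtopology)
  then obtain T' where T': "openin (mtop M) T'" "\<tau> q ` ?K = T' \<inter> Orb p" by blast
  have y0K: "y0 \<in> ?K" by (rule cube_self[OF chart_Rn[OF cG e] T(1)])
  have qT: "q \<in> T'" using T'(2) y0K \<tau>_y0[OF qA] by (metis IntD1 image_eqI)
  have "openin (subtopology (Euclidean_space n) W) {y \<in> topspace (subtopology (Euclidean_space n) W). \<sigma> y \<in> T'}"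
    using openin_continuous_map_preimage[OF smooth_map_cont[OF \<sigma>] T'(1)] by simp
  then have "openin (Euclidean_space n) {y \<in> topspace (subtopology (Euclidean_space n) W). \<sigma> y \<in> T'}"
    using W openin_trans_full by blast
  from openin_continuous_map_preimage[OF \<gamma>c this]
  have "open {t. \<gamma> t \<in> {y \<in> topspace (subtopology (Euclidean_space n) W). \<sigma> y \<in> T'}}" by simp
  moreover have "0 \<in> {t. \<gamma> t \<in> {y \<in> topspace (subtopology (Euclidean_space n) W). \<sigma> y \<in> T'}}"
    using x xR qT by (simp add: \<gamma>0 q_def)
  ultimately have "eventually (\<lambda>t. \<gamma> t \<in> W \<and> \<sigma> (\<gamma> t) \<in> T') (nhds 0)"
    unfolding eventually_nhds by (intro exI[of _ "{t. \<gamma> t \<in> {y \<in> topspace (subtopology (Euclidean_space n) W). \<sigma> y \<in> T'}}"]) auto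
  then have ev: "eventually (\<lambda>t. \<gamma> t \<in> W \<and> \<sigma> (\<gamma> t) \<in> T') (at 0)"
    using eventually_nhds_conv_at by blast
  \<comment> \<open>Orbit points in T' lie in the image of \<open>\<tau> q\<close>. Where the curve
    has left W or T' the implication is vacuous and y0 serves as default, so \<open>y t\<close> lies
    in the cube for every t.\<close>
  have "\<exists>y\<in>?K. \<gamma> t \<in> W \<and> \<sigma> (\<gamma> t) \<in> T' \<longrightarrow> \<tau> q y = \<sigma> (\<gamma> t)" for t
  proof (cases "\<gamma> t \<in> W \<and> \<sigma> (\<gamma> t) \<in> T'")
    case True
    then have "\<sigma> (\<gamma> t) \<in> \<tau> q ` ?K" unfolding T'(2) using \<sigma>O by blast
    then show ?thesis by force
  qed (use y0K in blast)
  then obtain y where y: "\<And>t. y t \<in> ?K" "\<And>t. \<gamma> t \<in> W \<Longrightarrow> \<sigma> (\<gamma> t) \<in> T' \<Longrightarrow> \<tau> q (y t) = \<sigma> (\<gamma> t)" by metis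
  have fy: "?f i (y t) = s i t" if "\<gamma> t \<in> W" "\<sigma> (\<gamma> t) \<in> T'" for i t using y(2)[OF that] by (simp add: s_def)
  have f0: "?f i y0 = s i 0" for i using \<tau>_y0[OF qA] by (simp add: s_def \<gamma>0 q_def)
  define Z where "Z t = (\<Sum>j<n. \<bar>y t j - y0 j\<bar>)" for t
  \<comment> \<open>One more than the limit of the estimated difference quotients, so that
    eventually \<open>Z t\<close> is at most M0 |t|: the lifted curve y is Lipschitz at 0 before
    anything is known about its differentiability.\<close>
  define M0 where "M0 = C * (\<Sum>i<N. \<bar>D i\<bar>) + 1"
  have M0: "M0 > 0" unfolding M0_def using T(2) by (intro add_nonneg_pos mult_nonneg_nonneg sum_nonneg) auto
  have e0: "eventually (\<lambda>t. t \<noteq> (0::real)) (at 0)" by (simp add: eventually_neq_at_within)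
  have "((\<lambda>t. C * (\<Sum>i<N. \<bar>(s i t - s i 0) / t\<bar>)) \<longlongrightarrow> C * (\<Sum>i<N. \<bar>D i\<bar>)) (at 0)"
    by (intro tendsto_intros sD) auto
  then have "eventually (\<lambda>t. C * (\<Sum>i<N. \<bar>(s i t - s i 0) / t\<bar>) < M0) (at 0)"
    by (rule order_tendstoD) (simp add: M0_def)
  with ev e0 have Zb: "eventually (\<lambda>t. Z t \<le> M0 * \<bar>t\<bar>) (at 0)"
  proof eventually_elim
    case (elim t)
    have "Z t \<le> C * (\<Sum>i<N. \<bar>?f i (y t) - ?f i y0\<bar>)" unfolding Z_def by (rule T(6)[OF y(1) y0K])
    also have "\<dots> = C * (\<Sum>i<N. \<bar>(s i t - s i 0) / t\<bar>) * \<bar>t\<bar>"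
      using elim by (simp add: fy f0 abs_divide sum_divide_distrib[symmetric])
    also have "\<dots> \<le> M0 * \<bar>t\<bar>" using elim by (intro mult_right_mono) auto
    finally show ?case .
  qed
  have "((\<lambda>t. M0 * \<bar>t\<bar>) \<longlongrightarrow> M0 * \<bar>0\<bar>) (at (0::real))" by (intro tendsto_intros)
  then have Ml: "((\<lambda>t. M0 * \<bar>t\<bar>) \<longlongrightarrow> 0) (at (0::real))" by simp
  define u where "u t = (\<lambda>j. (y t j - y0 j) / t)" for t
  have Au: "((\<lambda>t. xv c q (u t) i) \<longlongrightarrow> D i) (at 0)" if i: "i < N" for i
  proof -
    have "((\<lambda>t. (s i t - s i 0) / t - xv c q (u t) i) \<longlongrightarrow> 0) (at 0)"
    proof (rule tendstoI)
      fix \<epsilon> :: real assume \<epsilon>: "\<epsilon> > 0"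
      \<comment> \<open>Together with the Lipschitz bound M0 this tolerance leaves an error of
        \<epsilon> / 2.\<close>
      define \<epsilon>' where "\<epsilon>' = \<epsilon> / (2 * M0)"
      have e': "\<epsilon>' > 0" using \<epsilon> M0 by (simp add: \<epsilon>'_def)
      obtain \<delta>' where d': "\<delta>' > 0" "\<forall>a\<in>cube n y0 \<delta>'. \<forall>b\<in>cube n y0 \<delta>'.
          \<bar>?f i a - ?f i b - dd n (?f i) y0 (\<lambda>j. a j - b j)\<bar> \<le> \<epsilon>' * (\<Sum>j<n. \<bar>a j - b j\<bar>)"
        using smooth_on_strict[OF T(5)[OF i] y0K e'] by blast
      have "eventually (\<lambda>t. M0 * \<bar>t\<bar> < \<delta>') (at 0)" by (rule order_tendstoD(2)[OF Ml d'(1)])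
      with Zb ev e0 show "eventually (\<lambda>t. dist ((s i t - s i 0) / t - xv c q (u t) i) 0 < \<epsilon>) (at 0)"
      proof eventually_elim
        case (elim t)
        have "\<bar>y t j - y0 j\<bar> < \<delta>'" if "j < n" for j
        proof -
          have "\<bar>y t j - y0 j\<bar> \<le> Z t" unfolding Z_def using that by (intro member_le_sum) auto
          then show ?thesis using elim by linarith
        qed
        then have yc: "y t \<in> cube n y0 \<delta>'" using cube_Rn[OF y(1)] by (simp add: cube_def)
        have y0c: "y0 \<in> cube n y0 \<delta>'" by (rule cube_self[OF chart_Rn[OF cG e] d'(1)])
        have "\<bar>?f i (y t) - ?f i y0 - dd n (?f i) y0 (\<lambda>j. y t j - y0 j)\<bar> \<le> \<epsilon>' * Z t"
          using d'(2) yc y0c unfolding Z_def by blast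
        also have "?f i (y t) - ?f i y0 - dd n (?f i) y0 (\<lambda>j. y t j - y0 j) = t * ((s i t - s i 0) / t - xv c q (u t) i)"
        proof -
          have "dd n (?f i) y0 (\<lambda>j. y t j - y0 j) = t * dd n (?f i) y0 (u t)"
            unfolding dd_def u_def sum_distrib_left using elim by (intro sum.cong) auto
          then show ?thesis using elim T(7)[OF i, of "u t"] fy f0 by (simp add: field_simps)
        qed
        finally have "\<bar>t\<bar> * \<bar>(s i t - s i 0) / t - xv c q (u t) i\<bar> \<le> \<epsilon>' * Z t" by (simp add: abs_mult)
        also have "\<dots> \<le> \<epsilon>' * (M0 * \<bar>t\<bar>)" using elim e' by (intro mult_left_mono) auto
        also have "\<dots> = \<bar>t\<bar> * (\<epsilon> / 2)" using M0 by (simp add: \<epsilon>'_def)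
        finally have "\<bar>(s i t - s i 0) / t - xv c q (u t) i\<bar> \<le> \<epsilon> / 2" using elim by simp
        then show ?case using \<epsilon> by (simp add: dist_real_def)
      qed
    qed
    from tendsto_diff[OF sD[OF i] this] show ?thesis by simp
  qed
  have uR: "u t \<in> Rn n" for t using cube_Rn[OF y(1)] chart_Rn[OF cG e] by (simp add: u_def Rn_iff)
  have xl: "xv c q u' i = (\<Sum>j<n. xi c q j i * u' j)" if "u' \<in> Rn n" for u' i
    using xv_sum[OF that, of c q] by (simp add: mult.commute)
  \<comment> \<open>The fundamental vectors at q are independent, so a left inverse transfers
    convergence of \<open>xv c q (u t)\<close> to the difference quotients \<open>u t\<close>
    themselves.\<close>
  obtain b where b: "\<And>u' j. j < n \<Longrightarrow> (\<Sum>i<N. b j i * (\<Sum>l<n. xi c q l i * u' l)) = u' j"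
  proof (rule left_inverse_exists[where k = n and m = N and a = "\<lambda>i l. xi c q l i"])
    fix u' assume u': "u' \<in> Rn n" and z: "\<And>i. i < N \<Longrightarrow> (\<Sum>j<n. xi c q j i * u' j) = 0"
    have "xv c q u' = (\<lambda>_. 0)" by (rule Rn_eqI[OF xv_Rn Rn_zero]) (use z xl[OF u'] in simp)
    then show "u' = (\<lambda>_. 0)" by (rule xv_kernel[OF q\<Omega> c(1) cq u'])
  qed (rule that)
  define u0 where "u0 j = (if j < n then \<Sum>i<N. b j i * D i else 0)" for j
  have u0R: "u0 \<in> Rn n" by (simp add: u0_def Rn_iff)
  have ul: "((\<lambda>t. u t j) \<longlongrightarrow> u0 j) (at 0)" if j: "j < n" for j
  proof -
    have "((\<lambda>t. \<Sum>i<N. b j i * xv c q (u t) i) \<longlongrightarrow> (\<Sum>i<N. b j i * D i)) (at 0)"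
      by (intro tendsto_intros Au) auto
    then show ?thesis using b[OF j] xl[OF uR] j by (simp add: u0_def)
  qed
  have "D i = xv c q u0 i" if i: "i < N" for i
  proof -
    have "((\<lambda>t. \<Sum>j<n. xi c q j i * u t j) \<longlongrightarrow> (\<Sum>j<n. xi c q j i * u0 j)) (at 0)"
      by (intro tendsto_intros ul) auto
    then have "((\<lambda>t. xv c q (u t) i) \<longlongrightarrow> xv c q u0 i) (at 0)" by (simp add: xl[OF uR] xl[OF u0R])
    from tendsto_unique[OF _ Au[OF i] this] show ?thesis by simp
  qed
  then have "differential (open_mfd n W) M \<sigma> (W, \<lambda>x. x) c x v = xv c q u0"
    by (intro Rn_eqI[OF differential_Rn xv_Rn]) (simp add: DO(3) D_def)
  then show ?thesis using u0R by (auto simp: q_def)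
qed

end

section \<open>Minimal Lagrangian orbits\<close>

lemma injective_square_surj:
  fixes m :: "nat \<Rightarrow> nat \<Rightarrow> real"
  assumes ker: "\<And>z. z \<in> Rn k \<Longrightarrow> (\<And>j. j < k \<Longrightarrow> (\<Sum>a<k. m j a * z a) = 0) \<Longrightarrow> z = (\<lambda>_. 0)"
  obtains z where "z \<in> Rn k" "\<And>j. j < k \<Longrightarrow> (\<Sum>a<k. m j a * z a) = v j"
proof
  have d: "dt k m \<noteq> 0" unfolding dt_nonzero_iff using ker by blast
  let ?z = "\<lambda>a. if a < k then \<Sum>l<k. mat_inv k m a l * v l else 0"
  show "?z \<in> Rn k" by (simp add: Rn_iff)
  show "(\<Sum>a<k. m j a * ?z a) = v j" if j: "j < k" for j
  proof -
    have "(\<Sum>a<k. m j a * ?z a) = (\<Sum>l<k. (\<Sum>a<k. m j a * mat_inv k m a l) * v l)"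
      by (simp add: sum_mult_assoc)
    also have "\<dots> = (\<Sum>l<k. (if j = l then 1 else 0) * v l)" by (simp add: mat_inv_mult(1)[OF d j])
    finally show ?thesis using sum_delta_left[OF j] by simp
  qed
qed

context orbit_setting
begin

section \<open>Arbitrary parametrizations of an orbit and the frame of fundamental vectors\<close>

lemma local_paramD:
  assumes "local_param M n K W \<sigma>"
  shows param_open: "openin (Euclidean_space n) W" and param_smooth: "smooth_map (open_mfd n W) M \<sigma>"
    and param_inj: "x \<in> W \<Longrightarrow> c \<in> atlas M \<Longrightarrow> \<sigma> x \<in> fst c \<Longrightarrow> inj_on (differential (open_mfd n W) M \<sigma> (W, \<lambda>x. x) c x) (Rn n)"
    and param_in: "x \<in> W \<Longrightarrow> \<sigma> x \<in> K"
  using assms openin_imp_subset[of "mtop M" K "\<sigma> ` W"] unfolding local_param_def by blast+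

lemma param_immersion:
  assumes lp: "local_param M n K W \<sigma>" and c: "c \<in> atlas M"
  shows "immersion_in_chart N (U c) (w c) n {y \<in> W. \<sigma> y \<in> fst c} (\<lambda>y. snd c (\<sigma> y))"
proof -
  interpret kaehler_chart N "U c" "w c" by (rule kaehler_chart[OF c])
  note W = param_open[OF lp] and \<sigma> = param_smooth[OF lp]
  let ?W = "{y \<in> W. \<sigma> y \<in> fst c}"
  have eq: "snd (W, \<lambda>x. x) ` (fst (W, \<lambda>x. x) \<inter> \<sigma> -` fst c) = ?W" by auto
  have o: "openin (Euclidean_space n) ?W"
    using chart_pullback_open[OF charted_open_mfd[OF W] _ smooth_map_cont[OF \<sigma>] chart_open[OF cM c], of "(W, \<lambda>x. x)"] eq by simp
  show ?thesis
  proof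
    show "smooth_on n ?W (\<lambda>y. snd c (\<sigma> y) i)" if i: "i < N" for i
    \<comment> \<open>The coordinate facts are stated relative to a point of the domain, so the
      empty domain is treated apart; there every function is smooth.\<close>
    proof (cases "?W = {}")
      case True
      show ?thesis using smooth_on_const[OF o, of 0] unfolding True by (simp add: smooth_on_def)
    next
      case False
      then obtain x where "x \<in> W" "\<sigma> x \<in> fst c" by blast
      then show ?thesis using differential_open_mfd(2)[OF W \<sigma> cM c] i by blast
    qed
  qed (use o dim_M in auto)
qed

lemma param_tangent:
  assumes lp: "local_param M n K W \<sigma>" and c: "c \<in> atlas M" and x: "x \<in> W" "\<sigma> x \<in> fst c"
  shows "a < n \<Longrightarrow> tangent_vec (\<lambda>y. snd c (\<sigma> y)) x a = differential (open_mfd n W) M \<sigma> (W, \<lambda>x. x) c x (unit_vec a)"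
    and "z \<in> Rn n \<Longrightarrow> differential (open_mfd n W) M \<sigma> (W, \<lambda>x. x) c x z = (\<lambda>k. \<Sum>a<n. z a * tangent_vec (\<lambda>y. snd c (\<sigma> y)) x a k)"
proof -
  interpret immersion_in_chart N "U c" "w c" n "{y \<in> W. \<sigma> y \<in> fst c}" "\<lambda>y. snd c (\<sigma> y)" by (rule param_immersion[OF lp c])
  let ?D = "differential (open_mfd n W) M \<sigma> (W, \<lambda>x. x) c x"
  show *: "T x a = ?D (unit_vec a)" if a: "a < n" for a
  proof (rule Rn_eqI[OF T_Rn differential_Rn])
    fix k assume "k < N"
    then show "T x a k = ?D (unit_vec a) k"
      using a by (simp add: differential_open_mfd(3)[OF param_open[OF lp] param_smooth[OF lp] cM c x(2) x(1)] dd_unit tangent_vec_def)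
  qed (use a x in auto)
  assume z: "z \<in> Rn n"
  have "?D z = (\<lambda>k. \<Sum>a<n. z a * ?D (unit_vec a) k)"
    using differential_lin[where A = "{..<n}" and a = z and u = unit_vec and X = "open_mfd n W" and Y = M and F = \<sigma> and c = "(W, \<lambda>x. x)" and d = c and p = x]
      Rn_expand[OF z] by simp
  then show "?D z = (\<lambda>k. \<Sum>a<n. z a * T x a k)" using * by simp
qed

text \<open>By \<open>orbit_tangent\<close> every tangent vector of the parametrization is a
  fundamental vector. The resulting coefficient matrix is square and injective, because the
  differential is, hence it is surjective.\<close>

lemma param_span:
  assumes p: "p \<in> \<Omega>" and lp: "local_param M n (Orb p) W \<sigma>" and c: "c \<in> atlas M" and x: "x \<in> W" "\<sigma> x \<in> fst c" and v: "v \<in> Rn n"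
  obtains z where "z \<in> Rn n" "differential (open_mfd n W) M \<sigma> (W, \<lambda>x. x) c x z = xv c (\<sigma> x) v"
proof -
  let ?D = "differential (open_mfd n W) M \<sigma> (W, \<lambda>x. x) c x"
  obtain u where u: "\<And>a. a < n \<Longrightarrow> u a \<in> Rn n" "\<And>a. a < n \<Longrightarrow> ?D (unit_vec a) = xv c (\<sigma> x) (u a)"
    using orbit_tangent[OF p lp x(1) c x(2) unit_vec_Rn] by metis
  have D: "?D z = xv c (\<sigma> x) (\<lambda>j. \<Sum>a<n. z a * u a j)" if z: "z \<in> Rn n" for z
  proof -
    have "?D z = (\<lambda>k. \<Sum>a<n. z a * xv c (\<sigma> x) (u a) k)"
      unfolding param_tangent(2)[OF lp c x z] using param_tangent(1)[OF lp c x] u by simp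
    also have "\<dots> = xv c (\<sigma> x) (\<lambda>j. \<Sum>a<n. z a * u a j)" unfolding xv_def by (rule differential_lin[symmetric])
    finally show ?thesis .
  qed
  have uR: "(\<lambda>j. \<Sum>a<n. z a * u a j) \<in> Rn n" for z by (rule Rn_sum) (use u in auto)
  obtain z where z: "z \<in> Rn n" "\<And>j. j < n \<Longrightarrow> (\<Sum>a<n. u a j * z a) = v j"
  proof (rule injective_square_surj[where k = n and m = "\<lambda>j a. u a j" and v = v])
    fix z assume z: "z \<in> Rn n" and 0: "\<And>j. j < n \<Longrightarrow> (\<Sum>a<n. u a j * z a) = 0"
    have "(\<lambda>j. \<Sum>a<n. z a * u a j) = (\<lambda>_. 0)" by (rule Rn_eqI[OF uR Rn_zero]) (use 0 in \<open>simp add: mult.commute\<close>)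
    then have "?D z = ?D (\<lambda>_. 0)" using D[OF z] by (simp add: differential_zero xv_def)
    then show "z = (\<lambda>_. 0)" using inj_onD[OF param_inj[OF lp x(1) c x(2)] _ z Rn_zero] by blast
  qed blast
  have "(\<lambda>j. \<Sum>a<n. z a * u a j) = v" by (rule Rn_eqI[OF uR v]) (use z in \<open>simp add: mult.commute\<close>)
  then have "?D z = xv c (\<sigma> x) v" using D[OF z(1)] by simp
  then show thesis by (rule that[OF z(1)])
qed

lemma param_at:
  assumes p: "p \<in> \<Omega>" and q: "q \<in> Orb p"
  obtains W \<sigma> x where "local_param M n (Orb p) W \<sigma>" "x \<in> W" "q = \<sigma> x"
  using orbit_embedded[OF p] q unfolding embedded_submanifold_def by blast

text \<open>Vanishing of \<omega> on fundamental vectors, phrased through the metric because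
  \<omega>(u, v) = - g(u, J v): tangent vectors are orthogonal to the images of tangent vectors
  under J.\<close>

definition isotropic_orbit :: "'m \<Rightarrow> bool" where
  "isotropic_orbit p \<longleftrightarrow> (\<forall>q\<in>Orb p. \<forall>c\<in>atlas M. q \<in> fst c \<longrightarrow> (\<forall>u\<in>Rn n. \<forall>v\<in>Rn n. gm c q (xv c q u) (J (xv c q v)) = 0))"

text \<open>All functions div JX vanish along the orbit. By \<open>gramM_ray\<close> this is
  stationarity of the Gram determinant in the directions JX at points of the open orbit.\<close>

definition critical_orbit :: "'m \<Rightarrow> bool" where
  "critical_orbit p \<longleftrightarrow> (\<forall>q\<in>Orb p. \<forall>c\<in>atlas M. q \<in> fst c \<longrightarrow> (\<forall>v\<in>Rn n. dvJ c v (snd c q) = 0))"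

lemma half_dim: "N div 2 = n" using dim_M by simp

lemma \<omega>_gm: "c \<in> atlas M \<Longrightarrow> p \<in> fst c \<Longrightarrow> u \<in> Rn N \<Longrightarrow> v \<in> Rn N \<Longrightarrow> bil N (\<omega> c p) u v = - gm c p u (J v)"
  using kaehler_chart.w_G[OF kaehler_chart, of c "snd c p" u v] w_eq[of c p] by (simp add: gm_chart)

lemma lagrangian_iff:
  assumes p: "p \<in> \<Omega>"
  shows "lagrangian M \<omega> (Orb p) \<longleftrightarrow> isotropic_orbit p"
proof
  assume L: "lagrangian M \<omega> (Orb p)"
  show "isotropic_orbit p" unfolding isotropic_orbit_def
  proof (intro ballI impI)
    fix q c u v assume q: "q \<in> Orb p" and c: "c \<in> atlas M" "q \<in> fst c" and u: "u \<in> Rn n" and v: "v \<in> Rn n"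
    obtain W \<sigma> x where lp: "local_param M n (Orb p) W \<sigma>" and x: "x \<in> W" "q = \<sigma> x" by (rule param_at[OF p q])
    have cx: "\<sigma> x \<in> fst c" using c x by simp
    obtain y where y: "y \<in> Rn n" "differential (open_mfd n W) M \<sigma> (W, \<lambda>x. x) c x y = xv c (\<sigma> x) u"
      by (rule param_span[OF p lp c(1) x(1) cx u])
    obtain z where z: "z \<in> Rn n" "differential (open_mfd n W) M \<sigma> (W, \<lambda>x. x) c x z = xv c (\<sigma> x) v"
      by (rule param_span[OF p lp c(1) x(1) cx v])
    have "bil N (\<omega> c q) (xv c q u) (xv c q v) = 0"
      using L lp x c y z unfolding lagrangian_def half_dim Let_def by metis
    then show "gm c q (xv c q u) (J (xv c q v)) = 0" using \<omega>_gm[OF c xv_Rn xv_Rn] by simp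
  qed
next
  assume I: "isotropic_orbit p"
  show "lagrangian M \<omega> (Orb p)" unfolding lagrangian_def half_dim Let_def
  proof (intro conjI allI impI ballI orbit_embedded[OF p])
    fix W \<sigma> x c u v
    assume lp: "local_param M n (Orb p) W \<sigma>" and x: "x \<in> W" and c: "c \<in> atlas M" "\<sigma> x \<in> fst c" and u: "u \<in> Rn n" and v: "v \<in> Rn n"
    obtain a b where ab: "a \<in> Rn n" "b \<in> Rn n" "differential (open_mfd n W) M \<sigma> (W, \<lambda>x. x) c x u = xv c (\<sigma> x) a"
      "differential (open_mfd n W) M \<sigma> (W, \<lambda>x. x) c x v = xv c (\<sigma> x) b"
      using orbit_tangent[OF p lp x c u] orbit_tangent[OF p lp x c v] by blast
    have "gm c (\<sigma> x) (xv c (\<sigma> x) a) (J (xv c (\<sigma> x) b)) = 0"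
      using I param_in[OF lp x] c ab unfolding isotropic_orbit_def by blast
    then show "bil N (\<omega> c (\<sigma> x)) (differential (open_mfd n W) M \<sigma> (W, \<lambda>x. x) c x u) (differential (open_mfd n W) M \<sigma> (W, \<lambda>x. x) c x v) = 0"
      unfolding ab using \<omega>_gm[OF c xv_Rn xv_Rn] by simp
  qed
qed

text \<open>Isotropy makes each JX a normal field along the orbit, so
  \<open>mean_curvature_normal\<close> evaluates its pairing with the mean curvature. The tangent
  vectors being fundamental vectors, these pairings control the whole normal component.\<close>

lemma mean_curvature_iff:
  assumes p: "p \<in> \<Omega>" and I: "isotropic_orbit p" and lp: "local_param M n (Orb p) W \<sigma>" and x: "x \<in> W" and c: "c \<in> atlas M" "\<sigma> x \<in> fst c"
  shows "(\<forall>i<N. mean_curvature N n (in_coords (kaehler_metric M \<omega>) c) (\<lambda>y. snd c (\<sigma> y)) x i = 0) \<longleftrightarrow>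
    (\<forall>v\<in>Rn n. dvJ c v (snd c (\<sigma> x)) = 0)"
proof -
  let ?W = "{y \<in> W. \<sigma> y \<in> fst c}"
  interpret immersion_in_chart N "U c" "w c" n ?W "\<lambda>y. snd c (\<sigma> y)" by (rule param_immersion[OF lp c(1)])
  have xW: "x \<in> ?W" using x c by simp
  let ?H = "mean_curvature N n (gc c) (\<lambda>y. snd c (\<sigma> y)) x"
  have T: "\<exists>u\<in>Rn n. T y a = xv c (\<sigma> y) u" if "y \<in> ?W" "a < n" for y a
    using orbit_tangent[OF p lp _ c(1) _ unit_vec_Rn[OF that(2)], of y] param_tangent(1)[OF lp c(1), of y a] that by simp
  have iso: "bil N (gc c (snd c (\<sigma> y))) (xv c (\<sigma> y) u) (J (xv c (\<sigma> y) v)) = 0" if "y \<in> ?W" "u \<in> Rn n" "v \<in> Rn n" for y u v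
    using I param_in[OF lp, of y] c(1) that gm_chart[OF c(1), of "\<sigma> y"] unfolding isotropic_orbit_def by force
  have nz: "dt n (\<lambda>a b. bil N (gc c (snd c (\<sigma> x))) (T x a) (T x b)) \<noteq> 0" unfolding dt_nonzero_iff
  proof (intro ballI impI)
    fix z assume z: "z \<in> Rn n" and 0: "\<forall>i<n. (\<Sum>j<n. bil N (gc c (snd c (\<sigma> x))) (T x i) (T x j) * z j) = 0"
    let ?t = "\<lambda>k. \<Sum>a<n. z a * T x a k"
    have "bil N (gc c (snd c (\<sigma> x))) ?t ?t = 0" unfolding bil_lin1 unfolding bil_lin2 using 0 by (simp add: mult.commute)
    moreover have "?t \<in> Rn N" by (rule Rn_sum) (use T_Rn[OF xW] in auto)
    ultimately have "?t = (\<lambda>_. 0)" using G_pos[OF s_U[OF xW]] by force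
    then have "differential (open_mfd n W) M \<sigma> (W, \<lambda>x. x) c x z = differential (open_mfd n W) M \<sigma> (W, \<lambda>x. x) c x (\<lambda>_. 0)"
      using param_tangent(2)[OF lp c(1) x c(2) z] by (simp add: differential_zero)
    then show "z = (\<lambda>_. 0)" using inj_onD[OF param_inj[OF lp x c] _ z Rn_zero] by blast
  qed
  have isoT: "bil N (gc c (snd c (\<sigma> x))) (T x a) (J (T x b)) = 0" if "a < n" "b < n" for a b
    using T[OF xW that(1)] T[OF xW that(2)] iso[OF xW] by auto
  have H: "2 * bil N (gc c (snd c (\<sigma> x))) ?H (J (xv c (\<sigma> x) v)) = - dvJ c v (snd c (\<sigma> x))" if v: "v \<in> Rn n" for v
  proof -
    have "2 * bil N (gc c (snd c (\<sigma> x))) ?H (J (XF c v (snd c (\<sigma> x)))) = - dv (\<lambda>y. J (XF c v y)) (snd c (\<sigma> x))"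
    proof (rule mean_curvature_normal[OF XF_props(1)[OF c(1)] _ xW nz isoT])
      fix y b assume y: "y \<in> ?W" and b: "b < n"
      have "XF c v (snd c (\<sigma> y)) = xv c (\<sigma> y) v" by (rule XF_xv[OF c(1) _ v]) (use y in simp)
      then show "bil N (gc c (snd c (\<sigma> y))) (T y b) (J (XF c v (snd c (\<sigma> y)))) = 0" using T[OF y b] iso[OF y _ v] by auto
    qed
    then show ?thesis unfolding XF_xv[OF c v] by (simp add: dvJ_def)
  qed
  show ?thesis unfolding gc_eq[OF c(1), symmetric]
  proof
    assume z: "\<forall>i<N. ?H i = 0"
    have "bil N (gc c (snd c (\<sigma> x))) ?H v = bil N (gc c (snd c (\<sigma> x))) (\<lambda>_. 0) v" for v by (rule bil_cong) (use z in auto)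
    then show "\<forall>v\<in>Rn n. dvJ c v (snd c (\<sigma> x)) = 0" using H by (simp add: bil_zero1)
  next
    assume z: "\<forall>v\<in>Rn n. dvJ c v (snd c (\<sigma> x)) = 0"
    have "bil N (gc c (snd c (\<sigma> x))) ?H (J (T x a)) = 0" if "a < n" for a using T[OF xW that] H z by auto
    then show "\<forall>i<N. ?H i = 0" using mean_curvature_zeroI[OF xW nz isoT] by blast
  qed
qed

lemma minimal_iff:
  assumes p: "p \<in> \<Omega>" and I: "isotropic_orbit p"
  shows "minimal_submanifold M (kaehler_metric M \<omega>) n (Orb p) \<longleftrightarrow> critical_orbit p"
proof
  assume m: "minimal_submanifold M (kaehler_metric M \<omega>) n (Orb p)"
  show "critical_orbit p" unfolding critical_orbit_def
  proof (rule ballI, rule ballI, rule impI)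
    fix q c assume q: "q \<in> Orb p" and c: "c \<in> atlas M" "q \<in> fst c"
    obtain W \<sigma> x where lp: "local_param M n (Orb p) W \<sigma>" and x: "x \<in> W" "q = \<sigma> x" by (rule param_at[OF p q])
    have cx: "\<sigma> x \<in> fst c" using c x by simp
    show "\<forall>v\<in>Rn n. dvJ c v (snd c q) = 0"
      using m lp c(1) x(1) cx mean_curvature_iff[OF p I lp x(1) c(1) cx] unfolding minimal_submanifold_def x(2) by blast
  qed
next
  assume cr: "critical_orbit p"
  show "minimal_submanifold M (kaehler_metric M \<omega>) n (Orb p)" unfolding minimal_submanifold_def
  proof (intro conjI orbit_embedded[OF p], rule allI, rule allI, rule impI, rule ballI, rule ballI, rule impI)
    fix W \<sigma> x c assume lp: "local_param M n (Orb p) W \<sigma>" and x: "x \<in> W" and c: "c \<in> atlas M" "\<sigma> x \<in> fst c"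
    show "\<forall>i<N. mean_curvature N n (in_coords (kaehler_metric M \<omega>) c) (\<lambda>y. snd c (\<sigma> y)) x i = 0"
      using cr param_in[OF lp x] c unfolding mean_curvature_iff[OF p I lp x c] critical_orbit_def by blast
  qed
qed

lemma critical_isotropic:
  assumes p: "p \<in> \<Omega>" and cr: "critical_orbit p"
  shows "isotropic_orbit p"
  unfolding isotropic_orbit_def
proof (intro ballI impI)
  fix q c u v assume q: "q \<in> Orb p" and c: "c \<in> atlas M" "q \<in> fst c" and u: "u \<in> Rn n" and v: "v \<in> Rn n"
  obtain W \<sigma> x where lp: "local_param M n (Orb p) W \<sigma>" and x: "x \<in> W" "q = \<sigma> x" by (rule param_at[OF p q])
  have cx: "\<sigma> x \<in> fst c" using c x by simp
  let ?W = "{y \<in> W. \<sigma> y \<in> fst c}"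
  interpret immersion_in_chart N "U c" "w c" n ?W "\<lambda>y. snd c (\<sigma> y)" by (rule param_immersion[OF lp c(1)])
  have xW: "x \<in> ?W" using x cx by simp
  have T: "gm c q (T x a) (J (xv c q v)) = 0" if a: "a < n" for a
  proof -
    have "dd N (dvJ c v) (snd c (\<sigma> x)) (T x a) = pd a (\<lambda>y. dvJ c v (snd c (\<sigma> y))) x"
      by (rule pd_comp_s[OF dvJ_smooth[OF c(1)] xW a, symmetric])
    also have "\<dots> = pd a (\<lambda>y. 0) x"
    proof (rule pd_cong[OF W _ xW a])
      fix y assume "y \<in> ?W"
      then show "dvJ c v (snd c (\<sigma> y)) = 0" using cr param_in[OF lp, of y] c(1) v unfolding critical_orbit_def by blast
    qed
    also have "\<dots> = 0" by (simp add: pd_def)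
    \<comment> \<open>The vanishing derivative equals - 2 r g(T a, JX), and r is positive.\<close>
    finally show ?thesis
      using dvJ_derivative[OF c T_Rn[OF xW a] v] r_pos x(2) by simp
  qed
  obtain z where z: "z \<in> Rn n" "differential (open_mfd n W) M \<sigma> (W, \<lambda>x. x) c x z = xv c (\<sigma> x) u"
    by (rule param_span[OF p lp c(1) x(1) cx u])
  have "xv c q u = (\<lambda>k. \<Sum>a<n. z a * T x a k)" using z param_tangent(2)[OF lp c(1) x(1) cx z(1)] x(2) by simp
  then show "gm c q (xv c q u) (J (xv c q v)) = 0" using T by (simp add: gm_def bil_lin1)
qed

theorem minimal_lagrangian_iff_critical:
  assumes p: "p \<in> \<Omega>"
  shows "lagrangian M \<omega> (Orb p) \<and> minimal_submanifold M (kaehler_metric M \<omega>) n (Orb p) \<longleftrightarrow> critical_orbit p"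
  using lagrangian_iff[OF p] minimal_iff[OF p] critical_isotropic[OF p] by blast

end

section \<open>Existence and uniqueness\<close>

context orbit_setting
begin

section \<open>The Gram determinant along the curves p exp(i t X)\<close>

lemma curve_in_chart:
  assumes v: "v \<in> Rn NC" and p: "p \<in> A" and c: "c \<in> atlas M" "act (ep v t) p \<in> fst c"
  shows curve_eventually: "eventually (\<lambda>s. act (ep v s) p \<in> fst c) (nhds t)"
    and curve_derivative: "smooth_on N (U c) f \<Longrightarrow>
      ((\<lambda>s. f (snd c (act (ep v s) p))) has_real_derivative dd N f (snd c (act (ep v t) p)) (zv c (act (ep v t) p) v)) (at t)"
proof -
  have "open {s. act (ep v s) p \<in> fst c}"
    using openin_continuous_map_preimage[OF curve_cont[OF v p] chart_open[OF cM c(1)]] by simp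
  then show ev: "eventually (\<lambda>s. act (ep v s) p \<in> fst c) (nhds t)" using c(2) eventually_nhds by blast
  assume f: "smooth_on N (U c) f"
  have "eventually (\<lambda>s. act (ep v s) p \<in> fst c) (at t)" using ev eventually_nhds_conv_at by blast
  then have R: "eventually (\<lambda>s. snd c (act (ep v s) p) \<in> Rn N) (at t)" by eventually_elim (rule chart_Rn[OF cM c(1)])
  show "((\<lambda>s. f (snd c (act (ep v s) p))) has_real_derivative dd N f (snd c (act (ep v t) p)) (zv c (act (ep v t) p) v)) (at t)"
    by (rule smooth_on_curve[OF f _ curve_velocity[OF v p c] R]) (use c in auto)
qed

abbreviation ray where "ray v p t \<equiv> act (ep (J (L v)) t) p"

lemma JL_Rn: "J (L v) \<in> Rn NC" by (rule J_Rn[OF NC_even L_Rn])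

lemma ray_\<Omega>: "p \<in> \<Omega> \<Longrightarrow> ray v p t \<in> \<Omega>"
  using \<Omega>_act ep_closed[OF JL_Rn] \<Omega>_sub by blast

lemma ray_0: "p \<in> A \<Longrightarrow> ray v p 0 = p"
  using ep_zero[OF JL_Rn] act_one by simp

text \<open>The ray is an integral curve of JX, because the infinitesimal action is complex linear;
  the derivative of the Gram determinant along JX then applies at every time.\<close>

lemma gramM_ray:
  assumes p: "p \<in> \<Omega>" and v: "v \<in> Rn n" and c: "c \<in> atlas M" "ray v p t \<in> fst c"
  shows "((\<lambda>s. gramM (ray v p s)) has_real_derivative 2 * dvJ c v (snd c (ray v p t)) * gramM (ray v p t)) (at t)"
proof -
  have pA: "p \<in> A" using p \<Omega>_sub by blast
  note C = curve_in_chart[OF JL_Rn pA c]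
  have "zv c (ray v p t) (J (L v)) = J (xv c (ray v p t) v)" using zv_J[OF c L_Rn] zv_L[OF c] by simp
  then have "((\<lambda>s. gram c (chart_inv c (snd c (ray v p s)))) has_real_derivative 2 * dvJ c v (snd c (ray v p t)) * gram c (ray v p t)) (at t)"
    using C(2)[OF gram_smooth[OF c(1)]] gram_derivative_J[OF c dim_M gram_nonzero[OF ray_\<Omega>[OF p] c] v] by simp
  moreover have "eventually (\<lambda>s. gram c (chart_inv c (snd c (ray v p s))) = gramM (ray v p s)) (nhds t)"
    using C(1) by eventually_elim (simp add: chart_inv_left[OF cM c(1)] gramM_chart[OF c(1)])
  ultimately show ?thesis using DERIV_cong_ev[OF refl _ refl] gramM_chart[OF c] by fastforce
qed

lemma gramM_nonzero: "p \<in> \<Omega> \<Longrightarrow> gramM p \<noteq> 0"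
proof -
  assume p: "p \<in> \<Omega>"
  then obtain c where c: "c \<in> atlas M" "p \<in> fst c" using \<Omega>_sub charted_cover[OF cM] by blast
  show ?thesis using gram_nonzero[OF p c] gramM_chart[OF c] by simp
qed

lemma gramM_continuous: "continuous_map (mtop M) euclideanreal gramM"
proof (rule pasting_lemma[where I = "atlas M" and T = fst and f = "\<lambda>_. gramM"])
  fix c assume c: "c \<in> atlas M"
  show "openin (mtop M) (fst c)" by (rule chart_open[OF cM c])
  have 1: "continuous_map (subtopology (mtop M) (fst c)) (subtopology (Euclidean_space N) (U c)) (snd c)"
    by (rule homeomorphic_imp_continuous_map[OF chart_homeo[OF cM c]])
  have 2: "continuous_map (subtopology (Euclidean_space N) (U c)) euclideanreal (\<lambda>y. gram c (chart_inv c y))"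
    using gram_smooth[OF c] unfolding smooth_on_def by (elim conjE allE[of _ "[]"]) simp
  show "continuous_map (subtopology (mtop M) (fst c)) euclideanreal gramM"
    by (rule continuous_map_eq[OF continuous_map_compose[OF 1 2]]) (simp add: chart_inv_left[OF cM c] gramM_chart[OF c])
qed (use charted_cover[OF cM] in blast)+

lemma critical_orbit_exists: "\<exists>p\<in>\<Omega>. critical_orbit p"
proof -
  obtain p0 where p0: "p0 \<in> \<Omega>" using M_compactification Gc_group one_carrier
    by (auto simp: compactification_def orbit_def)
  let ?F = "\<lambda>p. \<bar>gramM p\<bar>"
  have "compactin euclideanreal (?F ` A)"
    by (rule image_compactin[of "mtop M"])
       (use M_compact gramM_continuous in \<open>auto simp: compact_space_def intro: continuous_map_real_abs\<close>)
  then have "compact (?F ` A)" by simp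
  moreover have "?F ` A \<noteq> {}" using p0 \<Omega>_sub by blast
  ultimately obtain p where p: "p \<in> A" "\<And>q. q \<in> A \<Longrightarrow> ?F q \<le> ?F p"
    using compact_attains_sup[of "?F ` A"] by blast
  have "?F p0 \<le> ?F p" using p(2) p0 \<Omega>_sub by blast
  then have nz: "gramM p \<noteq> 0" using gramM_nonzero[OF p0] by auto
  obtain c0 where c0: "c0 \<in> atlas M" "p \<in> fst c0" using charted_cover[OF cM p(1)] .
  have p\<Omega>: "p \<in> \<Omega>" using gram_nonzero_\<Omega>[OF p(1) c0] nz gramM_chart[OF c0] by simp
  have "dvJ c v (snd c q) = 0" if q: "q \<in> Orb p" and c: "c \<in> atlas M" "q \<in> fst c" and v: "v \<in> Rn n" for q c v
  proof -
    interpret group G by (rule G_group)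
    obtain g where g: "g \<in> carrier G" "q = act (\<iota> g) p" using q Orb_image by blast
    have qA: "q \<in> A" and q\<Omega>: "q \<in> \<Omega>" using q Orb_sub[OF p(1)] Orb_\<Omega>[OF p\<Omega>] by blast+
    obtain l where l: "\<And>p. p \<in> A \<Longrightarrow> gramM (act (\<iota> g) p) = l * gramM p" using gramM_act[OF g(1)] by blast
    \<comment> \<open>The element g multiplies the Gram determinant by the same factor everywhere on
      M, so it carries the maximum at p to a maximum at q; every point of the orbit is one.\<close>
    have max: "?F m \<le> ?F q" if m: "m \<in> A" for m
    proof -
      let ?m = "act (\<iota> (inv\<^bsub>G\<^esub> g)) m"
      have mA: "?m \<in> A" using act_closed[OF \<iota>_closed m] g by simp
      have "m = act (\<iota> g) ?m" using act_mult_G[of "inv\<^bsub>G\<^esub> g" g m] g m \<iota>_one act_one by simp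
      then have "?F m = \<bar>l\<bar> * ?F ?m" using l[OF mA] by (simp add: abs_mult)
      also have "\<dots> \<le> \<bar>l\<bar> * ?F p" by (intro mult_left_mono p(2) mA) simp
      finally show ?thesis using l[OF p(1)] g by (simp add: abs_mult)
    qed
    have q0: "ray v q 0 = q" by (rule ray_0[OF qA])
    \<comment> \<open>The square has the same maxima as the absolute value and its derivative is
      given by the power rule.\<close>
    let ?f = "\<lambda>s. (gramM (ray v q s))\<^sup>2"
    have "(?f has_real_derivative 2 * gramM q * (2 * dvJ c v (snd c q) * gramM q)) (at 0)"
      using DERIV_power[OF gramM_ray[OF q\<Omega> v c(1), of 0], of 2] c q0 by (simp add: mult_ac)
    moreover have "?f s \<le> ?f 0" for s
      using max[of "ray v q s"] ray_\<Omega>[OF q\<Omega>] \<Omega>_sub unfolding q0 abs_le_square_iff by blast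
    ultimately have "2 * gramM q * (2 * dvJ c v (snd c q) * gramM q) = 0"
      by (intro DERIV_local_max[of ?f _ 0 1]) auto
    then show ?thesis using gramM_nonzero[OF q\<Omega>] by simp
  qed
  then show ?thesis using p\<Omega> unfolding critical_orbit_def by blast
qed

lemma critical_ray_constant:
  assumes p: "p \<in> \<Omega>" and v: "v \<in> Rn n" and cp: "critical_orbit p" and cq: "critical_orbit (ray v p 1)"
  shows "v = (\<lambda>_. 0)"
proof (rule ccontr)
  assume nz: "v \<noteq> (\<lambda>_. 0)"
  have pA: "p \<in> A" using p \<Omega>_sub by blast
  \<comment> \<open>The logarithmic derivative of the Gram determinant along the ray. Unlike
    \<open>dvJ\<close> it mentions no chart, so it is a single function of t although no one chart
    need contain the ray.\<close>
  define h where "h t = deriv (\<lambda>s. gramM (ray v p s)) t / gramM (ray v p t)" for t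
  have h: "h t = 2 * dvJ c v (snd c (ray v p t))" if "c \<in> atlas M" "ray v p t \<in> fst c" for c t
    using DERIV_imp_deriv[OF gramM_ray[OF p v that]] gramM_nonzero[OF ray_\<Omega>[OF p]] by (simp add: h_def)
  have self: "ray v p t \<in> Orb (ray v p t)" for t by (rule Orb_self) (use ray_\<Omega>[OF p] \<Omega>_sub in blast)
  have cov: "\<exists>c\<in>atlas M. ray v p t \<in> fst c" for t
    using ray_\<Omega>[OF p, where v = v and t = t] \<Omega>_sub charted_cover[OF cM, of "ray v p t"] by blast
  have zero: "h t = 0" if "critical_orbit (ray v p t)" for t
    using cov[of t] h that self[of t] v unfolding critical_orbit_def by fastforce
  have "\<exists>y. (h has_real_derivative y) (at t) \<and> y < 0" for t
  proof -
    obtain c where c: "c \<in> atlas M" "ray v p t \<in> fst c" using cov by blast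
    note C = curve_in_chart[OF JL_Rn pA c]
    let ?q = "ray v p t" and ?x = "xv c (ray v p t) v"
    have JR: "J ?x \<in> Rn N" by (rule J_Rn[OF evN xv_Rn])
    have "?x \<noteq> (\<lambda>_. 0)" using xv_kernel[OF ray_\<Omega>[OF p] c v] nz by blast
    then have "J ?x \<noteq> (\<lambda>_. 0)" using fun_cong[OF J_J[of ?x]] J_zero by fastforce
    then have pos: "gm c ?q (J ?x) (J ?x) > 0" by (rule gm_pos[OF c JR])
    have "zv c ?q (J (L v)) = J ?x" using zv_J[OF c L_Rn] zv_L[OF c] by simp
    then have "((\<lambda>s. dvJ c v (snd c (ray v p s))) has_real_derivative - 2 * r * gm c ?q (J ?x) (J ?x)) (at t)"
      using C(2)[OF dvJ_smooth[OF c(1)]] dvJ_derivative[OF c JR v] by metis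
    from DERIV_cmult[OF this, of 2]
    have D: "((\<lambda>s. 2 * dvJ c v (snd c (ray v p s))) has_real_derivative 2 * (- 2 * r * gm c ?q (J ?x) (J ?x))) (at t)" .
    have "eventually (\<lambda>s. 2 * dvJ c v (snd c (ray v p s)) = h s) (nhds t)"
      using C(1) by eventually_elim (simp add: h[OF c(1)])
    then have "(h has_real_derivative 2 * (- 2 * r * gm c ?q (J ?x) (J ?x))) (at t)"
      using DERIV_cong_ev[OF refl _ refl] D by fast
    then show ?thesis using r_pos pos by (intro exI conjI) auto
  qed
  \<comment> \<open>The derivative of h is - 4 r g(JX, JX), and JX is nonzero along the ray by
    \<open>xv_kernel\<close>; vanishing at both ends is then impossible.\<close>
  then have "h 1 < h 0" by (intro DERIV_neg_imp_decreasing[of 0 1 h]) auto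
  moreover have "h 0 = 0" by (rule zero) (use cp ray_0[OF pA] in simp)
  ultimately show False using zero[OF cq] by simp
qed

text \<open>Polar decomposition writes the group element from p to q as exp(i v) g with g in G, so
  the orbit of q is that of the endpoint of a ray from p. Criticality is a property of the orbit,
  and \<open>critical_ray_constant\<close> forces v = 0.\<close>

lemma critical_orbit_unique:
  assumes p: "p \<in> \<Omega>" and q: "q \<in> \<Omega>" and cp: "critical_orbit p" and cq: "critical_orbit q"
  shows "Orb p = Orb q"
proof -
  have pA: "p \<in> A" using p \<Omega>_sub by blast
  obtain y where y: "y \<in> carrier Gc" "q = act y p" using \<Omega>_orbit[OF p] q by blast
  have "y \<in> (\<lambda>(v, g). E (J (L v)) \<otimes>\<^bsub>Gc\<^esub> \<iota> g) ` topspace (mtop (prod_mfd (open_mfd n (Rn n)) XG))"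
    using E_polar y(1) Gc_top unfolding diffeomorphism_def bij_betw_def by simp
  then obtain v g where vg: "v \<in> Rn n" "g \<in> carrier G" "y = E (J (L v)) \<otimes>\<^bsub>Gc\<^esub> \<iota> g" using G_top by auto
  let ?s = "ray v p 1"
  have s\<Omega>: "?s \<in> \<Omega>" by (rule ray_\<Omega>[OF p])
  then have sA: "?s \<in> A" using \<Omega>_sub by blast
  have "q = act (\<iota> g) ?s" using act_mult[OF ep_closed[OF JL_Rn, where v1 = v and t = 1] \<iota>_closed[OF vg(2)] pA] y vg by simp
  then have "q \<in> Orb ?s" using vg(2) Orb_image by blast
  then have eq: "Orb q = Orb ?s" by (rule Orb_eq[OF sA])
  then have "critical_orbit ?s" using cq by (simp add: critical_orbit_def)
  then have "v = (\<lambda>_. 0)" by (rule critical_ray_constant[OF p vg(1) cp])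
  then have "?s = ray v p 0" by (simp add: L_zero J_zero)
  then show ?thesis using eq ray_0[OF pA] by simp
qed

end

theorem corollary5p2:
  fixes G :: "'g monoid" and XG :: "'g mfd"
    and Gc :: "'c monoid" and XGc :: "'c mfd" and \<iota> :: "'g \<Rightarrow> 'c"
    and M :: "'m mfd" and act :: "'c \<Rightarrow> 'm \<Rightarrow> 'm" and \<Omega> :: "'m set"
    and \<omega> :: "'m tensor2"
  assumes "compact_lie_group G XG"
    and "complexification G XG Gc XGc \<iota>"
    and "compactification Gc XGc M act \<Omega>"
    and "\<forall>p\<in>\<Omega>. finite (stabilizer Gc act p)"
    and "kaehler_form M \<omega>"
    and "invariant_form G M (\<lambda>g. act (\<iota> g)) \<omega>"
    and "positive_kaehler_einstein M \<omega>"
  shows "\<exists>!L. (\<exists>p\<in>\<Omega>. L = orbit G (\<lambda>g. act (\<iota> g)) p) \<and>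
    lagrangian M \<omega> L \<and> minimal_submanifold M (kaehler_metric M \<omega>) (mdim M div 2) L"
proof -
  obtain r where r: "r > 0" "\<And>c p i j. c \<in> atlas M \<Longrightarrow> p \<in> fst c \<Longrightarrow> i < mdim M \<Longrightarrow> j < mdim M \<Longrightarrow> ricci_form M \<omega> c p i j = r * \<omega> c p i j"
    using assms(7) unfolding positive_kaehler_einstein_def by blast
  have G: "group G" "charted XG" "carrier G = topspace (mtop XG)"
    using assms(1) smooth_manifold_charted by (auto simp: compact_lie_group_def lie_group_def)
  have Gc: "group Gc" "charted XGc" "carrier Gc = topspace (mtop XGc)"
    using assms(2) smooth_manifold_charted by (auto simp: complexification_def complex_lie_group_def complex_manifold_def)
  obtain e where e: "e \<in> atlas XG" "\<one>\<^bsub>G\<^esub> \<in> fst e"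
    using charted_cover[OF G(2)] G monoid.one_closed[OF group.is_monoid] by metis
  obtain d where d: "d \<in> atlas XGc" "\<one>\<^bsub>Gc\<^esub> \<in> fst d"
    using charted_cover[OF Gc(2)] Gc monoid.one_closed[OF group.is_monoid] by metis
  \<comment> \<open>The complexification provides an exponential map for every pair of charts at the
    identities, in particular for e and d.\<close>
  obtain E where "orbit_setting G XG Gc XGc \<iota> M act \<Omega> \<omega> r e d E"
    using assms r e d unfolding orbit_setting_def complexification_def Let_def by blast
  then interpret orbit_setting G XG Gc XGc \<iota> M act \<Omega> \<omega> r e d E .
  show ?thesis unfolding half_dim
    using critical_orbit_exists critical_orbit_unique minimal_lagrangian_iff_critical by blast
qed

end
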